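(* Let $N\ge 2$, $2\le k\le N$, $m\ge 1$, let $\Omega$ be a smooth bounded $k$-rotationally symmetric domain in $\mathbb{R}^N$, let $F=(f_1,\dots,f_m)\in C^1([0,+\infty)\times\overline{\Omega''}\times\mathbb{R}^m;\mathbb{R}^m)$, and let $U=(u_1,\dots,u_m)\in C^2(\overline{\Omega};\mathbb{R}^m)$ be a solution of $$-\Delta U=F(|x'|,x'',U)\ \text{ in }\Omega,\qquad U=0\ \text{ on }\partial\Omega .$$ Assume that the system is fully coupled along $U$ in $\Omega$ and that at least one of the following holds: (a) for any $i=1,\dots,m$ the function $f_i(|x'|,x'',S)$ is convex in $S\in\mathbb{R}^m$; (b) for any $i,j=1,\dots,m$ the function $\frac{\partial f_i}{\partial s_j}(|x'|,x'',S)$ is convex in $S\in\mathbb{R}^m$. If $U$ has Morse index one and is not radial (i.e. $U$ is not a function of $(|x'|,x'')$ only), then, with $(r,\vartheta)$ the coordinates with respect to which $U=U(r,x'',\vartheta)$ is $k$-sectionally foliated Schwarz symmetric, $$\sum_{j=1}^m\frac{\partial f_i}{\partial s_j}\big(r,x'',U(r,x'',\vartheta)\big)\frac{\partial u_j}{\partial\vartheta}(r,x'',\vartheta)=\sum_{j=1}^m\frac{\partial f_j}{\partial s_i}\big(r,x'',U(r,x'',\vartheta)\big)\frac{\partial u_j}{\partial\vartheta}(r,x'',\vartheta)$$ for any $i=1,\dots,m$. In particular, if $m=2$, this implies that $$\frac{\partial f_1}{\partial s_2}(|x'|,x'',U(x))=\frac{\partial f_2}{\partial s_1}(|x'|,x'',U(x))\qquad\forall\,x\in\Omega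 .$$
   Context: Notation. If $k<N$, write $x=(x',x'')\in\mathbb{R}^k\times\mathbb{R}^{N-k}$ and $\Omega''=\{x''\in\mathbb{R}^{N-k}:\exists x'\in\mathbb{R}^k,\ (x',x'')\in\Omega\}$. If $k=N$, then $x'=x$ and the variable $x''$ is absent. $k$-rotationally symmetric domain. A bounded domain $\Omega\subset\mathbb{R}^N$ is $k$-rotationally symmetric if either $k=N$ and $\Omega$ is a ball or an annulus (centered at the origin), or $2\le k<N$ and for every $h\in\Omega''$ the section $\Omega^h=\Omega\cap\{x''=h\}$ is either a $k$-dimensional ball or a $k$-dimensional annulus with center $(0,h)$. $k$-sectional foliated Schwarz symmetry. A continuous $U:\Omega\to\mathbb{R}^m$ is $k$-sectionally foliated Schwarz symmetric if there is a unit vector $p'=(p_1,\dots,p_k,0,\dots,0)\in\mathbb{R}^N$ such that $U(x)=U(x',x'')$ depends only on $x''$, $r=|x'|$ and $\vartheta=\arccos\big(\frac{x'}{|x'|}\cdot p'\big)$, and $U$ is (componentwise) nonincreasing in $\vartheta$. Under the assumptions of the claim (Morse index one), $U$ is known to be $k$-sectionally foliated Schwarz symmetric, so it can be written as $U(r,x'',\vartheta)$. Full coupling. The system is cooperative (weakly coupled) in an open set $\Omega'\subseteq\Omega$ if $\frac{\partial f_i}{\partial s_j}(|x'|,x'',S)\ge 0$ for all $x\in\Omega'$, $S\in\mathbb{R}^m$ and $i\ne j$. It is fully coupled along $U$ in $\Omega'$ if it is cooperative in $\Omega'$ and for all nonempty disjoint $I,J$ with $I\cup J=\{1,\dots,m\}$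 there are $i_0\in I$, $j_0\in J$ such that $\{x\in\Omega':\frac{\partial f_{i_0}}{\partial s_{j_0}}(|x'|,x'',U(x))>0\}$ has positive measure. Morse index. Let $$Q_U(\Psi;\Omega)=\int_\Omega\Big[\sum_{i=1}^m|\nabla\psi_i|^2-\sum_{i,j=1}^m\frac{\partial f_i}{\partial s_j}(|x'|,x'',U(x))\,\psi_i\psi_j\Big]dx,\qquad \Psi=(\psi_1,\dots,\psi_m)\in C_c^1(\Omega;\mathbb{R}^m).$$ The Morse index $m(U)$ is the maximal dimension of a subspace of $C_c^1(\Omega;\mathbb{R}^m)$ on which $Q_U$ is negative definite ($0$ if $Q_U\ge 0$). *)

theory Defs
  imports
    "HOL-Analysis.Analysis"
    "HOL-Library.Extended_Nat"
    "HOL-Library.Function_Algebras"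
begin

text \<open>
  Pointwise scalar multiplication turns functions into a real vector space, so that the
  library's \<^const>\<open>subspace\<close> and \<^const>\<open>dim\<close> apply to spaces of test functions.
\<close>

instantiation "fun" :: (type, real_vector) real_vector
begin

definition scaleR_fun :: "real \<Rightarrow> ('a \<Rightarrow> 'b) \<Rightarrow> 'a \<Rightarrow> 'b"
  where "scaleR_fun c f = (\<lambda>x. c *\<^sub>R f x)"

instance
  by standard (auto simp: scaleR_fun_def fun_eq_iff algebra_simps)

end

text \<open>
  \<open>C\<^sup>n\<close> functions on a set \<open>A\<close>, open or not. On an open set this is the usual notion. On a
  closed set such as the closure of a smooth domain, derivatives are taken within \<open>A\<close>, so
  that they exist and are continuous up to the boundary.
\<close>

primrec Ck_on :: "nat \<Rightarrow> 'a set \<Rightarrow> ('a::euclidean_space \<Rightarrow> 'b::real_normed_vector) \<Rightarrow> bool"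
  where
    "Ck_on 0 A f \<longleftrightarrow> continuous_on A f"
  | "Ck_on (Suc n) A f \<longleftrightarrow>
       (\<exists>D. (\<forall>x\<in>A. (f has_derivative D x) (at x within A)) \<and> (\<forall>v. Ck_on n A (\<lambda>x. D x v)))"

definition laplacian :: "('a::euclidean_space \<Rightarrow> 'b::real_normed_vector) \<Rightarrow> 'a \<Rightarrow> 'b"
  where "laplacian u x =
    (\<Sum>b\<in>Basis. frechet_derivative (\<lambda>y. frechet_derivative u (at y) b) (at x) b)"

definition gradient :: "(real^'n \<Rightarrow> real) \<Rightarrow> real^'n \<Rightarrow> real^'n"
  where "gradient u x = (\<chi> l. frechet_derivative u (at x) (axis l 1))"

text \<open>
  The splitting \<open>x = (x', x'')\<close> is given by the set \<open>K\<close> of the \<open>k\<close> coordinates that make up \<open>x'\<close>.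
  Both parts are regarded as elements of the full space, padded with zeros; for \<open>K = UNIV\<close> the
  part \<open>x''\<close> is always \<open>0\<close>, i.e. absent.
\<close>

definition part1 :: "'n set \<Rightarrow> real^'n \<Rightarrow> real^'n"
  where "part1 K x = (\<chi> l. if l \<in> K then x $ l else 0)"

definition part2 :: "'n set \<Rightarrow> real^'n \<Rightarrow> real^'n"
  where "part2 K x = (\<chi> l. if l \<in> K then 0 else x $ l)"

definition bounded_domain :: "'a::euclidean_space set \<Rightarrow> bool"
  where "bounded_domain \<Omega> \<longleftrightarrow> open \<Omega> \<and> connected \<Omega> \<and> \<Omega> \<noteq> {} \<and> bounded \<Omega>"

definition smooth_boundary :: "'a::euclidean_space set \<Rightarrow> bool"
  where "smooth_boundary \<Omega> \<longleftrightarrow>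
    (\<forall>p\<in>frontier \<Omega>. \<exists>V (g :: 'a \<Rightarrow> real). open V \<and> p \<in> V \<and> (\<forall>n. Ck_on n V g) \<and>
       (\<forall>x\<in>V. \<exists>v. frechet_derivative g (at x) v \<noteq> 0) \<and> \<Omega> \<inter> V = {x \<in> V. g x < 0})"

definition rotationally_symmetric :: "'n set \<Rightarrow> (real^'n) set \<Rightarrow> bool"
  where "rotationally_symmetric K \<Omega> \<longleftrightarrow>
    (K = UNIV \<and>
      ((\<exists>R>0. \<Omega> = ball 0 R) \<or> (\<exists>a b. 0 < a \<and> a < b \<and> \<Omega> = {x. a < norm x \<and> norm x < b}))) \<or>
    (2 \<le> card K \<and> K \<noteq> UNIV \<and>
      (\<forall>h \<in> part2 K ` \<Omega>.
        (\<exists>R>0. \<Omega> \<inter> {x. part2 K x = h} = {x. part2 K x = h \<and> norm (part1 K x) < R}) \<or>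
        (\<exists>a b. 0 < a \<and> a < b \<and>
          \<Omega> \<inter> {x. part2 K x = h} =
            {x. part2 K x = h \<and> a < norm (part1 K x) \<and> norm (part1 K x) < b})))"

text \<open>\<open>partial_s F i j r y S\<close> is \<open>\<partial>f\<^sub>i/\<partial>s\<^sub>j (r, y, S)\<close>.\<close>

definition partial_s ::
    "(real \<Rightarrow> real^'n \<Rightarrow> real^'m \<Rightarrow> real^'m) \<Rightarrow> 'm \<Rightarrow> 'm \<Rightarrow> real \<Rightarrow> real^'n \<Rightarrow> real^'m \<Rightarrow> real"
  where "partial_s F i j r y S = frechet_derivative (\<lambda>T. F r y T $ i) (at S) (axis j 1)"

definition cooperative ::
    "'n set \<Rightarrow> (real \<Rightarrow> real^'n \<Rightarrow> real^'m \<Rightarrow> real^'m) \<Rightarrow> (real^'n) set \<Rightarrow> bool"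
  where "cooperative K F \<Omega> \<longleftrightarrow>
    (\<forall>x\<in>\<Omega>. \<forall>S i j. i \<noteq> j \<longrightarrow> partial_s F i j (norm (part1 K x)) (part2 K x) S \<ge> 0)"

definition fully_coupled ::
    "'n set \<Rightarrow> (real \<Rightarrow> real^'n \<Rightarrow> real^'m \<Rightarrow> real^'m) \<Rightarrow> (real^'n \<Rightarrow> real^'m) \<Rightarrow>
      (real^'n) set \<Rightarrow> bool"
  where "fully_coupled K F U \<Omega> \<longleftrightarrow> cooperative K F \<Omega> \<and>
    (\<forall>I J. I \<noteq> {} \<and> J \<noteq> {} \<and> I \<inter> J = {} \<and> I \<union> J = UNIV \<longrightarrow>
      (\<exists>i\<in>I. \<exists>j\<in>J.
        emeasure lebesgue
          {x\<in>\<Omega>. partial_s F i j (norm (part1 K x)) (part2 K x) (U x) > 0} > 0))"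

text \<open>\<open>C\<^sub>c\<^sup>1(\<Omega>; \<real>\<^sup>m)\<close>, with each function extended by zero to the whole space.\<close>

definition C1c :: "(real^'n) set \<Rightarrow> (real^'n \<Rightarrow> real^'m) set"
  where "C1c \<Omega> = {\<Psi>. Ck_on 1 UNIV \<Psi> \<and>
    compact (closure {x. \<Psi> x \<noteq> 0}) \<and> closure {x. \<Psi> x \<noteq> 0} \<subseteq> \<Omega>}"

definition quad_form ::
    "'n set \<Rightarrow> (real \<Rightarrow> real^'n \<Rightarrow> real^'m \<Rightarrow> real^'m) \<Rightarrow> (real^'n \<Rightarrow> real^'m) \<Rightarrow>
      (real^'n) set \<Rightarrow> (real^'n \<Rightarrow> real^'m) \<Rightarrow> real"
  where "quad_form K F U \<Omega> \<Psi> =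
    set_lebesgue_integral lebesgue \<Omega> (\<lambda>x.
      (\<Sum>i\<in>UNIV. (norm (gradient (\<lambda>y. \<Psi> y $ i) x))\<^sup>2) -
      (\<Sum>i\<in>UNIV. \<Sum>j\<in>UNIV.
        partial_s F i j (norm (part1 K x)) (part2 K x) (U x) * \<Psi> x $ i * \<Psi> x $ j))"

text \<open>
  The library assigns \<^const>\<open>dim\<close> the value 0 to infinite-dimensional spaces. This is harmless here:
  an infinite-dimensional \<open>V\<close> contains admissible subspaces of every finite dimension, so
  the supremum is then \<open>\<infinity>\<close>.
\<close>

definition morse_index ::
    "'n set \<Rightarrow> (real \<Rightarrow> real^'n \<Rightarrow> real^'m \<Rightarrow> real^'m) \<Rightarrow> (real^'n \<Rightarrow> real^'m) \<Rightarrow>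
      (real^'n) set \<Rightarrow> enat"
  where "morse_index K F U \<Omega> =
    Sup {enat (dim V) | V. subspace V \<and> V \<subseteq> C1c \<Omega> \<and>
      (\<forall>\<Psi>\<in>V. \<Psi> \<noteq> 0 \<longrightarrow> quad_form K F U \<Omega> \<Psi> < 0)}"

definition radial :: "'n set \<Rightarrow> (real^'n) set \<Rightarrow> (real^'n \<Rightarrow> real^'m) \<Rightarrow> bool"
  where "radial K \<Omega> U \<longleftrightarrow> (\<exists>g. \<forall>x\<in>\<Omega>. U x = g (norm (part1 K x)) (part2 K x))"

text \<open>
  The angle is meaningful only where \<open>x' \<noteq> 0\<close>; for \<open>x' = 0\<close> the convention \<open>v / 0 = 0\<close> makes it
  \<open>\<pi>/2\<close>, so that there \<open>U\<close> depends on \<open>x''\<close> alone.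
\<close>

definition angle :: "'n set \<Rightarrow> real^'n \<Rightarrow> real^'n \<Rightarrow> real"
  where "angle K p x = arccos ((part1 K x /\<^sub>R norm (part1 K x)) \<bullet> p)"

text \<open>
  \<open>W r y \<theta>\<close> represents \<open>U\<close> in the coordinates \<open>(r, x'', \<theta>)\<close> associated with the axis \<open>p\<close>.
\<close>

definition foliated_Schwarz_rep ::
    "'n set \<Rightarrow> (real^'n) set \<Rightarrow> (real^'n \<Rightarrow> real^'m) \<Rightarrow> real^'n \<Rightarrow>
      (real \<Rightarrow> real^'n \<Rightarrow> real \<Rightarrow> real^'m) \<Rightarrow> bool"
  where "foliated_Schwarz_rep K \<Omega> U p W \<longleftrightarrow>
    norm p = 1 \<and> part2 K p = 0 \<and>
    (\<forall>x\<in>\<Omega>. U x = W (norm (part1 K x)) (part2 K x) (angle K p x)) \<and>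
    (\<forall>x\<in>\<Omega>. part1 K x \<noteq> 0 \<longrightarrow>
      (\<forall>i. antimono_on {0..pi} (\<lambda>\<theta>. W (norm (part1 K x)) (part2 K x) \<theta> $ i)))"

text \<open>One-sided at \<open>\<theta> = 0\<close> and \<open>\<theta> = \<pi>\<close>.\<close>

definition partial_theta ::
    "(real \<Rightarrow> real^'n \<Rightarrow> real \<Rightarrow> real^'m) \<Rightarrow> 'm \<Rightarrow> real \<Rightarrow> real^'n \<Rightarrow> real \<Rightarrow> real"
  where "partial_theta W j r y \<theta> =
    vector_derivative (\<lambda>t. W r y t $ j) (at \<theta> within {0..pi})"

end

theory Submission
  imports Defs
begin

text \<open>
  Compare \<open>U\<close> with its reflections in the hyperplanes through the \<open>x''\<close>-space. As the Morse index is
  one, the quadratic form cannot be negative on both sides of a hyperplane, and a continuity argument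
  gives a direction \<open>e\<close> for which it is nonnegative on both sides. There \<open>w = U - U \<circ> \<sigma>\<close>
  has a sign: under (b) its positive part minimises the form whose potential is averaged over the
  reflection, under (a) a sign change would produce a two-dimensional negative space. Rotating the
  hyperplane from \<open>e\<close> to \<open>- e\<close> while \<open>w \<ge> 0\<close> must stop at a direction of symmetry, since by the strong
  maximum principle and the maximum principle in domains of small measure the set of directions with
  \<open>w \<ge> 0\<close> is open and closed unless \<open>w\<close> vanishes.

  If \<open>U\<close> is symmetric in \<open>e\<close> and \<open>q \<perp> e\<close>, the derivative \<open>v\<close> of \<open>U\<close> along the rotations of the plane of
  \<open>e\<close> and \<open>q\<close> solves the linearised system and vanishes on the symmetry hyperplane. By symmetry the
  quadratic form is nonnegative on the half domain, so the positive part of \<open>v\<close> is a minimiser and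
  solves the symmetrised linear system. Hence \<open>v\<close>, if not zero, has a sign and solves both systems,
  which gives the identity. For fixed \<open>e\<close> and a point of the half domain, \<open>v\<close> is linear in \<open>q\<close>, so it
  vanishes for all \<open>q\<close> orthogonal to a single direction, which is the axis.
\<close>

subsection \<open>Integrals of continuous functions with compact support\<close>

text \<open>The natural minimisers are positive parts, in general not C^1, while the Morse index is
  defined with compactly supported C^1 functions. So no limit of gradients is ever taken:
  \<open>cutv\<close> truncates a positive part at height 1/(k+1), its energy is bounded above by a
  null sequence, and its pairing with a fixed bump converges because integration by parts moves
  every derivative onto the bump. Equations are tested against one explicit family, the cubes of
  (s^2 - |x - x0|^2)^+; they suffice for the strong maximum principle and for recovering pointwise
  identities. The Jacobian of the nonlinearity need not be symmetric, but a quadratic form sees only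
  its symmetric part. Hence a minimiser solves the symmetrised system, and the identity of the
  theorem is exactly the difference between the two systems. Since \<open>U\<close> is only C^2, its
  angular derivative is only C^1 and satisfies its equation weakly. Full coupling enters through one
  fact: a set of positive measure is not contained in a hyperplane, so the components cannot
  decouple on both halves at once.\<close>

definition cc :: "('a::euclidean_space \<Rightarrow> real) \<Rightarrow> bool"
  where "cc f \<longleftrightarrow> continuous_on UNIV f \<and> (\<exists>C. compact C \<and> (\<forall>x. x \<notin> C \<longrightarrow> f x = 0))"

lemma ccI:
  assumes "continuous_on UNIV f" "compact C" "\<And>x. x \<notin> C \<Longrightarrow> f x = 0"
  shows "cc f"
  using assms by (auto simp: cc_def)

lemma cc_continuous: "cc f \<Longrightarrow> continuous_on S f"
  by (auto simp: cc_def intro: continuous_on_subset)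

lemma cc_zero [simp]: "cc (\<lambda>x. 0)"
  by (rule ccI[of _ "{}"]) auto

lemma cc_mult_left:
  assumes "cc f" "continuous_on UNIV g"
  shows "cc (\<lambda>x. g x * f x)"
  using assms by (auto simp: cc_def intro!: continuous_intros)

lemma cc_mult_right:
  assumes "cc f" "continuous_on UNIV g"
  shows "cc (\<lambda>x. f x * g x)"
  using assms by (auto simp: cc_def intro!: continuous_intros)

lemma cc_cmult: "cc f \<Longrightarrow> cc (\<lambda>x. c * f x)"
  by (rule cc_mult_left) auto

lemma cc_mult: "cc f \<Longrightarrow> cc g \<Longrightarrow> cc (\<lambda>x. f x * g x)"
  by (rule cc_mult_left) (auto simp: cc_continuous)

lemma cc_minus: "cc f \<Longrightarrow> cc (\<lambda>x. - f x)"
  using cc_cmult[of f "-1"] by simp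

lemma cc_add:
  assumes "cc f" "cc g"
  shows "cc (\<lambda>x. f x + g x)"
proof -
  from assms obtain A B where "compact A" "\<forall>x. x \<notin> A \<longrightarrow> f x = 0" "compact B" "\<forall>x. x \<notin> B \<longrightarrow> g x = 0"
    by (auto simp: cc_def)
  then show ?thesis
    using assms by (intro ccI[of _ "A \<union> B"]) (auto simp: compact_Un cc_continuous intro!: continuous_intros)
qed

lemma cc_diff: "cc f \<Longrightarrow> cc g \<Longrightarrow> cc (\<lambda>x. f x - g x)"
  using cc_add[of f "\<lambda>x. - g x"] cc_minus[of g] by simp

lemma cc_sum: "(\<And>i. i \<in> I \<Longrightarrow> cc (f i)) \<Longrightarrow> cc (\<lambda>x. \<Sum>i\<in>I. f i x)"
  by (induction I rule: infinite_finite_induct) (auto intro: cc_add)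

lemma cc_power: "cc f \<Longrightarrow> cc (\<lambda>x. (f x)^Suc n)"
  by (induction n) (auto intro: cc_mult)

lemma cc_abs: "cc f \<Longrightarrow> cc (\<lambda>x. \<bar>f x\<bar>)"
  by (auto simp: cc_def intro!: continuous_intros)

lemmas cc_intros = cc_zero cc_add cc_diff cc_minus cc_sum cc_cmult cc_mult cc_power cc_abs

lemma cc_box:
  assumes "cc f"
  obtains a where "\<And>x. x \<notin> cbox (-a) a \<Longrightarrow> f x = 0"
proof -
  from assms obtain C where C: "compact C" "\<And>x. x \<notin> C \<Longrightarrow> f x = 0" by (auto simp: cc_def)
  then obtain a where "C \<subseteq> cbox (-a) a"
    using bounded_subset_cbox_symmetric compact_imp_bounded by blast
  then show ?thesis using C that by blast
qed

lemma cc_has_integral_box: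
  assumes "cc f" "\<And>x. x \<notin> cbox a b \<Longrightarrow> f x = 0"
  shows "(f has_integral integral (cbox a b) f) UNIV"
proof -
  have "(f has_integral integral (cbox a b) f) (cbox a b)"
    using assms(1) by (intro integrable_integral integrable_continuous) (simp add: cc_continuous)
  then show ?thesis
    by (rule has_integral_on_superset) (use assms in auto)
qed

lemma cc_integrable: "cc f \<Longrightarrow> f integrable_on UNIV"
  by (meson cc_box cc_has_integral_box has_integral_integrable)

lemma cc_integral_box:
  assumes "cc f" "\<And>x. x \<notin> cbox a b \<Longrightarrow> f x = 0"
  shows "integral UNIV f = integral (cbox a b) f"
  using cc_has_integral_box[OF assms] by (simp add: integral_unique)

lemma cc_integral_add:
  "cc f \<Longrightarrow> cc g \<Longrightarrow> integral UNIV (\<lambda>x. f x + g x) = integral UNIV f + integral UNIV g"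
  by (intro integral_add cc_integrable)

lemma cc_integral_diff:
  "cc f \<Longrightarrow> cc g \<Longrightarrow> integral UNIV (\<lambda>x. f x - g x) = integral UNIV f - integral UNIV g"
  by (intro integral_diff cc_integrable)

lemma cc_integral_sum:
  "finite I \<Longrightarrow> (\<And>i. i \<in> I \<Longrightarrow> cc (f i)) \<Longrightarrow>
    integral UNIV (\<lambda>x. \<Sum>i\<in>I. f i x) = (\<Sum>i\<in>I. integral UNIV (f i))"
  by (rule integral_sum) (auto intro: cc_integrable)

lemma cc_integral_mono:
  "cc f \<Longrightarrow> cc g \<Longrightarrow> (\<And>x. f x \<le> g x) \<Longrightarrow> integral UNIV f \<le> integral UNIV g"
  by (rule integral_le) (auto intro: cc_integrable)

lemma cc_integral_nonneg:
  "cc f \<Longrightarrow> (\<And>x. 0 \<le> f x) \<Longrightarrow> 0 \<le> integral UNIV f"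
  by (rule integral_nonneg) (auto intro: cc_integrable)

lemma cc_integral_eq_0D:
  assumes "cc f" "\<And>x. 0 \<le> f x" "integral UNIV f = 0"
  shows "f x = 0"
proof (rule ccontr)
  assume "f x \<noteq> 0"
  obtain a where a: "\<And>x. x \<notin> cbox (-a) a \<Longrightarrow> f x = 0" using cc_box[OF assms(1)] by auto
  \<comment> \<open>The box from \<open>-a\<close> to \<open>a\<close> may be degenerate. Enlarging
    it by one in every coordinate gives it an interior, which the vanishing criterion for integrals
    over boxes requires.\<close>
  let ?c = "\<Sum>i\<in>Basis. (\<bar>a \<bullet> i\<bar> + 1) *\<^sub>R i"
  have sub: "cbox (-a) a \<subseteq> cbox (- ?c) ?c"
    by (force simp: mem_box)
  have ne: "box (- ?c) ?c \<noteq> {}"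
    by (auto simp: box_ne_empty) 
  have "integral UNIV f = integral (cbox (- ?c) ?c) f"
    using a sub by (intro cc_integral_box assms) auto
  then have "\<forall>x\<in>cbox (- ?c) ?c. f x = 0"
    using integral_cbox_eq_0_iff[of "- ?c" ?c f] assms cc_continuous ne by auto
  then show False using \<open>f x \<noteq> 0\<close> a sub by blast
qed

lemma cc_shift: "cc f \<Longrightarrow> cc (\<lambda>x. f (x + c))"
proof -
  assume f: "cc f"
  then obtain C where C: "compact C" "\<forall>x. x \<notin> C \<longrightarrow> f x = 0" by (auto simp: cc_def)
  have "compact ((\<lambda>x. - c + x) ` C)"
    by (intro compact_continuous_image continuous_intros C)
  moreover have "f (x + c) = 0" if "x \<notin> (\<lambda>x. - c + x) ` C" for x
    using that C(2) by (metis add.commute image_eqI uminus_add_conv_diff add_diff_cancel)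
  moreover have "continuous_on UNIV (\<lambda>x. f (x + c))"
    by (rule continuous_on_compose2[OF cc_continuous[OF f, of UNIV]]) (auto intro!: continuous_intros)
  ultimately show ?thesis by (intro ccI)
qed

lemma cc_integral_shift:
  assumes "cc f"
  shows "integral UNIV (\<lambda>x. f (x + c)) = integral UNIV f"
proof -
  obtain a where a: "\<And>x. x \<notin> cbox (-a) a \<Longrightarrow> f x = 0" using cc_box[OF assms] by auto
  have "((f \<circ> (+) c) has_integral integral UNIV f) (cbox (-a-c) (a-c))"
    unfolding has_integral_shift_cbox_iff
    using cc_integral_box[OF assms a] assms
    by (auto intro!: integrable_integral integrable_continuous cc_continuous)
  then have "((\<lambda>x. f (x + c)) has_integral integral UNIV f) (cbox (-a-c) (a-c))"
    by (simp add: o_def add.commute)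
  then have "((\<lambda>x. f (x + c)) has_integral integral UNIV f) UNIV"
  proof (rule has_integral_on_superset)
    fix x assume "x \<notin> cbox (-a-c) (a-c)"
    then have "x + c \<notin> cbox (-a) a" by (auto simp: mem_box algebra_simps)
    then show "f (x + c) = 0" by (rule a)
  qed auto
  then show ?thesis by (rule integral_unique)
qed

lemma continuous_on_slice1:
  assumes "continuous_on (A \<times> B) (\<lambda>(x, y). f x y)" "x \<in> A"
  shows "continuous_on B (f x)"
proof -
  have "continuous_on B (\<lambda>y. (x, y))" by (intro continuous_on_Pair continuous_on_const continuous_on_id)
  from continuous_on_compose2[OF assms(1) this] assms(2) show ?thesis by auto
qed

lemma continuous_on_slice2:
  assumes "continuous_on (A \<times> B) (\<lambda>(x, y). f x y)" "y \<in> B"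
  shows "continuous_on A (\<lambda>x. f x y)"
proof -
  have "continuous_on A (\<lambda>x. (x, y))" by (intro continuous_on_Pair continuous_on_const continuous_on_id)
  from continuous_on_compose2[OF assms(1) this] assms(2) show ?thesis by auto
qed

lemma cc_integral_param_deriv:
  fixes f :: "real \<Rightarrow> 'a::euclidean_space \<Rightarrow> real"
  assumes U: "convex U" "t0 \<in> U" and C: "compact C"
    and f0: "\<And>t x. t \<in> U \<Longrightarrow> x \<notin> C \<Longrightarrow> f t x = 0"
    and g0: "\<And>t x. t \<in> U \<Longrightarrow> x \<notin> C \<Longrightarrow> g t x = 0"
    and deriv: "\<And>t x. t \<in> U \<Longrightarrow> ((\<lambda>t. f t x) has_field_derivative g t x) (at t within U)"
    and cf: "\<And>t. t \<in> U \<Longrightarrow> continuous_on UNIV (f t)"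
    and cg: "continuous_on (U \<times> UNIV) (\<lambda>(t, x). g t x)"
  shows "((\<lambda>t. integral UNIV (f t)) has_field_derivative integral UNIV (g t0)) (at t0 within U)"
proof -
  obtain a where a: "C \<subseteq> cbox (-a) a"
    using bounded_subset_cbox_symmetric compact_imp_bounded C by blast
  have ccf: "cc (f t)" if "t \<in> U" for t
    using that f0 cf C by (intro ccI[of _ C]) auto
  have "continuous_on UNIV (g t0)"
    using continuous_on_slice1[OF cg U(2)] by simp
  then have ccg: "cc (g t0)"
    using g0 U C by (intro ccI[of _ C]) auto
  have "((\<lambda>t. integral (cbox (-a) a) (f t)) has_field_derivative integral (cbox (-a) a) (g t0)) (at t0 within U)"
    by (rule leibniz_rule_field_derivative)
      (use deriv ccf U in \<open>auto intro!: integrable_continuous cc_continuous continuous_on_subset[OF cg]\<close>)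
  moreover have "integral UNIV (f t) = integral (cbox (-a) a) (f t)" if "t \<in> U" for t
    using f0 that a by (intro cc_integral_box ccf) auto
  moreover have "integral UNIV (g t0) = integral (cbox (-a) a) (g t0)"
    using g0 U a by (intro cc_integral_box ccg) auto
  ultimately show ?thesis
    using U(2) by (auto simp: has_field_derivative_def intro: has_derivative_transform)
qed

text \<open>The support lies in a product of two boxes, where Fubini for continuous functions
  applies; the rest is the passage between boxes and whole spaces.\<close>

lemma cc_integral_swap:
  fixes f :: "'a::euclidean_space \<Rightarrow> 'b::euclidean_space \<Rightarrow> real"
  assumes c: "continuous_on UNIV (\<lambda>(x, y). f x y)"
    and "compact A" "\<And>x y. x \<notin> A \<Longrightarrow> f x y = 0" "compact B" "\<And>x y. y \<notin> B \<Longrightarrow> f x y = 0"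
  shows "integral UNIV (\<lambda>x. integral UNIV (f x)) = integral UNIV (\<lambda>y. integral UNIV (\<lambda>x. f x y))"
proof -
  obtain a where a: "A \<subseteq> cbox (-a) a"
    using bounded_subset_cbox_symmetric compact_imp_bounded assms by blast
  obtain b where b: "B \<subseteq> cbox (-b) b"
    using bounded_subset_cbox_symmetric compact_imp_bounded assms by blast
  have c1: "continuous_on UNIV (f x)" for x
    using continuous_on_slice1[of UNIV UNIV f] c by simp
  have c2: "continuous_on UNIV (\<lambda>x. f x y)" for y
    using continuous_on_slice2[of UNIV UNIV f] c by simp
  have e1: "integral UNIV (f x) = integral (cbox (-b) b) (f x)" for x
    using assms(2-4) assms(5)[of _ x] b c1 by (intro cc_integral_box ccI[of _ B]) blast+
  have e2: "integral UNIV (\<lambda>x. f x y) = integral (cbox (-a) a) (\<lambda>x. f x y)" for y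
    using assms a c2 by (intro cc_integral_box ccI[of _ A]) blast+
  have k1: "continuous_on UNIV (\<lambda>x. integral (cbox (-b) b) (f x))"
    using integral_continuous_on_param[of UNIV "-b" b f] continuous_on_subset[OF c] by auto
  have c': "continuous_on UNIV (\<lambda>(y, x). f x y)"
  proof -
    have "continuous_on UNIV (\<lambda>p :: 'b \<times> 'a. (snd p, fst p))"
      by (intro continuous_on_Pair continuous_on_fst continuous_on_snd continuous_on_id)
    from continuous_on_compose2[OF c this] show ?thesis by (simp add: split_beta)
  qed
  have k2: "continuous_on UNIV (\<lambda>y. integral (cbox (-a) a) (\<lambda>x. f x y))"
    using integral_continuous_on_param[of UNIV "-a" a "\<lambda>y x. f x y"] continuous_on_subset[OF c'] by auto
  have "integral UNIV (\<lambda>x. integral (cbox (-b) b) (f x)) = integral (cbox (-a) a) (\<lambda>x. integral (cbox (-b) b) (f x))"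
  proof (intro cc_integral_box ccI[of _ A] k1 assms(2))
    show "integral (cbox (-b) b) (f x) = 0" if "x \<notin> A" for x
    proof -
      have "f x = (\<lambda>_. 0)" using assms(3)[OF that] by auto
      then show ?thesis by simp
    qed
    then show "integral (cbox (-b) b) (f x) = 0" if "x \<notin> cbox (-a) a" for x
      using that a by blast
  qed
  moreover have "integral UNIV (\<lambda>y. integral (cbox (-a) a) (\<lambda>x. f x y)) = integral (cbox (-b) b) (\<lambda>y. integral (cbox (-a) a) (\<lambda>x. f x y))"
  proof (intro cc_integral_box ccI[of _ B] k2 assms(4))
    show "integral (cbox (-a) a) (\<lambda>x. f x y) = 0" if "y \<notin> B" for y
      using assms(5)[OF that] by simp
    then show "integral (cbox (-a) a) (\<lambda>x. f x y) = 0" if "y \<notin> cbox (-b) b" for y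
      using that b by blast
  qed
  moreover have "integral (cbox (-a) a) (\<lambda>x. integral (cbox (-b) b) (f x)) = integral (cbox (-b) b) (\<lambda>y. integral (cbox (-a) a) (\<lambda>x. f x y))"
    using integral_swap_continuous[of "-a" "-b" a b f] continuous_on_subset[OF c] by auto
  ultimately show ?thesis by (simp add: e1 e2)
qed

section \<open>Invariance of the integral under orthogonal maps\<close>

definition bump0 :: "'a::euclidean_space \<Rightarrow> real"
  where "bump0 x = max 0 (1 - (norm x)\<^sup>2)"

lemma bump0_eq_0: "x \<notin> cball 0 1 \<Longrightarrow> bump0 x = 0"
proof -
  assume "x \<notin> cball 0 1"
  then have "1 < norm x" by simp
  then have "1 < (norm x)\<^sup>2" by (rule one_less_power) simp
  then show ?thesis by (simp add: bump0_def)
qed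

lemma cc_bump0: "cc bump0"
proof (rule ccI[of _ "cball 0 1"])
  show "bump0 x = 0" if "x \<notin> cball 0 1" for x :: 'a
    by (rule bump0_eq_0[OF that])
qed (auto simp: bump0_def[abs_def] intro!: continuous_intros)

lemma integral_bump0_pos: "0 < integral UNIV (bump0 :: 'a::euclidean_space \<Rightarrow> real)"
proof -
  have "integral UNIV (bump0 :: 'a \<Rightarrow> real) \<noteq> 0"
    using cc_integral_eq_0D[OF cc_bump0, of "0::'a"] by (auto simp: bump0_def)
  moreover have "0 \<le> integral UNIV (bump0 :: 'a \<Rightarrow> real)"
    by (rule cc_integral_nonneg[OF cc_bump0]) (auto simp: bump0_def)
  ultimately show ?thesis by linarith
qed

lemma cc_orthogonal:
  assumes T: "orthogonal_transformation (T :: 'a::euclidean_space \<Rightarrow> 'a)" and f: "cc f"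
  shows "cc (\<lambda>x. f (T x))"
proof -
  obtain C where C: "compact C" "\<And>x. x \<notin> C \<Longrightarrow> f x = 0" using f by (auto simp: cc_def)
  have Ti: "orthogonal_transformation (inv T)" and bT: "bij T"
    using T orthogonal_transformation_inv orthogonal_transformation_bij by auto
  have ct: "continuous_on S T" "continuous_on S (inv T)" for S
    using T Ti orthogonal_transformation_linear linear_continuous_on linear_conv_bounded_linear by blast+
  show ?thesis
  proof (rule ccI)
    show "compact (inv T ` C)" by (intro compact_continuous_image ct C)
    show "continuous_on UNIV (\<lambda>x. f (T x))"
      by (rule continuous_on_compose2[OF cc_continuous[OF f, of UNIV] ct(1)]) auto
    show "f (T x) = 0" if "x \<notin> inv T ` C" for x
      using that bT C(2) by (metis bij_inv_eq_iff image_eqI)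
  qed
qed

text \<open>
  Both sides are translation invariant functionals of \<open>f\<close>. Convolving with a radial weight, which
  \<open>T\<close> preserves, and exchanging the order of integration shows that they agree.
\<close>

lemma cc_integral_orthogonal:
  assumes T: "orthogonal_transformation (T :: 'a::euclidean_space \<Rightarrow> 'a)" and f: "cc f"
  shows "integral UNIV (\<lambda>x. f (T x)) = integral UNIV f"
proof -
  let ?h = "bump0 :: 'a \<Rightarrow> real"
  let ?I = "integral UNIV (\<lambda>x. f (T x))"
  have bT: "bij T" and Ti: "orthogonal_transformation (inv T)"
    using T orthogonal_transformation_inv orthogonal_transformation_bij by auto
  have lT: "linear T" using T orthogonal_transformation_linear by blast
  have ct: "continuous_on S T" "continuous_on S (inv T)" for S
    using lT Ti orthogonal_transformation_linear linear_continuous_on linear_conv_bounded_linear by blast+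
  note ct' = ct(2) and ct = ct(1)
  have cfT: "cc (\<lambda>x. f (T x))" by (rule cc_orthogonal[OF T f])
  obtain C where C: "compact C" "\<And>x. x \<notin> C \<Longrightarrow> f x = 0" using f by (auto simp: cc_def)
  have TT: "T (inv T y) = y" "inv T (T y) = y" for y
    using bT by (simp_all add: bij_is_surj surj_f_inv_f bij_is_inj)
  have e1: "?I = integral UNIV (\<lambda>x. f (T x + y))" for y
    using cc_integral_shift[OF cfT, of "inv T y"] linear_add[OF lT] TT by simp
  have hz: "?h y = 0" if "y \<notin> cball 0 1" for y
    by (rule bump0_eq_0[OF that])
  have hc: "continuous_on S ?h" for S by (rule cc_continuous[OF cc_bump0])
  have fc: "continuous_on S f" for S by (rule cc_continuous[OF f])
  \<comment> \<open>\<open>B\<close> contains every \<open>x\<close> for which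
    \<open>T x + y\<close> lies in \<open>C\<close> for some \<open>y\<close> in the unit ball. It
    bounds the \<open>x\<close>-support in both exchanges of integrals below.\<close>
  define B where "B = inv T ` {x - y | x y. x \<in> C \<and> y \<in> cball 0 1}"
  have cB: "compact B"
    unfolding B_def by (intro compact_continuous_image compact_differences C compact_cball ct')
  have inB: "x \<in> B" if "T x + y \<in> C" "y \<in> cball 0 1" for x y
  proof -
    have "T x \<in> {x - y | x y. x \<in> C \<and> y \<in> cball 0 1}"
      using that by (intro CollectI exI[of _ "T x + y"] exI[of _ y]) simp
    then show ?thesis unfolding B_def using imageI[of "T x" _ "inv T"] TT(2)[of x] by simp
  qed
  have c1: "continuous_on UNIV (\<lambda>(y, x). ?h y * f (T x + y))"
    unfolding split_beta
    by (intro continuous_intros continuous_on_compose2[OF hc[of UNIV]] continuous_on_compose2[OF fc[of UNIV]] 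
        continuous_on_compose2[OF ct[of UNIV]]) auto
  have c2: "continuous_on UNIV (\<lambda>(x, y). ?h (y - T x) * f y)"
    unfolding split_beta
    by (intro continuous_intros continuous_on_compose2[OF hc[of UNIV]] continuous_on_compose2[OF fc[of UNIV]] 
        continuous_on_compose2[OF ct[of UNIV]]) auto
  have "integral UNIV ?h * ?I = integral UNIV (\<lambda>y. integral UNIV (\<lambda>x. ?h y * f (T x + y)))"
  proof -
    have *: "integral UNIV (\<lambda>x. ?h y * f (T x + y)) = ?h y * ?I" for y using e1[of y] by simp
    show ?thesis unfolding * by simp
  qed
  also have "\<dots> = integral UNIV (\<lambda>x. integral UNIV (\<lambda>y. ?h y * f (T x + y)))"
  proof (rule cc_integral_swap[OF c1 compact_cball[of 0 1] _ cB])
    show "?h y * f (T x + y) = 0" if "y \<notin> cball 0 1" for x y using hz[OF that] by simp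
    show "?h y * f (T x + y) = 0" if "x \<notin> B" for x y using inB[of x y] that hz[of y] C(2) by auto
  qed
  also have "\<dots> = integral UNIV (\<lambda>x. integral UNIV (\<lambda>y. ?h (y - T x) * f y))"
  proof -
    have "integral UNIV (\<lambda>y. ?h y * f (T x + y)) = integral UNIV (\<lambda>y. ?h (y - T x) * f y)" for x
    proof -
      have cch: "cc (\<lambda>y. ?h (y - T x))" using cc_shift[OF cc_bump0, of "- T x"] by simp
      show ?thesis
        using cc_integral_shift[OF cc_mult[OF cch f], of "T x"] by (simp add: add.commute)
    qed
    then show ?thesis by simp
  qed
  also have "\<dots> = integral UNIV (\<lambda>y. integral UNIV (\<lambda>x. ?h (y - T x) * f y))"
  proof (rule cc_integral_swap[OF c2 cB _ C(1)])
    show "?h (y - T x) * f y = 0" if "x \<notin> B" for x y using inB[of x "y - T x"] that hz[of "y - T x"] C(2) by auto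
    show "?h (y - T x) * f y = 0" if "y \<notin> C" for x y using that C(2) by auto
  qed
  also have "\<dots> = integral UNIV (\<lambda>y. f y * integral UNIV ?h)"
  proof -
    have *: "integral UNIV (\<lambda>x. ?h (y - T x) * f y) = f y * integral UNIV ?h" for y
    proof -
      have "norm (y - T x) = norm (x + (- inv T y))" for x
      proof -
        have "norm (y - T x) = norm (T (inv T y - x))"
          using TT by (simp add: linear_diff[OF lT])
        also have "\<dots> = norm (inv T y - x)" using T by (rule orthogonal_transformation_norm)
        finally show ?thesis by (simp add: norm_minus_commute)
      qed
      then have "?h (y - T x) = ?h (x + (- inv T y))" for x by (simp add: bump0_def)
      then have "integral UNIV (\<lambda>x. ?h (y - T x)) = integral UNIV ?h"
        by (simp only: cc_integral_shift[OF cc_bump0])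
      then show ?thesis by (simp add: mult.commute)
    qed
    show ?thesis unfolding * ..
  qed
  finally have "integral UNIV ?h * ?I = integral UNIV ?h * integral UNIV f" by simp
  then show ?thesis using integral_bump0_pos[where 'a='a] by simp
qed

subsection \<open>Test functions and integration by parts\<close>

definition csupp :: "'a::euclidean_space set \<Rightarrow> ('a \<Rightarrow> real) \<Rightarrow> bool"
  where "csupp D f \<longleftrightarrow> continuous_on UNIV f \<and> (\<exists>C. compact C \<and> C \<subseteq> D \<and> (\<forall>x. x \<notin> C \<longrightarrow> f x = 0))"

lemma csupp_cc: "csupp D f \<Longrightarrow> cc f"
  by (auto simp: csupp_def cc_def)

text \<open>Two relatively open sets cover \<open>S\<close>: on \<open>S \<inter> D\<close> both
  factors are continuous, and off \<open>C\<close> the product vanishes whatever \<open>g\<close>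
  does there. So a coefficient that is meaningful only on \<open>D\<close> may be multiplied by a
  test function.\<close>

lemma continuous_on_mult_supp:
  fixes f g :: "'a::topological_space \<Rightarrow> real"
  assumes "closed C" "open D" "C \<subseteq> D" "continuous_on S f" "\<And>x. x \<in> S \<Longrightarrow> x \<notin> C \<Longrightarrow> f x = 0"
    "continuous_on (S \<inter> D) g"
  shows "continuous_on S (\<lambda>x. f x * g x)"
proof -
  have "continuous_on (S \<inter> D) (\<lambda>x. f x * g x)"
    using assms by (auto intro!: continuous_intros intro: continuous_on_subset)
  moreover have "continuous_on (S - C) (\<lambda>x. f x * g x)"
    using assms(5) by (subst continuous_on_cong[of _ "S - C" _ "\<lambda>_. 0"]) auto
  moreover have "openin (top_of_set S) (S \<inter> D)" "openin (top_of_set S) (S - C)"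
    using assms(1,2) by (auto simp: openin_open_Int Diff_eq open_Compl)
  ultimately have "continuous_on ((S \<inter> D) \<union> (S - C)) (\<lambda>x. f x * g x)"
    using assms(3) by (intro continuous_on_Un_local_open) (auto simp: Un_absorb1 intro: openin_subset_trans)
  moreover have "(S \<inter> D) \<union> (S - C) = S" using assms(3) by auto
  ultimately show ?thesis by simp
qed

lemma csupp_mult:
  assumes "open D" "csupp D f" "continuous_on D g"
  shows "csupp D (\<lambda>x. f x * g x)"
proof -
  from assms obtain C where C: "compact C" "C \<subseteq> D" "\<And>x. x \<notin> C \<Longrightarrow> f x = 0" "continuous_on UNIV f"
    by (auto simp: csupp_def)
  then have "continuous_on UNIV (\<lambda>x. f x * g x)"
    using assms by (intro continuous_on_mult_supp[of C D]) (auto intro: compact_imp_closed)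
  with C show ?thesis by (auto simp: csupp_def)
qed

lemma gradient_eqI:
  "(f has_derivative (\<lambda>h. g \<bullet> h)) (at x) \<Longrightarrow> gradient f x = g"
  by (auto simp: gradient_def vec_eq_iff inner_axis frechet_derivative_at[symmetric])

text \<open>\<open>gradient\<close> is built from \<open>frechet_derivative\<close> and has a value
  even where no derivative exists; hence the explicit requirement that it represent the
  derivative.\<close>

definition C1_on :: "(real^'n) set \<Rightarrow> (real^'n \<Rightarrow> real) \<Rightarrow> bool"
  where "C1_on D f \<longleftrightarrow>
    (\<forall>x\<in>D. (f has_derivative (\<lambda>h. gradient f x \<bullet> h)) (at x)) \<and> continuous_on D (gradient f)"

lemma C1_onI:
  assumes "\<And>x. x \<in> D \<Longrightarrow> (f has_derivative (\<lambda>h. g x \<bullet> h)) (at x)" "continuous_on D g"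
  shows "C1_on D f"
proof -
  have "gradient f x = g x" if "x \<in> D" for x using assms(1)[OF that] by (rule gradient_eqI)
  then show ?thesis using assms by (auto simp: C1_on_def cong: continuous_on_cong)
qed

lemma C1_onD: "C1_on D f \<Longrightarrow> x \<in> D \<Longrightarrow> (f has_derivative (\<lambda>h. gradient f x \<bullet> h)) (at x)"
  by (simp add: C1_on_def)

lemma C1_on_continuous_gradient: "C1_on D f \<Longrightarrow> continuous_on D (gradient f)"
  by (simp add: C1_on_def)

lemma C1_on_subset: "C1_on D f \<Longrightarrow> E \<subseteq> D \<Longrightarrow> C1_on E f"
  by (auto simp: C1_on_def intro: continuous_on_subset)

lemma C1_on_continuous: "C1_on D f \<Longrightarrow> continuous_on D f"
  by (meson C1_onD continuous_at_imp_continuous_on has_derivative_continuous)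

lemma gradient_const [simp]: "gradient (\<lambda>x. c) x = 0"
  by (rule gradient_eqI) (auto intro!: derivative_eq_intros)

lemma gradient_add:
  assumes "(f has_derivative (\<lambda>h. gradient f x \<bullet> h)) (at x)" "(g has_derivative (\<lambda>h. gradient g x \<bullet> h)) (at x)"
  shows "gradient (\<lambda>x. f x + g x) x = gradient f x + gradient g x"
  by (rule gradient_eqI) (rule has_derivative_eq_rhs[OF has_derivative_add[OF assms]], simp add: fun_eq_iff inner_add_left)

lemma gradient_cmult:
  assumes "(f has_derivative (\<lambda>h. gradient f x \<bullet> h)) (at x)"
  shows "gradient (\<lambda>x. c * f x) x = c *\<^sub>R gradient f x"
  by (rule gradient_eqI) (rule has_derivative_eq_rhs[OF has_derivative_mult_right[OF assms]], simp add: fun_eq_iff)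

lemma C1_on_add:
  assumes "C1_on D f" "C1_on D g"
  shows "C1_on D (\<lambda>x. f x + g x)"
  by (rule C1_onI[of _ _ "\<lambda>x. gradient f x + gradient g x"])
    (use assms in \<open>auto simp: C1_on_def inner_add_left intro!: continuous_intros derivative_eq_intros\<close>)

lemma C1_on_cmult:
  assumes "C1_on D f"
  shows "C1_on D (\<lambda>x. c * f x)"
  by (rule C1_onI[of _ _ "\<lambda>x. c *\<^sub>R gradient f x"])
    (use assms in \<open>auto simp: C1_on_def intro!: continuous_intros derivative_eq_intros\<close>)

lemma C1_on_minus: "C1_on D f \<Longrightarrow> C1_on D (\<lambda>x. - f x)"
  using C1_on_cmult[of D f "-1"] by simp

lemma C1_on_diff: "C1_on D f \<Longrightarrow> C1_on D g \<Longrightarrow> C1_on D (\<lambda>x. f x - g x)"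
  using C1_on_add[of D f "\<lambda>x. - g x"] C1_on_minus[of D g] by simp

lemma gradient_minus:
  assumes "(f has_derivative (\<lambda>h. gradient f x \<bullet> h)) (at x)"
  shows "gradient (\<lambda>x. - f x) x = - gradient f x"
  using gradient_cmult[OF assms, of "-1"] by simp

lemma gradient_diff:
  assumes "(f has_derivative (\<lambda>h. gradient f x \<bullet> h)) (at x)" "(g has_derivative (\<lambda>h. gradient g x \<bullet> h)) (at x)"
  shows "gradient (\<lambda>x. f x - g x) x = gradient f x - gradient g x"
  by (rule gradient_eqI) (rule has_derivative_eq_rhs[OF has_derivative_diff[OF assms]], simp add: fun_eq_iff inner_diff_left)

definition test :: "(real^'n) set \<Rightarrow> (real^'n \<Rightarrow> real) \<Rightarrow> bool"
  where "test D \<phi> \<longleftrightarrow> C1_on UNIV \<phi> \<and> (\<exists>C. compact C \<and> C \<subseteq> D \<and> (\<forall>x. x \<notin> C \<longrightarrow> \<phi> x = 0))"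

lemma testI:
  assumes "C1_on UNIV \<phi>" "compact C" "C \<subseteq> D" "\<And>x. x \<notin> C \<Longrightarrow> \<phi> x = 0"
  shows "test D \<phi>"
  using assms by (auto simp: test_def)

lemma test_mono: "test D \<phi> \<Longrightarrow> D \<subseteq> E \<Longrightarrow> test E \<phi>"
  by (force simp: test_def)

lemma test_C1: "test D \<phi> \<Longrightarrow> C1_on UNIV \<phi>"
  by (simp add: test_def)

lemma test_deriv: "test D \<phi> \<Longrightarrow> (\<phi> has_derivative (\<lambda>h. gradient \<phi> x \<bullet> h)) (at x)"
  by (auto simp: test_def C1_on_def)

lemma gradient_outside:
  assumes "closed C" "\<And>x. x \<notin> C \<Longrightarrow> \<phi> x = 0" "x \<notin> C"
  shows "gradient \<phi> x = 0"
proof -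
  have "((\<lambda>x. 0) has_derivative (\<lambda>h. 0 \<bullet> h)) (at x)" by simp
  then have "(\<phi> has_derivative (\<lambda>h. 0 \<bullet> h)) (at x)"
    by (rule has_derivative_transform_within_open[of _ _ _ _ "- C"]) (use assms in auto)
  then show ?thesis by (rule gradient_eqI)
qed

lemma test_supp:
  assumes "test D \<phi>"
  obtains C where "compact C" "C \<subseteq> D" "\<And>x. x \<notin> C \<Longrightarrow> \<phi> x = 0" "\<And>x. x \<notin> C \<Longrightarrow> gradient \<phi> x = 0"
proof -
  obtain C where C: "compact C" "C \<subseteq> D" "\<And>x. x \<notin> C \<Longrightarrow> \<phi> x = 0"
    using assms by (auto simp: test_def)
  with gradient_outside[of C \<phi>] compact_imp_closed show ?thesis by (auto intro!: that[of C])
qed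

lemma test_csupp: "test D \<phi> \<Longrightarrow> csupp D \<phi>"
  unfolding csupp_def test_def by (auto intro: C1_on_continuous)

lemma test_csupp_gradient: "test D \<phi> \<Longrightarrow> csupp D (\<lambda>x. gradient \<phi> x $ l)"
  unfolding csupp_def
  by (rule conjI[OF continuous_on_component[OF C1_on_continuous_gradient[OF test_C1]]], assumption)
    (metis test_supp zero_index)

lemma test_outside: "test D \<phi> \<Longrightarrow> x \<notin> D \<Longrightarrow> \<phi> x = 0 \<and> gradient \<phi> x = 0"
  by (metis test_supp subsetD)

lemma test_cc: "test D \<phi> \<Longrightarrow> cc \<phi>"
  by (blast intro: csupp_cc test_csupp)

lemma inner_vec_sum: "x \<bullet> y = (\<Sum>l\<in>UNIV. x $ l * y $ l)" for x y :: "real^'n"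
  by (simp add: inner_vec_def)

lemma test_cc_gradient_inner:
  assumes "open D" "test D \<phi>" "continuous_on D G"
  shows "cc (\<lambda>x. gradient \<phi> x \<bullet> G x)" "cc (\<lambda>x. G x \<bullet> gradient \<phi> x)"
proof -
  show "cc (\<lambda>x. gradient \<phi> x \<bullet> G x)"
    unfolding inner_vec_sum using assms
    by (intro cc_sum csupp_cc[OF csupp_mult[OF assms(1) test_csupp_gradient[OF assms(2)]]]
        continuous_on_component assms)
  then show "cc (\<lambda>x. G x \<bullet> gradient \<phi> x)" by (simp add: inner_commute)
qed

lemma test_add: "test D f \<Longrightarrow> test D g \<Longrightarrow> test D (\<lambda>x. f x + g x)"
proof -
  assume *: "test D f" "test D g"
  then obtain A B where "compact A" "A \<subseteq> D" "\<forall>x. x \<notin> A \<longrightarrow> f x = 0"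
    "compact B" "B \<subseteq> D" "\<forall>x. x \<notin> B \<longrightarrow> g x = 0"
    by (auto simp: test_def)
  then show ?thesis
    using * by (intro testI[of _ "A \<union> B"]) (auto simp: compact_Un test_def intro: C1_on_add)
qed

lemma test_cmult: "test D f \<Longrightarrow> test D (\<lambda>x. c * f x)"
  by (auto simp: test_def intro!: C1_on_cmult)

lemma test_zero [simp]: "test D (\<lambda>x. 0)"
  by (rule testI[of _ "{}"]) (auto intro!: C1_onI[of _ _ "\<lambda>_. 0"])

text \<open>By translation invariance the integral of \<open>\<phi>\<close> shifted by
  \<open>t\<close> along the axis \<open>l\<close> does not depend on \<open>t\<close>;
  differentiating under the integral at \<open>t = 0\<close> gives the claim.\<close>

lemma integral_gradient_test:
  assumes "test D \<phi>"
  shows "integral UNIV (\<lambda>x. gradient \<phi> x $ l) = 0"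
proof -
  let ?b = "axis l (1::real)"
  obtain C where C: "compact C" "\<And>x. x \<notin> C \<Longrightarrow> \<phi> x = 0" "\<And>x. x \<notin> C \<Longrightarrow> gradient \<phi> x = 0"
    using test_supp[OF assms] by metis
  \<comment> \<open>The compact set swept out by all shifts of \<open>C\<close> with parameter in
    [-1, 1]. It contains the supports of all translates at once.\<close>
  define C' where "C' = (\<lambda>p. fst p - snd p *\<^sub>R ?b) ` (C \<times> {-1..1::real})"
  have cC': "compact C'"
    unfolding C'_def by (intro compact_continuous_image compact_Times C compact_Icc continuous_intros)
  have inC': "x \<in> C'" if "t \<in> {-1..1}" "x + t *\<^sub>R ?b \<in> C" for t x
    unfolding C'_def using that by (intro image_eqI[of _ _ "(x + t *\<^sub>R ?b, t)"]) auto
  have cp: "continuous_on S \<phi>" and cg: "continuous_on S (gradient \<phi>)" for S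
    using C1_on_continuous[OF test_C1[OF assms]] C1_on_continuous_gradient[OF test_C1[OF assms]]
    by (auto intro: continuous_on_subset)
  have "((\<lambda>t. integral UNIV (\<lambda>x. \<phi> (x + t *\<^sub>R ?b))) has_field_derivative
      integral UNIV (\<lambda>x. gradient \<phi> (x + 0 *\<^sub>R ?b) \<bullet> ?b)) (at 0 within {-1..1})"
  proof (rule cc_integral_param_deriv[OF _ _ cC'])
    show "((\<lambda>t. \<phi> (x + t *\<^sub>R ?b)) has_field_derivative gradient \<phi> (x + t *\<^sub>R ?b) \<bullet> ?b) (at t within {-1..1})"
      for t x
    proof -
      have "((\<lambda>t. \<phi> (x + t *\<^sub>R ?b)) has_derivative (\<lambda>h. gradient \<phi> (x + t *\<^sub>R ?b) \<bullet> (h *\<^sub>R ?b))) (at t within {-1..1})"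
        by (rule has_derivative_compose[OF _ test_deriv[OF assms]]) (auto intro!: derivative_eq_intros)
      then show ?thesis
        by (rule has_derivative_imp_has_field_derivative) simp
    qed
    show "continuous_on ({-1..1} \<times> UNIV) (\<lambda>(t, x). gradient \<phi> (x + t *\<^sub>R ?b) \<bullet> ?b)"
      unfolding split_beta by (intro continuous_intros continuous_on_compose2[OF cg[of UNIV]]) auto
    show "continuous_on UNIV (\<lambda>x. \<phi> (x + t *\<^sub>R ?b))" for t
      by (intro continuous_intros continuous_on_compose2[OF cp[of UNIV]]) auto
    show "\<phi> (x + t *\<^sub>R ?b) = 0" if "t \<in> {-1..1}" "x \<notin> C'" for t x
      using inC'[OF that(1)] that(2) C(2) by blast
    show "gradient \<phi> (x + t *\<^sub>R ?b) \<bullet> ?b = 0" if "t \<in> {-1..1}" "x \<notin> C'" for t x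
    proof -
      have "gradient \<phi> (x + t *\<^sub>R ?b) = 0" using inC'[OF that(1)] that(2) C(3) by blast
      then show ?thesis by simp
    qed
  qed auto
  moreover have "integral UNIV (\<lambda>x. \<phi> (x + t *\<^sub>R ?b)) = integral UNIV \<phi>" for t
    by (rule cc_integral_shift[OF test_cc[OF assms]])
  ultimately have "((\<lambda>t. integral UNIV \<phi>) has_field_derivative integral UNIV (\<lambda>x. gradient \<phi> x \<bullet> ?b)) (at 0 within {-1..1})"
    by simp
  moreover have "((\<lambda>t. integral UNIV \<phi>) has_field_derivative 0) (at (0::real) within {-1..1})" by simp
  ultimately have "integral UNIV (\<lambda>x. gradient \<phi> x \<bullet> ?b) = 0"
    using vector_derivative_unique_within_closed_interval[of "-1" 1 0 "\<lambda>t. integral UNIV \<phi>"]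
    by (simp add: has_real_derivative_iff_has_vector_derivative)
  then show ?thesis by (simp add: inner_axis)
qed

lemma test_mult:
  assumes "open D" "test D \<phi>" "C1_on D w"
  shows "test D (\<lambda>x. \<phi> x * w x)"
    and "gradient (\<lambda>x. \<phi> x * w x) x = \<phi> x *\<^sub>R gradient w x + w x *\<^sub>R gradient \<phi> x"
proof -
  obtain C where C: "compact C" "C \<subseteq> D" "\<And>x. x \<notin> C \<Longrightarrow> \<phi> x = 0" "\<And>x. x \<notin> C \<Longrightarrow> gradient \<phi> x = 0"
    using test_supp[OF assms(2)] by metis
  have d: "((\<lambda>x. \<phi> x * w x) has_derivative (\<lambda>h. (\<phi> x *\<^sub>R gradient w x + w x *\<^sub>R gradient \<phi> x) \<bullet> h)) (at x)" for x
  proof (cases "x \<in> D")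
    case True
    show ?thesis
      by (rule has_derivative_eq_rhs[OF has_derivative_mult[OF test_deriv[OF assms(2)] C1_onD[OF assms(3) True]]])
        (simp add: fun_eq_iff inner_add_left)
  next
    case False
    then have x: "x \<notin> C" using C by auto
    have "((\<lambda>x. 0) has_derivative (\<lambda>h. 0 \<bullet> h)) (at x)" by simp
    then have "((\<lambda>x. \<phi> x * w x) has_derivative (\<lambda>h. 0 \<bullet> h)) (at x)"
      by (rule has_derivative_transform_within_open[of _ _ _ _ "- C"]) (use C x in \<open>auto intro: compact_imp_closed\<close>)
    then show ?thesis using C x by simp
  qed
  then show "gradient (\<lambda>x. \<phi> x * w x) x = \<phi> x *\<^sub>R gradient w x + w x *\<^sub>R gradient \<phi> x"
    by (rule gradient_eqI)
  have *: "continuous_on UNIV (\<lambda>x. gradient \<phi> x $ l)" "continuous_on UNIV \<phi>" for l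
    by (intro continuous_on_component C1_on_continuous_gradient[OF test_C1[OF assms(2)]]
        C1_on_continuous[OF test_C1[OF assms(2)]])+
  have "continuous_on UNIV (\<lambda>x. (\<phi> x *\<^sub>R gradient w x + w x *\<^sub>R gradient \<phi> x) $ l)" for l
  proof -
    have "continuous_on UNIV (\<lambda>x. \<phi> x * gradient w x $ l)"
      using assms C * by (intro continuous_on_mult_supp[of C D])
        (auto intro!: compact_imp_closed continuous_on_component C1_on_continuous_gradient)
    moreover have "continuous_on UNIV (\<lambda>x. gradient \<phi> x $ l * w x)"
      using assms C * by (intro continuous_on_mult_supp[of C D])
        (auto intro!: compact_imp_closed C1_on_continuous)
    ultimately show ?thesis by (simp add: mult.commute continuous_on_add)
  qed
  then have "continuous_on UNIV (\<lambda>x. \<chi> l. (\<phi> x *\<^sub>R gradient w x + w x *\<^sub>R gradient \<phi> x) $ l)"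
    by (intro continuous_on_vec_lambda)
  then have "continuous_on UNIV (\<lambda>x. \<phi> x *\<^sub>R gradient w x + w x *\<^sub>R gradient \<phi> x)"
    by (simp only: vec_lambda_eta)
  then have "C1_on UNIV (\<lambda>x. \<phi> x * w x)"
    using d by (intro C1_onI[of _ _ "\<lambda>x. \<phi> x *\<^sub>R gradient w x + w x *\<^sub>R gradient \<phi> x"]) auto
  then show "test D (\<lambda>x. \<phi> x * w x)"
    using C by (intro testI[of _ C]) auto
qed

lemma integral_by_parts_test:
  assumes "open D" "test D \<phi>" "C1_on D w"
  shows "integral UNIV (\<lambda>x. \<phi> x * gradient w x $ l) = - integral UNIV (\<lambda>x. gradient \<phi> x $ l * w x)"
    and "cc (\<lambda>x. \<phi> x * gradient w x $ l)" "cc (\<lambda>x. gradient \<phi> x $ l * w x)"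
proof -
  show a: "cc (\<lambda>x. \<phi> x * gradient w x $ l)"
    by (intro csupp_cc[OF csupp_mult[OF assms(1) test_csupp[OF assms(2)]]]
        continuous_on_component C1_on_continuous_gradient assms)
  show b: "cc (\<lambda>x. gradient \<phi> x $ l * w x)"
    by (rule csupp_cc[OF csupp_mult[OF assms(1) test_csupp_gradient[OF assms(2)] C1_on_continuous[OF assms(3)]]])
  have "0 = integral UNIV (\<lambda>x. \<phi> x * gradient w x $ l + gradient \<phi> x $ l * w x)"
    using integral_gradient_test[OF test_mult(1)[OF assms], of l]
    by (simp add: test_mult(2)[OF assms] mult.commute)
  also have "\<dots> = integral UNIV (\<lambda>x. \<phi> x * gradient w x $ l) + integral UNIV (\<lambda>x. gradient \<phi> x $ l * w x)"
    by (rule cc_integral_add[OF a b])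
  finally show "integral UNIV (\<lambda>x. \<phi> x * gradient w x $ l) = - integral UNIV (\<lambda>x. gradient \<phi> x $ l * w x)"
    by simp
qed

text \<open>The adjoint of an orthogonal map is its inverse, which is why the gradient is pulled
  back by \<open>inv T\<close>.\<close>

lemma C1_on_orthogonal:
  fixes T :: "real^'n \<Rightarrow> real^'n"
  assumes T: "orthogonal_transformation T" and f: "C1_on D f"
  shows "C1_on (T -` D) (\<lambda>x. f (T x))"
    and "x \<in> T -` D \<Longrightarrow> gradient (\<lambda>x. f (T x)) x = inv T (gradient f (T x))"
proof -
  have Ti: "orthogonal_transformation (inv T)" and bT: "bij T"
    using T orthogonal_transformation_inv orthogonal_transformation_bij by auto
  have lT: "bounded_linear T" and lTi: "bounded_linear (inv T)"
    using T Ti by (auto simp: orthogonal_transformation_linear linear_conv_bounded_linear[symmetric])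
  have adj: "g \<bullet> T h = inv T g \<bullet> h" for g h
  proof -
    have "g \<bullet> T h = T (inv T g) \<bullet> T h" using bT by (simp add: bij_is_surj surj_f_inv_f)
    then show ?thesis using T by (simp add: orthogonal_transformation_def)
  qed
  have d: "((\<lambda>x. f (T x)) has_derivative (\<lambda>h. inv T (gradient f (T x)) \<bullet> h)) (at x)" if "x \<in> T -` D" for x
  proof -
    have "((\<lambda>x. f (T x)) has_derivative (\<lambda>h. gradient f (T x) \<bullet> T h)) (at x)"
      using that by (intro has_derivative_compose[OF bounded_linear_imp_has_derivative[OF lT] C1_onD[OF f]]) auto
    then show ?thesis by (simp add: adj)
  qed
  then show "x \<in> T -` D \<Longrightarrow> gradient (\<lambda>x. f (T x)) x = inv T (gradient f (T x))"
    by (rule gradient_eqI)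
  have "continuous_on (T -` D) (\<lambda>x. inv T (gradient f (T x)))"
    by (intro bounded_linear.continuous_on[OF lTi] continuous_on_compose2[OF C1_on_continuous_gradient[OF f]]
        linear_continuous_on lT) auto
  then show "C1_on (T -` D) (\<lambda>x. f (T x))"
    using d by (intro C1_onI[of _ _ "\<lambda>x. inv T (gradient f (T x))"])
qed

lemma inner_gradient_orthogonal:
  fixes T :: "real^'n \<Rightarrow> real^'n"
  assumes T: "orthogonal_transformation T" and "C1_on D f" "C1_on D g" "T x \<in> D"
  shows "gradient (\<lambda>x. f (T x)) x \<bullet> gradient (\<lambda>x. g (T x)) x = gradient f (T x) \<bullet> gradient g (T x)"
proof -
  have "orthogonal_transformation (inv T)" using T orthogonal_transformation_inv by blast
  with assms show ?thesis by (simp add: C1_on_orthogonal(2)[OF T] orthogonal_transformation_def)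
qed

lemma test_orthogonal:
  fixes T :: "real^'n \<Rightarrow> real^'n"
  assumes T: "orthogonal_transformation T" and f: "test D f"
  shows "test (T -` D) (\<lambda>x. f (T x))"
proof -
  obtain C where C: "compact C" "C \<subseteq> D" "\<And>x. x \<notin> C \<Longrightarrow> f x = 0"
    using f by (auto simp: test_def)
  have Ti: "orthogonal_transformation (inv T)" and bT: "bij T"
    using T orthogonal_transformation_inv orthogonal_transformation_bij by auto
  have "continuous_on C (inv T)"
    using Ti orthogonal_transformation_linear linear_continuous_on linear_conv_bounded_linear by blast
  then have "compact (inv T ` C)" using C by (intro compact_continuous_image)
  then have "compact (T -` C)" using bT by (simp add: bij_vimage_eq_inv_image)
  moreover have "C1_on UNIV (\<lambda>x. f (T x))"
    using C1_on_orthogonal(1)[OF T test_C1[OF f]] by simp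
  ultimately show ?thesis using C by (intro testI[of _ "T -` C"]) auto
qed

subsection \<open>Truncations\<close>

lemma has_derivative_pos_power:
  "((\<lambda>t::real. (max 0 t)^Suc (Suc n)) has_real_derivative (real (Suc (Suc n)) * (max 0 t)^Suc n)) (at t)"
proof -
  consider "t > 0" | "t < 0" | "t = 0" by linarith
  then show ?thesis
  proof cases
    case 1
    have "((\<lambda>t::real. t^Suc (Suc n)) has_real_derivative (real (Suc (Suc n)) * (max 0 t)^Suc n)) (at t)"
      using DERIV_pow[of "Suc (Suc n)" t] 1 by (simp add: max_def)
    then show ?thesis
      by (rule has_field_derivative_transform_within_open[of _ _ _ "{0<..}"]) (use 1 in auto)
  next
    case 2
    have "((\<lambda>t::real. 0) has_real_derivative (real (Suc (Suc n)) * (max 0 t)^Suc n)) (at t)"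
      using 2 by auto
    then show ?thesis
      by (rule has_field_derivative_transform_within_open[of _ _ _ "{..<0}"]) (use 2 in auto)
  next
    case 3
    have "((\<lambda>h::real. (max 0 h)^Suc n) \<longlongrightarrow> (max 0 0)^Suc n) (at 0)"
      by (intro tendsto_intros)
    then have "((\<lambda>h::real. (max 0 h)^Suc n) \<longlongrightarrow> 0) (at 0)" by simp
    then have "((\<lambda>h::real. (max 0 h)^Suc (Suc n) / h) \<longlongrightarrow> 0) (at 0)"
      by (rule Lim_transform_eventually) (auto simp: eventually_at max_def intro!: exI[of _ 1])
    then show ?thesis using 3 by (simp add: has_field_derivative_iff)
  qed
qed

lemma has_derivative_pos_square:
  "((\<lambda>t::real. (max 0 t)\<^sup>2) has_real_derivative 2 * max 0 t) (at t)"
  using has_derivative_pos_power[of 0 t] by (simp add: power2_eq_square)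

lemma has_derivative_pos_cube:
  "((\<lambda>t::real. (max 0 t)^3) has_real_derivative 3 * (max 0 t)\<^sup>2) (at t)"
  using has_derivative_pos_power[of 1 t] by (simp add: power2_eq_square power3_eq_cube mult.assoc)

text \<open>A continuously differentiable approximation of the positive part that vanishes near \<open>0\<close>.\<close>

definition trunc :: "real \<Rightarrow> real \<Rightarrow> real"
  where "trunc \<epsilon> t = (max 0 (t - \<epsilon>))\<^sup>2 / t"

definition trunc' :: "real \<Rightarrow> real \<Rightarrow> real"
  where "trunc' \<epsilon> t = (2 * max 0 (t - \<epsilon>) * t - (max 0 (t - \<epsilon>))\<^sup>2) / t\<^sup>2"

lemma trunc_eq_0: "t \<le> \<epsilon> \<Longrightarrow> trunc \<epsilon> t = 0" "t \<le> \<epsilon> \<Longrightarrow> trunc' \<epsilon> t = 0"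
  by (auto simp: trunc_def trunc'_def)

lemma trunc_deriv:
  assumes "\<epsilon> > 0"
  shows "(trunc \<epsilon> has_real_derivative trunc' \<epsilon> t) (at t)"
proof (cases "t < \<epsilon>")
  case True
  have "((\<lambda>t::real. 0) has_real_derivative trunc' \<epsilon> t) (at t)" using True by (simp add: trunc_eq_0)
  then show ?thesis
    by (rule has_field_derivative_transform_within_open[of _ _ _ "{..<\<epsilon>}"]) (use True in \<open>auto simp: trunc_eq_0\<close>)
next
  case False
  then have "t > 0" using assms by simp
  have "((\<lambda>t. (max 0 (t - \<epsilon>))\<^sup>2) has_real_derivative 2 * max 0 (t - \<epsilon>) * 1) (at t)"
    by (rule DERIV_chain2[OF has_derivative_pos_square]) (auto intro!: derivative_eq_intros)
  from DERIV_divide[OF this DERIV_ident] \<open>t > 0\<close>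
  show ?thesis by (simp add: trunc_def[abs_def] trunc'_def power2_eq_square)
qed

lemma trunc_pos:
  assumes "\<epsilon> > 0" "t > \<epsilon>"
  shows "trunc \<epsilon> t = t - 2 * \<epsilon> + \<epsilon>\<^sup>2 / t" "trunc' \<epsilon> t = 1 - (\<epsilon> / t)\<^sup>2"
  using assms by (auto simp: trunc_def trunc'_def max_def field_simps power2_eq_square)

text \<open>Above \<epsilon> the truncation is t - 2 \<epsilon> + \<epsilon>^2/t, with slope 1 -
  (\<epsilon>/t)^2. A slope in [0, 1] makes the squared gradient of a truncated function at most its
  inner product with the original gradient; the energy estimates rest on this.\<close>

lemma trunc'_bounds: "\<epsilon> > 0 \<Longrightarrow> 0 \<le> trunc' \<epsilon> t" "\<epsilon> > 0 \<Longrightarrow> trunc' \<epsilon> t \<le> 1"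
proof -
  assume e: "\<epsilon> > 0"
  have "0 \<le> trunc' \<epsilon> t \<and> trunc' \<epsilon> t \<le> 1"
  proof (cases "t \<le> \<epsilon>")
    case False
    then have "(\<epsilon> / t)\<^sup>2 \<le> 1" using e by (simp add: power_le_one)
    then show ?thesis using False e by (simp add: trunc_pos)
  qed (simp add: trunc_eq_0)
  then show "0 \<le> trunc' \<epsilon> t" "trunc' \<epsilon> t \<le> 1" by auto
qed

lemma trunc_bounds:
  assumes "\<epsilon> > 0"
  shows "0 \<le> trunc \<epsilon> t" "trunc \<epsilon> t \<le> max 0 t" "max 0 t - 2 * \<epsilon> \<le> trunc \<epsilon> t"
proof -
  have "0 \<le> trunc \<epsilon> t \<and> trunc \<epsilon> t \<le> max 0 t \<and> max 0 t - 2 * \<epsilon> \<le> trunc \<epsilon> t"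
  proof (cases "t \<le> \<epsilon>")
    case False
    then have "\<epsilon>\<^sup>2 / t \<le> \<epsilon>" using assms by (simp add: power2_eq_square divide_le_eq)
    moreover have "0 \<le> \<epsilon>\<^sup>2 / t" using False assms by simp
    moreover have "0 \<le> trunc \<epsilon> t" using False assms by (simp add: trunc_def)
    ultimately show ?thesis using False assms by (auto simp: trunc_pos)
  qed (use assms in \<open>auto simp: trunc_eq_0\<close>)
  then show "0 \<le> trunc \<epsilon> t" "trunc \<epsilon> t \<le> max 0 t" "max 0 t - 2 * \<epsilon> \<le> trunc \<epsilon> t" by auto
qed

lemma continuous_on_trunc': "\<epsilon> > 0 \<Longrightarrow> continuous_on UNIV (trunc' \<epsilon>)"
proof -
  assume e: "\<epsilon> > 0"
  have "continuous_on {0<..} (trunc' \<epsilon>)"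
    unfolding trunc'_def[abs_def] by (intro continuous_intros) auto
  moreover have "continuous_on {..<\<epsilon>} (trunc' \<epsilon>)"
    by (subst continuous_on_cong[of _ "{..<\<epsilon>}" _ "\<lambda>_. 0"]) (auto simp: trunc_eq_0)
  ultimately have "continuous_on ({0<..} \<union> {..<\<epsilon>}) (trunc' \<epsilon>)"
    by (intro continuous_on_open_Un) auto
  moreover have "{0<..} \<union> {..<\<epsilon>} = UNIV" using e by auto
  ultimately show ?thesis by simp
qed

text \<open>On the frontier \<open>z \<le> 0 < \<epsilon>\<close>, so the superlevel set taken in
  the closure already lies in \<open>D\<close> and is closed. It carries the truncation
  \<open>cut\<close>, which therefore has compact support in \<open>D\<close>.\<close>

lemma compact_superlevel:
  fixes z :: "real^'n \<Rightarrow> real"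
  assumes "bounded D" "continuous_on (closure D) z" "\<And>x. x \<in> frontier D \<Longrightarrow> z x \<le> 0" "\<epsilon> > 0" "open D"
  shows "compact {x \<in> D. \<epsilon> \<le> z x}"
proof -
  have "closed {x \<in> closure D. \<epsilon> \<le> z x}"
  proof -
    have "{x \<in> closure D. \<epsilon> \<le> z x} = closure D \<inter> z -` {\<epsilon>..}" by auto
    then show ?thesis using continuous_closed_preimage[OF assms(2) closed_closure, of "{\<epsilon>..}"] by simp
  qed
  moreover have "{x \<in> closure D. \<epsilon> \<le> z x} = {x \<in> D. \<epsilon> \<le> z x}"
    using assms(3,4,5) closure_subset[of D] by (force simp: frontier_def interior_open)
  moreover have "bounded {x \<in> D. \<epsilon> \<le> z x}"
    using assms(1) by (rule bounded_subset) auto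
  ultimately show ?thesis by (simp add: compact_eq_bounded_closed)
qed

definition cut :: "(real^'n) set \<Rightarrow> (real^'n \<Rightarrow> real) \<Rightarrow> real \<Rightarrow> real^'n \<Rightarrow> real"
  where "cut D z \<epsilon> x = (if x \<in> D then trunc \<epsilon> (z x) else 0)"

definition pos_on :: "(real^'n) set \<Rightarrow> (real^'n \<Rightarrow> real) \<Rightarrow> real^'n \<Rightarrow> real"
  where "pos_on D z x = (if x \<in> D then max 0 (z x) else 0)"

lemma
  assumes D: "open D" "bounded D" and z: "C1_on D z" "continuous_on (closure D) z"
    "\<And>x. x \<in> frontier D \<Longrightarrow> z x \<le> 0" and e: "\<epsilon> > 0"
  shows test_cut: "test D (cut D z \<epsilon>)"
    and gradient_cut: "x \<in> D \<Longrightarrow> gradient (cut D z \<epsilon>) x = trunc' \<epsilon> (z x) *\<^sub>R gradient z x"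
    and gradient_cut_out: "x \<notin> D \<Longrightarrow> gradient (cut D z \<epsilon>) x = 0"
proof -
  let ?C = "{x \<in> D. \<epsilon> \<le> z x}"
  have C: "compact ?C" by (rule compact_superlevel[OF D(2) z(2,3) e D(1)])
  define g where "g x = (if x \<in> D then trunc' \<epsilon> (z x) *\<^sub>R gradient z x else 0)" for x
  have out: "cut D z \<epsilon> x = 0" "g x = 0" if "x \<notin> ?C" for x
    using that by (auto simp: cut_def g_def trunc_eq_0)
  have d: "(cut D z \<epsilon> has_derivative (\<lambda>h. g x \<bullet> h)) (at x)" for x
  proof (cases "x \<in> D")
    case True
    have "((\<lambda>x. trunc \<epsilon> (z x)) has_derivative (\<lambda>h. trunc' \<epsilon> (z x) * (gradient z x \<bullet> h))) (at x)"
      using has_derivative_compose[OF C1_onD[OF z(1) True] trunc_deriv[OF e, unfolded has_field_derivative_def]]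
      by simp
    then have "((\<lambda>x. trunc \<epsilon> (z x)) has_derivative (\<lambda>h. g x \<bullet> h)) (at x)"
      using True by (simp add: g_def)
    then show ?thesis
      by (rule has_derivative_transform_within_open[of _ _ _ _ D]) (use True D in \<open>auto simp: cut_def\<close>)
  next
    case False
    then have x: "x \<notin> ?C" by auto
    have "((\<lambda>x. 0) has_derivative (\<lambda>h. 0 \<bullet> h)) (at x)" by simp
    then have "(cut D z \<epsilon> has_derivative (\<lambda>h. 0 \<bullet> h)) (at x)"
      by (rule has_derivative_transform_within_open[of _ _ _ _ "- ?C"])
        (use C x out in \<open>auto intro: compact_imp_closed\<close>)
    then show ?thesis using out(2)[OF x] by simp
  qed
  have gr: "gradient (cut D z \<epsilon>) x = g x" for x using d by (rule gradient_eqI)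
  then show "x \<in> D \<Longrightarrow> gradient (cut D z \<epsilon>) x = trunc' \<epsilon> (z x) *\<^sub>R gradient z x"
    and "x \<notin> D \<Longrightarrow> gradient (cut D z \<epsilon>) x = 0" by (auto simp: g_def)
  have "continuous_on D g"
  proof -
    have "continuous_on D (\<lambda>x. trunc' \<epsilon> (z x) *\<^sub>R gradient z x)"
      by (intro continuous_intros continuous_on_compose2[OF continuous_on_trunc'[OF e]]
          C1_on_continuous C1_on_continuous_gradient z) auto
    then show ?thesis by (simp add: g_def cong: continuous_on_cong)
  qed
  moreover have "continuous_on (- ?C) g"
    using out by (subst continuous_on_cong[of _ "- ?C" _ "\<lambda>_. 0"]) auto
  ultimately have "continuous_on (D \<union> - ?C) g"
    using C D by (intro continuous_on_open_Un) (auto intro: compact_imp_closed)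
  moreover have "D \<union> - ?C = UNIV" by auto
  ultimately have "continuous_on UNIV g" by simp
  then show "test D (cut D z \<epsilon>)"
    using d out C by (intro testI[of _ ?C] C1_onI[of _ _ g]) auto
qed

lemma cut_bounds:
  assumes "\<epsilon> > 0"
  shows "0 \<le> cut D z \<epsilon> x" "cut D z \<epsilon> x \<le> pos_on D z x" "pos_on D z x - 2 * \<epsilon> \<le> cut D z \<epsilon> x"
    "\<bar>cut D z \<epsilon> x - pos_on D z x\<bar> \<le> 2 * \<epsilon>"
  using trunc_bounds[OF assms, of "z x"] assms by (auto simp: cut_def pos_on_def)

subsection \<open>The bumps\<close>

definition bp :: "real^'n \<Rightarrow> real \<Rightarrow> real^'n \<Rightarrow> real"
  where "bp x0 s x = max 0 (s\<^sup>2 - (norm (x - x0))\<^sup>2)"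

text \<open>The cube is the lowest integer power of the truncated paraboloid \<open>bp\<close> that
  is C^2. Its Laplacian \<open>lap_bump\<close> is then continuous and again a polynomial in
  \<open>bp\<close>.\<close>

definition bump :: "real^'n \<Rightarrow> real \<Rightarrow> real^'n \<Rightarrow> real"
  where "bump x0 s x = bp x0 s x ^ 3"

definition lap_bump :: "real^'n \<Rightarrow> real \<Rightarrow> real^'n \<Rightarrow> real"
  where "lap_bump x0 s x = 24 * s\<^sup>2 * bp x0 s x - (6 * CARD('n) + 24) * (bp x0 s x)\<^sup>2"

lemma bp_nonneg [simp]: "0 \<le> bp x0 s x" by (simp add: bp_def)

lemma bp_outside: "0 \<le> s \<Longrightarrow> x \<notin> ball x0 s \<Longrightarrow> bp x0 s x = 0"
  by (auto simp: bp_def dist_norm norm_minus_commute intro!: power_mono)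

lemma bp_pos: "x \<in> ball x0 s \<Longrightarrow> 0 < bp x0 s x"
  by (auto simp: bp_def dist_norm norm_minus_commute less_max_iff_disj intro!: power_strict_mono)

lemma bp_le: "bp x0 s x \<le> s\<^sup>2" by (simp add: bp_def)

lemma continuous_on_bp: "continuous_on S (bp x0 s)"
  unfolding bp_def[abs_def] by (intro continuous_intros)

lemma csupp_bp: "0 \<le> s \<Longrightarrow> cball x0 s \<subseteq> D \<Longrightarrow> csupp D (bp x0 s)"
  unfolding csupp_def by (intro conjI exI[of _ "cball x0 s"] continuous_on_bp) (auto intro!: bp_outside)

lemma normsq_deriv: "((\<lambda>x. s\<^sup>2 - (norm (x - x0))\<^sup>2) has_derivative (\<lambda>h. - 2 * ((x - x0) \<bullet> h))) (at (x::real^'n))"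
  unfolding power2_norm_eq_inner by (auto intro!: derivative_eq_intros simp: inner_commute)

lemma bp_square_deriv:
  "((\<lambda>x. (bp x0 s x)\<^sup>2) has_derivative (\<lambda>h. (- 4 * bp x0 s x) *\<^sub>R (x - x0) \<bullet> h)) (at x)"
  using has_derivative_compose[OF normsq_deriv has_derivative_pos_square[unfolded has_field_derivative_def], of s x0 x]
  by (simp add: bp_def mult_ac)

lemma bump_deriv:
  "(bump x0 s has_derivative (\<lambda>h. (- 6 * (bp x0 s x)\<^sup>2) *\<^sub>R (x - x0) \<bullet> h)) (at x)"
  using has_derivative_compose[OF normsq_deriv has_derivative_pos_cube[unfolded has_field_derivative_def], of s x0 x]
  by (simp add: bp_def bump_def[abs_def] mult_ac)

lemma gradient_bump: "gradient (bump x0 s) x = (- 6 * (bp x0 s x)\<^sup>2) *\<^sub>R (x - x0)"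
  by (rule gradient_eqI[OF bump_deriv])

lemma C1_on_bump: "C1_on D (bump x0 s)"
  by (rule C1_onI[OF bump_deriv]) (intro continuous_intros continuous_on_bp)

lemma bump_outside: "0 \<le> s \<Longrightarrow> x \<notin> ball x0 s \<Longrightarrow> bump x0 s x = 0"
  by (simp add: bump_def bp_outside)

lemma bump_nonneg [simp]: "0 \<le> bump x0 s x" by (simp add: bump_def)

lemma bump_pos: "x \<in> ball x0 s \<Longrightarrow> 0 < bump x0 s x" by (simp add: bump_def bp_pos)

lemma test_bump: "0 \<le> s \<Longrightarrow> cball x0 s \<subseteq> D \<Longrightarrow> test D (bump x0 s)"
  by (rule testI[OF C1_on_bump, of "cball x0 s"]) (auto intro!: bump_outside)

lemma gradient_bump_deriv:
  "((\<lambda>x. gradient (bump x0 s) x $ l) has_derivative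
     (\<lambda>h. (24 * bp x0 s x * (x - x0) $ l) *\<^sub>R (x - x0) \<bullet> h - 6 * (bp x0 s x)\<^sup>2 * h $ l)) (at x)"
proof -
  have "((\<lambda>x. (x - x0) $ l) has_derivative (\<lambda>h. h $ l)) (at x)"
    by (auto intro!: derivative_eq_intros bounded_linear_imp_has_derivative bounded_linear_vec_nth)
  from has_derivative_mult[OF has_derivative_mult_right[OF bp_square_deriv, of "-6"] this]
  show ?thesis by (simp add: gradient_bump algebra_simps)
qed

lemma test_gradient_bump:
  assumes "0 \<le> s" "cball x0 s \<subseteq> D"
  shows "test D (\<lambda>x. gradient (bump x0 s) x $ l)"
    and "gradient (\<lambda>x. gradient (bump x0 s) x $ l) x $ k =
      24 * bp x0 s x * (x - x0) $ l * (x - x0) $ k - (if k = l then 6 * (bp x0 s x)\<^sup>2 else 0)"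
proof -
  let ?g = "\<lambda>x. (24 * bp x0 s x * (x - x0) $ l) *\<^sub>R (x - x0) - (6 * (bp x0 s x)\<^sup>2) *\<^sub>R axis l 1"
  have d: "((\<lambda>x. gradient (bump x0 s) x $ l) has_derivative (\<lambda>h. ?g x \<bullet> h)) (at x)" for x
    by (rule has_derivative_eq_rhs[OF gradient_bump_deriv]) (simp add: fun_eq_iff inner_diff_left inner_axis')
  have "C1_on UNIV (\<lambda>x. gradient (bump x0 s) x $ l)"
    by (rule C1_onI[OF d]) (intro continuous_intros continuous_on_bp)
  then show "test D (\<lambda>x. gradient (bump x0 s) x $ l)"
    using assms by (intro testI[of _ "cball x0 s"]) (auto simp: gradient_bump bp_outside)
  show "gradient (\<lambda>x. gradient (bump x0 s) x $ l) x $ k =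
      24 * bp x0 s x * (x - x0) $ l * (x - x0) $ k - (if k = l then 6 * (bp x0 s x)\<^sup>2 else 0)"
    by (simp add: gradient_eqI[OF d] axis_def)
qed

lemma lap_bump_eq:
  fixes x0 :: "real^'n"
  assumes "0 \<le> s"
  shows "(\<Sum>l\<in>UNIV. gradient (\<lambda>x. gradient (bump x0 s) x $ l) x $ l) = lap_bump x0 s x"
proof -
  have "(\<Sum>l\<in>UNIV. gradient (\<lambda>x. gradient (bump x0 s) x $ l) x $ l) =
     24 * bp x0 s x * ((x - x0) \<bullet> (x - x0)) - CARD('n) * (6 * (bp x0 s x)\<^sup>2)"
    using assms by (simp add: test_gradient_bump(2)[OF _ subset_UNIV] sum_subtractf inner_vec_def sum_distrib_left mult_ac
        del: vector_minus_component)
  \<comment> \<open>Where \<open>bp\<close> is positive, |x - x0|^2 equals s^2 - \<open>bp\<close>;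
    elsewhere both sides vanish.\<close>
  also have "bp x0 s x * ((x - x0) \<bullet> (x - x0)) = bp x0 s x * (s\<^sup>2 - bp x0 s x)"
    by (auto simp: bp_def power2_norm_eq_inner max_def)
  then have "24 * bp x0 s x * ((x - x0) \<bullet> (x - x0)) = 24 * bp x0 s x * (s\<^sup>2 - bp x0 s x)" by simp
  finally show ?thesis by (simp add: lap_bump_def power2_eq_square algebra_simps)
qed

lemma csupp_lap_bump: "0 \<le> s \<Longrightarrow> cball x0 s \<subseteq> D \<Longrightarrow> csupp D (lap_bump x0 s)"
  unfolding csupp_def lap_bump_def[abs_def]
  by (intro conjI exI[of _ "cball x0 s"] continuous_intros continuous_on_bp) (auto simp: bp_outside)

text \<open>All second derivatives fall on the explicit bump, so \<open>w\<close> need only be C^1.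
  This converts weak equations with gradients into equations tested against \<open>lap_bump\<close>,
  in which \<open>w\<close> is not differentiated.\<close>

lemma
  assumes "0 \<le> s" "cball x0 s \<subseteq> D" "open D" "C1_on D w"
  shows integral_by_parts_bump:
      "integral UNIV (\<lambda>x. gradient w x \<bullet> gradient (bump x0 s) x) = - integral UNIV (\<lambda>x. w x * lap_bump x0 s x)"
proof -
  note T = test_gradient_bump(1)[OF assms(1,2)]
  note I = integral_by_parts_test[OF assms(3) T assms(4)]
  have "integral UNIV (\<lambda>x. gradient w x \<bullet> gradient (bump x0 s) x) =
      (\<Sum>l\<in>UNIV. integral UNIV (\<lambda>x. gradient (bump x0 s) x $ l * gradient w x $ l))"
    unfolding inner_vec_sum mult.commute[of "gradient w _ $ _"] by (intro cc_integral_sum I) auto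
  also have "\<dots> = - (\<Sum>l\<in>UNIV. integral UNIV (\<lambda>x. gradient (\<lambda>x. gradient (bump x0 s) x $ l) x $ l * w x))"
    by (simp add: I(1) sum_negf)
  also have "(\<Sum>l\<in>UNIV. integral UNIV (\<lambda>x. gradient (\<lambda>x. gradient (bump x0 s) x $ l) x $ l * w x)) =
      integral UNIV (\<lambda>x. \<Sum>l\<in>UNIV. gradient (\<lambda>x. gradient (bump x0 s) x $ l) x $ l * w x)"
    by (intro cc_integral_sum[symmetric] I) auto
  also have "\<dots> = integral UNIV (\<lambda>x. w x * lap_bump x0 s x)"
    by (simp add: lap_bump_eq[OF assms(1), symmetric] sum_distrib_left mult.commute)
  finally show "integral UNIV (\<lambda>x. gradient w x \<bullet> gradient (bump x0 s) x) = - integral UNIV (\<lambda>x. w x * lap_bump x0 s x)" .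
qed

text \<open>If \<open>h\<close> were positive at a point, a bump supported in a small ball where
  \<open>h\<close> is positive would give a positive integral. The same argument for
  \<open>- h\<close> excludes negative values.\<close>

lemma fundamental_lemma_bump:
  fixes h :: "real^'n \<Rightarrow> real"
  assumes D: "open D" and h: "continuous_on D h"
    and eq: "\<And>x0 s. 0 < s \<Longrightarrow> cball x0 s \<subseteq> D \<Longrightarrow> integral UNIV (\<lambda>x. h x * bump x0 s x) = 0"
    and x: "x \<in> D"
  shows "h x = 0"
proof -
  have aux: "g x \<le> 0" if g: "continuous_on D g"
    and eqg: "\<And>x0 s. 0 < s \<Longrightarrow> cball x0 s \<subseteq> D \<Longrightarrow> integral UNIV (\<lambda>x. g x * bump x0 s x) = 0" for g
  proof (rule ccontr)
    assume "\<not> g x \<le> 0"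
    then have "x \<in> {y\<in>D. 0 < g y}" using x by simp
    moreover have "open {y\<in>D. 0 < g y}"
      using continuous_open_preimage[OF g D, of "{0<..}"] by (simp add: vimage_def Int_def)
    ultimately obtain s where s: "0 < s" "cball x s \<subseteq> {y\<in>D. 0 < g y}"
      using open_contains_cball by metis
    then have sD: "cball x s \<subseteq> D" by auto
    have cc: "cc (\<lambda>y. g y * bump x s y)"
      using csupp_cc[OF csupp_mult[OF D test_csupp[OF test_bump[OF _ sD]] g]] s(1) by (simp add: mult.commute)
    have "g y * bump x s y \<ge> 0" for y
    proof (cases "y \<in> ball x s")
      case True
      then have "y \<in> cball x s" by simp
      then have "0 < g y" using s(2) by blast
      then show ?thesis by simp
    next
      case False
      then show ?thesis using bump_outside[of s y x] s(1) by simp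
    qed
    then have "g x * bump x s x = 0"
      by (rule cc_integral_eq_0D[OF cc]) (use eqg s(1) sD in auto)
    then show False using bump_pos[of x x s] s(1) \<open>\<not> g x \<le> 0\<close> by simp
  qed
  have "h x \<le> 0" by (rule aux[OF h eq])
  moreover have "- h x \<le> 0"
    by (rule aux) (use h eq in \<open>auto intro!: continuous_intros\<close>)
  ultimately show ?thesis by simp
qed

subsection \<open>The strong maximum principle\<close>

text \<open>
  For \<open>p = (s\<^sup>2 - |x - x0|\<^sup>2)\<^sub>+\<close> one has \<open>\<Delta>(p\<^sup>3) = 24 s\<^sup>2 p - (6n + 24) p\<^sup>2\<close>, so the hypothesis becomes a
  differential inequality for \<open>I s = \<integral> v p\<^sup>2\<close>, by which \<open>I s / s\<^sup>(\<^sup>n\<^sup>+\<^sup>4\<^sup>)\<close> is decreasing up to a bounded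
  factor. At \<open>s = 0\<close> its limit is a multiple of \<open>v x0 = 0\<close>.
\<close>

lemma strong_maximum_principle_local:
  fixes v :: "real^'n \<Rightarrow> real"
  assumes D: "open D" and v: "continuous_on D v" "\<And>x. x \<in> D \<Longrightarrow> 0 \<le> v x" and M: "0 \<le> M"
    and ineq: "\<And>y s. 0 < s \<Longrightarrow> cball y s \<subseteq> D \<Longrightarrow>
      integral UNIV (\<lambda>x. v x * lap_bump y s x) \<le> M * integral UNIV (\<lambda>x. v x * bump y s x)"
    and x0: "x0 \<in> D" "v x0 = 0"
  shows "\<exists>r>0. \<forall>x\<in>ball x0 r. v x = 0"
proof -
  obtain r where r: "0 < r" "cball x0 r \<subseteq> D" using D x0 open_contains_cball by metis
  let ?n = "real CARD('n)"
  define I where "I s = integral UNIV (\<lambda>x. v x * (bp x0 s x)\<^sup>2)" for s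
  define J where "J s = integral UNIV (\<lambda>x. v x * bp x0 s x)" for s
  have sub: "cball x0 s \<subseteq> D" if "s \<le> r" for s
    using that r by (meson order_trans subset_cball)
  have vout: "v x * bp x0 s x = 0" if "x \<notin> D" "0 \<le> s" "s \<le> r" for x s
  proof -
    have "x \<notin> ball x0 s" using that(1) sub[OF that(3)] ball_subset_cball by blast
    from bp_outside[OF that(2) this] show ?thesis by simp
  qed
  have ccJ: "cc (\<lambda>x. v x * bp x0 s x)" if "0 \<le> s" "s \<le> r" for s
    using csupp_cc[OF csupp_mult[OF D csupp_bp[OF that(1) sub[OF that(2)]] v(1)]] by (simp add: mult.commute)
  have ccI2: "cc (\<lambda>x. v x * (bp x0 s x)\<^sup>2)" if "0 \<le> s" "s \<le> r" for s
    using cc_mult_right[OF ccJ[OF that] continuous_on_bp, of x0 s] by (simp add: power2_eq_square mult_ac)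
  have ccI3: "cc (\<lambda>x. v x * bump x0 s x)" if "0 \<le> s" "s \<le> r" for s
    using cc_mult_right[OF ccI2[OF that] continuous_on_bp, of x0 s]
    by (simp add: power2_eq_square power3_eq_cube mult_ac bump_def)
  have nn: "0 \<le> v x * bp x0 s x" if "0 \<le> s" "s \<le> r" for x s
  proof (cases "x \<in> D")
    case False
    show ?thesis unfolding vout[OF False that] ..
  qed (simp add: v)
  have I_nonneg: "0 \<le> I s" if "0 \<le> s" "s \<le> r" for s
    unfolding I_def using nn[OF that]
    by (intro cc_integral_nonneg ccI2 that) (simp add: power2_eq_square mult.assoc[symmetric])
  have I_deriv: "(I has_field_derivative 4 * s * J s) (at s within {0<..<r})" if s: "s \<in> {0<..<r}" for s
  proof -
    have "((\<lambda>s. integral UNIV (\<lambda>x. v x * (bp x0 s x)\<^sup>2)) has_field_derivative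
        integral UNIV (\<lambda>x. v x * (bp x0 s x * (4 * s)))) (at s within {0<..<r})"
    proof (rule cc_integral_param_deriv[OF _ s compact_cball[of x0 r]])
      show "v x * (bp x0 t x)\<^sup>2 = 0" "v x * (bp x0 t x * (4 * t)) = 0"
        if "t \<in> {0<..<r}" "x \<notin> cball x0 r" for t x
        using that bp_outside[of t x x0] by auto
      show "((\<lambda>t. v x * (bp x0 t x)\<^sup>2) has_field_derivative v x * (bp x0 t x * (4 * t))) (at t within {0<..<r})" for t x
      proof -
        have "((\<lambda>t. t\<^sup>2 - (norm (x - x0))\<^sup>2) has_field_derivative 2 * t) (at t within {0<..<r})"
          by (auto intro!: derivative_eq_intros)
        from DERIV_chain2[OF has_derivative_pos_square this]
        have "((\<lambda>t. (bp x0 t x)\<^sup>2) has_field_derivative bp x0 t x * (4 * t)) (at t within {0<..<r})"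
          by (simp add: bp_def mult_ac)
        then show ?thesis by (rule DERIV_cmult)
      qed
      show "continuous_on UNIV (\<lambda>x. v x * (bp x0 t x)\<^sup>2)" if "t \<in> {0<..<r}" for t
        using ccI2[of t] that by (simp add: cc_continuous)
      have "continuous_on ({0<..<r} \<times> UNIV) (\<lambda>p. (bp x0 (fst p) (snd p) * (4 * fst p)) * v (snd p))"
      proof (rule continuous_on_mult_supp[of "UNIV \<times> cball x0 r" "UNIV \<times> D"])
        show "continuous_on ({0<..<r} \<times> UNIV) (\<lambda>p. bp x0 (fst p) (snd p) * (4 * fst p))"
          unfolding bp_def by (intro continuous_intros)
        show "continuous_on ({0<..<r} \<times> UNIV \<inter> UNIV \<times> D) (\<lambda>p. v (snd p))"
          by (intro continuous_on_compose2[OF v(1)] continuous_intros) auto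
        show "bp x0 (fst p) (snd p) * (4 * fst p) = 0"
          if "p \<in> {0<..<r} \<times> UNIV" "p \<notin> UNIV \<times> cball x0 r" for p
        proof -
          have "snd p \<notin> ball x0 (fst p)" "0 \<le> fst p" using that by (auto simp: mem_Times_iff)
          then show ?thesis by (simp add: bp_outside)
        qed
      qed (use D r in \<open>auto simp: closed_Times open_Times\<close>)
      then show "continuous_on ({0<..<r} \<times> UNIV) (\<lambda>(t, x). v x * (bp x0 t x * (4 * t)))"
        by (simp add: split_beta mult.commute)
    qed auto
    moreover have "integral UNIV (\<lambda>x. v x * (bp x0 s x * (4 * s))) = 4 * s * J s"
      by (simp add: J_def mult.assoc[symmetric] mult.commute[of _ "4 * s"])
    ultimately show ?thesis by (simp add: I_def[abs_def])
  qed
  \<comment> \<open>Since 4 s \<open>J s\<close> is the derivative of \<open>I\<close>, this reads 6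
    s I' \<le> (6 n + 24 + M s^2) I. The cubic term on the right of \<open>ineq\<close> is absorbed
    by \<open>bp\<close> \<le> s^2.\<close>
  have diff_ineq: "6 * s * (4 * s * J s) \<le> (6 * ?n + 24 + M * s\<^sup>2) * I s" if s: "s \<in> {0<..<r}" for s
  proof -
    have s': "0 \<le> s" "s \<le> r" "0 < s" using s by auto
    have "24 * s\<^sup>2 * J s - (6 * ?n + 24) * I s = integral UNIV (\<lambda>x. v x * lap_bump x0 s x)"
    proof -
      have "integral UNIV (\<lambda>x. v x * lap_bump x0 s x) =
          integral UNIV (\<lambda>x. 24 * s\<^sup>2 * (v x * bp x0 s x) - (6 * ?n + 24) * (v x * (bp x0 s x)\<^sup>2))"
        by (simp add: lap_bump_def algebra_simps)
      also have "\<dots> = integral UNIV (\<lambda>x. 24 * s\<^sup>2 * (v x * bp x0 s x)) - integral UNIV (\<lambda>x. (6 * ?n + 24) * (v x * (bp x0 s x)\<^sup>2))"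
        by (intro cc_integral_diff cc_cmult ccJ ccI2 s')
      finally show ?thesis by (simp add: I_def J_def)
    qed
    also have "\<dots> \<le> M * integral UNIV (\<lambda>x. v x * bump x0 s x)"
      by (rule ineq[OF s'(3) sub[OF s'(2)]])
    also have "integral UNIV (\<lambda>x. v x * bump x0 s x) \<le> integral UNIV (\<lambda>x. s\<^sup>2 * (v x * (bp x0 s x)\<^sup>2))"
    proof (intro cc_integral_mono ccI3 cc_cmult ccI2 s')
      fix x
      have "(v x * bp x0 s x) * bp x0 s x * bp x0 s x \<le> (v x * bp x0 s x) * bp x0 s x * s\<^sup>2"
        by (intro mult_left_mono bp_le mult_nonneg_nonneg[OF nn[OF s'(1,2)]]) simp
      then show "v x * bump x0 s x \<le> s\<^sup>2 * (v x * (bp x0 s x)\<^sup>2)"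
        by (simp add: bump_def power2_eq_square power3_eq_cube mult_ac)
    qed
    then have "M * integral UNIV (\<lambda>x. v x * bump x0 s x) \<le> M * (s\<^sup>2 * I s)"
      using M by (simp add: I_def mult_left_mono)
    finally show ?thesis by (simp add: power2_eq_square algebra_simps)
  qed
  \<comment> \<open>The integrating factor s^(-n-4) exp(- M s^2 / 12) of this inequality, written as
    one exponential.\<close>
  define E where "E s = exp (- (?n + 4) * ln s - M / 12 * s\<^sup>2)" for s :: real
  have E_deriv: "(E has_field_derivative E s * (- (?n + 4) / s - M * s / 6)) (at s within {0<..<r})"
    if "s \<in> {0<..<r}" for s
    unfolding E_def[abs_def] using that by (auto intro!: derivative_eq_intros simp: field_simps)
  have decr: "I (r/2) * E (r/2) \<le> I s * E s" if s: "0 < s" "s \<le> r/2" for s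
  proof (rule DERIV_nonpos_imp_nonincreasing[OF s(2), of "\<lambda>s. I s * E s"])
    fix x assume x: "s \<le> x" "x \<le> r/2"
    then have xr: "x \<in> {0<..<r}" using s r by auto
    have "x > 0" using xr by simp
    have "((\<lambda>s. I s * E s) has_field_derivative
        4 * x * J x * E x + E x * (- (?n + 4) / x - M * x / 6) * I x) (at x within {0<..<r})"
      by (rule DERIV_mult[OF I_deriv[OF xr] E_deriv[OF xr]])
    then have d: "((\<lambda>s. I s * E s) has_field_derivative
        4 * x * J x * E x + E x * (- (?n + 4) / x - M * x / 6) * I x) (at x)"
      unfolding at_within_open[OF xr open_greaterThanLessThan] .
    have "4 * x * J x \<le> (6 * ?n + 24 + M * x\<^sup>2) * I x / (6 * x)"
      using diff_ineq[OF xr] \<open>x > 0\<close> by (simp add: pos_le_divide_eq mult_ac)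
    also have "\<dots> = ((?n + 4) / x + M * x / 6) * I x"
      using \<open>x > 0\<close> by (simp add: field_simps power2_eq_square)
    finally have "E x * (4 * x * J x) \<le> E x * (((?n + 4) / x + M * x / 6) * I x)"
      by (intro mult_left_mono) (simp_all add: E_def)
    then have "4 * x * J x * E x + E x * (- (?n + 4) / x - M * x / 6) * I x \<le> 0"
      using \<open>x > 0\<close> by (simp add: field_simps)
    with d show "\<exists>y. ((\<lambda>s. I s * E s) has_real_derivative y) (at x) \<and> y \<le> 0" by blast
  qed
  \<comment> \<open>For small s one has \<open>v\<close> < e on the ball, and \<open>bp\<close>^2
    \<le> s^4. The ball lies in a cube of side 2 s, so \<open>I s\<close> is at most e 2^n s^(n+4),
    and \<open>E s\<close> cancels this power of s. As e is arbitrary, the left-hand side is not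
    positive.\<close>
  have *: "I (r/2) * E (r/2) \<le> e * 2 ^ CARD('n)" if "e > 0" for e
  proof -
    have "continuous (at x0) v" using v(1) D x0(1) by (simp add: continuous_on_eq_continuous_at)
    then obtain d where d: "d > 0" "\<And>x. dist x x0 < d \<Longrightarrow> dist (v x) (v x0) < e"
      unfolding continuous_at_eps_delta using \<open>e > 0\<close> by metis
    define s where "s = min d (r/2)"
    have s: "0 < s" "s \<le> r/2" "s \<le> d" "s \<le> r" using d r by (auto simp: s_def)
    have bd: "v x * (bp x0 s x)\<^sup>2 \<le> e * s ^ 4" for x
    proof (cases "x \<in> ball x0 s")
      case True
      then have "v x \<le> e" "x \<in> D" using d(2)[of x] s x0(2) sub[OF s(4)] by (auto simp: dist_commute dist_norm)
      moreover have "(bp x0 s x)\<^sup>2 \<le> (s\<^sup>2)\<^sup>2" by (intro power_mono bp_le) simp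
      ultimately have "v x * (bp x0 s x)\<^sup>2 \<le> e * (s\<^sup>2)\<^sup>2"
        using v(2)[of x] \<open>e > 0\<close> by (intro mult_mono) auto
      then show ?thesis by simp
    next
      case False
      then show ?thesis using bp_outside[of s x x0] s \<open>e > 0\<close> by simp
    qed
    let ?a = "x0 - (\<chi> i. s)" and ?b = "x0 + (\<chi> i. s)"
    have out: "v x * (bp x0 s x)\<^sup>2 = 0" if "x \<notin> cbox ?a ?b" for x
    proof -
      have "x \<notin> ball x0 s"
      proof
        assume "x \<in> ball x0 s"
        then have "\<bar>(x - x0) $ i\<bar> \<le> s" for i
          using component_le_norm_cart[of "x - x0" i] by (simp add: dist_norm norm_minus_commute)
        then have "x \<in> cbox ?a ?b" by (simp add: mem_box_cart abs_le_iff algebra_simps)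
        with that show False by simp
      qed
      then show ?thesis using bp_outside[of s x x0] s by simp
    qed
    have cI: "cc (\<lambda>x. v x * (bp x0 s x)\<^sup>2)" using ccI2 s by simp
    have "I s = integral (cbox ?a ?b) (\<lambda>x. v x * (bp x0 s x)\<^sup>2)"
      unfolding I_def by (rule cc_integral_box[OF cI out])
    also have "\<dots> \<le> integral (cbox ?a ?b) (\<lambda>x. e * s ^ 4)"
      by (intro integral_le integrable_continuous cc_continuous cI continuous_intros bd)
    also have "\<dots> = (2 * s) ^ CARD('n) * (e * s ^ 4)"
    proof -
      have "measure lborel (cbox ?a ?b) = (2 * s) ^ CARD('n)"
        using s by (subst content_cbox_cart) (auto simp: interval_ne_empty_cart)
      then show ?thesis by simp
    qed
    finally have Is: "I s \<le> (2 * s) ^ CARD('n) * (e * s ^ 4)" .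
    have "E s \<le> exp (- (?n + 4) * ln s)"
      using M by (simp add: E_def)
    also have "\<dots> = 1 / s ^ (CARD('n) + 4)"
    proof -
      have "exp (- (?n + 4) * ln s) = inverse (exp (real (CARD('n) + 4) * ln s))"
        by (simp add: exp_minus[symmetric] algebra_simps)
      also have "exp (real (CARD('n) + 4) * ln s) = s ^ (CARD('n) + 4)"
        using s by (simp add: exp_of_nat_mult del: of_nat_add)
      finally show ?thesis by (simp add: inverse_eq_divide)
    qed
    finally have Es: "E s \<le> 1 / s ^ (CARD('n) + 4)" .
    have "I (r/2) * E (r/2) \<le> I s * E s" by (rule decr[OF s(1,2)])
    also have "\<dots> \<le> ((2 * s) ^ CARD('n) * (e * s ^ 4)) * (1 / s ^ (CARD('n) + 4))"
      using s \<open>e > 0\<close> by (intro mult_mono Is Es) (auto simp: E_def)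
    also have "\<dots> = e * 2 ^ CARD('n)" using s by (simp add: power_add power_mult_distrib)
    finally show ?thesis .
  qed
  have "I (r/2) * E (r/2) \<le> 0"
  proof (rule field_le_epsilon)
    fix e :: real assume "0 < e"
    then show "I (r/2) * E (r/2) \<le> 0 + e" using *[of "e / 2 ^ CARD('n)"] by simp
  qed
  moreover have r2: "0 \<le> r/2" "r/2 \<le> r" using r by auto
  ultimately have I0: "I (r/2) = 0"
    using I_nonneg[OF r2] by (simp add: E_def mult_le_0_iff)
  have "v x = 0" if x: "x \<in> ball x0 (r/2)" for x
  proof -
    have "v x * (bp x0 (r/2) x)\<^sup>2 = 0"
    proof (rule cc_integral_eq_0D[OF ccI2[OF r2]])
      show "0 \<le> v x * (bp x0 (r/2) x)\<^sup>2" for x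
        using nn[OF r2, of x] by (simp add: power2_eq_square mult.assoc[symmetric])
    qed (use I0 in \<open>simp add: I_def\<close>)
    then show ?thesis using bp_pos[OF x] by simp
  qed
  then show ?thesis using r by (intro exI[of _ "r/2"]) auto
qed

text \<open>The zero set is open by the local version and the positivity set by continuity; a
  connected set cannot meet both.\<close>

lemma strong_maximum_principle:
  fixes v :: "real^'n \<Rightarrow> real"
  assumes D: "open D" "connected D" and v: "continuous_on D v" "\<And>x. x \<in> D \<Longrightarrow> 0 \<le> v x" and M: "0 \<le> M"
    and ineq: "\<And>y s. 0 < s \<Longrightarrow> cball y s \<subseteq> D \<Longrightarrow>
      integral UNIV (\<lambda>x. v x * lap_bump y s x) \<le> M * integral UNIV (\<lambda>x. v x * bump y s x)"
  shows "(\<forall>x\<in>D. v x = 0) \<or> (\<forall>x\<in>D. 0 < v x)"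
proof -
  let ?Z = "{x\<in>D. v x = 0}" and ?P = "{x\<in>D. 0 < v x}"
  have "open ?P"
    using continuous_open_preimage[OF v(1) D(1), of "{0<..}"] by (simp add: vimage_def Int_def)
  moreover have "open ?Z"
    unfolding open_contains_ball
  proof
    fix x assume x: "x \<in> ?Z"
    then obtain r where r: "r > 0" "\<forall>y\<in>ball x r. v y = 0"
      using strong_maximum_principle_local[OF D(1) v M ineq] by blast
    obtain r' where r': "r' > 0" "ball x r' \<subseteq> D" using D(1) x open_contains_ball by blast
    show "\<exists>e>0. ball x e \<subseteq> ?Z"
      using r r' by (intro exI[of _ "min r r'"]) auto
  qed
  moreover have "D \<subseteq> ?Z \<union> ?P" using v(2) by force
  ultimately have "?Z \<inter> D = {} \<or> ?P \<inter> D = {}"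
    using D(2) unfolding connected_def by (metis (mono_tags, lifting) Int_assoc Int_emptyI less_irrefl mem_Collect_eq)
  then show ?thesis using v(2) by force
qed

subsection \<open>A Poincare inequality on sets of small measure\<close>

text \<open>Cauchy-Schwarz against the indicator of \<open>S\<close>, obtained by integrating (|u| -
  c)^2 \<ge> 0 over \<open>S\<close>. The value \<open>c = A / k\<close> optimises the resulting
  bound.\<close>

lemma square_integral_le:
  fixes u :: "real^'n \<Rightarrow> real"
  assumes u: "cc u" "\<And>x. x \<notin> S \<Longrightarrow> u x = 0" and S: "S \<in> lmeasurable" "measure lebesgue S \<le> k" and k: "0 < k"
  shows "(integral UNIV (\<lambda>x. \<bar>u x\<bar>))\<^sup>2 \<le> k * integral UNIV (\<lambda>x. (u x)\<^sup>2)"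
proof -
  define A where "A = integral UNIV (\<lambda>x. \<bar>u x\<bar>)"
  define c where "c = A / k"
  have cu2: "cc (\<lambda>x. (u x)\<^sup>2)" using cc_power[OF u(1), of 1] by (simp add: numeral_2_eq_2)
  have ind: "(indicat_real S has_integral measure lebesgue S) UNIV"
    using S(1) by (simp add: lmeasurable_iff_indicator_has_integral[symmetric])
  have "((\<lambda>x. (u x)\<^sup>2 - 2 * c * \<bar>u x\<bar> + c\<^sup>2 * indicat_real S x) has_integral
      integral UNIV (\<lambda>x. (u x)\<^sup>2) - 2 * c * A + c\<^sup>2 * measure lebesgue S) UNIV"
    unfolding A_def
    by (intro has_integral_add has_integral_diff has_integral_mult_right ind integrable_integral cc_integrable cu2 cc_abs u)
  moreover have "0 \<le> (u x)\<^sup>2 - 2 * c * \<bar>u x\<bar> + c\<^sup>2 * indicat_real S x" for x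
  proof (cases "x \<in> S")
    case True
    have "0 \<le> (\<bar>u x\<bar> - c)\<^sup>2" by simp
    also have "\<dots> = (u x)\<^sup>2 - 2 * c * \<bar>u x\<bar> + c\<^sup>2" by (simp add: power2_diff)
    finally show ?thesis using True by simp
  qed (simp add: u)
  ultimately have "0 \<le> integral UNIV (\<lambda>x. (u x)\<^sup>2) - 2 * c * A + c\<^sup>2 * measure lebesgue S"
    by (rule has_integral_nonneg)
  also have "\<dots> \<le> integral UNIV (\<lambda>x. (u x)\<^sup>2) - 2 * c * A + c\<^sup>2 * k"
    using S by (simp add: mult_left_mono)
  also have "\<dots> = integral UNIV (\<lambda>x. (u x)\<^sup>2) - A\<^sup>2 / k"
    using k by (simp add: c_def field_simps power2_eq_square)
  finally show ?thesis using k by (simp add: A_def field_simps)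
qed

text \<open>The integral of u(x) u(x + h), weighted over shifts |h| < \<open>e\<close>, is estimated
  twice. From below, each shift costs at most a quarter of the squared L^2 norm plus |h|^2 times the
  Dirichlet energy. From above, the weighted integral is at most e^2 times the squared L^1 norm,
  which is small when \<open>u\<close> lives on a set of small measure. Hence \<open>k\<close> is
  independent of the shape of \<open>S\<close>.\<close>

lemma small_set_poincare:
  assumes eta: "0 < \<eta>"
  shows "\<exists>k>0. \<forall>S u. S \<in> lmeasurable \<longrightarrow> measure lebesgue S \<le> k \<longrightarrow> test UNIV (u :: real^'n \<Rightarrow> real) \<longrightarrow>
    (\<forall>x. x \<notin> S \<longrightarrow> u x = 0) \<longrightarrow>
    integral UNIV (\<lambda>x. (u x)\<^sup>2) \<le> \<eta> * integral UNIV (\<lambda>x. gradient u x \<bullet> gradient u x)"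
proof -
  \<comment> \<open>The final estimate leaves A/2 \<le> e^2 G, hence this choice.\<close>
  define e where "e = sqrt (\<eta> / 2)"
  have e: "0 < e" "e\<^sup>2 = \<eta> / 2" using eta by (auto simp: e_def)
  let ?w = "bp (0::real^'n) e"
  define W where "W = integral UNIV ?w"
  have ccw: "cc ?w" using csupp_cc[OF csupp_bp[of e 0 UNIV]] e by simp
  have "W \<noteq> 0"
    using cc_integral_eq_0D[OF ccw bp_nonneg, of 0] bp_pos[of "0 :: real^'n" 0 e] e by (auto simp: W_def)
  then have W: "0 < W" using cc_integral_nonneg[OF ccw bp_nonneg] by (simp add: W_def)
  \<comment> \<open>The weight is at most e^2 by \<open>bp_le\<close>, and this \<open>k\<close>
    turns the upper bound e^2 k A into W A / 4.\<close>
  define k where "k = W / (4 * e\<^sup>2)"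
  have k: "0 < k" using W e eta by (simp add: k_def)
  have "integral UNIV (\<lambda>x. (u x)\<^sup>2) \<le> \<eta> * integral UNIV (\<lambda>x. gradient u x \<bullet> gradient u x)"
    if S: "S \<in> lmeasurable" "measure lebesgue S \<le> k" and tu: "test UNIV u" and u0: "\<forall>x. x \<notin> S \<longrightarrow> u x = 0"
    for S and u :: "real^'n \<Rightarrow> real"
  proof -
    define A where "A = integral UNIV (\<lambda>x. (u x)\<^sup>2)"
    define G where "G = integral UNIV (\<lambda>x. gradient u x \<bullet> gradient u x)"
    obtain C where C: "compact C" "\<And>x. x \<notin> C \<Longrightarrow> u x = 0" "\<And>x. x \<notin> C \<Longrightarrow> gradient u x = 0"
      using test_supp[OF tu] by metis
    have ccu: "cc u" by (rule test_cc[OF tu])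
    have cu: "continuous_on S' u" for S' by (rule cc_continuous[OF ccu])
    have cgu: "continuous_on S' (gradient u)" for S'
      using C1_on_continuous_gradient[OF test_C1[OF tu]] by (rule continuous_on_subset) simp
    have cu2: "cc (\<lambda>x. (u x)\<^sup>2)" using cc_power[OF ccu, of 1] by (simp add: numeral_2_eq_2)
    have cG: "cc (\<lambda>x. gradient u x \<bullet> gradient u x)"
      by (rule test_cc_gradient_inner[OF open_UNIV tu cgu])
    \<comment> \<open>Mean value theorem along the segment from 0 to \<open>h\<close>. The
      derivative is bounded below through u p \<ge> - u^2/4 - p^2, where p is the derivative of
      \<open>u\<close> in direction \<open>h\<close>.\<close>
    have shift: "3 / 4 * A - (norm h)\<^sup>2 * G \<le> integral UNIV (\<lambda>x. u x * u (x + h))" for h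
    proof -
      define g where "g t = integral UNIV (\<lambda>x. u x * u (x + t *\<^sub>R h))" for t :: real
      define g' where "g' t = integral UNIV (\<lambda>x. u x * (gradient u (x + t *\<^sub>R h) \<bullet> h))" for t :: real
      have ccg: "cc (\<lambda>x. u x * (gradient u (x + t *\<^sub>R h) \<bullet> h))" for t
        by (intro cc_mult_right[OF ccu] continuous_intros continuous_on_compose2[OF cgu[of UNIV]]) auto
      have d: "(g has_field_derivative g' t) (at t)" for t
        unfolding g_def[abs_def] g'_def
      proof (rule cc_integral_param_deriv[OF _ _ C(1), of UNIV])
        show "((\<lambda>t. u x * u (x + t *\<^sub>R h)) has_field_derivative u x * (gradient u (x + t *\<^sub>R h) \<bullet> h)) (at t)" for t x
        proof -
          have "((\<lambda>t. u (x + t *\<^sub>R h)) has_derivative (\<lambda>s. gradient u (x + t *\<^sub>R h) \<bullet> (s *\<^sub>R h))) (at t)"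
            by (rule has_derivative_compose[OF _ test_deriv[OF tu]]) (auto intro!: derivative_eq_intros)
          then have "((\<lambda>t. u (x + t *\<^sub>R h)) has_field_derivative gradient u (x + t *\<^sub>R h) \<bullet> h) (at t)"
            by (rule has_derivative_imp_has_field_derivative) simp
          then show ?thesis by (rule DERIV_cmult)
        qed
        show "continuous_on UNIV (\<lambda>x. u x * u (x + t *\<^sub>R h))" for t
          by (intro continuous_intros cu continuous_on_compose2[OF cu[of UNIV]]) auto
        show "continuous_on (UNIV \<times> UNIV) (\<lambda>(t, x). u x * (gradient u (x + t *\<^sub>R h) \<bullet> h))"
          unfolding split_beta
          by (intro continuous_intros continuous_on_compose2[OF cu[of UNIV]] continuous_on_compose2[OF cgu[of UNIV]]) auto
      qed (use C in auto)
      have bd: "- (1/4 * A + (norm h)\<^sup>2 * G) \<le> g' t" for t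
      proof -
        have cGs: "cc (\<lambda>x. gradient u (x + t *\<^sub>R h) \<bullet> gradient u (x + t *\<^sub>R h))"
          using cc_shift[OF cG, of "t *\<^sub>R h"] by simp
        have "- (u x * (gradient u (x + t *\<^sub>R h) \<bullet> h)) \<le>
            1/4 * (u x)\<^sup>2 + (norm h)\<^sup>2 * (gradient u (x + t *\<^sub>R h) \<bullet> gradient u (x + t *\<^sub>R h))" for x
        proof -
          let ?p = "gradient u (x + t *\<^sub>R h)"
          have "(?p \<bullet> h)\<^sup>2 \<le> (norm h)\<^sup>2 * (?p \<bullet> ?p)"
            using Cauchy_Schwarz_ineq[of ?p h] by (simp add: power2_norm_eq_inner mult.commute)
          moreover have "0 \<le> (u x / 2 + ?p \<bullet> h)\<^sup>2" by simp
          moreover have "(u x / 2 + ?p \<bullet> h)\<^sup>2 = 1/4 * (u x)\<^sup>2 + u x * (?p \<bullet> h) + (?p \<bullet> h)\<^sup>2"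
            by (simp add: power2_eq_square algebra_simps)
          ultimately show ?thesis by linarith
        qed
        then have "integral UNIV (\<lambda>x. - (u x * (gradient u (x + t *\<^sub>R h) \<bullet> h))) \<le>
            integral UNIV (\<lambda>x. 1/4 * (u x)\<^sup>2 + (norm h)\<^sup>2 * (gradient u (x + t *\<^sub>R h) \<bullet> gradient u (x + t *\<^sub>R h)))"
          by (intro cc_integral_mono cc_minus cc_add cc_cmult cu2 ccg cGs)
        also have "\<dots> = integral UNIV (\<lambda>x. 1/4 * (u x)\<^sup>2) +
            integral UNIV (\<lambda>x. (norm h)\<^sup>2 * (gradient u (x + t *\<^sub>R h) \<bullet> gradient u (x + t *\<^sub>R h)))"
          by (intro cc_integral_add cc_cmult cu2 cGs)
        also have "\<dots> = 1/4 * A + (norm h)\<^sup>2 * G"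
          using cc_integral_shift[OF cG, of "t *\<^sub>R h"] by (simp add: A_def G_def)
        finally show ?thesis by (simp add: g'_def)
      qed
      have "\<exists>z::real. 0 < z \<and> z < 1 \<and> g 1 - g 0 = (1 - 0) * g' z"
        by (rule MVT2) (use d in auto)
      then obtain z where "g 1 - g 0 = g' z" by auto
      moreover have "g 0 = A" by (simp add: g_def A_def power2_eq_square)
      ultimately show ?thesis using bd[of z] by (simp add: g_def)
    qed
    define F where "F h x = ?w h * (u x * u (x + h))" for h x
    have cF: "continuous_on UNIV (\<lambda>(h, x). F h x)"
      unfolding split_beta F_def
      by (intro continuous_intros continuous_on_compose2[OF cu[of UNIV]] continuous_on_compose2[OF continuous_on_bp[of UNIV]]) auto
    have wout: "?w h = 0" if "h \<notin> cball 0 e" for h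
    proof -
      have "h \<notin> ball 0 e" using that ball_subset_cball by blast
      with bp_outside[of e h 0] e show ?thesis by simp
    qed
    have swap: "integral UNIV (\<lambda>h. integral UNIV (F h)) = integral UNIV (\<lambda>x. integral UNIV (\<lambda>h. F h x))"
      by (rule cc_integral_swap[OF cF compact_cball[of 0 e] _ C(1)])
        (simp_all add: F_def wout C del: mem_cball)
    have cinner: "cc (\<lambda>h. ?w h * integral UNIV (\<lambda>x. u x * u (x + h)))"
    proof (rule cc_mult_right[OF ccw])
      obtain a where a: "C \<subseteq> cbox (-a) a"
        using bounded_subset_cbox_symmetric compact_imp_bounded C by blast
      have "integral UNIV (\<lambda>x. u x * u (x + h)) = integral (cbox (-a) a) (\<lambda>x. u x * u (x + h))" for h
        using a C by (intro cc_integral_box cc_mult cc_shift ccu) auto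
      moreover have "continuous_on UNIV (\<lambda>h. integral (cbox (-a) a) (\<lambda>x. u x * u (x + h)))"
        unfolding split_beta
        by (rule integral_continuous_on_param)
          (auto simp: split_beta intro!: continuous_intros continuous_on_compose2[OF cu[of UNIV]])
      ultimately show "continuous_on UNIV (\<lambda>h. integral UNIV (\<lambda>x. u x * u (x + h)))" by simp
    qed
    have G0: "0 \<le> G" unfolding G_def by (rule cc_integral_nonneg[OF cG]) simp
    have "W * (3/4 * A - e\<^sup>2 * G) = integral UNIV (\<lambda>h. (3/4 * A - e\<^sup>2 * G) * ?w h)"
      by (simp add: W_def)
    also have "\<dots> \<le> integral UNIV (\<lambda>h. ?w h * integral UNIV (\<lambda>x. u x * u (x + h)))"
    proof (intro cc_integral_mono cc_cmult ccw cinner)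
      fix h :: "real^'n"
      show "(3/4 * A - e\<^sup>2 * G) * ?w h \<le> ?w h * integral UNIV (\<lambda>x. u x * u (x + h))"
      proof (cases "h \<in> ball 0 e")
        case True
        then have "(norm h)\<^sup>2 \<le> e\<^sup>2" by (intro power_mono) auto
        then have "(norm h)\<^sup>2 * G \<le> e\<^sup>2 * G" using G0 by (intro mult_right_mono)
        then have "3/4 * A - e\<^sup>2 * G \<le> integral UNIV (\<lambda>x. u x * u (x + h))" using shift[of h] by linarith
        from mult_left_mono[OF this bp_nonneg[of 0 e h]] show ?thesis
          by (simp only: mult.commute[of "?w h"])
      next
        case False
        then show ?thesis using bp_outside[of e h 0] e by simp
      qed
    qed
    also have "\<dots> = integral UNIV (\<lambda>h. integral UNIV (F h))" by (simp add: F_def[abs_def])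
    also have "\<dots> = integral UNIV (\<lambda>x. u x * integral UNIV (\<lambda>h. ?w h * u (x + h)))"
    proof -
      have "integral UNIV (\<lambda>h. F h x) = u x * integral UNIV (\<lambda>h. ?w h * u (x + h))" for x
        by (simp add: F_def mult.left_commute)
      then show ?thesis by (simp add: swap)
    qed
    also have "\<dots> \<le> integral UNIV (\<lambda>x. (e\<^sup>2 * integral UNIV (\<lambda>x. \<bar>u x\<bar>)) * \<bar>u x\<bar>)"
    proof (intro cc_integral_mono cc_cmult cc_abs ccu cc_mult_right[OF ccu])
      obtain a where a: "cball (0::real^'n) e \<subseteq> cbox (-a) a"
        using bounded_subset_cbox_symmetric bounded_cball by blast
      have sw: "cc (\<lambda>h. ?w h * u (x + h))" for x
        by (intro cc_mult_right[OF ccw] continuous_on_compose2[OF cu[of UNIV]] continuous_intros) auto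
      have "integral UNIV (\<lambda>h. ?w h * u (x + h)) = integral (cbox (-a) a) (\<lambda>h. ?w h * u (x + h))" for x
      proof (rule cc_integral_box[OF sw])
        fix h assume "h \<notin> cbox (-a) a"
        then have "h \<notin> cball 0 e" using a by blast
        from wout[OF this] show "?w h * u (x + h) = 0" by simp
      qed
      moreover have "continuous_on UNIV (\<lambda>x. integral (cbox (-a) a) (\<lambda>h. ?w h * u (x + h)))"
        by (rule integral_continuous_on_param)
          (auto simp: split_beta intro!: continuous_intros continuous_on_compose2[OF cu[of UNIV]]
            continuous_on_compose2[OF continuous_on_bp[of UNIV]])
      ultimately show "continuous_on UNIV (\<lambda>x. integral UNIV (\<lambda>h. ?w h * u (x + h)))" by simp
      fix x
      have ca: "cc (\<lambda>h. \<bar>u (h + x)\<bar>)" by (rule cc_abs[OF cc_shift[OF ccu]])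
      have "\<bar>integral UNIV (\<lambda>h. ?w h * u (x + h))\<bar> \<le> integral UNIV (\<lambda>h. e\<^sup>2 * \<bar>u (h + x)\<bar>)"
      proof -
        have b: "\<bar>?w h * u (x + h)\<bar> \<le> e\<^sup>2 * \<bar>u (h + x)\<bar>" for h
          using mult_right_mono[OF bp_le[of 0 e h], of "\<bar>u (x + h)\<bar>"] by (simp add: abs_mult add.commute)
        have "integral UNIV (\<lambda>h. ?w h * u (x + h)) \<le> integral UNIV (\<lambda>h. e\<^sup>2 * \<bar>u (h + x)\<bar>)"
          by (intro cc_integral_mono sw cc_cmult ca) (use b in \<open>auto simp: abs_le_iff\<close>)
        moreover have "integral UNIV (\<lambda>h. - (?w h * u (x + h))) \<le> integral UNIV (\<lambda>h. e\<^sup>2 * \<bar>u (h + x)\<bar>)"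
          by (intro cc_integral_mono cc_minus sw cc_cmult ca) (use b in \<open>auto simp: abs_le_iff\<close>)
        ultimately show ?thesis by simp
      qed
      also have "\<dots> = e\<^sup>2 * integral UNIV (\<lambda>x. \<bar>u x\<bar>)"
        using cc_integral_shift[OF cc_abs[OF ccu], of x] by simp
      finally have "\<bar>u x\<bar> * \<bar>integral UNIV (\<lambda>h. ?w h * u (x + h))\<bar> \<le> \<bar>u x\<bar> * (e\<^sup>2 * integral UNIV (\<lambda>x. \<bar>u x\<bar>))"
        by (intro mult_left_mono) auto
      then show "u x * integral UNIV (\<lambda>h. ?w h * u (x + h)) \<le> (e\<^sup>2 * integral UNIV (\<lambda>x. \<bar>u x\<bar>)) * \<bar>u x\<bar>"
        unfolding abs_mult[symmetric] by (simp add: mult.commute)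
    qed
    also have "\<dots> = e\<^sup>2 * (integral UNIV (\<lambda>x. \<bar>u x\<bar>))\<^sup>2" by (simp add: power2_eq_square)
    also have "\<dots> \<le> e\<^sup>2 * (k * A)"
      unfolding A_def using square_integral_le[OF ccu _ S k] u0 by (intro mult_left_mono) auto
    also have "\<dots> = W * (1/4 * A)" using e eta by (simp add: k_def)
    finally have "3/4 * A - e\<^sup>2 * G \<le> 1/4 * A" using W by simp
    then show ?thesis using e by (simp add: A_def[symmetric] G_def[symmetric] mult.commute)
  qed
  with k show ?thesis by blast
qed

subsection \<open>Quadratic forms\<close>

definition tests :: "(real^'n) set \<Rightarrow> (real^'n \<Rightarrow> real^'m) \<Rightarrow> bool"
  where "tests D \<Phi> \<longleftrightarrow> (\<forall>i. test D (\<lambda>x. \<Phi> x $ i))"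

text \<open>The coefficient \<open>c i j\<close> pairs component \<open>i\<close> of the first
  argument with component \<open>j\<close> of the second. For non-symmetric \<open>c\<close> the
  arguments cannot be exchanged, and only \<open>sympart c\<close> gives the polarisation of the
  quadratic form.\<close>

definition BF :: "('m \<Rightarrow> 'm \<Rightarrow> real^'n \<Rightarrow> real) \<Rightarrow> (real^'n \<Rightarrow> real^'m) \<Rightarrow> (real^'n \<Rightarrow> real^'m) \<Rightarrow> real"
  where "BF c \<Phi> \<Psi> = integral UNIV (\<lambda>x.
    (\<Sum>i\<in>UNIV. gradient (\<lambda>y. \<Phi> y $ i) x \<bullet> gradient (\<lambda>y. \<Psi> y $ i) x) -
    (\<Sum>i\<in>UNIV. \<Sum>j\<in>UNIV. c i j x * \<Phi> x $ i * \<Psi> x $ j))"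

lemma tests_mono: "tests D \<Phi> \<Longrightarrow> D \<subseteq> E \<Longrightarrow> tests E \<Phi>"
  by (auto simp: tests_def intro: test_mono)

lemma tests_add: "tests D f \<Longrightarrow> tests D g \<Longrightarrow> tests D (\<lambda>x. f x + g x)"
  by (auto simp: tests_def intro: test_add)

lemma tests_scaleR: "tests D f \<Longrightarrow> tests D (\<lambda>x. t *\<^sub>R f x)"
  by (auto simp: tests_def intro: test_cmult)

lemma tests_axis: "test D \<phi> \<Longrightarrow> tests D (\<lambda>x. \<phi> x *\<^sub>R axis i 1)"
  by (auto simp: tests_def axis_def)

lemma tests_orthogonal:
  fixes T :: "real^'n \<Rightarrow> real^'n"
  shows "orthogonal_transformation T \<Longrightarrow> tests D \<Phi> \<Longrightarrow> tests (T -` D) (\<lambda>x. \<Phi> (T x))"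
  unfolding tests_def using test_orthogonal[of T D "\<lambda>x. \<Phi> x $ i" for i] by blast

lemma
  fixes \<Phi> \<Psi> :: "real^'n \<Rightarrow> real^'m"
  assumes D: "open D" and c: "\<And>i j. continuous_on D (c i j)" and t: "tests D \<Phi>" "tests D \<Psi>"
  shows cc_BF_grad: "cc (\<lambda>x. gradient (\<lambda>y. \<Phi> y $ i) x \<bullet> gradient (\<lambda>y. \<Psi> y $ i) x)"
    and cc_BF_pot: "cc (\<lambda>x. c i j x * \<Phi> x $ i * \<Psi> x $ j)"
proof -
  have t': "test D (\<lambda>x. \<Phi> x $ i)" "test D (\<lambda>x. \<Psi> x $ i)" for i using t by (auto simp: tests_def)
  show "cc (\<lambda>x. gradient (\<lambda>y. \<Phi> y $ i) x \<bullet> gradient (\<lambda>y. \<Psi> y $ i) x)"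
    using C1_on_continuous_gradient[OF test_C1[OF t'(2)]]
    by (intro test_cc_gradient_inner(1)[OF D t'(1)]) (auto intro: continuous_on_subset)
  have "cc (\<lambda>x. \<Phi> x $ i * c i j x * \<Psi> x $ j)"
    by (intro cc_mult csupp_cc[OF csupp_mult[OF D test_csupp[OF t'(1)] c]] test_cc[OF t'(2)])
  then show "cc (\<lambda>x. c i j x * \<Phi> x $ i * \<Psi> x $ j)" by (simp add: mult_ac)
qed

lemma BF_eq:
  fixes \<Phi> \<Psi> :: "real^'n \<Rightarrow> real^'m"
  assumes D: "open D" and c: "\<And>i j. continuous_on D (c i j)" and t: "tests D \<Phi>" "tests D \<Psi>"
  shows "BF c \<Phi> \<Psi> = (\<Sum>i\<in>UNIV. integral UNIV (\<lambda>x. gradient (\<lambda>y. \<Phi> y $ i) x \<bullet> gradient (\<lambda>y. \<Psi> y $ i) x)) -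
    (\<Sum>i\<in>UNIV. \<Sum>j\<in>UNIV. integral UNIV (\<lambda>x. c i j x * \<Phi> x $ i * \<Psi> x $ j))"
proof -
  note C = cc_BF_grad[OF D c t] cc_BF_pot[OF D c t]
  have 1: "cc (\<lambda>x. \<Sum>i\<in>UNIV. gradient (\<lambda>y. \<Phi> y $ i) x \<bullet> gradient (\<lambda>y. \<Psi> y $ i) x)"
    by (intro cc_sum C)
  have 2: "cc (\<lambda>x. \<Sum>j\<in>UNIV. c i j x * \<Phi> x $ i * \<Psi> x $ j)" for i
    by (intro cc_sum C)
  have 3: "cc (\<lambda>x. \<Sum>i\<in>UNIV. \<Sum>j\<in>UNIV. c i j x * \<Phi> x $ i * \<Psi> x $ j)"
    by (intro cc_sum C)
  have s1: "integral UNIV (\<lambda>x. \<Sum>i\<in>UNIV. gradient (\<lambda>y. \<Phi> y $ i) x \<bullet> gradient (\<lambda>y. \<Psi> y $ i) x) =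
      (\<Sum>i\<in>UNIV. integral UNIV (\<lambda>x. gradient (\<lambda>y. \<Phi> y $ i) x \<bullet> gradient (\<lambda>y. \<Psi> y $ i) x))"
    by (intro cc_integral_sum C) auto
  have s2: "integral UNIV (\<lambda>x. \<Sum>j\<in>UNIV. c i j x * \<Phi> x $ i * \<Psi> x $ j) =
      (\<Sum>j\<in>UNIV. integral UNIV (\<lambda>x. c i j x * \<Phi> x $ i * \<Psi> x $ j))" for i
    by (intro cc_integral_sum C) auto
  have s3: "integral UNIV (\<lambda>x. \<Sum>i\<in>UNIV. \<Sum>j\<in>UNIV. c i j x * \<Phi> x $ i * \<Psi> x $ j) =
      (\<Sum>i\<in>UNIV. integral UNIV (\<lambda>x. \<Sum>j\<in>UNIV. c i j x * \<Phi> x $ i * \<Psi> x $ j))"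
    by (intro cc_integral_sum 2) auto
  show ?thesis
    unfolding BF_def cc_integral_diff[OF 1 3] s1 s2 s3 ..
qed

lemma gradient_component_add:
  assumes "tests D \<Phi>" "tests D \<Psi>"
  shows "gradient (\<lambda>y. (\<Phi> y + t *\<^sub>R \<Psi> y) $ i) x = gradient (\<lambda>y. \<Phi> y $ i) x + t *\<^sub>R gradient (\<lambda>y. \<Psi> y $ i) x"
proof -
  have t: "test D (\<lambda>x. \<Phi> x $ i)" "test D (\<lambda>x. \<Psi> x $ i)" using assms by (auto simp: tests_def)
  show ?thesis
    using gradient_add[OF test_deriv[OF t(1)] test_deriv[OF test_cmult[OF t(2), of t]], of x]
    by (simp add: gradient_cmult[OF test_deriv[OF t(2)]])
qed

lemma BF_add_right:
  fixes \<Phi> \<Psi> :: "real^'n \<Rightarrow> real^'m"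
  assumes D: "open D" and c: "\<And>i j. continuous_on D (c i j)" and t: "tests D \<Phi>" "tests D \<Psi>" "tests D X"
  shows "BF c X (\<lambda>x. \<Phi> x + t *\<^sub>R \<Psi> x) = BF c X \<Phi> + t * BF c X \<Psi>"
proof -
  note C = cc_BF_grad[OF D c] cc_BF_pot[OF D c]
  have "BF c X (\<lambda>x. \<Phi> x + t *\<^sub>R \<Psi> x) = integral UNIV (\<lambda>x.
      ((\<Sum>i\<in>UNIV. gradient (\<lambda>y. X y $ i) x \<bullet> gradient (\<lambda>y. \<Phi> y $ i) x) -
        (\<Sum>i\<in>UNIV. \<Sum>j\<in>UNIV. c i j x * X x $ i * \<Phi> x $ j)) +
      t * ((\<Sum>i\<in>UNIV. gradient (\<lambda>y. X y $ i) x \<bullet> gradient (\<lambda>y. \<Psi> y $ i) x) -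
        (\<Sum>i\<in>UNIV. \<Sum>j\<in>UNIV. c i j x * X x $ i * \<Psi> x $ j)))"
    unfolding BF_def gradient_component_add[OF t(1,2)]
    by (intro arg_cong[where f="integral UNIV"] ext)
      (simp add: inner_add_right sum.distrib sum_distrib_left algebra_simps)
  also have "\<dots> = BF c X \<Phi> + t * BF c X \<Psi>"
  proof -
    have A: "cc (\<lambda>x. (\<Sum>i\<in>UNIV. gradient (\<lambda>y. X y $ i) x \<bullet> gradient (\<lambda>y. \<Phi> y $ i) x) -
        (\<Sum>i\<in>UNIV. \<Sum>j\<in>UNIV. c i j x * X x $ i * \<Phi> x $ j))" if "tests D \<Phi>" for \<Phi>
      by (intro cc_diff cc_sum C t that)
    show ?thesis
      unfolding BF_def cc_integral_add[OF A[OF t(1)] cc_cmult[OF A[OF t(2)]]] by simp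
  qed
  finally show ?thesis .
qed

lemma BF_commute: "(\<And>i j. c i j = c j i) \<Longrightarrow> BF c \<Phi> \<Psi> = BF c \<Psi> \<Phi>"
  unfolding BF_def
  by (subst (2) sum.swap) (simp add: inner_commute mult_ac)

lemma BF_quadratic:
  fixes \<Phi> \<Psi> :: "real^'n \<Rightarrow> real^'m"
  assumes D: "open D" and c: "\<And>i j. continuous_on D (c i j)" and sym: "\<And>i j. c i j = c j i"
    and t: "tests D \<Phi>" "tests D \<Psi>"
  shows "BF c (\<lambda>x. \<Phi> x + t *\<^sub>R \<Psi> x) (\<lambda>x. \<Phi> x + t *\<^sub>R \<Psi> x) = BF c \<Phi> \<Phi> + 2 * t * BF c \<Phi> \<Psi> + t\<^sup>2 * BF c \<Psi> \<Psi>"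
proof -
  have t': "tests D (\<lambda>x. \<Phi> x + t *\<^sub>R \<Psi> x)" using t by (intro tests_add tests_scaleR)
  note A = BF_add_right[OF D c] and S = BF_commute[of c, OF sym]
  have "BF c (\<lambda>x. \<Phi> x + t *\<^sub>R \<Psi> x) (\<lambda>x. \<Phi> x + t *\<^sub>R \<Psi> x) =
      BF c (\<lambda>x. \<Phi> x + t *\<^sub>R \<Psi> x) \<Phi> + t * BF c (\<lambda>x. \<Phi> x + t *\<^sub>R \<Psi> x) \<Psi>"
    by (rule A[OF t t'])
  moreover have "BF c (\<lambda>x. \<Phi> x + t *\<^sub>R \<Psi> x) \<Phi> = BF c \<Phi> \<Phi> + t * BF c \<Phi> \<Psi>"
    by (rule trans[OF S A[OF t t(1)]])
  moreover have "BF c (\<lambda>x. \<Phi> x + t *\<^sub>R \<Psi> x) \<Psi> = BF c \<Psi> \<Phi> + t * BF c \<Psi> \<Psi>"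
    by (rule trans[OF S A[OF t t(2)]])
  moreover have "BF c \<Psi> \<Phi> = BF c \<Phi> \<Psi>" by (rule S)
  ultimately show ?thesis by (simp add: power2_eq_square algebra_simps)
qed

lemma BF_scaleR:
  fixes \<Phi> :: "real^'n \<Rightarrow> real^'m"
  assumes "tests D \<Phi>"
  shows "BF c (\<lambda>x. t *\<^sub>R \<Phi> x) (\<lambda>x. t *\<^sub>R \<Phi> x) = t\<^sup>2 * BF c \<Phi> \<Phi>"
proof -
  have "gradient (\<lambda>y. (t *\<^sub>R \<Phi> y) $ i) x = t *\<^sub>R gradient (\<lambda>y. \<Phi> y $ i) x" for i x
  proof -
    have "test D (\<lambda>x. \<Phi> x $ i)" using assms by (simp add: tests_def)
    from gradient_cmult[OF test_deriv[OF this]] show ?thesis by simp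
  qed
  then have "BF c (\<lambda>x. t *\<^sub>R \<Phi> x) (\<lambda>x. t *\<^sub>R \<Phi> x) = integral UNIV (\<lambda>x. t\<^sup>2 * (
    (\<Sum>i\<in>UNIV. gradient (\<lambda>y. \<Phi> y $ i) x \<bullet> gradient (\<lambda>y. \<Phi> y $ i) x) -
    (\<Sum>i\<in>UNIV. \<Sum>j\<in>UNIV. c i j x * \<Phi> x $ i * \<Phi> x $ j)))"
    unfolding BF_def by (simp add: sum_distrib_left algebra_simps power2_eq_square)
  then show ?thesis by (simp add: BF_def)
qed

lemma BF_scaleR_right:
  fixes \<Phi> \<Psi> :: "real^'n \<Rightarrow> real^'m"
  assumes "tests D \<Psi>"
  shows "BF c \<Phi> (\<lambda>x. t *\<^sub>R \<Psi> x) = t * BF c \<Phi> \<Psi>"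
proof -
  have "gradient (\<lambda>y. (t *\<^sub>R \<Psi> y) $ i) x = t *\<^sub>R gradient (\<lambda>y. \<Psi> y $ i) x" for i x
  proof -
    have "test D (\<lambda>x. \<Psi> x $ i)" using assms by (simp add: tests_def)
    from gradient_cmult[OF test_deriv[OF this]] show ?thesis by simp
  qed
  then have "BF c \<Phi> (\<lambda>x. t *\<^sub>R \<Psi> x) = integral UNIV (\<lambda>x. t * (
    (\<Sum>i\<in>UNIV. gradient (\<lambda>y. \<Phi> y $ i) x \<bullet> gradient (\<lambda>y. \<Psi> y $ i) x) -
    (\<Sum>i\<in>UNIV. \<Sum>j\<in>UNIV. c i j x * \<Phi> x $ i * \<Psi> x $ j)))"
    unfolding BF_def by (simp add: sum_distrib_left algebra_simps)
  then show ?thesis by (simp add: BF_def)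
qed

definition sympart :: "('m \<Rightarrow> 'm \<Rightarrow> 'a \<Rightarrow> real) \<Rightarrow> 'm \<Rightarrow> 'm \<Rightarrow> 'a \<Rightarrow> real"
  where "sympart b i j x = (b i j x + b j i x) / 2"

lemma sympart_commute: "sympart b i j = sympart b j i"
  by (auto simp: sympart_def fun_eq_iff)

text \<open>Exchanging the summation indices cancels the antisymmetric part on the diagonal.
  Nonnegativity of the form of \<open>b\<close> is thus a statement about \<open>sympart b\<close>,
  and the Euler-Lagrange equation carries the symmetrised coefficients.\<close>

lemma BF_sympart: "BF (sympart b) \<Phi> \<Phi> = BF b \<Phi> \<Phi>"
proof -
  have "(\<Sum>i\<in>UNIV. \<Sum>j\<in>UNIV. sympart b i j x * \<Phi> x $ i * \<Phi> x $ j) =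
      (\<Sum>i\<in>UNIV. \<Sum>j\<in>UNIV. b i j x * \<Phi> x $ i * \<Phi> x $ j)" for x
  proof -
    let ?S = "\<Sum>i\<in>UNIV. \<Sum>j\<in>UNIV. b i j x * \<Phi> x $ i * \<Phi> x $ j"
    have "(\<Sum>i\<in>UNIV. \<Sum>j\<in>UNIV. b j i x * \<Phi> x $ i * \<Phi> x $ j) = ?S"
      by (subst sum.swap) (simp add: mult_ac)
    moreover have "(\<Sum>i\<in>UNIV. \<Sum>j\<in>UNIV. sympart b i j x * \<Phi> x $ i * \<Phi> x $ j) =
        (?S + (\<Sum>i\<in>UNIV. \<Sum>j\<in>UNIV. b j i x * \<Phi> x $ i * \<Phi> x $ j)) / 2"
      by (simp add: sympart_def sum.distrib[symmetric] sum_divide_distrib field_simps)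
    ultimately show ?thesis by simp
  qed
  then show ?thesis by (simp add: BF_def)
qed

lemma BF_cong_on:
  assumes "tests D \<Phi>" "\<And>i j x. x \<in> D \<Longrightarrow> c i j x = c' i j x"
  shows "BF c \<Phi> \<Psi> = BF c' \<Phi> \<Psi>"
proof -
  have *: "c i j x * \<Phi> x $ i * \<Psi> x $ j = c' i j x * \<Phi> x $ i * \<Psi> x $ j" for i j x
    using assms test_outside[of D "\<lambda>x. \<Phi> x $ i" x] by (cases "x \<in> D") (auto simp: tests_def)
  show ?thesis unfolding BF_def * ..
qed

lemma BF_orthogonal:
  fixes T :: "real^'n \<Rightarrow> real^'n" and \<Phi> \<Psi> :: "real^'n \<Rightarrow> real^'m"
  assumes T: "orthogonal_transformation T"
    and D: "open D" and c: "\<And>i j. continuous_on D (c i j)" and t: "tests D \<Phi>" "tests D \<Psi>"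
  shows "BF (\<lambda>i j x. c i j (T x)) (\<lambda>x. \<Phi> (T x)) (\<lambda>x. \<Psi> (T x)) = BF c \<Phi> \<Psi>"
proof -
  note C = cc_BF_grad[OF D c] cc_BF_pot[OF D c]
  let ?f = "\<lambda>x. (\<Sum>i\<in>UNIV. gradient (\<lambda>y. \<Phi> y $ i) x \<bullet> gradient (\<lambda>y. \<Psi> y $ i) x) -
    (\<Sum>i\<in>UNIV. \<Sum>j\<in>UNIV. c i j x * \<Phi> x $ i * \<Psi> x $ j)"
  have t': "C1_on UNIV (\<lambda>x. \<Phi> x $ i)" "C1_on UNIV (\<lambda>x. \<Psi> x $ i)" for i
    using t unfolding tests_def by (blast intro: test_C1)+
  have "cc ?f" by (intro cc_diff cc_sum C t)
  from cc_integral_orthogonal[OF T this] show ?thesis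
    unfolding BF_def by (simp add: inner_gradient_orthogonal[OF T t'])
qed

subsection \<open>Minimisers on a subdomain\<close>

lemma cc_extend:
  fixes f :: "real^'n \<Rightarrow> real"
  assumes D: "open D" "bounded D" and f: "continuous_on (closure D) f" "\<And>x. x \<in> frontier D \<Longrightarrow> f x = 0"
  shows "cc (\<lambda>x. if x \<in> D then f x else 0)"
proof -
  let ?f = "\<lambda>x. if x \<in> D then f x else 0"
  have "continuous_on (closure D) ?f"
  proof -
    have "f x = ?f x" if "x \<in> closure D" for x
      using that f(2)[of x] D by (auto simp: frontier_def interior_open)
    with f(1) show ?thesis by (simp cong: continuous_on_cong)
  qed
  moreover have "continuous_on (- D) ?f"
    by (subst continuous_on_cong[of _ "- D" _ "\<lambda>_. 0"]) auto
  ultimately have "continuous_on (closure D \<union> - D) ?f"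
    using D by (intro continuous_on_closed_Un) auto
  moreover have "closure D \<union> - D = UNIV" using closure_subset[of D] by auto
  ultimately show ?thesis
    using D closure_subset[of D] by (intro ccI[of _ "closure D"]) auto
qed

definition posv :: "(real^'n) set \<Rightarrow> (real^'n \<Rightarrow> real^'m) \<Rightarrow> real^'n \<Rightarrow> real^'m"
  where "posv D z x = (\<chi> i. pos_on D (\<lambda>x. z x $ i) x)"

definition cutv :: "(real^'n) set \<Rightarrow> (real^'n \<Rightarrow> real^'m) \<Rightarrow> nat \<Rightarrow> real^'n \<Rightarrow> real^'m"
  where "cutv D z k x = (\<chi> i. cut D (\<lambda>x. z x $ i) (1 / real (Suc k)) x)"

text \<open>\<open>v\<close> solves \<open>- \<Delta> v = c v\<close> in \<open>D\<close> when tested against all bumps.\<close>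

definition weak_sol :: "('m \<Rightarrow> 'm \<Rightarrow> real^'n \<Rightarrow> real) \<Rightarrow> (real^'n) set \<Rightarrow> (real^'n \<Rightarrow> real^'m) \<Rightarrow> bool"
  where "weak_sol c D v \<longleftrightarrow> (\<forall>i y s. 0 < s \<longrightarrow> cball y s \<subseteq> D \<longrightarrow>
    - integral UNIV (\<lambda>x. v x $ i * lap_bump y s x) =
      integral UNIV (\<lambda>x. (\<Sum>j\<in>UNIV. c i j x * v x $ j) * bump y s x))"

text \<open>What \<open>test_cut\<close> asks of each component of \<open>z\<close>, with equality
  on the frontier so that \<open>- z\<close> qualifies as well.\<close>

definition zero_trace :: "(real^'n) set \<Rightarrow> (real^'n \<Rightarrow> real^'m) \<Rightarrow> bool"
  where "zero_trace D z \<longleftrightarrow> (\<forall>i. C1_on D (\<lambda>x. z x $ i)) \<and> continuous_on (closure D) z \<and> (\<forall>x\<in>frontier D. z x = 0)"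

text \<open>The weak form of - \<Delta> z_i \<le> \<Sum>j. b_ij z_j^+ on the set where z_i > 0:
  admissible test functions vanish in \<open>D\<close> where z_i \<le> 0, so nothing is demanded
  there. The inequality is made to be tested with truncations of z_i^+.\<close>

definition subsol :: "('m \<Rightarrow> 'm \<Rightarrow> real^'n \<Rightarrow> real) \<Rightarrow> (real^'n) set \<Rightarrow> (real^'n \<Rightarrow> real^'m) \<Rightarrow> bool"
  where "subsol b D z \<longleftrightarrow> (\<forall>i \<phi>. test D \<phi> \<longrightarrow> (\<forall>x. 0 \<le> \<phi> x) \<longrightarrow> (\<forall>x\<in>D. z x $ i \<le> 0 \<longrightarrow> \<phi> x = 0) \<longrightarrow>
    integral UNIV (\<lambda>x. gradient (\<lambda>y. z y $ i) x \<bullet> gradient \<phi> x) \<le>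
    integral UNIV (\<lambda>x. (\<Sum>j\<in>UNIV. b i j x * posv D z x $ j) * \<phi> x))"

context
  fixes D :: "(real^'n) set" and z :: "real^'n \<Rightarrow> real^'m"
  assumes D: "open D" "bounded D" and z: "zero_trace D z"
begin

lemma tests_cutv: "tests D (cutv D z k)"
  unfolding tests_def
proof
  fix i
  have "test D (cut D (\<lambda>x. z x $ i) (1 / real (Suc k)))"
    using z by (intro test_cut D) (auto simp: zero_trace_def intro!: continuous_on_component)
  then show "test D (\<lambda>x. cutv D z k x $ i)" by (simp add: cutv_def)
qed

lemma gradient_cutv:
  "gradient (\<lambda>x. cutv D z k x $ i) x =
    (if x \<in> D then trunc' (1 / real (Suc k)) (z x $ i) *\<^sub>R gradient (\<lambda>x. z x $ i) x else 0)"
  unfolding cutv_def vec_lambda_beta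
  using z D by (auto simp: zero_trace_def intro!: gradient_cut gradient_cut_out continuous_on_component)

lemma cutv_bounds:
  "0 \<le> cutv D z k x $ i" "cutv D z k x $ i \<le> posv D z x $ i" "0 \<le> posv D z x $ i"
  unfolding cutv_def posv_def using cut_bounds(1,2)[of "1 / real (Suc k)" D "\<lambda>x. z x $ i" x]
  by (auto simp: pos_on_def)

lemma cutv_lim: "(\<lambda>k. cutv D z k x $ i) \<longlonglongrightarrow> posv D z x $ i"
proof (rule Lim_transform2)
  have "(\<lambda>k. 2 * (1 / real (Suc k))) \<longlonglongrightarrow> 2 * 0"
    by (intro tendsto_intros LIMSEQ_Suc[OF lim_1_over_n])
  then have l: "(\<lambda>k. 2 / real (Suc k)) \<longlonglongrightarrow> 0" by simp
  show "(\<lambda>k. posv D z x $ i - cutv D z k x $ i) \<longlonglongrightarrow> 0"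
    by (rule tendsto_rabs_zero_cancel, rule tendsto_sandwich[OF _ _ tendsto_const l])
      (use cut_bounds(4)[of "1 / real (Suc _)" D "\<lambda>x. z x $ i" x] in \<open>auto simp: cutv_def posv_def abs_minus_commute\<close>)
qed (rule tendsto_const)

lemma cc_mult_posv:
  assumes "continuous_on (closure D) g"
  shows "cc (\<lambda>x. g x * posv D z x $ i)"
proof -
  have "cc (\<lambda>x. if x \<in> D then g x * max 0 (z x $ i) else 0)"
    using z by (intro cc_extend D continuous_intros assms) (auto simp: zero_trace_def intro!: continuous_on_component)
  moreover have "(if x \<in> D then g x * max 0 (z x $ i) else 0) = g x * posv D z x $ i" for x
    by (simp add: posv_def pos_on_def)
  ultimately show ?thesis by simp
qed

lemma cc_posv: "cc (\<lambda>x. posv D z x $ i)"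
  using cc_mult_posv[of "\<lambda>_. 1" i] by simp

lemma cutv_integral_lim:
  assumes "continuous_on (closure D) g" "\<And>k. cc (f k)" "\<And>x. (\<lambda>k. f k x) \<longlonglongrightarrow> h x"
    "\<And>k x. \<bar>f k x\<bar> \<le> H x" "cc h" "cc H"
  shows "(\<lambda>k. integral UNIV (\<lambda>x. g x * cutv D z k x $ i * f k x)) \<longlonglongrightarrow> integral UNIV (\<lambda>x. g x * posv D z x $ i * h x)"
proof (rule dominated_convergence(2))
  show "(\<lambda>x. \<bar>g x * posv D z x $ i\<bar> * H x) integrable_on UNIV"
    by (intro cc_integrable cc_mult cc_abs cc_mult_posv assms)
  have gD: "continuous_on D g" using assms(1) closure_subset by (rule continuous_on_subset)
  have "cc (\<lambda>x. cutv D z k x $ i * g x)" for k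
    using tests_cutv[of k] by (intro csupp_cc[OF csupp_mult[OF D(1)]] test_csupp gD) (auto simp: tests_def)
  from cc_mult[OF this assms(2)] have "cc (\<lambda>x. (cutv D z k x $ i * g x) * f k x)" for k .
  then show "(\<lambda>x. g x * cutv D z k x $ i * f k x) integrable_on UNIV" for k
    by (intro cc_integrable) (simp add: mult_ac)
  show "norm (g x * cutv D z k x $ i * f k x) \<le> \<bar>g x * posv D z x $ i\<bar> * H x" for k x
    using cutv_bounds(1)[of k x i] cutv_bounds(2)[of k x i] cutv_bounds(3)[of x i] assms(4)[of k x]
    unfolding real_norm_def abs_mult by (intro mult_mono mult_nonneg_nonneg) auto
  show "(\<lambda>k. g x * cutv D z k x $ i * f k x) \<longlonglongrightarrow> g x * posv D z x $ i * h x" for x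
    by (intro tendsto_intros cutv_lim assms)
qed

text \<open>Testing the subsolution inequality with the truncation itself bounds its Dirichlet
  energy, because the slope of \<open>trunc\<close> is at most one. What remains, \<open>q\<close>,
  is the discrepancy between \<open>cutv\<close> and \<open>posv\<close> inside the potential terms,
  and it vanishes by dominated convergence.\<close>

lemma BF_cutv_upper:
  assumes b: "\<And>i j. continuous_on (closure D) (b i j)" and sub: "subsol b D z"
  shows "\<exists>q. q \<longlonglongrightarrow> 0 \<and> (\<forall>k. BF b (cutv D z k) (cutv D z k) \<le> q k)"
proof -
  have bD: "continuous_on D (b i j)" for i j
    using b closure_subset by (rule continuous_on_subset)
  note C = cc_BF_grad[OF D(1) bD] cc_BF_pot[OF D(1) bD]
  have ccg: "cc (\<lambda>x. b i j x * cutv D z k x $ i * f x)" if "cc f" for i j k f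
  proof -
    have "cc (\<lambda>x. (cutv D z k x $ i * b i j x) * f x)"
      using tests_cutv[of k]
      by (intro cc_mult[OF csupp_cc[OF csupp_mult[OF D(1)]]] that test_csupp bD) (auto simp: tests_def)
    then show ?thesis by (simp add: mult_ac)
  qed
  define q where "q k = (\<Sum>i\<in>UNIV. \<Sum>j\<in>UNIV. integral UNIV (\<lambda>x. b i j x * cutv D z k x $ i * posv D z x $ j)) -
    (\<Sum>i\<in>UNIV. \<Sum>j\<in>UNIV. integral UNIV (\<lambda>x. b i j x * cutv D z k x $ i * cutv D z k x $ j))" for k
  have "q \<longlonglongrightarrow> (\<Sum>i\<in>UNIV. \<Sum>j\<in>UNIV. integral UNIV (\<lambda>x. b i j x * posv D z x $ i * posv D z x $ j)) -
    (\<Sum>i\<in>UNIV. \<Sum>j\<in>UNIV. integral UNIV (\<lambda>x. b i j x * posv D z x $ i * posv D z x $ j))"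
    unfolding q_def[abs_def]
  proof (intro tendsto_diff tendsto_sum)
    fix i j
    show "(\<lambda>k. integral UNIV (\<lambda>x. b i j x * cutv D z k x $ i * posv D z x $ j))
        \<longlonglongrightarrow> integral UNIV (\<lambda>x. b i j x * posv D z x $ i * posv D z x $ j)"
      by (rule cutv_integral_lim[where H="\<lambda>x. posv D z x $ j"]) (auto intro!: b cc_posv simp: cutv_bounds)
    show "(\<lambda>k. integral UNIV (\<lambda>x. b i j x * cutv D z k x $ i * cutv D z k x $ j))
        \<longlonglongrightarrow> integral UNIV (\<lambda>x. b i j x * posv D z x $ i * posv D z x $ j)"
      by (rule cutv_integral_lim[where H="\<lambda>x. posv D z x $ j"])
        (use tests_cutv in \<open>auto intro!: b cc_posv cutv_lim test_cc simp: cutv_bounds tests_def\<close>)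
  qed
  then have "q \<longlonglongrightarrow> 0" by simp
  moreover have "BF b (cutv D z k) (cutv D z k) \<le> q k" for k
  proof -
    have "integral UNIV (\<lambda>x. gradient (\<lambda>y. cutv D z k y $ i) x \<bullet> gradient (\<lambda>y. cutv D z k y $ i) x) \<le>
       (\<Sum>j\<in>UNIV. integral UNIV (\<lambda>x. b i j x * cutv D z k x $ i * posv D z x $ j))" for i
    proof -
      let ?\<phi> = "\<lambda>y. cutv D z k y $ i" and ?e = "1 / real (Suc k)"
      have t: "test D ?\<phi>" using tests_cutv by (simp add: tests_def)
      have "integral UNIV (\<lambda>x. gradient ?\<phi> x \<bullet> gradient ?\<phi> x) \<le>
          integral UNIV (\<lambda>x. gradient (\<lambda>y. z y $ i) x \<bullet> gradient ?\<phi> x)"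
      proof (rule cc_integral_mono)
        show "cc (\<lambda>x. gradient ?\<phi> x \<bullet> gradient ?\<phi> x)" by (rule C(1)[OF tests_cutv tests_cutv])
        show "cc (\<lambda>x. gradient (\<lambda>y. z y $ i) x \<bullet> gradient ?\<phi> x)"
          using z by (intro test_cc_gradient_inner(2)[OF D(1) t]) (auto simp: zero_trace_def intro: C1_on_continuous_gradient)
        fix x
        let ?t = "trunc' ?e (z x $ i)" and ?g = "gradient (\<lambda>y. z y $ i) x"
        have "?t * (?t * (?g \<bullet> ?g)) \<le> 1 * (?t * (?g \<bullet> ?g))"
          using trunc'_bounds[of ?e "z x $ i"] by (intro mult_right_mono) auto
        then show "gradient ?\<phi> x \<bullet> gradient ?\<phi> x \<le> ?g \<bullet> gradient ?\<phi> x"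
          by (simp add: gradient_cutv)
      qed
      also have "\<dots> \<le> integral UNIV (\<lambda>x. (\<Sum>j\<in>UNIV. b i j x * posv D z x $ j) * ?\<phi> x)"
      proof -
        have "\<forall>x\<in>D. z x $ i \<le> 0 \<longrightarrow> ?\<phi> x = 0"
          by (auto simp: cutv_def cut_def intro!: trunc_eq_0(1) intro: order_trans[of _ 0])
        then show ?thesis using sub t cutv_bounds(1) unfolding subsol_def by blast
      qed
      also have "\<dots> = integral UNIV (\<lambda>x. \<Sum>j\<in>UNIV. b i j x * cutv D z k x $ i * posv D z x $ j)"
        by (simp add: sum_distrib_left sum_distrib_right mult_ac)
      also have "\<dots> = (\<Sum>j\<in>UNIV. integral UNIV (\<lambda>x. b i j x * cutv D z k x $ i * posv D z x $ j))"
        by (intro cc_integral_sum ccg cc_posv) auto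
      finally show ?thesis .
    qed
    then show ?thesis
      unfolding BF_eq[OF D(1) bD tests_cutv tests_cutv] q_def by (intro diff_right_mono sum_mono)
  qed
  ultimately show ?thesis by blast
qed

text \<open>After integration by parts the truncations occur without derivatives, so their pointwise
  convergence under a common bound suffices. The limit is the first variation at \<open>posv\<close>
  in the direction of the bump.\<close>

lemma BF_cutv_bump_lim:
  assumes c: "\<And>i j. continuous_on (closure D) (c i j)" and s: "0 < s"
  shows "(\<lambda>k. BF c (cutv D z k) (\<lambda>x. bump y s x *\<^sub>R axis i 1)) \<longlonglongrightarrow>
    - integral UNIV (\<lambda>x. posv D z x $ i * lap_bump y s x) - integral UNIV (\<lambda>x. (\<Sum>j\<in>UNIV. c j i x * posv D z x $ j) * bump y s x)"
proof -
  have s0: "0 \<le> s" using s by simp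
  have cD: "continuous_on D (c i j)" for i j using c closure_subset by (rule continuous_on_subset)
  have cb: "cc (bump y s)" "cc (lap_bump y s)"
    using csupp_cc[OF test_csupp[OF test_bump[OF s0 subset_UNIV]]] csupp_cc[OF csupp_lap_bump[OF s0 subset_UNIV]] by auto
  have eq: "BF c (cutv D z k) (\<lambda>x. bump y s x *\<^sub>R axis i 1) =
     - integral UNIV (\<lambda>x. 1 * cutv D z k x $ i * lap_bump y s x) -
     (\<Sum>j\<in>UNIV. integral UNIV (\<lambda>x. c j i x * cutv D z k x $ j * bump y s x))" for k
  proof -
    have t: "test UNIV (\<lambda>x. cutv D z k x $ i)" for i
      using tests_cutv test_mono[of D _ UNIV] by (auto simp: tests_def)
    have g: "gradient (\<lambda>y'. (bump y s y' *\<^sub>R axis i 1 :: real^'m) $ j) x = (if j = i then gradient (bump y s) x else 0)" for j x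
      by (simp add: axis_def)
    have "BF c (cutv D z k) (\<lambda>x. bump y s x *\<^sub>R axis i 1) = integral UNIV (\<lambda>x.
      gradient (\<lambda>y. cutv D z k y $ i) x \<bullet> gradient (bump y s) x - (\<Sum>j\<in>UNIV. c j i x * cutv D z k x $ j * bump y s x))"
      unfolding BF_def g
      by (intro arg_cong[where f="integral UNIV"] ext)
        (simp add: if_distrib[of "\<lambda>v. _ \<bullet> v"] axis_def if_distrib[of "\<lambda>v. _ * v"] cong: if_cong)
    also have "\<dots> = integral UNIV (\<lambda>x. gradient (\<lambda>y. cutv D z k y $ i) x \<bullet> gradient (bump y s) x) -
      integral UNIV (\<lambda>x. \<Sum>j\<in>UNIV. c j i x * cutv D z k x $ j * bump y s x)"
    proof (intro cc_integral_diff cc_sum)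
      show "cc (\<lambda>x. gradient (\<lambda>y. cutv D z k y $ i) x \<bullet> gradient (bump y s) x)"
        by (rule test_cc_gradient_inner(1)[OF open_UNIV t]) (rule C1_on_continuous_gradient[OF C1_on_bump])
      have "cc (\<lambda>x. (cutv D z k x $ j * c j i x) * bump y s x)" for j
        using tests_cutv[of k]
        by (intro cc_mult[OF csupp_cc[OF csupp_mult[OF D(1)]]] cb test_csupp cD) (auto simp: tests_def)
      then show "cc (\<lambda>x. c j i x * cutv D z k x $ j * bump y s x)" for j by (simp add: mult_ac)
    qed
    also have "integral UNIV (\<lambda>x. gradient (\<lambda>y. cutv D z k y $ i) x \<bullet> gradient (bump y s) x) =
        - integral UNIV (\<lambda>x. cutv D z k x $ i * lap_bump y s x)"
      by (rule integral_by_parts_bump[OF s0 subset_UNIV open_UNIV test_C1[OF t]])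
    also have "integral UNIV (\<lambda>x. \<Sum>j\<in>UNIV. c j i x * cutv D z k x $ j * bump y s x) =
        (\<Sum>j\<in>UNIV. integral UNIV (\<lambda>x. c j i x * cutv D z k x $ j * bump y s x))"
    proof (intro cc_integral_sum)
      have "cc (\<lambda>x. (cutv D z k x $ j * c j i x) * bump y s x)" for j
        using tests_cutv[of k]
        by (intro cc_mult[OF csupp_cc[OF csupp_mult[OF D(1)]]] cb test_csupp cD) (auto simp: tests_def)
      then show "cc (\<lambda>x. c j i x * cutv D z k x $ j * bump y s x)" for j by (simp add: mult_ac)
    qed auto
    finally show ?thesis by simp
  qed
  have lim: "(\<Sum>j\<in>UNIV. integral UNIV (\<lambda>x. c j i x * posv D z x $ j * bump y s x)) =
      integral UNIV (\<lambda>x. (\<Sum>j\<in>UNIV. c j i x * posv D z x $ j) * bump y s x)"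
    by (subst cc_integral_sum[symmetric]) (auto simp: sum_distrib_right intro!: cc_mult cc_mult_posv c cb)
  have "(\<lambda>k. - integral UNIV (\<lambda>x. 1 * cutv D z k x $ i * lap_bump y s x) -
     (\<Sum>j\<in>UNIV. integral UNIV (\<lambda>x. c j i x * cutv D z k x $ j * bump y s x))) \<longlonglongrightarrow>
     - integral UNIV (\<lambda>x. 1 * posv D z x $ i * lap_bump y s x) - (\<Sum>j\<in>UNIV. integral UNIV (\<lambda>x. c j i x * posv D z x $ j * bump y s x))"
    by (intro tendsto_intros cutv_integral_lim[where H="\<lambda>x. \<bar>lap_bump y s x\<bar>"] cutv_integral_lim[where H="\<lambda>x. \<bar>bump y s x\<bar>"] cc_abs cb c)
      auto
  then show ?thesis by (simp add: eq lim)
qed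

text \<open>
  The truncations of \<open>z\<^sup>+\<close> have asymptotically nonpositive energy, so that \<open>z\<^sup>+\<close> minimises a
  nonnegative form and solves the Euler--Lagrange equation of its symmetric part.
\<close>

lemma minimiser_weak_sol:
  assumes b: "\<And>i j. continuous_on (closure D) (b i j)" and sub: "subsol b D z"
    and nonneg: "\<And>\<Phi>. tests D \<Phi> \<Longrightarrow> 0 \<le> BF b \<Phi> \<Phi>"
  shows "weak_sol (sympart b) D (posv D z)"
  unfolding weak_sol_def
proof (intro allI impI)
  fix i y and s :: real assume s: "0 < s" "cball y s \<subseteq> D"
  let ?c = "sympart b" and ?B = "\<lambda>x. bump y s x *\<^sub>R axis i 1 :: real^'m"
  have c: "continuous_on (closure D) (?c i j)" for i j
    unfolding sympart_def[abs_def] by (intro continuous_intros b) auto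
  have cD: "continuous_on D (?c i j)" for i j using c closure_subset by (rule continuous_on_subset)
  have tB: "tests D ?B" using s by (intro tests_axis test_bump) auto
  obtain q where q: "q \<longlonglongrightarrow> 0" "\<And>k. BF b (cutv D z k) (cutv D z k) \<le> q k"
    using BF_cutv_upper[OF b sub] by blast
  define l where "l = - integral UNIV (\<lambda>x. posv D z x $ i * lap_bump y s x) -
    integral UNIV (\<lambda>x. (\<Sum>j\<in>UNIV. ?c j i x * posv D z x $ j) * bump y s x)"
  define Q where "Q = BF ?c ?B ?B"
  \<comment> \<open>The energy of the truncation perturbed by \<open>t\<close> times the bump is
    nonnegative; letting \<open>k\<close> tend to infinity leaves only the linear and the quadratic
    term in \<open>t\<close>.\<close>
  have ge: "0 \<le> 2 * t * l + t\<^sup>2 * Q" for t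
  proof -
    have "(\<lambda>k. q k + 2 * t * BF ?c (cutv D z k) ?B + t\<^sup>2 * Q) \<longlonglongrightarrow> 0 + 2 * t * l + t\<^sup>2 * Q"
      unfolding l_def by (intro tendsto_intros q BF_cutv_bump_lim c s)
    moreover have "0 \<le> q k + 2 * t * BF ?c (cutv D z k) ?B + t\<^sup>2 * Q" for k
    proof -
      have "0 \<le> BF b (\<lambda>x. cutv D z k x + t *\<^sub>R ?B x) (\<lambda>x. cutv D z k x + t *\<^sub>R ?B x)"
        by (intro nonneg tests_add tests_scaleR tests_cutv tB)
      also have "\<dots> = BF ?c (\<lambda>x. cutv D z k x + t *\<^sub>R ?B x) (\<lambda>x. cutv D z k x + t *\<^sub>R ?B x)"
        by (simp only: BF_sympart)
      also have "\<dots> = BF ?c (cutv D z k) (cutv D z k) + 2 * t * BF ?c (cutv D z k) ?B + t\<^sup>2 * Q"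
        unfolding Q_def by (rule BF_quadratic[OF D(1) cD sympart_commute tests_cutv tB])
      also have "BF ?c (cutv D z k) (cutv D z k) \<le> q k" using q(2)[of k] by (simp only: BF_sympart)
      finally show ?thesis by simp
    qed
    ultimately show ?thesis by (intro LIMSEQ_le_const[of _ "2 * t * l + t\<^sup>2 * Q"]) auto
  qed
  have "l = 0"
  proof (rule ccontr)
    assume l: "l \<noteq> 0"
    \<comment> \<open>A step against the sign of \<open>l\<close>. The denominator |Q| + 1 is
      positive whatever the sign of \<open>Q\<close>, and the linear gain outweighs the quadratic
      term.\<close>
    define t where "t = - l / (\<bar>Q\<bar> + 1)"
    have Q: "0 < \<bar>Q\<bar> + 1" by simp
    have "2 * t * l + t\<^sup>2 * Q \<le> 2 * t * l + t\<^sup>2 * (\<bar>Q\<bar> + 1)"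
      by (intro add_left_mono mult_left_mono) auto
    also have "\<dots> = - l\<^sup>2 / (\<bar>Q\<bar> + 1)"
    proof -
      have "t * (\<bar>Q\<bar> + 1) = - l" using Q by (simp add: t_def)
      then have "t\<^sup>2 * (\<bar>Q\<bar> + 1) = - t * l" by (simp add: power2_eq_square mult.assoc)
      then have "2 * t * l + t\<^sup>2 * (\<bar>Q\<bar> + 1) = t * l" by simp
      then show ?thesis by (simp add: t_def power2_eq_square)
    qed
    also have "\<dots> < 0" using l Q by (simp add: divide_neg_pos)
    finally show False using ge[of t] by simp
  qed
  then show "- integral UNIV (\<lambda>x. posv D z x $ i * lap_bump y s x) =
      integral UNIV (\<lambda>x. (\<Sum>j\<in>UNIV. ?c i j x * posv D z x $ j) * bump y s x)"
    by (simp add: l_def sympart_commute[of b _ i])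
qed

end

subsection \<open>Cooperative weak solutions\<close>

text \<open>Off-diagonal terms are nonnegative and may be dropped. What remains is the scalar
  inequality - \<Delta> v_i \<ge> - M v_i, in the form that the strong maximum principle
  takes.\<close>

lemma weak_sol_component:
  fixes v :: "real^'n \<Rightarrow> real^'m"
  assumes D: "open D" and v: "\<And>i. continuous_on D (\<lambda>x. v x $ i)" "\<And>x i. x \<in> D \<Longrightarrow> 0 \<le> v x $ i"
    and c: "\<And>i j. continuous_on D (c i j)" "\<And>i j x. x \<in> D \<Longrightarrow> i \<noteq> j \<Longrightarrow> 0 \<le> c i j x"
    and M: "\<And>x. x \<in> D \<Longrightarrow> - M \<le> c i i x"
    and sol: "- integral UNIV (\<lambda>x. v x $ i * lap_bump y s x) =
      integral UNIV (\<lambda>x. (\<Sum>j\<in>UNIV. c i j x * v x $ j) * bump y s x)"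
    and s: "0 < s" "cball y s \<subseteq> D"
  shows "integral UNIV (\<lambda>x. v x $ i * lap_bump y s x) \<le> M * integral UNIV (\<lambda>x. v x $ i * bump y s x)"
proof -
  have tb: "test D (bump y s)" using s by (intro test_bump) auto
  have cc1: "cc (\<lambda>x. g x * bump y s x)" if "continuous_on D g" for g
    using csupp_cc[OF csupp_mult[OF D test_csupp[OF tb] that]] by (simp add: mult.commute)
  have "integral UNIV (\<lambda>x. - M * (v x $ i * bump y s x)) \<le>
      integral UNIV (\<lambda>x. (\<Sum>j\<in>UNIV. c i j x * v x $ j) * bump y s x)"
  proof (intro cc_integral_mono cc_cmult cc1 v continuous_intros c)
    fix x
    show "- M * (v x $ i * bump y s x) \<le> (\<Sum>j\<in>UNIV. c i j x * v x $ j) * bump y s x"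
    proof (cases "x \<in> D")
      case True
      have "- M * v x $ i \<le> c i i x * v x $ i" using M[OF True] v(2)[OF True] by (intro mult_right_mono)
      also have "\<dots> \<le> (\<Sum>j\<in>UNIV. c i j x * v x $ j)"
      proof -
        have "(\<Sum>j\<in>UNIV. c i j x * v x $ j) = c i i x * v x $ i + (\<Sum>j\<in>UNIV - {i}. c i j x * v x $ j)"
          by (simp add: sum.remove[of UNIV i])
        moreover have "0 \<le> (\<Sum>j\<in>UNIV - {i}. c i j x * v x $ j)"
          using c(2)[OF True, of i] v(2)[OF True] by (intro sum_nonneg mult_nonneg_nonneg) auto
        ultimately show ?thesis by simp
      qed
      finally show ?thesis using mult_right_mono[OF _ bump_nonneg[of y s x]] by (metis mult.assoc)
    next
      case False
      then show ?thesis using test_outside[OF tb] by simp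
    qed
  qed
  then show ?thesis using sol by simp
qed

text \<open>Each component is identically zero or positive throughout. For a vanishing component the
  equation reduces to a vanishing sum of nonnegative terms c_ij v_j, which kills the coefficients
  against the positive components.\<close>

lemma weak_sol_dichotomy:
  fixes v :: "real^'n \<Rightarrow> real^'m"
  assumes D: "open D" "connected D" and v: "\<And>i. continuous_on D (\<lambda>x. v x $ i)" "\<And>x i. x \<in> D \<Longrightarrow> 0 \<le> v x $ i"
    and c: "\<And>i j. continuous_on D (c i j)" "\<And>i j x. x \<in> D \<Longrightarrow> i \<noteq> j \<Longrightarrow> 0 \<le> c i j x"
    and M: "\<And>i x. x \<in> D \<Longrightarrow> \<bar>c i i x\<bar> \<le> M"
    and sol: "weak_sol c D v"
  shows "\<exists>I. (\<forall>i\<in>I. \<forall>x\<in>D. 0 < v x $ i) \<and> (\<forall>i\<in>-I. \<forall>x\<in>D. v x $ i = 0) \<and>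
    (\<forall>i\<in>-I. \<forall>j\<in>I. \<forall>x\<in>D. c i j x = 0)"
proof -
  \<comment> \<open>The strong maximum principle wants a nonnegative constant, which the bound by
    \<open>M\<close> does not provide when \<open>D\<close> is empty.\<close>
  have M': "- max M 0 \<le> c i i x" if "x \<in> D" for i x using M[OF that, of i] by linarith
  have dich: "(\<forall>x\<in>D. v x $ i = 0) \<or> (\<forall>x\<in>D. 0 < v x $ i)" for i
  proof (rule strong_maximum_principle[OF D v, of "max M 0"])
    fix y s assume "0 < (s::real)" "cball y s \<subseteq> D"
    then show "integral UNIV (\<lambda>x. v x $ i * lap_bump y s x) \<le> max M 0 * integral UNIV (\<lambda>x. v x $ i * bump y s x)"
      using sol by (intro weak_sol_component[OF D(1) v c M']) (auto simp: weak_sol_def)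
  qed auto
  define I where "I = {i. \<forall>x\<in>D. 0 < v x $ i}"
  have "c i j x = 0" if i: "i \<notin> I" and j: "j \<in> I" and x: "x \<in> D" for i j x
  proof -
    have z: "v x $ i = 0" if "x \<in> D" for x using dich[of i] i that by (auto simp: I_def)
    have "(\<Sum>j\<in>UNIV. c i j x * v x $ j) = 0"
    proof (rule fundamental_lemma_bump[OF D(1) _ _ x])
      show "continuous_on D (\<lambda>x. \<Sum>j\<in>UNIV. c i j x * v x $ j)" by (intro continuous_intros c v)
      fix y s assume s: "0 < (s::real)" "cball y s \<subseteq> D"
      have *: "v x $ i * lap_bump y s x = 0" for x
      proof (cases "x \<in> D")
        case False
        then have "x \<notin> ball y s" using s(2) ball_subset_cball by blast
        from bp_outside[OF _ this] s(1) show ?thesis by (simp add: lap_bump_def)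
      qed (simp add: z)
      have 0: "integral UNIV (\<lambda>x. v x $ i * lap_bump y s x) = 0" unfolding * by simp
      have "- integral UNIV (\<lambda>x. v x $ i * lap_bump y s x) =
          integral UNIV (\<lambda>x. (\<Sum>j\<in>UNIV. c i j x * v x $ j) * bump y s x)"
        using sol s unfolding weak_sol_def by blast
      then show "integral UNIV (\<lambda>x. (\<Sum>j\<in>UNIV. c i j x * v x $ j) * bump y s x) = 0"
        unfolding 0 by simp
    qed
    moreover have "0 \<le> c i j x * v x $ j" for j
      using c(2)[OF x, of i j] v(2)[OF x, of j] z[OF x] by (cases "i = j") auto
    ultimately have "c i j x * v x $ j = 0" by (simp add: sum_nonneg_eq_0_iff)
    moreover have "0 < v x $ j" using j x by (simp add: I_def)
    ultimately show ?thesis by simp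
  qed
  moreover have "v x $ i = 0" if "i \<notin> I" "x \<in> D" for i x
    using dich[of i] that by (auto simp: I_def)
  moreover have "0 < v x $ i" if "i \<in> I" "x \<in> D" for i x
    using that by (simp add: I_def)
  ultimately show ?thesis by (intro exI[of _ I]) blast
qed

lemma continuous_on_posv:
  assumes "open D" "bounded D" "zero_trace D z"
  shows "continuous_on S (\<lambda>x. posv D z x $ i)"
  by (rule cc_continuous[OF cc_posv[OF assms]])

subsection \<open>Symmetries of the domain\<close>

lemma sum_Basis_vec: "(\<Sum>b\<in>Basis. f (b :: real^'n)) = (\<Sum>l\<in>UNIV. f (axis l 1))"
proof -
  have "(Basis :: (real^'n) set) = range (\<lambda>l. axis l 1)" by (auto simp: Basis_vec_def)
  moreover have "inj (\<lambda>l::'n. axis l (1::real))" by (auto simp: inj_on_def axis_eq_axis)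
  ultimately show ?thesis
    using sum.reindex[of "\<lambda>l::'n. axis l (1::real)" UNIV f] by (simp add: o_def)
qed

lemma linear_part1: "linear (part1 K)" and linear_part2: "linear (part2 K)"
  by (auto intro!: linearI simp: part1_def part2_def vec_eq_iff)

lemma continuous_on_part1 [continuous_intros]: "continuous_on S g \<Longrightarrow> continuous_on S (\<lambda>x. part1 K (g x))"
  by (rule continuous_on_compose2[OF linear_continuous_on[of "part1 K" UNIV]])
    (auto simp: linear_conv_bounded_linear[symmetric] linear_part1)

lemma continuous_on_part2 [continuous_intros]: "continuous_on S g \<Longrightarrow> continuous_on S (\<lambda>x. part2 K (g x))"
  by (rule continuous_on_compose2[OF linear_continuous_on[of "part2 K" UNIV]])
    (auto simp: linear_conv_bounded_linear[symmetric] linear_part2)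

lemma part1_plus_part2: "part1 K x + part2 K x = x"
  by (simp add: part1_def part2_def vec_eq_iff)

lemma norm_part12: "(norm x)\<^sup>2 = (norm (part1 K x))\<^sup>2 + (norm (part2 K x))\<^sup>2"
proof -
  have "x \<bullet> x = part1 K x \<bullet> part1 K x + part2 K x \<bullet> part2 K x"
    unfolding inner_vec_def sum.distrib[symmetric] by (rule sum.cong) (auto simp: part1_def part2_def)
  then show ?thesis by (simp add: power2_norm_eq_inner)
qed

lemma inner_part1: "part2 K e = 0 \<Longrightarrow> part1 K x \<bullet> e = x \<bullet> e"
proof -
  assume *: "part2 K e = 0"
  have "e $ l = 0" if "l \<notin> K" for l
  proof -
    have "part2 K e $ l = e $ l" using that by (simp add: part2_def)
    then show ?thesis using * by simp
  qed
  then show ?thesis by (auto simp: inner_vec_def part1_def intro!: sum.cong)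
qed

text \<open>Such maps preserve |x'| and x''. They therefore map \<open>\<Omega>\<close> onto itself
  and leave the nonlinearity unchanged; reflections and plane rotations are the instances
  used.\<close>

definition symm :: "'n set \<Rightarrow> (real^'n \<Rightarrow> real^'n) \<Rightarrow> bool"
  where "symm K T \<longleftrightarrow> orthogonal_transformation T \<and> (\<forall>x. part2 K (T x) = part2 K x)"

lemma symm_norm_part1: "symm K T \<Longrightarrow> norm (part1 K (T x)) = norm (part1 K x)"
proof -
  assume T: "symm K T"
  have "(norm (T x))\<^sup>2 = (norm x)\<^sup>2" using T by (simp add: symm_def orthogonal_transformation)
  then have "(norm (part1 K (T x)))\<^sup>2 = (norm (part1 K x))\<^sup>2"
    using T norm_part12[of "T x" K] norm_part12[of x K] by (simp add: symm_def)
  then show ?thesis by (simp add: power2_eq_iff_nonneg)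
qed

lemma symm_inv: 
  assumes "symm K T" shows "symm K (inv T)" "T (inv T x) = x" "inv T (T x) = x"
proof -
  have o: "orthogonal_transformation T" using assms by (simp add: symm_def)
  then have b: "bij T" by (rule orthogonal_transformation_bij)
  show *: "T (inv T x) = x" "inv T (T x) = x" for x
    using b by (simp_all add: bij_is_surj surj_f_inv_f bij_is_inj)
  have "part2 K (inv T x) = part2 K x" for x
    using assms *(1)[of x] unfolding symm_def by metis
  then show "symm K (inv T)" using orthogonal_transformation_inv[OF o] by (simp add: symm_def)
qed

lemma symm_continuous: "symm K T \<Longrightarrow> continuous_on S T"
  by (simp add: symm_def linear_continuous_on linear_conv_bounded_linear[symmetric] orthogonal_transformation_linear)

definition unitK :: "'n set \<Rightarrow> real^'n \<Rightarrow> bool"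
  where "unitK K e \<longleftrightarrow> norm e = 1 \<and> part2 K e = 0"

lemma unitK_inner: "unitK K e \<Longrightarrow> e \<bullet> e = 1"
  by (simp add: unitK_def power2_norm_eq_inner[symmetric])

lemma unitK_minus: "unitK K e \<Longrightarrow> unitK K (- e)"
  by (simp add: unitK_def linear_neg[OF linear_part2])

definition reflect :: "real^'n \<Rightarrow> real^'n \<Rightarrow> real^'n"
  where "reflect e x = x - (2 * (e \<bullet> x)) *\<^sub>R e"

text \<open>For orthonormal \<open>a\<close> and \<open>b\<close>: the rotation by \<open>t\<close>
  in their plane, taking \<open>a\<close> towards \<open>b\<close> and fixing the orthogonal
  complement. \<open>rotgen\<close> is its infinitesimal generator.\<close>

definition rotp :: "real^'n \<Rightarrow> real^'n \<Rightarrow> real \<Rightarrow> real^'n \<Rightarrow> real^'n"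
  where "rotp a b t x = x + ((cos t - 1) * (a \<bullet> x) - sin t * (b \<bullet> x)) *\<^sub>R a
    + (sin t * (a \<bullet> x) + (cos t - 1) * (b \<bullet> x)) *\<^sub>R b"

definition rotgen :: "real^'n \<Rightarrow> real^'n \<Rightarrow> real^'n \<Rightarrow> real^'n"
  where "rotgen a b x = (a \<bullet> x) *\<^sub>R b - (b \<bullet> x) *\<^sub>R a"

lemma symmI:
  assumes "linear T" "\<And>x. T x \<bullet> T x = x \<bullet> x" "\<And>x. part2 K (T x) = part2 K x"
  shows "symm K T"
proof -
  have "norm (T x) = norm x" for x using assms(2)[of x] by (simp add: norm_eq_sqrt_inner)
  then show ?thesis using assms by (simp add: symm_def orthogonal_transformation)
qed

lemma symm_reflect: "unitK K e \<Longrightarrow> symm K (reflect e)"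
proof (rule symmI)
  assume e: "unitK K e"
  show "linear (reflect e)" by (rule linearI) (auto simp: reflect_def algebra_simps)
  show "reflect e x \<bullet> reflect e x = x \<bullet> x" for x
    using unitK_inner[OF e] by (simp add: reflect_def inner_diff_left inner_diff_right inner_commute algebra_simps)
  show "part2 K (reflect e x) = part2 K x" for x
    using e by (simp add: reflect_def linear_diff[OF linear_part2] linear_scale[OF linear_part2] unitK_def)
qed

lemma reflect_reflect: "unitK K e \<Longrightarrow> reflect e (reflect e x) = x"
  using unitK_inner[of K e] by (simp add: reflect_def inner_diff_right algebra_simps)

lemma reflect_minus: "reflect (- e) = reflect e"
  by (auto simp: reflect_def fun_eq_iff)

lemma inner_reflect: "unitK K e \<Longrightarrow> e \<bullet> reflect e x = - (e \<bullet> x)"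
  using unitK_inner[of K e] by (simp add: reflect_def inner_diff_right)

lemma reflect_fix: "e \<bullet> x = 0 \<Longrightarrow> reflect e x = x"
  by (simp add: reflect_def)

lemma symm_rotp:
  assumes "unitK K a" "unitK K b" "a \<bullet> b = 0"
  shows "symm K (rotp a b t)"
proof (rule symmI)
  show "linear (rotp a b t)" by (rule linearI) (auto simp: rotp_def algebra_simps)
  show "part2 K (rotp a b t x) = part2 K x" for x
    using assms by (simp add: rotp_def linear_add[OF linear_part2] linear_scale[OF linear_part2] unitK_def)
  fix x
  define p q where "p = (cos t - 1) * (a \<bullet> x) - sin t * (b \<bullet> x)" and "q = sin t * (a \<bullet> x) + (cos t - 1) * (b \<bullet> x)"
  have r: "rotp a b t x = x + p *\<^sub>R a + q *\<^sub>R b" by (simp add: rotp_def p_def q_def)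
  have "rotp a b t x \<bullet> rotp a b t x = x \<bullet> x + (2 * p * (a \<bullet> x) + 2 * q * (b \<bullet> x) + p\<^sup>2 + q\<^sup>2)"
    using unitK_inner[OF assms(1)] unitK_inner[OF assms(2)] assms(3) unfolding r
    by (simp add: inner_add_left inner_add_right inner_commute power2_eq_square algebra_simps)
  also have "2 * p * (a \<bullet> x) + 2 * q * (b \<bullet> x) + p\<^sup>2 + q\<^sup>2 = 0"
  proof -
    \<comment> \<open>A polynomial identity whose last factor vanishes for c = cos t and s = sin
      t.\<close>
    have "2 * ((c - 1) * u - s * v) * u + 2 * (s * u + (c - 1) * v) * v + ((c - 1) * u - s * v)\<^sup>2
        + (s * u + (c - 1) * v)\<^sup>2 = (u\<^sup>2 + v\<^sup>2) * (s\<^sup>2 + c\<^sup>2 - 1)" for c s u v :: real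
      by (simp add: power2_eq_square algebra_simps)
    then show ?thesis unfolding p_def q_def by simp
  qed
  finally show "rotp a b t x \<bullet> rotp a b t x = x \<bullet> x" by simp
qed

lemma rotp_0: "rotp a b 0 x = x" by (simp add: rotp_def)

lemma rotp_deriv:
  assumes "unitK K a" "unitK K b" "a \<bullet> b = 0"
  shows "((\<lambda>t. rotp a b t x) has_vector_derivative rotgen a b (rotp a b t x)) (at t within S)"
proof -
  have 1: "a \<bullet> rotp a b t x = cos t * (a \<bullet> x) - sin t * (b \<bullet> x)"
    "b \<bullet> rotp a b t x = sin t * (a \<bullet> x) + cos t * (b \<bullet> x)"
    using unitK_inner[OF assms(1)] unitK_inner[OF assms(2)] assms(3)
    by (auto simp: rotp_def inner_add_right inner_commute algebra_simps)
  have "((\<lambda>t. rotp a b t x) has_vector_derivative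
     (- sin t * (a \<bullet> x) - cos t * (b \<bullet> x)) *\<^sub>R a + (cos t * (a \<bullet> x) - sin t * (b \<bullet> x)) *\<^sub>R b) (at t within S)"
    unfolding rotp_def
    by (auto intro!: derivative_eq_intros simp: has_vector_derivative_def[symmetric] algebra_simps)
  then show ?thesis by (simp add: rotgen_def 1 algebra_simps)
qed

lemma continuous_on_rotp: "continuous_on S (\<lambda>p. rotp a b (fst p) (snd p))"
  unfolding rotp_def by (intro continuous_intros)

lemma Ck1_continuous: "Ck_on 1 S g \<Longrightarrow> continuous_on S g"
  unfolding One_nat_def Ck_on.simps continuous_on_eq_continuous_within by (blast intro: has_derivative_continuous)

subsection \<open>The elliptic system\<close>

lemma linear_axis_expansion:
  fixes L :: "real^'n \<Rightarrow> real^'m"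
  assumes "linear L"
  shows "L h = (\<Sum>l\<in>UNIV. h $ l *\<^sub>R L (axis l 1))"
proof -
  have "L h = L (\<Sum>l\<in>UNIV. h $ l *\<^sub>R axis l 1)"
    using basis_expansion[of h] by (simp add: scalar_mult_eq_scaleR)
  also have "\<dots> = (\<Sum>l\<in>UNIV. h $ l *\<^sub>R L (axis l 1))"
    using linear_sum[OF assms, of "\<lambda>l. h $ l *\<^sub>R axis l 1" UNIV] linear_scale[OF assms] by simp
  finally show ?thesis .
qed

lemma gradient_of_vector_derivative:
  fixes g :: "real^'n \<Rightarrow> real^'m"
  assumes "(g has_derivative L) (at x)"
  shows "((\<lambda>x. g x $ i) has_derivative (\<lambda>h. (\<chi> l. L (axis l 1) $ i) \<bullet> h)) (at x)"
proof -
  have "((\<lambda>x. g x $ i) has_derivative (\<lambda>h. L h $ i)) (at x)"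
    by (rule bounded_linear.has_derivative[OF bounded_linear_vec_nth assms])
  moreover have "(\<lambda>h. L h $ i) = (\<lambda>h. (\<chi> l. L (axis l 1) $ i) \<bullet> h)"
  proof
    fix h
    show "L h $ i = (\<chi> l. L (axis l 1) $ i) \<bullet> h"
      unfolding linear_axis_expansion[OF has_derivative_linear[OF assms], of h]
      by (simp add: inner_vec_def mult.commute)
  qed
  ultimately show ?thesis by (rule has_derivative_eq_rhs)
qed

locale elliptic_system =
  fixes K :: "'n::finite set"
    and \<Omega> :: "(real^'n) set"
    and F :: "real \<Rightarrow> real^'n \<Rightarrow> real^'m \<Rightarrow> real^'m::finite"
    and U :: "real^'n \<Rightarrow> real^'m"
  assumes card_K: "2 \<le> card K"
    and dom: "bounded_domain \<Omega>" and rot: "rotationally_symmetric K \<Omega>"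
    and F_C1: "Ck_on 1 ({0..} \<times> closure (part2 K ` \<Omega>) \<times> UNIV) (\<lambda>(r, y, S). F r y S)"
    and U_C2: "Ck_on 2 (closure \<Omega>) U"
    and pde: "\<forall>x\<in>\<Omega>. - laplacian U x = F (norm (part1 K x)) (part2 K x) (U x)"
    and bc: "\<forall>x\<in>frontier \<Omega>. U x = 0"
    and coupled: "fully_coupled K F U \<Omega>"
begin

lemma \<Omega>: "open \<Omega>" "connected \<Omega>" "bounded \<Omega>" "\<Omega> \<noteq> {}"
  using dom by (auto simp: bounded_domain_def)

text \<open>A section over fixed x'' is a ball or an annulus centred at x' = 0, so only |x'| decides
  membership. For \<open>K = UNIV\<close> the same follows from |x|, which
  \<open>norm_part12\<close> recovers.\<close>

lemma \<Omega>_invariant: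
  assumes "norm (part1 K x) = norm (part1 K y)" "part2 K x = part2 K y"
  shows "x \<in> \<Omega> \<longleftrightarrow> y \<in> \<Omega>"
proof -
  have aux: "y \<in> \<Omega>" if x: "x \<in> \<Omega>" and e: "norm (part1 K x) = norm (part1 K y)" "part2 K x = part2 K y" for x y
    using rot unfolding rotationally_symmetric_def
  proof (elim disjE conjE)
    have "(norm x)\<^sup>2 = (norm y)\<^sup>2"
      unfolding norm_part12[of x K] norm_part12[of y K] using e by simp
    then have n: "norm x = norm y" by (simp add: power2_eq_iff_nonneg)
    show "y \<in> \<Omega>" if "\<exists>R>0. \<Omega> = ball 0 R" using that n x by auto
    show "y \<in> \<Omega>" if "\<exists>a b. 0 < a \<and> a < b \<and> \<Omega> = {x. a < norm x \<and> norm x < b}" using that n x by auto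
    assume *: "\<forall>h\<in>part2 K ` \<Omega>.
        (\<exists>R>0. \<Omega> \<inter> {x. part2 K x = h} = {x. part2 K x = h \<and> norm (part1 K x) < R}) \<or>
        (\<exists>a b. 0 < a \<and> a < b \<and>
          \<Omega> \<inter> {x. part2 K x = h} = {x. part2 K x = h \<and> a < norm (part1 K x) \<and> norm (part1 K x) < b})"
    have xs: "x \<in> \<Omega> \<inter> {z. part2 K z = part2 K x}" using x by simp
    have "(\<exists>R>0. \<Omega> \<inter> {z. part2 K z = part2 K x} = {z. part2 K z = part2 K x \<and> norm (part1 K z) < R}) \<or>
        (\<exists>a b. 0 < a \<and> a < b \<and> \<Omega> \<inter> {z. part2 K z = part2 K x} =
          {z. part2 K z = part2 K x \<and> a < norm (part1 K z) \<and> norm (part1 K z) < b})"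
      by (rule bspec[OF *]) (use x in simp)
    then show "y \<in> \<Omega>"
    proof (elim disjE exE conjE)
      fix R assume eq: "\<Omega> \<inter> {z. part2 K z = part2 K x} = {z. part2 K z = part2 K x \<and> norm (part1 K z) < R}"
      have "y \<in> {z. part2 K z = part2 K x \<and> norm (part1 K z) < R}" using xs e unfolding eq by simp
      then show ?thesis unfolding eq[symmetric] by simp
    next
      fix a b assume eq: "\<Omega> \<inter> {z. part2 K z = part2 K x} =
          {z. part2 K z = part2 K x \<and> a < norm (part1 K z) \<and> norm (part1 K z) < b}"
      have "y \<in> {z. part2 K z = part2 K x \<and> a < norm (part1 K z) \<and> norm (part1 K z) < b}"
        using xs e unfolding eq by simp
      then show ?thesis unfolding eq[symmetric] by simp
    qed
  qed
  then show ?thesis using assms by metis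
qed

lemma symm_\<Omega>: "symm K T \<Longrightarrow> T x \<in> \<Omega> \<longleftrightarrow> x \<in> \<Omega>"
  by (rule \<Omega>_invariant) (auto simp: symm_norm_part1 symm_def)

lemma symm_vimage: "symm K T \<Longrightarrow> T -` \<Omega> = \<Omega>"
  by (auto simp: symm_\<Omega>)

lemma symm_closure: "symm K T \<Longrightarrow> T x \<in> closure \<Omega> \<longleftrightarrow> x \<in> closure \<Omega>"
proof -
  have aux: "T x \<in> closure \<Omega>" if T: "symm K T" and x: "x \<in> closure \<Omega>" for T x
  proof -
    have "T ` closure \<Omega> \<subseteq> closure \<Omega>"
      by (rule image_closure_subset[OF symm_continuous[OF T]])
        (use symm_\<Omega>[OF T] closure_subset in auto)
    then show ?thesis using x by auto
  qed
  assume T: "symm K T"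
  show ?thesis using aux[OF T, of x] aux[OF symm_inv(1)[OF T], of "T x"] symm_inv(3)[OF T, of x] by auto
qed

lemma frontier_\<Omega>: "frontier \<Omega> = closure \<Omega> - \<Omega>"
  using \<Omega> by (simp add: frontier_def interior_open)

lemma symm_frontier: "symm K T \<Longrightarrow> T x \<in> frontier \<Omega> \<longleftrightarrow> x \<in> frontier \<Omega>"
  by (simp add: frontier_\<Omega> symm_closure symm_\<Omega>)

definition rhs :: "real^'n \<Rightarrow> real^'m \<Rightarrow> real^'m"
  where "rhs x S = F (norm (part1 K x)) (part2 K x) S"

definition jac :: "'m \<Rightarrow> 'm \<Rightarrow> real^'n \<Rightarrow> real^'m \<Rightarrow> real"
  where "jac i j x S = partial_s F i j (norm (part1 K x)) (part2 K x) S"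

text \<open>The coefficients of the linearisation at \<open>U\<close>, with row \<open>i\<close>
  belonging to the equation of component \<open>i\<close>: nonnegative off the diagonal in
  \<open>\<Omega>\<close>, but in general not symmetric.\<close>

definition pot :: "'m \<Rightarrow> 'm \<Rightarrow> real^'n \<Rightarrow> real"
  where "pot i j x = jac i j x (U x)"

lemma rhs_symm: "symm K T \<Longrightarrow> rhs (T x) S = rhs x S"
  by (simp add: rhs_def symm_norm_part1) (simp add: symm_def)

lemma jac_symm: "symm K T \<Longrightarrow> jac i j (T x) S = jac i j x S"
  by (simp add: jac_def symm_norm_part1) (simp add: symm_def)

lemma jac_nonneg: "x \<in> \<Omega> \<Longrightarrow> i \<noteq> j \<Longrightarrow> 0 \<le> jac i j x S"
  using coupled by (auto simp: fully_coupled_def cooperative_def jac_def)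

lemma polar_in: "x \<in> closure \<Omega> \<Longrightarrow> (norm (part1 K x), part2 K x, S) \<in> {0..} \<times> closure (part2 K ` \<Omega>) \<times> UNIV"
proof -
  have "part2 K ` closure \<Omega> \<subseteq> closure (part2 K ` \<Omega>)"
    by (rule image_closure_subset) (auto intro!: continuous_intros closure_subset)
  then show "x \<in> closure \<Omega> \<Longrightarrow> ?thesis" by auto
qed

text \<open>The derivative of \<open>F\<close> is given within a product set that may have empty
  interior in the first two factors. Its last factor is the whole space, so restriction to a slice
  yields a full derivative in \<open>S\<close>.\<close>

lemma F_derivative:
  "\<exists>DF. (\<forall>x\<in>closure \<Omega>. \<forall>S. (rhs x has_derivative DF x S) (at S)) \<and>
    (\<forall>h. continuous_on (closure \<Omega> \<times> UNIV) (\<lambda>(x, S). DF x S h))"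
proof -
  let ?X = "{0..} \<times> closure (part2 K ` \<Omega>) \<times> (UNIV :: (real^'m) set)"
  have "\<exists>D. (\<forall>p\<in>?X. ((\<lambda>(r, y, S). F r y S) has_derivative D p) (at p within ?X)) \<and>
      (\<forall>v. continuous_on ?X (\<lambda>p. D p v))"
    using F_C1 unfolding One_nat_def Ck_on.simps .
  then obtain D where D: "\<And>p. p \<in> ?X \<Longrightarrow> ((\<lambda>(r, y, S). F r y S) has_derivative D p) (at p within ?X)"
    "\<And>v. continuous_on ?X (\<lambda>p. D p v)"
    by blast
  define DF where "DF x S h = D (norm (part1 K x), part2 K x, S) (0, 0, h)" for x S h
  show ?thesis
  proof (intro exI[of _ DF] conjI ballI allI)
    fix x and S :: "real^'m" assume x: "x \<in> closure \<Omega>"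
    have d1: "((\<lambda>S. (norm (part1 K x), part2 K x, S)) has_derivative (\<lambda>h. (0, 0, h))) (at S)"
      by (auto intro!: derivative_eq_intros)
    have d2: "((\<lambda>(r, y, S). F r y S) has_derivative D (norm (part1 K x), part2 K x, S))
        (at (norm (part1 K x), part2 K x, S) within range (\<lambda>S. (norm (part1 K x), part2 K x, S)))"
      by (rule has_derivative_subset[OF D(1)[OF polar_in[OF x]]]) (use polar_in[OF x] in auto)
    have "((\<lambda>(r, y, S). F r y S) \<circ> (\<lambda>S. (norm (part1 K x), part2 K x, S)) has_derivative
        D (norm (part1 K x), part2 K x, S) \<circ> (\<lambda>h. (0, 0, h))) (at S)"
      by (rule diff_chain_within[OF d1 d2])
    then show "(rhs x has_derivative DF x S) (at S)"
      by (simp add: o_def rhs_def[abs_def] DF_def[abs_def])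
  next
    fix h
    show "continuous_on (closure \<Omega> \<times> UNIV) (\<lambda>(x, S). DF x S h)"
      unfolding DF_def split_beta
      by (rule continuous_on_compose2[OF D(2)[of "(0, 0, h)"]])
        (use polar_in in \<open>auto intro!: continuous_intros simp: image_subset_iff\<close>)
  qed
qed

lemma rhs_deriv:
  assumes x: "x \<in> closure \<Omega>"
  shows "((\<lambda>S. rhs x S $ i) has_derivative (\<lambda>h. \<Sum>j\<in>UNIV. jac i j x S * h $ j)) (at S)"
proof -
  obtain DF where DF: "\<And>x S. x \<in> closure \<Omega> \<Longrightarrow> (rhs x has_derivative DF x S) (at S)"
    using F_derivative by blast
  have d: "((\<lambda>S. rhs x S $ i) has_derivative (\<lambda>h. DF x S h $ i)) (at S)"
    by (rule bounded_linear.has_derivative[OF bounded_linear_vec_nth DF[OF x]])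
  have jac: "jac i j x S = DF x S (axis j 1) $ i" for j
    using fun_cong[OF frechet_derivative_at[OF d], of "axis j 1"]
    by (simp add: jac_def partial_s_def rhs_def[symmetric])
  have l: "linear (\<lambda>h. DF x S h $ i)" using d by (rule has_derivative_linear)
  have "DF x S h $ i = (\<Sum>j\<in>UNIV. jac i j x S * h $ j)" for h
  proof -
    have "DF x S h $ i = DF x S (\<Sum>j\<in>UNIV. h $ j *\<^sub>R axis j 1) $ i"
      using basis_expansion[of h] by (simp add: scalar_mult_eq_scaleR)
    also have "\<dots> = (\<Sum>j\<in>UNIV. h $ j * DF x S (axis j 1) $ i)"
      using linear_sum[OF l, of "\<lambda>j. h $ j *\<^sub>R axis j 1" UNIV] linear_scale[OF l] by simp
    finally show ?thesis by (simp add: jac mult.commute)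
  qed
  then show ?thesis using d by simp
qed

lemma jac_continuous: "continuous_on (closure \<Omega> \<times> UNIV) (\<lambda>(x, S). jac i j x S)"
proof -
  obtain DF where DF: "\<And>x S. x \<in> closure \<Omega> \<Longrightarrow> (rhs x has_derivative DF x S) (at S)"
    "\<And>h. continuous_on (closure \<Omega> \<times> UNIV) (\<lambda>(x, S). DF x S h)"
    using F_derivative by blast
  have "jac i j x S = DF x S (axis j 1) $ i" if "x \<in> closure \<Omega>" for x S
  proof -
    have d: "((\<lambda>S. rhs x S $ i) has_derivative (\<lambda>h. DF x S h $ i)) (at S)"
      by (rule bounded_linear.has_derivative[OF bounded_linear_vec_nth DF(1)[OF that]])
    show ?thesis
      using fun_cong[OF frechet_derivative_at[OF d], of "axis j 1"]
      by (simp add: jac_def partial_s_def rhs_def[symmetric])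
  qed
  moreover have "continuous_on (closure \<Omega> \<times> UNIV) (\<lambda>p. (case p of (x, S) \<Rightarrow> DF x S (axis j 1)) $ i)"
    by (intro continuous_on_component DF)
  moreover have "continuous_on (closure \<Omega> \<times> UNIV) (\<lambda>(x, S). jac i j x S) =
      continuous_on (closure \<Omega> \<times> UNIV) (\<lambda>p. (case p of (x, S) \<Rightarrow> DF x S (axis j 1)) $ i)"
    by (rule continuous_on_cong) (use calculation(1) in auto)
  ultimately show ?thesis by blast
qed

lemma rhs_continuous: "continuous_on (closure \<Omega> \<times> UNIV) (\<lambda>(x, S). rhs x S)"
proof -
  let ?X = "{0..} \<times> closure (part2 K ` \<Omega>) \<times> (UNIV :: (real^'m) set)"
  have "continuous_on ?X (\<lambda>(r, y, S). F r y S)" by (rule Ck1_continuous[OF F_C1])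
  then have "continuous_on (closure \<Omega> \<times> UNIV)
      (\<lambda>p. (\<lambda>(r, y, S). F r y S) (norm (part1 K (fst p)), part2 K (fst p), snd p))"
    by (rule continuous_on_compose2) (use polar_in in \<open>auto intro!: continuous_intros simp: image_subset_iff\<close>)
  then show ?thesis by (simp add: rhs_def split_beta)
qed

text \<open>A derivative up to the boundary, fixed by choice because uniqueness of derivatives
  within \<open>closure \<Omega>\<close> is not established at frontier points. Inside
  \<open>\<Omega>\<close> it is the full derivative, see \<open>DU_at\<close>.\<close>

definition DU :: "real^'n \<Rightarrow> real^'n \<Rightarrow> real^'m"
  where "DU = (SOME D. (\<forall>x\<in>closure \<Omega>. (U has_derivative D x) (at x within closure \<Omega>)) \<and>
    (\<forall>v. Ck_on 1 (closure \<Omega>) (\<lambda>x. D x v)))"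

lemma DU: "x \<in> closure \<Omega> \<Longrightarrow> (U has_derivative DU x) (at x within closure \<Omega>)"
    "Ck_on 1 (closure \<Omega>) (\<lambda>x. DU x v)"
proof -
  have "\<exists>D. (\<forall>x\<in>closure \<Omega>. (U has_derivative D x) (at x within closure \<Omega>)) \<and>
    (\<forall>v. Ck_on 1 (closure \<Omega>) (\<lambda>x. D x v))"
    using U_C2 unfolding numeral_2_eq_2 One_nat_def Ck_on.simps(2)[of "Suc 0"] .
  from someI_ex[OF this] show "x \<in> closure \<Omega> \<Longrightarrow> (U has_derivative DU x) (at x within closure \<Omega>)"
    "Ck_on 1 (closure \<Omega>) (\<lambda>x. DU x v)"
    unfolding DU_def by blast+
qed

lemma DU_linear: "x \<in> closure \<Omega> \<Longrightarrow> linear (DU x)"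
  using DU(1) by (rule has_derivative_linear)

lemma DU_continuous: "continuous_on (closure \<Omega>) (\<lambda>x. DU x v)"
  by (rule Ck1_continuous[OF DU(2)])

lemma U_continuous: "continuous_on (closure \<Omega>) U"
  using DU(1) by (auto simp: continuous_on_eq_continuous_within intro: has_derivative_continuous)

lemma in_closure: "x \<in> \<Omega> \<Longrightarrow> x \<in> closure \<Omega>"
  using closure_subset by blast

lemma at_within_closure: "x \<in> \<Omega> \<Longrightarrow> at x within closure \<Omega> = at x"
  using \<Omega> closure_subset by (meson at_within_interior interior_maximal subset_iff)

lemma DU_at: "x \<in> \<Omega> \<Longrightarrow> (U has_derivative DU x) (at x)"
  using DU(1)[OF in_closure] at_within_closure by simp

lemma U_C1: "C1_on \<Omega> (\<lambda>x. U x $ i)"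
  and gradient_U: "x \<in> \<Omega> \<Longrightarrow> gradient (\<lambda>x. U x $ i) x = (\<chi> l. DU x (axis l 1) $ i)"
proof -
  have d: "((\<lambda>x. U x $ i) has_derivative (\<lambda>h. (\<chi> l. DU x (axis l 1) $ i) \<bullet> h)) (at x)" if "x \<in> \<Omega>" for x
    by (rule gradient_of_vector_derivative[OF DU_at[OF that]])
  then show "x \<in> \<Omega> \<Longrightarrow> gradient (\<lambda>x. U x $ i) x = (\<chi> l. DU x (axis l 1) $ i)"
    by (rule gradient_eqI)
  show "C1_on \<Omega> (\<lambda>x. U x $ i)"
    by (rule C1_onI[OF d])
      (auto intro!: continuous_on_vec_lambda continuous_on_component continuous_on_subset[OF DU_continuous] closure_subset)
qed

lemma DU_C1: "C1_on \<Omega> (\<lambda>x. DU x v $ i)"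
proof -
  obtain E where E: "\<And>x. x \<in> closure \<Omega> \<Longrightarrow> ((\<lambda>x. DU x v) has_derivative E x) (at x within closure \<Omega>)"
    "\<And>h. continuous_on (closure \<Omega>) (\<lambda>x. E x h)"
    using DU(2)[of v] by (auto simp: One_nat_def)
  have "((\<lambda>x. DU x v) has_derivative E x) (at x)" if "x \<in> \<Omega>" for x
    using E(1)[OF in_closure[OF that]] at_within_closure[OF that] by simp
  from gradient_of_vector_derivative[OF this]
  have d: "((\<lambda>x. DU x v $ i) has_derivative (\<lambda>h. (\<chi> l. E x (axis l 1) $ i) \<bullet> h)) (at x)" if "x \<in> \<Omega>" for x
    using that .
  show ?thesis
    by (rule C1_onI[OF d])
      (auto intro!: continuous_on_vec_lambda continuous_on_component continuous_on_subset[OF E(2)] closure_subset)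
qed

lemma laplacian_U:
  assumes x: "x \<in> \<Omega>"
  shows "laplacian U x $ i = (\<Sum>l\<in>UNIV. gradient (\<lambda>y. DU y (axis l 1) $ i) x $ l)"
proof -
  have "frechet_derivative (\<lambda>y. frechet_derivative U (at y) b) (at x) b $ i = frechet_derivative (\<lambda>y. DU y b $ i) (at x) b" for b
  proof -
    obtain E where "\<And>x. x \<in> closure \<Omega> \<Longrightarrow> ((\<lambda>x. DU x b) has_derivative E x) (at x within closure \<Omega>)"
      using DU(2)[of b] by (auto simp: One_nat_def)
    then have E: "((\<lambda>x. DU x b) has_derivative E x) (at x)"
      using x at_within_closure[OF x] in_closure by metis
    have "((\<lambda>y. frechet_derivative U (at y) b) has_derivative E x) (at x)"
      by (rule has_derivative_transform_within_open[OF E \<Omega>(1) x]) (use frechet_derivative_at[OF DU_at] in auto)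
    then have "frechet_derivative (\<lambda>y. frechet_derivative U (at y) b) (at x) = E x"
      by (rule frechet_derivative_at[symmetric])
    moreover have "frechet_derivative (\<lambda>y. DU y b $ i) (at x) = (\<lambda>h. E x h $ i)"
      by (rule frechet_derivative_at[symmetric], rule bounded_linear.has_derivative[OF bounded_linear_vec_nth E])
    ultimately show ?thesis by simp
  qed
  then show ?thesis by (simp add: laplacian_def sum_Basis_vec gradient_def)
qed

lemma cc_rhs:
  assumes "test \<Omega> \<phi>" "continuous_on \<Omega> V"
  shows "cc (\<lambda>x. rhs x (V x) $ i * \<phi> x)"
proof -
  have "continuous_on \<Omega> (\<lambda>x. (case (x, V x) of (x, S) \<Rightarrow> rhs x S) $ i)"
    by (rule continuous_on_component, rule continuous_on_compose2[OF rhs_continuous])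
      (use closure_subset in \<open>auto intro!: continuous_intros assms\<close>)
  then have "continuous_on \<Omega> (\<lambda>x. rhs x (V x) $ i)" by simp
  from csupp_cc[OF csupp_mult[OF \<Omega>(1) test_csupp[OF assms(1)] this]]
  show ?thesis by (simp add: mult.commute)
qed

lemma weak_eq:
  assumes t: "test \<Omega> \<phi>"
  shows "integral UNIV (\<lambda>x. gradient (\<lambda>y. U y $ i) x \<bullet> gradient \<phi> x) = integral UNIV (\<lambda>x. rhs x (U x) $ i * \<phi> x)"
proof -
  note I = integral_by_parts_test[OF \<Omega>(1) t DU_C1]
  have "gradient (\<lambda>y. U y $ i) x \<bullet> gradient \<phi> x = (\<Sum>l\<in>UNIV. gradient \<phi> x $ l * DU x (axis l 1) $ i)" for x
    using test_outside[OF t, of x] gradient_U[of x i]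
    by (cases "x \<in> \<Omega>") (auto simp: inner_vec_sum mult.commute)
  then have "integral UNIV (\<lambda>x. gradient (\<lambda>y. U y $ i) x \<bullet> gradient \<phi> x) =
      (\<Sum>l\<in>UNIV. integral UNIV (\<lambda>x. gradient \<phi> x $ l * DU x (axis l 1) $ i))"
    by (simp only:) (intro cc_integral_sum I, auto)
  also have "\<dots> = - (\<Sum>l\<in>UNIV. integral UNIV (\<lambda>x. \<phi> x * gradient (\<lambda>y. DU y (axis l 1) $ i) x $ l))"
    by (simp add: I(1) sum_negf)
  also have "(\<Sum>l\<in>UNIV. integral UNIV (\<lambda>x. \<phi> x * gradient (\<lambda>y. DU y (axis l 1) $ i) x $ l)) =
      integral UNIV (\<lambda>x. \<Sum>l\<in>UNIV. \<phi> x * gradient (\<lambda>y. DU y (axis l 1) $ i) x $ l)"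
    by (intro cc_integral_sum[symmetric] I) auto
  also have "\<dots> = integral UNIV (\<lambda>x. - (rhs x (U x) $ i * \<phi> x))"
  proof (intro arg_cong[where f="integral UNIV"] ext)
    fix x
    show "(\<Sum>l\<in>UNIV. \<phi> x * gradient (\<lambda>y. DU y (axis l 1) $ i) x $ l) = - (rhs x (U x) $ i * \<phi> x)"
    proof (cases "x \<in> \<Omega>")
      case True
      have "laplacian U x $ i = - (rhs x (U x) $ i)"
        using pde True unfolding rhs_def by (metis minus_minus vector_uminus_component)
      then show ?thesis using laplacian_U[OF True, of i] by (simp add: sum_distrib_left[symmetric])
    qed (simp add: test_outside[OF t])
  qed
  finally show ?thesis by simp
qed

text \<open>The test function is transported by \<open>inv T\<close>: the Dirichlet pairing is
  invariant under orthogonal maps, and the nonlinearity depends only on |x'| and x'', which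
  \<open>T\<close> preserves. So \<open>U\<close> composed with \<open>T\<close> is again a weak
  solution.\<close>

lemma weak_eq_symm:
  assumes T: "symm K T" and t: "test \<Omega> \<phi>"
  shows "integral UNIV (\<lambda>x. gradient (\<lambda>y. U (T y) $ i) x \<bullet> gradient \<phi> x) = integral UNIV (\<lambda>x. rhs x (U (T x)) $ i * \<phi> x)"
proof -
  note iT = symm_inv[OF T]
  let ?\<psi> = "\<lambda>x. \<phi> (inv T x)"
  have oT: "orthogonal_transformation T" and oiT: "orthogonal_transformation (inv T)"
    using T iT(1) by (auto simp: symm_def)
  have t': "test \<Omega> ?\<psi>" using test_orthogonal[OF oiT t] symm_vimage[OF iT(1)] by simp
  have "gradient (\<lambda>y. U (T y) $ i) x \<bullet> gradient \<phi> x = gradient (\<lambda>y. U y $ i) (T x) \<bullet> gradient ?\<psi> (T x)" for x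
  proof (cases "x \<in> \<Omega>")
    case True
    then have "T x \<in> \<Omega>" using symm_\<Omega>[OF T] by simp
    from inner_gradient_orthogonal[OF oT U_C1 C1_on_subset[OF test_C1[OF t'] subset_UNIV] this]
    show ?thesis by (simp add: iT)
  next
    case False
    then show ?thesis using test_outside[OF t False] test_outside[OF t', of "T x"] symm_\<Omega>[OF T] by simp
  qed
  then have "integral UNIV (\<lambda>x. gradient (\<lambda>y. U (T y) $ i) x \<bullet> gradient \<phi> x) =
      integral UNIV (\<lambda>x. gradient (\<lambda>y. U y $ i) (T x) \<bullet> gradient ?\<psi> (T x))" by simp
  also have "\<dots> = integral UNIV (\<lambda>x. gradient (\<lambda>y. U y $ i) x \<bullet> gradient ?\<psi> x)"
    by (rule cc_integral_orthogonal[OF oT test_cc_gradient_inner(2)[OF \<Omega>(1) t' C1_on_continuous_gradient[OF U_C1]]])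
  also have "\<dots> = integral UNIV (\<lambda>x. rhs x (U x) $ i * ?\<psi> x)" by (rule weak_eq[OF t'])
  also have "\<dots> = integral UNIV (\<lambda>x. rhs (T x) (U (T x)) $ i * ?\<psi> (T x))"
    by (rule cc_integral_orthogonal[symmetric, OF oT cc_rhs[OF t']])
      (rule continuous_on_subset[OF U_continuous closure_subset])
  finally show ?thesis by (simp add: iT rhs_symm[OF T])
qed

end

lemma tests_outside:
  assumes "tests D \<Phi>" "x \<notin> D"
  shows "\<Phi> x $ i = 0" "gradient (\<lambda>y. \<Phi> y $ i) x = 0"
  using test_outside[of D "\<lambda>y. \<Phi> y $ i" x] assms by (auto simp: tests_def)

lemma tests_supp:
  fixes \<Phi> :: "real^'n \<Rightarrow> real^'m"
  assumes "tests D \<Phi>"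
  obtains C where "compact C" "C \<subseteq> D" "\<And>E. C \<subseteq> E \<Longrightarrow> tests E \<Phi>" "\<And>x. x \<notin> C \<Longrightarrow> \<Phi> x = 0"
proof -
  have "\<forall>i. \<exists>C. compact C \<and> C \<subseteq> D \<and> (\<forall>x. x \<notin> C \<longrightarrow> \<Phi> x $ i = 0)"
    using assms by (auto simp: tests_def test_def)
  then obtain C where C: "\<And>i. compact (C i)" "\<And>i. C i \<subseteq> D" "\<And>i x. x \<notin> C i \<Longrightarrow> \<Phi> x $ i = 0"
    by metis
  show ?thesis
  proof (rule that[of "\<Union>i. C i"])
    show "compact (\<Union>i. C i)" using C(1) by (intro compact_UN) auto
    show "(\<Union>i. C i) \<subseteq> D" using C(2) by blast
    show "\<Phi> x = 0" if "x \<notin> (\<Union>i. C i)" for x using that C(3) by (auto simp: vec_eq_iff)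
    show "tests E \<Phi>" if "(\<Union>i. C i) \<subseteq> E" for E
      unfolding tests_def
    proof
      fix i
      have "C1_on UNIV (\<lambda>x. \<Phi> x $ i)" using assms by (auto simp: tests_def test_def)
      moreover have "C i \<subseteq> E" using that by blast
      ultimately show "test E (\<lambda>x. \<Phi> x $ i)" using C(3) by (intro testI[OF _ C(1)]) auto
    qed
  qed
qed

lemma tests_C1c:
  fixes \<Psi> :: "real^'n \<Rightarrow> real^'m"
  assumes t: "tests \<Omega> \<Psi>"
  shows "\<Psi> \<in> C1c \<Omega>"
proof -
  obtain C where C: "compact C" "C \<subseteq> \<Omega>" "\<And>x. x \<notin> C \<Longrightarrow> \<Psi> x = 0" by (rule tests_supp[OF t]) blast
  have sub: "closure {x. \<Psi> x \<noteq> 0} \<subseteq> C"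
    using C by (intro closure_minimal compact_imp_closed) auto
  have t': "C1_on UNIV (\<lambda>x. \<Psi> x $ i)" for i using t by (auto simp: tests_def test_def)
  define D where "D x h = (\<chi> i. gradient (\<lambda>y. \<Psi> y $ i) x \<bullet> h)" for x h
  have "(\<Psi> has_derivative D x) (at x)" for x
    unfolding has_derivative_componentwise_within[of \<Psi>]
  proof
    fix b :: "real^'m" assume "b \<in> Basis"
    then obtain i where b: "b = axis i 1" by (auto simp: Basis_vec_def)
    show "((\<lambda>x. \<Psi> x \<bullet> b) has_derivative (\<lambda>h. D x h \<bullet> b)) (at x)"
      using C1_onD[OF t', of x i] by (simp add: b inner_axis D_def)
  qed
  moreover have "continuous_on UNIV (\<lambda>x. D x v)" for v
    unfolding D_def
    by (intro continuous_on_vec_lambda continuous_intros C1_on_continuous_gradient t')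
  ultimately have "Ck_on 1 UNIV \<Psi>"
    unfolding One_nat_def Ck_on.simps by blast
  moreover have "compact (closure {x. \<Psi> x \<noteq> 0})"
    using C(1) sub by (metis closed_closure compact_Int_closed inf.absorb_iff2)
  ultimately show ?thesis using sub C(2) by (auto simp: C1c_def)
qed

lemma cc_set_lebesgue_integral:
  fixes g :: "real^'n \<Rightarrow> real"
  assumes g: "cc g" "\<And>x. x \<notin> S \<Longrightarrow> g x = 0" and S: "open S"
  shows "set_lebesgue_integral lebesgue S g = integral UNIV g"
proof -
  obtain b where b: "\<And>x. x \<notin> cbox (-b) b \<Longrightarrow> g x = 0" using cc_box[OF g(1)] by auto
  have "g absolutely_integrable_on cbox (-b) b"
    using g(1) by (intro absolutely_integrable_continuous cc_continuous)
  then have "(\<lambda>x. if x \<in> cbox (-b) b then g x else 0) absolutely_integrable_on UNIV"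
    by (simp only: absolutely_integrable_restrict_UNIV)
  moreover have "(\<lambda>x. if x \<in> cbox (-b) b then g x else 0) = g" using b by auto
  ultimately have "g absolutely_integrable_on UNIV" by simp
  then have "g absolutely_integrable_on S"
    by (rule set_integrable_subset) (use S in auto)
  then have "set_lebesgue_integral lebesgue S g = integral S g"
    by (rule set_lebesgue_integral_eq_integral(2))
  also have "\<dots> = integral UNIV (\<lambda>x. if x \<in> S then g x else 0)"
    by (simp only: integral_restrict_UNIV)
  also have "(\<lambda>x. if x \<in> S then g x else 0) = g" using g(2) by auto
  finally show ?thesis .
qed

lemma subsolI:
  fixes z h :: "real^'n \<Rightarrow> real^'m"
  assumes D: "open D" "bounded D" and z: "zero_trace D z" and b: "\<And>i j. continuous_on (closure D) (b i j)"
    and h: "\<And>i \<phi>. test D \<phi> \<Longrightarrow> cc (\<lambda>x. h x $ i * \<phi> x)"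
    and eq: "\<And>i \<phi>. test D \<phi> \<Longrightarrow> integral UNIV (\<lambda>x. gradient (\<lambda>y. z y $ i) x \<bullet> gradient \<phi> x) = integral UNIV (\<lambda>x. h x $ i * \<phi> x)"
    and le: "\<And>i x. x \<in> D \<Longrightarrow> 0 < z x $ i \<Longrightarrow> h x $ i \<le> (\<Sum>j\<in>UNIV. b i j x * max 0 (z x $ j))"
  shows "subsol b D z"
  unfolding subsol_def
proof (intro allI impI)
  fix i \<phi> assume t: "test D \<phi>" and pos: "\<forall>x. 0 \<le> \<phi> x" and zero: "\<forall>x\<in>D. z x $ i \<le> 0 \<longrightarrow> \<phi> x = 0"
  have "integral UNIV (\<lambda>x. h x $ i * \<phi> x) \<le> integral UNIV (\<lambda>x. (\<Sum>j\<in>UNIV. b i j x * posv D z x $ j) * \<phi> x)"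
  proof (rule cc_integral_mono[OF h[OF t]])
    show "cc (\<lambda>x. (\<Sum>j\<in>UNIV. b i j x * posv D z x $ j) * \<phi> x)"
      by (intro cc_mult cc_sum cc_mult_posv D z b test_cc[OF t])
    fix x
    consider "x \<notin> D" | "x \<in> D" "z x $ i \<le> 0" | "x \<in> D" "0 < z x $ i" by linarith
    then show "h x $ i * \<phi> x \<le> (\<Sum>j\<in>UNIV. b i j x * posv D z x $ j) * \<phi> x"
    proof cases
      case 1
      then show ?thesis using test_outside[OF t] by simp
    next
      case 2
      then show ?thesis using zero by simp
    next
      case 3
      then have "(\<Sum>j\<in>UNIV. b i j x * posv D z x $ j) = (\<Sum>j\<in>UNIV. b i j x * max 0 (z x $ j))"
        by (simp add: posv_def pos_on_def)
      then show ?thesis using le[OF 3] pos by (simp add: mult_right_mono)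
    qed
  qed
  then show "integral UNIV (\<lambda>x. gradient (\<lambda>y. z y $ i) x \<bullet> gradient \<phi> x) \<le>
      integral UNIV (\<lambda>x. (\<Sum>j\<in>UNIV. b i j x * posv D z x $ j) * \<phi> x)" by (simp only: eq[OF t])
qed

text \<open>Normals of the rotating hyperplane. Advancing \<open>t\<close> by \<pi> reverses the
  normal, so one circle compares both sides of every hyperplane in the family.\<close>

definition circ :: "real^'n \<Rightarrow> real^'n \<Rightarrow> real \<Rightarrow> real^'n"
  where "circ p q t = cos t *\<^sub>R p + sin t *\<^sub>R q"

lemma unitK_circ:
  assumes "unitK K p" "unitK K q" "p \<bullet> q = 0"
  shows "unitK K (circ p q t)"
proof -
  have "circ p q t \<bullet> circ p q t = (cos t)\<^sup>2 * (p \<bullet> p) + (sin t)\<^sup>2 * (q \<bullet> q)"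
    using assms(3) by (simp add: circ_def inner_add_left inner_add_right inner_commute power2_eq_square)
  then have "circ p q t \<bullet> circ p q t = 1" using unitK_inner[OF assms(1)] unitK_inner[OF assms(2)] by simp
  moreover have "part2 K (circ p q t) = 0"
    using assms by (simp add: circ_def linear_add[OF linear_part2] linear_scale[OF linear_part2] unitK_def)
  ultimately show ?thesis by (simp add: unitK_def norm_eq_sqrt_inner)
qed

lemma circ_pi: "circ p q (t + pi) = - circ p q t"
  by (auto simp: circ_def)

lemma continuous_on_circ [continuous_intros]:
  fixes g :: "'a::t2_space \<Rightarrow> real"
  shows "continuous_on S g \<Longrightarrow> continuous_on S (\<lambda>x. circ p q (g x))"
  unfolding circ_def by (intro continuous_intros)

section \<open>Half domains cut off by a hyperplane\<close>

context elliptic_system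
begin

definition half :: "real^'n \<Rightarrow> (real^'n) set"
  where "half e = {x \<in> \<Omega>. 0 < e \<bullet> x}"

lemma half_subset: "half e \<subseteq> \<Omega>" by (auto simp: half_def)

lemma open_half: "open (half e)"
proof -
  have "half e = \<Omega> \<inter> {x. 0 < e \<bullet> x}" by (auto simp: half_def)
  then show ?thesis using \<Omega>(1) open_halfspace_gt[of 0 e] by auto
qed

lemma bounded_half: "bounded (half e)"
  using \<Omega>(3) half_subset by (rule bounded_subset)

lemma reflect_half: "unitK K e \<Longrightarrow> reflect e x \<in> half (- e) \<longleftrightarrow> x \<in> half e"
  using symm_\<Omega>[OF symm_reflect] by (auto simp: half_def inner_reflect)

lemma reflect_vimage_half: "unitK K e \<Longrightarrow> reflect e -` half e = half (- e)"
  using reflect_half[OF unitK_minus, of e] by (auto simp: reflect_minus)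

lemma closure_half: "closure (half e) \<subseteq> closure \<Omega> \<inter> {x. 0 \<le> e \<bullet> x}"
  using half_subset
  by (intro closure_minimal Int_greatest) (auto simp: half_def closed_halfspace_ge intro: in_closure)

lemma frontier_half: "x \<in> frontier (half e) \<Longrightarrow> x \<in> frontier \<Omega> \<or> (x \<in> \<Omega> \<and> e \<bullet> x = 0)"
proof -
  assume "x \<in> frontier (half e)"
  then have "x \<in> closure (half e)" "x \<notin> half e" using open_half[of e] by (auto simp: frontier_def interior_open)
  then show ?thesis using closure_half[of e] by (auto simp: frontier_\<Omega> half_def)
qed

lemma half_disjoint: "half e \<inter> half (- e) = {}"
  by (auto simp: half_def)

lemma half_nonempty:
  assumes e: "unitK K e"
  shows "half e \<noteq> {}"
proof -
  obtain x where x: "x \<in> \<Omega>" using \<Omega>(4) by auto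
  obtain r where r: "r > 0" "ball x r \<subseteq> \<Omega>" using \<Omega>(1) x open_contains_ball by metis
  have ex: "\<exists>y\<in>\<Omega>. e \<bullet> y \<noteq> 0"
  proof (cases "e \<bullet> x = 0")
    case True
    have "norm e = 1" using e by (simp add: unitK_def)
    then have "x + (r/2) *\<^sub>R e \<in> ball x r" using r by (simp add: dist_norm)
    moreover have "e \<bullet> (x + (r/2) *\<^sub>R e) \<noteq> 0" using True unitK_inner[OF e] r by (simp add: inner_add_right)
    ultimately show ?thesis using r by blast
  qed (use x in auto)
  then obtain y where y: "y \<in> \<Omega>" "e \<bullet> y \<noteq> 0" by auto
  show ?thesis
  proof (cases "0 < e \<bullet> y")
    case False
    then have "reflect e y \<in> half e" using y symm_\<Omega>[OF symm_reflect[OF e]] inner_reflect[OF e, of y] by (auto simp: half_def)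
    then show ?thesis by auto
  qed (use y in \<open>auto simp: half_def\<close>)
qed

lemma closure_halfI:
  assumes e: "unitK K e" and x: "x \<in> \<Omega>" "0 \<le> e \<bullet> x"
  shows "x \<in> closure (half e)"
  unfolding closure_approachable
proof (intro allI impI)
  fix \<epsilon> :: real assume \<epsilon>: "\<epsilon> > 0"
  obtain r where r: "r > 0" "ball x r \<subseteq> \<Omega>" using \<Omega>(1) x(1) open_contains_ball by metis
  define s where "s = min \<epsilon> r / 2"
  have s: "0 < s" "s < r" "s < \<epsilon>" using \<epsilon> r by (auto simp: s_def)
  have n: "norm e = 1" using e by (simp add: unitK_def)
  then have "x + s *\<^sub>R e \<in> ball x r" using s by (simp add: dist_norm)
  then have "x + s *\<^sub>R e \<in> half e"
    using r(2) x(2) s(1) unitK_inner[OF e] by (auto simp: half_def inner_add_right)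
  then show "\<exists>y\<in>half e. dist y x < \<epsilon>"
    using s n by (intro bexI[of _ "x + s *\<^sub>R e"]) (auto simp: dist_norm)
qed

text \<open>
  Folding \<open>\<Omega>\<close> along the hyperplane shows that \<open>\<Omega> \<inter> {e \<bullet> x \<ge> 0}\<close> is connected; the points of it on the
  hyperplane have convex neighbourhoods in the open half.
\<close>

lemma connected_half:
  assumes e: "unitK K e"
  shows "connected (half e)"
proof (rule ccontr)
  assume "\<not> connected (half e)"
  then obtain P Q where PQ: "open P" "open Q" "half e \<subseteq> P \<union> Q" "P \<inter> Q \<inter> half e = {}" "P \<inter> half e \<noteq> {}" "Q \<inter> half e \<noteq> {}"
    unfolding connected_def by blast
  define H where "H = {x \<in> \<Omega>. 0 \<le> e \<bullet> x}"
  define fold where "fold x = x + (\<bar>e \<bullet> x\<bar> - e \<bullet> x) *\<^sub>R e" for x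
  have fold: "fold x = x \<or> fold x = reflect e x" "0 \<le> e \<bullet> fold x" for x
  proof -
    have "e \<bullet> fold x = \<bar>e \<bullet> x\<bar>" using unitK_inner[OF e] by (simp add: fold_def inner_add_right)
    then show "0 \<le> e \<bullet> fold x" by simp
    show "fold x = x \<or> fold x = reflect e x"
    proof (cases "0 \<le> e \<bullet> x")
      case False
      then have "\<bar>e \<bullet> x\<bar> - e \<bullet> x = - (2 * (e \<bullet> x))" by simp
      then have "fold x = reflect e x" unfolding fold_def reflect_def by simp
      then show ?thesis ..
    qed (simp add: fold_def)
  qed
  have "H = fold ` \<Omega>"
  proof
    show "H \<subseteq> fold ` \<Omega>"
    proof
      fix x assume "x \<in> H"
      then have "fold x = x" "x \<in> \<Omega>" by (auto simp: H_def fold_def)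
      then show "x \<in> fold ` \<Omega>" by (metis imageI)
    qed
    show "fold ` \<Omega> \<subseteq> H"
      using fold symm_\<Omega>[OF symm_reflect[OF e]] unfolding H_def by (auto, metis)
  qed
  moreover have "continuous_on \<Omega> fold" unfolding fold_def by (intro continuous_intros)
  ultimately have "connected H" using \<Omega>(2) connected_continuous_image by simp
  let ?P = "closure (P \<inter> half e)" and ?Q = "closure (Q \<inter> half e)"
  have near: "\<exists>r>0. ball x r \<subseteq> \<Omega>" if "x \<in> H" for x
    using that \<Omega>(1) open_contains_ball unfolding H_def by blast
  have "H \<subseteq> closure (half e)" using closure_halfI[OF e] by (auto simp: H_def)
  also have "half e = (P \<inter> half e) \<union> (Q \<inter> half e)" using PQ(3) by auto
  finally have cover: "H \<subseteq> ?P \<union> ?Q" by simp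
  have hH: "half e \<subseteq> H" by (auto simp: half_def H_def)
  have "?P \<inter> ?Q \<inter> H \<noteq> {}"
  proof
    assume "?P \<inter> ?Q \<inter> H = {}"
    moreover have "?P \<inter> H \<noteq> {}" "?Q \<inter> H \<noteq> {}"
      using PQ(5,6) hH closure_subset[of "P \<inter> half e"] closure_subset[of "Q \<inter> half e"] by auto
    ultimately show False
      using \<open>connected H\<close> cover closed_closure unfolding connected_closed by blast
  qed
  then obtain x where x: "x \<in> ?P" "x \<in> ?Q" "x \<in> H" by auto
  obtain r where r: "r > 0" "ball x r \<subseteq> \<Omega>" using near[OF x(3)] by auto
  define C where "C = ball x r \<inter> {y. 0 < e \<bullet> y}"
  have Ch: "C \<subseteq> half e" using r by (auto simp: C_def half_def)
  have "connected C" unfolding C_def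
    by (intro convex_connected convex_Int convex_ball convex_halfspace_gt)
  moreover have "P \<inter> C \<noteq> {}" "Q \<inter> C \<noteq> {}"
  proof -
    obtain y where "y \<in> P \<inter> half e" "dist y x < r" using x(1) r(1) unfolding closure_approachable by blast
    then show "P \<inter> C \<noteq> {}" by (auto simp: C_def half_def dist_commute)
    obtain y where "y \<in> Q \<inter> half e" "dist y x < r" using x(2) r(1) unfolding closure_approachable by blast
    then show "Q \<inter> C \<noteq> {}" by (auto simp: C_def half_def dist_commute)
  qed
  moreover have "C \<subseteq> P \<union> Q" "P \<inter> Q \<inter> C = {}" using PQ Ch by blast+
  ultimately show False using PQ(1,2) unfolding connected_def by blast
qed

lemma hyperplane_negligible: "unitK K e \<Longrightarrow> negligible {x. e \<bullet> x = 0}"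
  by (rule negligible_hyperplane) (auto simp: unitK_def)

text \<open>A set of positive measure is not contained in the negligible hyperplane, so some
  coupling between \<open>I\<close> and its complement is visible in one of the two open halves,
  where sign information is available.\<close>

lemma coupling_half:
  assumes e: "unitK K e" and I: "I \<noteq> {}" "I \<noteq> UNIV"
  shows "\<exists>i\<in>I. \<exists>j\<in>-I. \<exists>x\<in>half e \<union> half (- e). 0 < pot i j x"
proof -
  obtain i j where ij: "i \<in> I" "j \<in> -I"
    "emeasure lebesgue {x\<in>\<Omega>. partial_s F i j (norm (part1 K x)) (part2 K x) (U x) > 0} > 0"
  proof -
    have all: "\<forall>I J. I \<noteq> {} \<and> J \<noteq> {} \<and> I \<inter> J = {} \<and> I \<union> J = UNIV \<longrightarrow> (\<exists>i\<in>I. \<exists>j\<in>J.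
        emeasure lebesgue {x\<in>\<Omega>. partial_s F i j (norm (part1 K x)) (part2 K x) (U x) > 0} > 0)"
      using coupled unfolding fully_coupled_def by (rule conjunct2)
    have "\<exists>i\<in>I. \<exists>j\<in>-I. emeasure lebesgue {x\<in>\<Omega>. partial_s F i j (norm (part1 K x)) (part2 K x) (U x) > 0} > 0"
      by (rule all[rule_format, of I "-I"]) (use I in auto)
    then show ?thesis using that by blast
  qed
  have "\<not> {x\<in>\<Omega>. 0 < pot i j x} \<subseteq> {x. e \<bullet> x = 0}"
  proof
    assume "{x\<in>\<Omega>. 0 < pot i j x} \<subseteq> {x. e \<bullet> x = 0}"
    then have "negligible {x\<in>\<Omega>. 0 < pot i j x}"
      using hyperplane_negligible[OF e] negligible_subset by blast
    then have "emeasure lebesgue {x\<in>\<Omega>. 0 < pot i j x} = 0"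
      by (simp add: negligible_iff_null_sets null_sets_def)
    then show False using ij(3) by (simp add: pot_def jac_def)
  qed
  then obtain x where "x \<in> \<Omega>" "0 < pot i j x" "e \<bullet> x \<noteq> 0" by auto
  then have "x \<in> half e \<union> half (- e)" by (auto simp: half_def)
  then show ?thesis using ij(1,2) \<open>0 < pot i j x\<close> by blast
qed

lemma pot_continuous: "continuous_on (closure \<Omega>) (pot i j)"
proof -
  have "continuous_on (closure \<Omega>) (\<lambda>x. case (x, U x) of (x, S) \<Rightarrow> jac i j x S)"
    by (rule continuous_on_compose2[OF jac_continuous]) (auto intro!: continuous_intros U_continuous)
  then show ?thesis by (simp add: pot_def[abs_def])
qed

lemma pot_continuous_on: "D \<subseteq> \<Omega> \<Longrightarrow> continuous_on D (pot i j)" "D \<subseteq> \<Omega> \<Longrightarrow> continuous_on (closure D) (pot i j)"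
  using pot_continuous closure_subset closure_mono by (meson continuous_on_subset order_trans)+

lemma pot_nonneg: "x \<in> \<Omega> \<Longrightarrow> i \<noteq> j \<Longrightarrow> 0 \<le> pot i j x"
  by (simp add: pot_def jac_nonneg)

text \<open>The integrand is continuous with compact support in \<open>\<Omega>\<close>, so the
  Lebesgue integral over \<open>\<Omega>\<close> and the gauge integral over the whole space
  agree.\<close>

lemma quad_form_eq:
  assumes t: "tests \<Omega> \<Psi>"
  shows "quad_form K F U \<Omega> \<Psi> = BF pot \<Psi> \<Psi>"
proof -
  let ?g = "\<lambda>x. (\<Sum>i\<in>UNIV. gradient (\<lambda>y. \<Psi> y $ i) x \<bullet> gradient (\<lambda>y. \<Psi> y $ i) x) -
    (\<Sum>i\<in>UNIV. \<Sum>j\<in>UNIV. pot i j x * \<Psi> x $ i * \<Psi> x $ j)"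
  have pc: "continuous_on \<Omega> (pot i j)" for i j by (rule pot_continuous_on) simp
  have "cc ?g"
    by (intro cc_diff cc_sum cc_BF_grad[OF \<Omega>(1) pc t t] cc_BF_pot[OF \<Omega>(1) pc t t])
  moreover have "?g x = 0" if "x \<notin> \<Omega>" for x
    using tests_outside[OF t that] by simp
  ultimately have "set_lebesgue_integral lebesgue \<Omega> ?g = integral UNIV ?g"
    using \<Omega>(1) by (rule cc_set_lebesgue_integral)
  then show ?thesis
    by (simp add: quad_form_def BF_def power2_norm_eq_inner pot_def jac_def)
qed

lemma BF_disjoint:
  fixes \<Phi> \<Psi> :: "real^'n \<Rightarrow> real^'m"
  assumes "tests D \<Phi>" "tests E \<Psi>" "D \<inter> E = {}"
  shows "BF c \<Phi> \<Psi> = 0"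
proof -
  have *: "(\<Sum>i\<in>UNIV. gradient (\<lambda>y. \<Phi> y $ i) x \<bullet> gradient (\<lambda>y. \<Psi> y $ i) x) -
    (\<Sum>i\<in>UNIV. \<Sum>j\<in>UNIV. c i j x * \<Phi> x $ i * \<Psi> x $ j) = 0" for x
  proof (cases "x \<in> D")
    case True
    then have "x \<notin> E" using assms(3) by auto
    then show ?thesis using tests_outside[OF assms(2)] by simp
  next
    case False
    then show ?thesis using tests_outside[OF assms(1)] by simp
  qed
  show ?thesis unfolding BF_def * by simp
qed

definition semistable :: "(real^'n) set \<Rightarrow> bool"
  where "semistable D \<longleftrightarrow> (\<forall>\<Phi>. tests D \<Phi> \<longrightarrow> 0 \<le> BF pot \<Phi> \<Phi>)"

lemma semistable_not: "\<not> semistable D \<Longrightarrow> \<exists>\<Phi>. tests D \<Phi> \<and> BF pot \<Phi> \<Phi> < 0"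
  by (auto simp: semistable_def not_le)

end

section \<open>Consequences of Morse index one\<close>

locale morse_one = elliptic_system K \<Omega> F U
  for K :: "'n::finite set" and \<Omega> and F :: "real \<Rightarrow> real^'n \<Rightarrow> real^'m \<Rightarrow> real^'m::finite" and U +
  assumes index: "morse_index K F U \<Omega> = 1"
begin

text \<open>Linear independence comes for free, since a vanishing combination would have energy
  zero. The span is then a two-dimensional space on which the form is negative definite.\<close>

lemma index_contra:
  assumes t: "tests \<Omega> \<Phi>" "tests \<Omega> \<Psi>"
    and neg: "\<And>s t. s \<noteq> 0 \<or> t \<noteq> 0 \<Longrightarrow> BF pot (\<lambda>x. s *\<^sub>R \<Phi> x + t *\<^sub>R \<Psi> x) (\<lambda>x. s *\<^sub>R \<Phi> x + t *\<^sub>R \<Psi> x) < 0"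
  shows False
proof -
  have comb: "s *\<^sub>R \<Phi> + t *\<^sub>R \<Psi> = (\<lambda>x. s *\<^sub>R \<Phi> x + t *\<^sub>R \<Psi> x)" for s t
    by (simp add: fun_eq_iff scaleR_fun_def plus_fun_def)
  have B0: "BF pot (\<lambda>x. 0) (\<lambda>x. 0) = 0"
    by (simp add: BF_def)
  have indep0: "s = 0 \<and> t = 0" if "s *\<^sub>R \<Phi> + t *\<^sub>R \<Psi> = 0" for s t
  proof (rule ccontr)
    assume "\<not> (s = 0 \<and> t = 0)"
    moreover have "(\<lambda>x. s *\<^sub>R \<Phi> x + t *\<^sub>R \<Psi> x) = (\<lambda>x. 0)" using that by (simp add: comb zero_fun_def)
    ultimately show False using neg[of s t] B0 by simp
  qed
  let ?V = "span {\<Phi>, \<Psi>}"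
  have V: "\<exists>s t. X = s *\<^sub>R \<Phi> + t *\<^sub>R \<Psi>" if mem: "X \<in> ?V" for X
  proof -
    obtain s where "X - s *\<^sub>R \<Phi> \<in> span {\<Psi>}" using mem span_breakdown_eq[of X \<Phi> "{\<Psi>}"] by auto
    then obtain t where "X - s *\<^sub>R \<Phi> = t *\<^sub>R \<Psi>" by (auto simp: span_singleton)
    then show ?thesis by (metis add.commute diff_add_cancel)
  qed
  have "\<Psi> \<noteq> 0" using indep0[of 0 1] by auto
  have nin: "\<Phi> \<notin> span {\<Psi>}"
  proof
    assume "\<Phi> \<in> span {\<Psi>}"
    then obtain t where "\<Phi> = t *\<^sub>R \<Psi>" by (auto simp: span_singleton)
    then have "1 *\<^sub>R \<Phi> + (- t) *\<^sub>R \<Psi> = 0" by simp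
    from indep0[OF this] show False by simp
  qed
  then have "\<Phi> \<noteq> \<Psi>" using span_base[of \<Psi> "{\<Psi>}"] by auto
  have "independent {\<Phi>, \<Psi>}"
    using nin \<open>\<Psi> \<noteq> 0\<close> \<open>\<Phi> \<noteq> \<Psi>\<close> by (simp add: independent_insert)
  then have "dim ?V = 2"
    using \<open>\<Phi> \<noteq> \<Psi>\<close> by (simp add: dim_eq_card_independent)
  moreover have "?V \<subseteq> C1c \<Omega>"
  proof
    fix X assume "X \<in> ?V"
    then obtain s u where "X = (\<lambda>x. s *\<^sub>R \<Phi> x + u *\<^sub>R \<Psi> x)" using V comb by metis
    then show "X \<in> C1c \<Omega>" using t by (auto intro!: tests_C1c tests_add tests_scaleR)
  qed
  moreover have "quad_form K F U \<Omega> X < 0" if mem: "X \<in> ?V" and X0: "X \<noteq> 0" for X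
  proof -
    obtain s u where X: "X = s *\<^sub>R \<Phi> + u *\<^sub>R \<Psi>" using V[OF mem] by blast
    have su: "s \<noteq> 0 \<or> u \<noteq> 0"
    proof (rule ccontr)
      assume "\<not> (s \<noteq> 0 \<or> u \<noteq> 0)"
      then have "s = 0" "u = 0" by blast+
      then have "X = 0" unfolding X by (simp only: scaleR_zero_left add_0_left)
      with X0 show False ..
    qed
    have "tests \<Omega> (\<lambda>x. s *\<^sub>R \<Phi> x + u *\<^sub>R \<Psi> x)"
      by (rule tests_add[OF tests_scaleR[OF t(1)] tests_scaleR[OF t(2)]])
    from quad_form_eq[OF this] neg[OF su] show ?thesis unfolding X comb[of s u] by (simp only:)
  qed
  ultimately have "enat 2 \<in> {enat (dim V) | V. subspace V \<and> V \<subseteq> C1c \<Omega> \<and>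
      (\<forall>\<Psi>\<in>V. \<Psi> \<noteq> 0 \<longrightarrow> quad_form K F U \<Omega> \<Psi> < 0)}"
    using subspace_span[of "{\<Phi>, \<Psi>}"] by (intro CollectI exI[of _ ?V]) auto
  then have "enat 2 \<le> morse_index K F U \<Omega>"
    unfolding morse_index_def by (rule Sup_upper)
  then show False by (simp add: index one_enat_def)
qed

text \<open>A symmetric 2 by 2 matrix whose diagonal entries lie below \<open>- d\<close> and whose
  off-diagonal entry is at most \<open>d\<close> in modulus is negative definite. The off-diagonal
  entry belongs to \<open>sympart pot\<close>, because that form governs the energy of a
  combination.\<close>

lemma index_contra_bilinear:
  assumes t: "tests \<Omega> X" "tests \<Omega> Y"
    and neg: "BF pot X X < - d" "BF pot Y Y < - d" "\<bar>BF (sympart pot) X Y\<bar> \<le> d"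
  shows False
proof (rule index_contra[OF t])
  fix s t' :: real assume st: "s \<noteq> 0 \<or> t' \<noteq> 0"
  let ?c = "sympart pot"
  have pc: "continuous_on \<Omega> (?c i j)" for i j
    unfolding sympart_def[abs_def] by (intro continuous_intros pot_continuous_on) auto
  have ts: "tests \<Omega> (\<lambda>x. s *\<^sub>R X x)" by (rule tests_scaleR[OF t(1)])
  have "BF pot (\<lambda>x. s *\<^sub>R X x + t' *\<^sub>R Y x) (\<lambda>x. s *\<^sub>R X x + t' *\<^sub>R Y x) =
      BF ?c (\<lambda>x. s *\<^sub>R X x + t' *\<^sub>R Y x) (\<lambda>x. s *\<^sub>R X x + t' *\<^sub>R Y x)" by (simp only: BF_sympart)
  also have "\<dots> = BF ?c (\<lambda>x. s *\<^sub>R X x) (\<lambda>x. s *\<^sub>R X x) + 2 * t' * BF ?c (\<lambda>x. s *\<^sub>R X x) Y + t'\<^sup>2 * BF ?c Y Y"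
    by (rule BF_quadratic[OF \<Omega>(1) pc sympart_commute ts t(2)])
  also have "BF ?c (\<lambda>x. s *\<^sub>R X x) Y = s * BF ?c X Y"
    using BF_scaleR_right[OF t(1), of ?c Y s] BF_commute[of ?c, OF sympart_commute] by metis
  also have "BF ?c (\<lambda>x. s *\<^sub>R X x) (\<lambda>x. s *\<^sub>R X x) = s\<^sup>2 * BF pot X X"
    unfolding BF_scaleR[OF t(1)] BF_sympart ..
  also have "BF ?c Y Y = BF pot Y Y" by (rule BF_sympart)
  finally have eq: "BF pot (\<lambda>x. s *\<^sub>R X x + t' *\<^sub>R Y x) (\<lambda>x. s *\<^sub>R X x + t' *\<^sub>R Y x) =
    s\<^sup>2 * BF pot X X + 2 * t' * (s * BF ?c X Y) + t'\<^sup>2 * BF pot Y Y" .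
  have d: "0 \<le> d" using neg(3) by simp
  have "2 * t' * (s * BF ?c X Y) \<le> \<bar>2 * t' * (s * BF ?c X Y)\<bar>" by simp
  also have "\<dots> = 2 * \<bar>t'\<bar> * \<bar>s\<bar> * \<bar>BF ?c X Y\<bar>" by (simp add: abs_mult)
  also have "\<dots> \<le> (s\<^sup>2 + t'\<^sup>2) * d"
  proof (rule mult_mono)
    have "0 \<le> (\<bar>t'\<bar> - \<bar>s\<bar>)\<^sup>2" by simp
    then show "2 * \<bar>t'\<bar> * \<bar>s\<bar> \<le> s\<^sup>2 + t'\<^sup>2" by (simp add: power2_diff)
  qed (use neg(3) in auto)
  finally have m: "2 * t' * (s * BF ?c X Y) \<le> (s\<^sup>2 + t'\<^sup>2) * d" .
  have a1: "s\<^sup>2 * BF pot X X \<le> s\<^sup>2 * (- d)" "t'\<^sup>2 * BF pot Y Y \<le> t'\<^sup>2 * (- d)"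
    by (rule mult_left_mono; use neg in simp)+
  have a2: "s\<^sup>2 * BF pot X X < s\<^sup>2 * (- d) \<or> t'\<^sup>2 * BF pot Y Y < t'\<^sup>2 * (- d)"
  proof (cases "s = 0")
    case False
    then have "0 < s\<^sup>2" by simp
    from mult_strict_left_mono[OF neg(1) this] show ?thesis ..
  next
    case True
    then have "0 < t'\<^sup>2" using st by simp
    from mult_strict_left_mono[OF neg(2) this] show ?thesis ..
  qed
  have "(s\<^sup>2 + t'\<^sup>2) * d = - (s\<^sup>2 * (- d)) - t'\<^sup>2 * (- d)" by (simp add: algebra_simps)
  with m a1 a2 show "BF pot (\<lambda>x. s *\<^sub>R X x + t' *\<^sub>R Y x) (\<lambda>x. s *\<^sub>R X x + t' *\<^sub>R Y x) < 0"
    unfolding eq by linarith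
qed

lemma index_contra_disjoint:
  assumes "tests D \<Phi>" "tests E \<Psi>" "D \<subseteq> \<Omega>" "E \<subseteq> \<Omega>" "D \<inter> E = {}" "BF pot \<Phi> \<Phi> < 0" "BF pot \<Psi> \<Psi> < 0"
  shows False
proof (rule index_contra_bilinear)
  show "tests \<Omega> \<Phi>" "tests \<Omega> \<Psi>" using assms tests_mono by blast+
  let ?d = "min (- BF pot \<Phi> \<Phi>) (- BF pot \<Psi> \<Psi>) / 2"
  show "BF pot \<Phi> \<Phi> < - ?d" "BF pot \<Psi> \<Psi> < - ?d" using assms(6,7) by (auto simp: min_def field_simps)
  show "\<bar>BF (sympart pot) \<Phi> \<Psi>\<bar> \<le> ?d"
    using assms(6,7) BF_disjoint[OF assms(1,2,5)] by auto
qed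

lemma semistable_half: "semistable (half e) \<or> semistable (half (- e))"
  using semistable_not index_contra_disjoint half_subset half_disjoint by metis

end

section \<open>Semistability along the circle of normals\<close>

context elliptic_system
begin

text \<open>The condition that \<open>x\<close> lies strictly on the positive side is open in
  \<open>(t, x)\<close>; the tube lemma makes this uniform over the compact
  \<open>C\<close>.\<close>

lemma half_stable:
  assumes C: "compact C" "C \<subseteq> half (circ p q t0)"
  shows "\<exists>\<delta>>0. \<forall>t. \<bar>t - t0\<bar> < \<delta> \<longrightarrow> C \<subseteq> half (circ p q t)"
proof -
  let ?W = "{z :: real \<times> (real^'n). 0 < circ p q (fst z) \<bullet> snd z}"
  have "open ?W"
    by (intro open_Collect_less continuous_intros)
  moreover have "{t0} \<times> C \<subseteq> ?W" using C(2) by (auto simp: half_def)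
  ultimately obtain X where X: "t0 \<in> X" "open X" "X \<times> C \<subseteq> ?W" using Elementary_Topology.tube_lemma[OF C(1), of ?W t0] by blast
  then obtain \<delta> where \<delta>: "\<delta> > 0" "ball t0 \<delta> \<subseteq> X" using open_contains_ball by metis
  have "C \<subseteq> half (circ p q t)" if "\<bar>t - t0\<bar> < \<delta>" for t
  proof
    fix x assume "x \<in> C"
    moreover have "t \<in> X" using that \<delta>(2) by (auto simp: dist_real_def abs_minus_commute)
    ultimately have "0 < circ p q t \<bullet> x" using X(3) by auto
    then show "x \<in> half (circ p q t)" using \<open>x \<in> C\<close> C(2) by (auto simp: half_def)
  qed
  with \<delta>(1) show ?thesis by blast
qed

text \<open>A function of negative energy has compact support in the open half, so it stays
  admissible for all nearby normals and instability is an open condition.\<close>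

lemma closed_semistable: "closed {t. semistable (half (circ p q t))}"
proof -
  have "open (- {t. semistable (half (circ p q t))})"
    unfolding open_contains_ball
  proof
    fix t0 assume "t0 \<in> - {t. semistable (half (circ p q t))}"
    then obtain \<Phi> where \<Phi>: "tests (half (circ p q t0)) \<Phi>" "BF pot \<Phi> \<Phi> < 0" using semistable_not by blast
    obtain C where C: "compact C" "C \<subseteq> half (circ p q t0)" "\<And>E. C \<subseteq> E \<Longrightarrow> tests E \<Phi>"
      by (rule tests_supp[OF \<Phi>(1)]) blast
    obtain \<delta> where \<delta>: "\<delta> > 0" "\<And>t. \<bar>t - t0\<bar> < \<delta> \<Longrightarrow> C \<subseteq> half (circ p q t)" using half_stable[OF C(1,2)] by blast
    have "\<not> semistable (half (circ p q t))" if "\<bar>t - t0\<bar> < \<delta>" for t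
      using C(3)[OF \<delta>(2)[OF that]] \<Phi>(2) by (auto simp: semistable_def not_le)
    then show "\<exists>e>0. ball t0 e \<subseteq> - {t. semistable (half (circ p q t))}"
      using \<delta>(1) by (intro exI[of _ \<delta>]) (auto simp: dist_real_def abs_minus_commute)
  qed
  then show ?thesis by (simp add: closed_def)
qed

end

context morse_one
begin

text \<open>Both sets of parameters are closed, a half turn exchanges them so that neither is empty,
  and \<open>semistable_half\<close> makes them cover the line. By connectedness they meet.\<close>

lemma semistable_both:
  shows "\<exists>t. semistable (half (circ p q t)) \<and> semistable (half (- circ p q t))"
proof -
  let ?A = "{t. semistable (half (circ p q t))}" and ?B = "{t. semistable (half (circ (- p) (- q) t))}"
  have neg: "circ (- p) (- q) t = - circ p q t" for t by (simp add: circ_def)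
  have "closed ?A" "closed ?B" by (rule closed_semistable)+
  moreover have "UNIV \<subseteq> ?A \<union> ?B" using semistable_half by (auto simp: neg)
  moreover have "?A \<inter> UNIV \<noteq> {}" "?B \<inter> UNIV \<noteq> {}"
  proof -
    have "t \<in> ?A \<longleftrightarrow> t + pi \<in> ?B" "t \<in> ?B \<longleftrightarrow> t + pi \<in> ?A" for t
      unfolding neg by (simp_all add: circ_pi)
    then show "?A \<inter> UNIV \<noteq> {}" "?B \<inter> UNIV \<noteq> {}" using \<open>UNIV \<subseteq> ?A \<union> ?B\<close> by blast+
  qed
  ultimately have "?A \<inter> ?B \<inter> UNIV \<noteq> {}" using connected_UNIV unfolding connected_closed by blast
  then show ?thesis by (auto simp: neg)
qed

end

subsection \<open>Pointwise inequalities for the nonlinearity\<close>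

context elliptic_system
begin

lemma rhs_line_deriv:
  assumes x: "x \<in> \<Omega>"
  shows "((\<lambda>t. rhs x (S + t *\<^sub>R V) $ i) has_field_derivative (\<Sum>j\<in>UNIV. jac i j x (S + t *\<^sub>R V) * V $ j)) (at t within X)"
proof -
  have "((\<lambda>t. S + t *\<^sub>R V) has_derivative (\<lambda>h. h *\<^sub>R V)) (at t within X)"
    by (auto intro!: derivative_eq_intros)
  from has_derivative_compose[OF this rhs_deriv[OF in_closure[OF x]]]
  have "((\<lambda>t. rhs x (S + t *\<^sub>R V) $ i) has_derivative (\<lambda>h. \<Sum>j\<in>UNIV. jac i j x (S + t *\<^sub>R V) * (h *\<^sub>R V) $ j)) (at t within X)" .
  then show ?thesis
    by (rule has_derivative_imp_has_field_derivative) (simp add: sum_distrib_left mult_ac)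
qed

lemma rhs_mean_value:
  assumes x: "x \<in> \<Omega>"
  shows "\<exists>Z\<in>closed_segment S' S. rhs x S $ i - rhs x S' $ i = (\<Sum>j\<in>UNIV. jac i j x Z * (S $ j - S' $ j))"
proof -
  have "\<exists>t::real. 0 < t \<and> t < 1 \<and> rhs x (S' + 1 *\<^sub>R (S - S')) $ i - rhs x (S' + 0 *\<^sub>R (S - S')) $ i =
      (1 - 0) * (\<Sum>j\<in>UNIV. jac i j x (S' + t *\<^sub>R (S - S')) * (S - S') $ j)"
    by (rule MVT2) (rule zero_less_one, rule rhs_line_deriv[OF x])
  then obtain t :: real where t: "0 < t" "t < 1" "rhs x S $ i - rhs x S' $ i =
      (\<Sum>j\<in>UNIV. jac i j x (S' + t *\<^sub>R (S - S')) * (S - S') $ j)" by auto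
  moreover have "S' + t *\<^sub>R (S - S') \<in> closed_segment S' S"
    using t by (auto simp: in_segment algebra_simps intro!: exI[of _ t])
  ultimately show ?thesis by auto
qed

lemma convex_on_line:
  fixes g :: "'v::real_vector \<Rightarrow> real"
  assumes "convex_on UNIV g"
  shows "convex_on UNIV (\<lambda>t::real. g (S + t *\<^sub>R V))"
proof (rule convex_onI)
  fix t x y :: real assume t: "0 < t" "t < 1"
  have "S + ((1 - t) *\<^sub>R x + t *\<^sub>R y) *\<^sub>R V = (1 - t) *\<^sub>R (S + x *\<^sub>R V) + t *\<^sub>R (S + y *\<^sub>R V)"
    by (simp add: algebra_simps)
  then show "g (S + ((1 - t) *\<^sub>R x + t *\<^sub>R y) *\<^sub>R V) \<le> (1 - t) * g (S + x *\<^sub>R V) + t * g (S + y *\<^sub>R V)"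
    using convex_onD[OF assms, of t "S + x *\<^sub>R V" "S + y *\<^sub>R V"] t by simp
qed auto

text \<open>The tangent at \<open>S\<close> stays below the convex function at \<open>S'\<close>.
  The coefficients thus sit at \<open>S\<close>, which will be \<open>U x\<close> in either
  half.\<close>

lemma rhs_convex_le:
  assumes x: "x \<in> \<Omega>" and cv: "convex_on UNIV (\<lambda>S. rhs x S $ i)"
  shows "rhs x S $ i - rhs x S' $ i \<le> (\<Sum>j\<in>UNIV. jac i j x S * (S $ j - S' $ j))"
proof -
  let ?g = "\<lambda>t. rhs x (S + t *\<^sub>R (S' - S)) $ i"
  have "?g 1 - ?g 0 \<ge> (\<Sum>j\<in>UNIV. jac i j x (S + 0 *\<^sub>R (S' - S)) * (S' - S) $ j) * (1 - 0)"
    by (rule convex_on_imp_above_tangent[OF convex_on_line[OF cv] _ _ _ rhs_line_deriv[OF x]]) auto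
  then have "rhs x S' $ i - rhs x S $ i \<ge> (\<Sum>j\<in>UNIV. jac i j x S * (S' $ j - S $ j))" by simp
  moreover have "(\<Sum>j\<in>UNIV. jac i j x S * (S' $ j - S $ j)) = - (\<Sum>j\<in>UNIV. jac i j x S * (S $ j - S' $ j))"
    by (simp add: sum_negf[symmetric] algebra_simps)
  ultimately show ?thesis by simp
qed

text \<open>Off the diagonal the coefficient is nonnegative, so passing to the positive part
  increases the term; on the diagonal the sign of \<open>V $ i\<close> leaves it unchanged.\<close>

lemma jac_pos_part_le:
  assumes x: "x \<in> \<Omega>" and "0 \<le> V $ i"
  shows "jac i j x Z * V $ j \<le> jac i j x Z * max 0 (V $ j)"
  using assms jac_nonneg[OF x, of i j Z] by (cases "i = j") (auto intro!: mult_left_mono)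

text \<open>Along the segment a convex entry of the Jacobian lies below its linear interpolant,
  whose integral is the average of the end values. Positive parts are taken before interpolating,
  since the upper bound must be multiplied by nonnegative factors.\<close>

lemma rhs_convex_jac_le:
  assumes x: "x \<in> \<Omega>" and cv: "\<And>i j. convex_on UNIV (\<lambda>S. jac i j x S)" and le: "S' $ i \<le> S $ i"
  shows "rhs x S $ i - rhs x S' $ i \<le> (\<Sum>j\<in>UNIV. (jac i j x S + jac i j x S') / 2 * max 0 (S $ j - S' $ j))"
proof -
  define V where "V = S - S'"
  define m where "m j = max 0 (V $ j)" for j
  \<comment> \<open>The right-hand side along the segment minus the antiderivative of its majorant;
    \<open>h 1 \<le> h 0\<close> is the assertion.\<close>
  define h where "h t = rhs x (S' + t *\<^sub>R V) $ i - (\<Sum>j\<in>UNIV. (jac i j x S' * t + (jac i j x S - jac i j x S') * t\<^sup>2 / 2) * m j)" for t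
  have "h 1 \<le> h 0"
  proof (rule DERIV_nonpos_imp_nonincreasing[of 0 1 h])
    fix t :: real assume t: "0 \<le> t" "t \<le> 1"
    have "(h has_field_derivative (\<Sum>j\<in>UNIV. jac i j x (S' + t *\<^sub>R V) * V $ j) -
        (\<Sum>j\<in>UNIV. (jac i j x S' + (jac i j x S - jac i j x S') * t) * m j)) (at t)"
      unfolding h_def
      by (intro DERIV_diff rhs_line_deriv[OF x] DERIV_sum) (auto intro!: derivative_eq_intros)
    moreover have "(\<Sum>j\<in>UNIV. jac i j x (S' + t *\<^sub>R V) * V $ j) \<le> (\<Sum>j\<in>UNIV. (jac i j x S' + (jac i j x S - jac i j x S') * t) * m j)"
    proof (rule sum_mono)
      fix j
      have "jac i j x (S' + t *\<^sub>R V) * V $ j \<le> jac i j x (S' + t *\<^sub>R V) * m j"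
        unfolding m_def by (rule jac_pos_part_le[OF x]) (use le in \<open>simp add: V_def\<close>)
      also have "\<dots> \<le> (jac i j x S' + (jac i j x S - jac i j x S') * t) * m j"
      proof (rule mult_right_mono)
        have eq: "S' + t *\<^sub>R V = (1 - t) *\<^sub>R S' + t *\<^sub>R S" by (simp add: V_def algebra_simps)
        have "jac i j x (S' + t *\<^sub>R V) \<le> (1 - t) * jac i j x S' + t * jac i j x S"
          unfolding eq using convex_onD[OF cv[of i j], of t S' S] t by simp
        also have "\<dots> = jac i j x S' + (jac i j x S - jac i j x S') * t" by (simp add: algebra_simps)
        finally show "jac i j x (S' + t *\<^sub>R V) \<le> jac i j x S' + (jac i j x S - jac i j x S') * t" .
      qed (simp add: m_def)
      finally show "jac i j x (S' + t *\<^sub>R V) * V $ j \<le> (jac i j x S' + (jac i j x S - jac i j x S') * t) * m j" .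
    qed
    ultimately show "\<exists>y. (h has_field_derivative y) (at t) \<and> y \<le> 0" by (intro exI conjI) auto
  qed simp
  moreover have "h 0 = rhs x S' $ i" by (simp add: h_def)
  moreover have "h 1 = rhs x S $ i - (\<Sum>j\<in>UNIV. (jac i j x S + jac i j x S') / 2 * max 0 (S $ j - S' $ j))"
  proof -
    have *: "(\<Sum>j\<in>UNIV. (jac i j x S' * 1 + (jac i j x S - jac i j x S') * 1\<^sup>2 / 2) * m j) =
        (\<Sum>j\<in>UNIV. (jac i j x S + jac i j x S') / 2 * max 0 (S $ j - S' $ j))"
      by (intro sum.cong refl) (simp add: m_def V_def field_simps)
    show ?thesis unfolding h_def * by (simp add: V_def)
  qed
  ultimately show ?thesis by simp
qed

lemma rhs_mono:
  assumes x: "x \<in> \<Omega>" and le: "\<And>j. S' $ j \<le> S $ j" and eq: "S' $ i = S $ i"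
  shows "rhs x S' $ i \<le> rhs x S $ i"
proof -
  obtain Z where Z: "rhs x S $ i - rhs x S' $ i = (\<Sum>j\<in>UNIV. jac i j x Z * (S $ j - S' $ j))"
    using rhs_mean_value[OF x] by blast
  have "0 \<le> jac i j x Z * (S $ j - S' $ j)" for j
    using jac_nonneg[OF x, of i j Z] le[of j] eq by (cases "i = j") auto
  then show ?thesis using Z by (smt (verit) sum_nonneg)
qed

text \<open>Stated within a closed interval because it is applied at the left endpoint, where
  constancy is known on one side only.\<close>

lemma const_deriv_zero:
  assumes "(g has_field_derivative D) (at t within {0..d})" "0 < d" "t \<in> {0..d}" "\<And>s. s \<in> {0..d} \<Longrightarrow> g s = (c::real)"
  shows "D = 0"
proof -
  have "((\<lambda>s. c) has_field_derivative D) (at t within {0..d})"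
    by (rule has_field_derivative_transform_within[OF assms(1) zero_less_one]) (use assms in auto)
  then have "((\<lambda>s. c) has_vector_derivative D) (at t within {0..d})"
    by (simp add: has_real_derivative_iff_has_vector_derivative)
  moreover have "((\<lambda>s. c) has_vector_derivative 0) (at t within {0..d})" by simp
  ultimately show ?thesis
    using vector_derivative_unique_within_closed_interval[of 0 d t "\<lambda>s. c" D 0] assms(2,3) by simp
qed

text \<open>Monotonicity in the other components squeezes component \<open>i\<close> to a constant
  along the segment in direction \<open>j\<close> downwards from \<open>S\<close> and along the one
  upwards from \<open>S'\<close>. The one-sided derivatives at their starting points are the two
  entries.\<close>

lemma rhs_eq_jac_zero:
  assumes x: "x \<in> \<Omega>" and le: "\<And>j. S' $ j \<le> S $ j" and eq: "S' $ i = S $ i" and lt: "S' $ j < S $ j"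
    and r: "rhs x S $ i = rhs x S' $ i"
  shows "jac i j x S = 0" "jac i j x S' = 0"
proof -
  let ?d = "S $ j - S' $ j" and ?e = "axis j 1 :: real^'m"
  have ij: "i \<noteq> j" using eq lt by auto
  have ax: "?e $ l = (if l = j then 1 else 0)" for l by (simp add: axis_def)
  have c1: "rhs x (S + s *\<^sub>R (- ?e)) $ i = rhs x S $ i" if "s \<in> {0..?d}" for s
  proof (rule antisym)
    show "rhs x (S + s *\<^sub>R (- ?e)) $ i \<le> rhs x S $ i"
      by (rule rhs_mono[OF x]) (use that ij in \<open>auto simp: ax\<close>)
    have "rhs x S' $ i \<le> rhs x (S + s *\<^sub>R (- ?e)) $ i"
      by (rule rhs_mono[OF x]) (use that ij le eq in \<open>auto simp: ax\<close>)
    then show "rhs x S $ i \<le> rhs x (S + s *\<^sub>R (- ?e)) $ i" using r by simp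
  qed
  have c2: "rhs x (S' + s *\<^sub>R ?e) $ i = rhs x S $ i" if "s \<in> {0..?d}" for s
  proof (rule antisym)
    show "rhs x (S' + s *\<^sub>R ?e) $ i \<le> rhs x S $ i"
      by (rule rhs_mono[OF x]) (use that ij le eq in \<open>auto simp: ax\<close>)
    have "rhs x S' $ i \<le> rhs x (S' + s *\<^sub>R ?e) $ i"
      by (rule rhs_mono[OF x]) (use that ij in \<open>auto simp: ax\<close>)
    then show "rhs x S $ i \<le> rhs x (S' + s *\<^sub>R ?e) $ i" using r by simp
  qed
  have s1: "(\<Sum>l\<in>UNIV. jac i l x Z * ?e $ l) = jac i j x Z" for Z
    by (simp add: ax if_distrib[of "\<lambda>v. _ * v"] cong: if_cong)
  have s2: "(\<Sum>l\<in>UNIV. jac i l x Z * (- ?e) $ l) = - jac i j x Z" for Z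
    using s1[of Z] by (simp add: sum_negf)
  have "(\<Sum>l\<in>UNIV. jac i l x (S + 0 *\<^sub>R (- ?e)) * (- ?e) $ l) = 0"
    by (rule const_deriv_zero[OF rhs_line_deriv[OF x] _ _ c1]) (use lt in auto)
  then show "jac i j x S = 0" unfolding s2 by simp
  have "(\<Sum>l\<in>UNIV. jac i l x (S' + 0 *\<^sub>R ?e) * ?e $ l) = 0"
    by (rule const_deriv_zero[OF rhs_line_deriv[OF x] _ _ c2]) (use lt in auto)
  then show "jac i j x S' = 0" unfolding s1 by simp
qed

lemma U_bounded: "\<exists>R. \<forall>x\<in>closure \<Omega>. norm (U x) \<le> R"
proof -
  have "compact (closure \<Omega>)" using \<Omega>(3) by simp
  then have "bounded (U ` closure \<Omega>)" using U_continuous compact_continuous_image compact_imp_bounded by blast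
  then show ?thesis unfolding bounded_iff by auto
qed

text \<open>Segments between values of \<open>U\<close> remain in a ball, so continuity on a compact
  set bounds every coefficient that the mean value theorem can produce.\<close>

lemma jac_bounded:
  "\<exists>M\<ge>0. \<forall>i j. \<forall>x\<in>\<Omega>. \<forall>y\<in>\<Omega>. \<forall>z\<in>\<Omega>. \<forall>Z\<in>closed_segment (U y) (U z). \<bar>jac i j x Z\<bar> \<le> M"
proof -
  obtain R where R: "\<And>x. x \<in> closure \<Omega> \<Longrightarrow> norm (U x) \<le> R" using U_bounded by auto
  have comp: "compact (closure \<Omega> \<times> cball (0::real^'m) R)" using \<Omega>(3) by (intro compact_Times) auto
  have "\<exists>B. \<forall>x\<in>closure \<Omega>. \<forall>Z\<in>cball 0 R. \<bar>jac (fst p) (snd p) x Z\<bar> \<le> B" for p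
  proof -
    have "compact ((\<lambda>(x, Z). jac (fst p) (snd p) x Z) ` (closure \<Omega> \<times> cball 0 R))"
      by (rule compact_continuous_image[OF continuous_on_subset[OF jac_continuous] comp]) auto
    then have "bounded ((\<lambda>(x, Z). jac (fst p) (snd p) x Z) ` (closure \<Omega> \<times> cball 0 R))" by (rule compact_imp_bounded)
    then show ?thesis unfolding bounded_iff by force
  qed
  then obtain B where B: "\<And>p x Z. x \<in> closure \<Omega> \<Longrightarrow> Z \<in> cball 0 R \<Longrightarrow> \<bar>jac (fst p) (snd p) x Z\<bar> \<le> B p" by metis
  define M where "M = (\<Sum>p\<in>UNIV. \<bar>B p\<bar>)"
  have BM: "B p \<le> M" for p
  proof -
    have "\<bar>B p\<bar> \<le> M" unfolding M_def by (rule member_le_sum) auto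
    then show ?thesis by simp
  qed
  have "\<bar>jac i j x Z\<bar> \<le> M" if "x \<in> \<Omega>" "y \<in> \<Omega>" "z \<in> \<Omega>" "Z \<in> closed_segment (U y) (U z)" for i j x y z Z
  proof -
    have "closed_segment (U y) (U z) \<subseteq> cball 0 R"
      by (rule closed_segment_subset) (use R that in_closure in auto)
    then show ?thesis using B[of x Z "(i, j)"] BM[of "(i, j)"] that in_closure by fastforce
  qed
  moreover have "0 \<le> M" unfolding M_def by (simp add: sum_nonneg)
  ultimately show ?thesis by blast
qed

subsection \<open>Differences across a hyperplane\<close>

definition w :: "real^'n \<Rightarrow> real^'n \<Rightarrow> real^'m"
  where "w e x = U x - U (reflect e x)"

text \<open>Both terms carry the same first argument \<open>x\<close>, because reflection preserves
  |x'| and x''. This is the right-hand side of the equation for \<open>w\<close>.\<close>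

definition wrhs :: "real^'n \<Rightarrow> real^'n \<Rightarrow> real^'m"
  where "wrhs e x = rhs x (U x) - rhs x (U (reflect e x))"

lemma w_minus: "w (- e) = w e" by (simp add: w_def[abs_def] reflect_minus)

lemma w_reflect: "unitK K e \<Longrightarrow> w e (reflect e x) = - w e x"
  by (simp add: w_def reflect_reflect)

lemma U_symm_C1:
  assumes T: "symm K T"
  shows "C1_on \<Omega> (\<lambda>x. U (T x) $ i)"
  using C1_on_orthogonal(1)[of T \<Omega> "\<lambda>x. U x $ i"] T U_C1 symm_vimage[OF T] by (simp add: symm_def)

lemma U_symm_continuous: "symm K T \<Longrightarrow> continuous_on (closure \<Omega>) (\<lambda>x. U (T x))"
  by (rule continuous_on_compose2[OF U_continuous symm_continuous]) (auto simp: symm_closure)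

lemma w_continuous: "unitK K e \<Longrightarrow> continuous_on (closure \<Omega>) (w e)"
  unfolding w_def[abs_def] by (intro continuous_intros U_continuous U_symm_continuous symm_reflect)

lemma closure_half_subset: "closure (half e) \<subseteq> closure \<Omega>"
  using closure_half by blast

lemma zero_trace_half:
  assumes "\<And>i. C1_on \<Omega> (\<lambda>x. z x $ i)" "continuous_on (closure \<Omega>) z"
    "\<And>x. x \<in> frontier \<Omega> \<Longrightarrow> z x = 0" "\<And>x. x \<in> \<Omega> \<Longrightarrow> e \<bullet> x = 0 \<Longrightarrow> z x = 0"
  shows "zero_trace (half e) z"
  unfolding zero_trace_def
  using assms frontier_half[of _ e]
  by (auto intro: C1_on_subset[OF _ half_subset] continuous_on_subset[OF _ closure_half_subset])

lemma zero_trace_w: "unitK K e \<Longrightarrow> zero_trace (half e) (w e)"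
proof (rule zero_trace_half)
  assume e: "unitK K e"
  show "C1_on \<Omega> (\<lambda>x. w e x $ i)" for i
    unfolding w_def vector_minus_component by (intro C1_on_diff U_C1 U_symm_C1 symm_reflect e)
  show "continuous_on (closure \<Omega>) (w e)" by (rule w_continuous[OF e])
  show "w e x = 0" if "x \<in> frontier \<Omega>" for x
    using that bc symm_frontier[OF symm_reflect[OF e]] by (simp add: w_def)
  show "w e x = 0" if "e \<bullet> x = 0" for x using that by (simp add: w_def reflect_fix)
qed

lemma zero_trace_minus: "zero_trace D z \<Longrightarrow> zero_trace D (\<lambda>x. - z x)"
  by (auto simp: zero_trace_def intro!: C1_on_minus continuous_intros)

lemma wrhs_cc:
  assumes e: "unitK K e" and t: "test \<Omega> \<phi>"
  shows "cc (\<lambda>x. wrhs e x $ i * \<phi> x)"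
  unfolding wrhs_def vector_minus_component left_diff_distrib
  by (intro cc_diff cc_rhs[OF t])
    (auto intro!: continuous_on_subset[OF U_continuous closure_subset] continuous_on_subset[OF U_symm_continuous[OF symm_reflect[OF e]] closure_subset])

lemma w_eq:
  assumes e: "unitK K e" and t: "test \<Omega> \<phi>"
  shows "integral UNIV (\<lambda>x. gradient (\<lambda>y. w e y $ i) x \<bullet> gradient \<phi> x) = integral UNIV (\<lambda>x. wrhs e x $ i * \<phi> x)"
proof -
  note s = symm_reflect[OF e]
  have c: "continuous_on \<Omega> U" "continuous_on \<Omega> (\<lambda>x. U (reflect e x))"
    by (auto intro: continuous_on_subset[OF U_continuous closure_subset] continuous_on_subset[OF U_symm_continuous[OF s] closure_subset])
  have "gradient (\<lambda>y. w e y $ i) x \<bullet> gradient \<phi> x =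
      gradient (\<lambda>y. U y $ i) x \<bullet> gradient \<phi> x - gradient (\<lambda>y. U (reflect e y) $ i) x \<bullet> gradient \<phi> x" for x
  proof (cases "x \<in> \<Omega>")
    case True
    then show ?thesis
      using gradient_diff[OF C1_onD[OF U_C1 True] C1_onD[OF U_symm_C1[OF s] True], of i]
      by (simp add: w_def inner_diff_left)
  qed (simp add: test_outside[OF t])
  then have "integral UNIV (\<lambda>x. gradient (\<lambda>y. w e y $ i) x \<bullet> gradient \<phi> x) =
      integral UNIV (\<lambda>x. gradient (\<lambda>y. U y $ i) x \<bullet> gradient \<phi> x - gradient (\<lambda>y. U (reflect e y) $ i) x \<bullet> gradient \<phi> x)" by simp
  also have "\<dots> = integral UNIV (\<lambda>x. rhs x (U x) $ i * \<phi> x) - integral UNIV (\<lambda>x. rhs x (U (reflect e x)) $ i * \<phi> x)"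
    unfolding weak_eq[OF t, symmetric] weak_eq_symm[OF s t, symmetric]
    by (intro cc_integral_diff test_cc_gradient_inner(2)[OF \<Omega>(1) t] C1_on_continuous_gradient U_C1 U_symm_C1 s)
  also have "\<dots> = integral UNIV (\<lambda>x. wrhs e x $ i * \<phi> x)"
    unfolding wrhs_def vector_minus_component left_diff_distrib
    by (rule cc_integral_diff[symmetric]) (intro cc_rhs[OF t] c)+
  finally show ?thesis .
qed

lemma subsol_w:
  assumes e: "unitK K e" and b: "\<And>i j. continuous_on (closure (half e)) (b i j)"
    and le: "\<And>i x. x \<in> half e \<Longrightarrow> 0 < w e x $ i \<Longrightarrow> wrhs e x $ i \<le> (\<Sum>j\<in>UNIV. b i j x * max 0 (w e x $ j))"
  shows "subsol b (half e) (w e)"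
  by (rule subsolI[OF open_half bounded_half zero_trace_w[OF e] b _ _ le])
    (auto intro!: wrhs_cc[OF e] w_eq[OF e] test_mono[OF _ half_subset])

text \<open>The positive part is a minimiser and so solves a cooperative system on the connected
  half, where the strong maximum principle decides each component as a whole. The last clause says
  that the two groups of components do not interact; it is played later against full coupling or
  against the index.\<close>

lemma posv_dichotomy:
  fixes z :: "real^'n \<Rightarrow> real^'m"
  assumes e: "unitK K e" and z: "zero_trace (half e) z"
    and b: "\<And>i j. continuous_on (closure (half e)) (b i j)" "\<And>i j x. x \<in> half e \<Longrightarrow> i \<noteq> j \<Longrightarrow> 0 \<le> b i j x"
    and sub: "subsol b (half e) z" and nonneg: "\<And>\<Phi>. tests (half e) \<Phi> \<Longrightarrow> 0 \<le> BF b \<Phi> \<Phi>"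
  shows "weak_sol (sympart b) (half e) (posv (half e) z)"
    and "\<exists>I. (\<forall>i\<in>I. \<forall>x\<in>half e. 0 < z x $ i) \<and> (\<forall>i\<in>-I. \<forall>x\<in>half e. z x $ i \<le> 0) \<and>
      (\<forall>i\<in>-I. \<forall>j\<in>I. \<forall>x\<in>half e. sympart b i j x = 0)"
proof -
  let ?c = "sympart b" and ?D = "half e"
  show sol: "weak_sol ?c ?D (posv ?D z)"
    by (rule minimiser_weak_sol[OF open_half bounded_half z b(1) sub nonneg])
  have cc: "continuous_on (closure ?D) (?c i j)" for i j
    unfolding sympart_def[abs_def] by (intro continuous_intros b) auto
  have cD: "continuous_on ?D (?c i j)" for i j using cc closure_subset by (rule continuous_on_subset)
  have "\<exists>M. \<forall>x\<in>closure ?D. \<bar>?c i i x\<bar> \<le> M" for i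
  proof -
    have "compact (closure ?D)" using bounded_half by simp
    then have "bounded (?c i i ` closure ?D)" using cc compact_continuous_image compact_imp_bounded by blast
    then show ?thesis unfolding bounded_iff by auto
  qed
  then obtain m where m: "\<And>i x. x \<in> closure ?D \<Longrightarrow> \<bar>?c i i x\<bar> \<le> m i" by metis
  have mM: "m i \<le> (\<Sum>i\<in>UNIV. \<bar>m i\<bar>)" for i
  proof -
    have "\<bar>m i\<bar> \<le> (\<Sum>i\<in>UNIV. \<bar>m i\<bar>)" by (rule member_le_sum) auto
    then show ?thesis by simp
  qed
  have M: "\<bar>?c i i x\<bar> \<le> (\<Sum>i\<in>UNIV. \<bar>m i\<bar>)" if "x \<in> ?D" for i x
    using m[of x i] mM[of i] that closure_subset by fastforce
  obtain I where I: "\<forall>i\<in>I. \<forall>x\<in>?D. 0 < posv ?D z x $ i" "\<forall>i\<in>-I. \<forall>x\<in>?D. posv ?D z x $ i = 0"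
    "\<forall>i\<in>-I. \<forall>j\<in>I. \<forall>x\<in>?D. ?c i j x = 0"
    using weak_sol_dichotomy[OF open_half connected_half[OF e] continuous_on_posv[OF open_half bounded_half z]
        cutv_bounds(3)[OF open_half bounded_half z] cD _ M sol] b(2)
    by (force simp: sympart_def)
  show "\<exists>I. (\<forall>i\<in>I. \<forall>x\<in>half e. 0 < z x $ i) \<and> (\<forall>i\<in>-I. \<forall>x\<in>half e. z x $ i \<le> 0) \<and>
      (\<forall>i\<in>-I. \<forall>j\<in>I. \<forall>x\<in>half e. ?c i j x = 0)"
  proof (intro exI[of _ I] conjI ballI)
    show "0 < z x $ i" if "i \<in> I" "x \<in> ?D" for i x
      using I(1) that by (force simp: posv_def pos_on_def)
    show "z x $ i \<le> 0" if "i \<in> - I" "x \<in> ?D" for i x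
      using bspec[OF bspec[OF I(2) that(1)] that(2)] that(2) by (simp add: posv_def pos_on_def max_def split: if_splits)
  qed (use I(3) in auto)
qed

lemma BF_avg:
  fixes \<Phi> :: "real^'n \<Rightarrow> real^'m"
  assumes D: "open D" and c: "\<And>i j. continuous_on D (c i j)" "\<And>i j. continuous_on D (c' i j)" and t: "tests D \<Phi>"
  shows "BF (\<lambda>i j x. (c i j x + c' i j x) / 2) \<Phi> \<Phi> = (BF c \<Phi> \<Phi> + BF c' \<Phi> \<Phi>) / 2"
proof -
  let ?G = "\<lambda>x. \<Sum>i\<in>UNIV. gradient (\<lambda>y. \<Phi> y $ i) x \<bullet> gradient (\<lambda>y. \<Phi> y $ i) x"
  have C: "cc (\<lambda>x. ?G x - (\<Sum>i\<in>UNIV. \<Sum>j\<in>UNIV. c i j x * \<Phi> x $ i * \<Phi> x $ j))"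
    if "\<And>i j. continuous_on D (c i j)" for c
    by (intro cc_diff cc_sum cc_BF_grad[OF D that t t] cc_BF_pot[OF D that t t])
  have "BF (\<lambda>i j x. (c i j x + c' i j x) / 2) \<Phi> \<Phi> = integral UNIV (\<lambda>x.
      (1/2) * ((?G x - (\<Sum>i\<in>UNIV. \<Sum>j\<in>UNIV. c i j x * \<Phi> x $ i * \<Phi> x $ j)) +
       (?G x - (\<Sum>i\<in>UNIV. \<Sum>j\<in>UNIV. c' i j x * \<Phi> x $ i * \<Phi> x $ j))))"
    unfolding BF_def
  proof (intro arg_cong[where f="integral UNIV"] ext)
    fix x
    have "(\<Sum>i\<in>UNIV. \<Sum>j\<in>UNIV. (c i j x + c' i j x) / 2 * \<Phi> x $ i * \<Phi> x $ j) =
      (1/2) * ((\<Sum>i\<in>UNIV. \<Sum>j\<in>UNIV. c i j x * \<Phi> x $ i * \<Phi> x $ j) + (\<Sum>i\<in>UNIV. \<Sum>j\<in>UNIV. c' i j x * \<Phi> x $ i * \<Phi> x $ j))"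
      unfolding sum.distrib[symmetric] sum_distrib_left by (intro sum.cong refl) (simp add: field_simps)
    then show "?G x - (\<Sum>i\<in>UNIV. \<Sum>j\<in>UNIV. (c i j x + c' i j x) / 2 * \<Phi> x $ i * \<Phi> x $ j) =
      (1/2) * ((?G x - (\<Sum>i\<in>UNIV. \<Sum>j\<in>UNIV. c i j x * \<Phi> x $ i * \<Phi> x $ j)) +
       (?G x - (\<Sum>i\<in>UNIV. \<Sum>j\<in>UNIV. c' i j x * \<Phi> x $ i * \<Phi> x $ j)))" by simp
  qed
  also have "\<dots> = (1/2) * (BF c \<Phi> \<Phi> + BF c' \<Phi> \<Phi>)"
    unfolding BF_def using cc_integral_add[OF C[OF c(1)] C[OF c(2)]] by simp
  finally show ?thesis by simp
qed

lemma BF_pot_reflect: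
  fixes \<Phi> :: "real^'n \<Rightarrow> real^'m"
  assumes e: "unitK K e" and t: "tests \<Omega> \<Phi>"
  shows "BF (\<lambda>i j x. pot i j (reflect e x)) \<Phi> \<Phi> = BF pot (\<lambda>x. \<Phi> (reflect e x)) (\<lambda>x. \<Phi> (reflect e x))"
proof -
  note s = symm_reflect[OF e]
  have o: "orthogonal_transformation (reflect e)" using s by (simp add: symm_def)
  have c: "continuous_on \<Omega> (\<lambda>x. pot i j (reflect e x))" for i j
    by (rule continuous_on_compose2[OF pot_continuous_on(1)[OF order_refl] symm_continuous[OF s]]) (auto simp: symm_\<Omega>[OF s])
  from BF_orthogonal[OF o \<Omega>(1) c t t] show ?thesis by (simp add: reflect_reflect[OF e])
qed

lemma pot_refl_continuous: "unitK K e \<Longrightarrow> continuous_on (closure \<Omega>) (\<lambda>x. pot i j (reflect e x))"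
  by (rule continuous_on_compose2[OF pot_continuous symm_continuous[OF symm_reflect]]) (auto simp: symm_closure symm_reflect)

lemma tests_reflect_half: "unitK K e \<Longrightarrow> tests (half e) \<Phi> \<Longrightarrow> tests (half (- e)) (\<lambda>x. \<Phi> (reflect e x))"
  using tests_orthogonal[of "reflect e" "half e" \<Phi>] symm_reflect[of K e] reflect_vimage_half[of e] by (simp add: symm_def)

text \<open>The form with averaged potential is the mean of the energies of a function and of its
  reflection, so semistability of both halves makes it nonnegative. A proper split of the components
  would annihilate their coupling at \<open>y\<close> and at its mirror image alike, hence on both
  halves.\<close>

lemma one_signed_convex_jac:
  assumes e: "unitK K e" and ss: "semistable (half e)" "semistable (half (- e))"
    and cv: "\<forall>x\<in>\<Omega>. \<forall>i j. convex_on UNIV (\<lambda>S. jac i j x S)"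
  shows "(\<forall>x\<in>half e. \<forall>i. 0 \<le> w e x $ i) \<or> (\<forall>x\<in>half e. \<forall>i. w e x $ i \<le> 0)"
proof -
  let ?b = "\<lambda>i j x. (pot i j x + pot i j (reflect e x)) / 2"
  have r\<Omega>: "reflect e x \<in> \<Omega> \<longleftrightarrow> x \<in> \<Omega>" for x by (rule symm_\<Omega>[OF symm_reflect[OF e]])
  have b: "continuous_on (closure (half e)) (?b i j)" for i j
    by (intro continuous_intros continuous_on_subset[OF pot_continuous closure_half_subset]
        continuous_on_subset[OF pot_refl_continuous[OF e] closure_half_subset]) auto
  have b0: "0 \<le> ?b i j x" if "x \<in> half e" "i \<noteq> j" for i j x
    using that pot_nonneg[of x i j] pot_nonneg[of "reflect e x" i j] r\<Omega> half_subset[of e] by auto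
  have sub: "subsol ?b (half e) (w e)"
  proof (rule subsol_w[OF e b])
    fix i x assume x: "x \<in> half e" "0 < w e x $ i"
    then have xO: "x \<in> \<Omega>" using half_subset by blast
    have "wrhs e x $ i \<le> (\<Sum>j\<in>UNIV. (jac i j x (U x) + jac i j x (U (reflect e x))) / 2 * max 0 (U x $ j - U (reflect e x) $ j))"
      unfolding wrhs_def vector_minus_component
      by (rule rhs_convex_jac_le[OF xO]) (use cv xO x in \<open>auto simp: w_def\<close>)
    also have "\<dots> = (\<Sum>j\<in>UNIV. ?b i j x * max 0 (w e x $ j))"
      by (simp add: pot_def w_def jac_symm[OF symm_reflect[OF e]])
    finally show "wrhs e x $ i \<le> (\<Sum>j\<in>UNIV. ?b i j x * max 0 (w e x $ j))" .
  qed
  have nonneg: "0 \<le> BF ?b \<Phi> \<Phi>" if t: "tests (half e) \<Phi>" for \<Phi>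
  proof -
    have tO: "tests \<Omega> \<Phi>" using t half_subset by (rule tests_mono)
    have c: "continuous_on \<Omega> (pot i j)" "continuous_on \<Omega> (\<lambda>x. pot i j (reflect e x))" for i j
      using pot_continuous pot_refl_continuous[OF e] closure_subset by (blast intro: continuous_on_subset)+
    have "BF ?b \<Phi> \<Phi> = (BF pot \<Phi> \<Phi> + BF pot (\<lambda>x. \<Phi> (reflect e x)) (\<lambda>x. \<Phi> (reflect e x))) / 2"
      unfolding BF_pot_reflect[OF e tO, symmetric] by (rule BF_avg[OF \<Omega>(1) c tO])
    moreover have "0 \<le> BF pot \<Phi> \<Phi>" "0 \<le> BF pot (\<lambda>x. \<Phi> (reflect e x)) (\<lambda>x. \<Phi> (reflect e x))"
      using ss t tests_reflect_half[OF e t] by (auto simp: semistable_def)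
    ultimately show ?thesis by simp
  qed
  obtain I where I: "\<forall>i\<in>I. \<forall>x\<in>half e. 0 < w e x $ i" "\<forall>i\<in>-I. \<forall>x\<in>half e. w e x $ i \<le> 0"
    "\<forall>i\<in>-I. \<forall>j\<in>I. \<forall>x\<in>half e. sympart ?b i j x = 0"
    using posv_dichotomy(2)[OF e zero_trace_w[OF e] b b0 sub nonneg] by blast
  consider "I = {}" | "I = UNIV" | "I \<noteq> {}" "I \<noteq> UNIV" by blast
  then show ?thesis
  proof cases
    case 3
    then obtain i j x where ij: "i \<in> I" "j \<in> -I" and x: "x \<in> half e \<union> half (- e)" "0 < pot i j x"
      using coupling_half[OF e] by blast
    have ne: "i \<noteq> j" using ij by auto
    have z: "pot i j y = 0 \<and> pot i j (reflect e y) = 0" if y: "y \<in> half e" for y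
    proof -
      have yO: "y \<in> \<Omega>" "reflect e y \<in> \<Omega>" using y half_subset r\<Omega> by blast+
      have "sympart ?b j i y = 0" using I(3) ij y by blast
      then have "pot i j y + pot j i y + pot i j (reflect e y) + pot j i (reflect e y) = 0"
        by (simp add: sympart_def field_simps)
      moreover have "0 \<le> pot i j y" "0 \<le> pot j i y" "0 \<le> pot i j (reflect e y)" "0 \<le> pot j i (reflect e y)"
        using pot_nonneg yO ne by auto
      ultimately show ?thesis by (intro conjI; linarith)
    qed
    have "pot i j x = 0"
    proof (cases "x \<in> half e")
      case False
      then have "reflect e x \<in> half e" using x(1) reflect_half[OF unitK_minus[OF e]] by (simp add: reflect_minus)
      from z[OF this] show ?thesis by (simp add: reflect_reflect[OF e])
    qed (use z in blast)
    then show ?thesis using x(2) by simp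
  qed (use I in \<open>auto intro: less_imp_le\<close>)
qed

end

context morse_one
begin

text \<open>
  If \<open>w\<close> takes both signs, some components \<open>w\<^sub>i\<close> are positive and others \<open>w\<^sub>j\<close> negative on the
  half, and the positive parts on the two halves decouple from each other in the quadratic form.
  Neither of them solves the equation in all of \<open>\<Omega>\<close>, so both can be perturbed independently to
  negative energy, against Morse index one.
\<close>

lemma not_both_signs:
  assumes e: "unitK K e"
    and zp: "zero_trace (half e) z" "subsol pot (half e) z" "semistable (half e)"
    and zm: "zero_trace (half (- e)) z" "subsol pot (half (- e)) z" "semistable (half (- e))"
    and anti: "\<And>x. z (reflect e x) = - z x"
    and i: "x1 \<in> half e" "0 < z x1 $ i" and j: "x2 \<in> half e" "z x2 $ j < 0"
  shows False
proof -
  let ?D = "half e" and ?D' = "half (- e)" and ?c = "sympart pot"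
  have e': "unitK K (- e)" by (rule unitK_minus[OF e])
  have pc: "continuous_on (closure (half e)) (pot i j)" for e i j by (rule pot_continuous_on(2)[OF half_subset])
  have p0: "0 \<le> pot i j x" if "x \<in> half e" "i \<noteq> j" for e i j x using that pot_nonneg half_subset by blast
  have c0: "continuous_on \<Omega> (?c i j)" for i j
    unfolding sympart_def[abs_def] by (intro continuous_intros pot_continuous_on) auto
  have cl: "continuous_on (closure (half e)) (?c i j)" for e i j
    unfolding sympart_def[abs_def] by (intro continuous_intros pc) auto
  have cn: "0 \<le> ?c i j x" if "x \<in> \<Omega>" "i \<noteq> j" for i j x
    using pot_nonneg[OF that(1)] that(2) by (simp add: sympart_def)
  have ssD: "0 \<le> BF pot \<Phi> \<Phi>" if "semistable D" "tests D \<Phi>" for D \<Phi>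
    using that by (simp add: semistable_def)
  have "\<exists>I. (\<forall>i\<in>I. \<forall>x\<in>?D. 0 < z x $ i) \<and> (\<forall>i\<in>-I. \<forall>x\<in>?D. z x $ i \<le> 0) \<and>
      (\<forall>i\<in>-I. \<forall>j\<in>I. \<forall>x\<in>?D. ?c i j x = 0)"
    by (rule posv_dichotomy(2)[OF e zp(1) pc p0 zp(2)]) (assumption | rule ssD[OF zp(3)])+
  then obtain I where I: "\<forall>i\<in>I. \<forall>x\<in>?D. 0 < z x $ i" "\<forall>i\<in>-I. \<forall>x\<in>?D. z x $ i \<le> 0"
    "\<forall>i\<in>-I. \<forall>j\<in>I. \<forall>x\<in>?D. ?c i j x = 0"
    by (elim exE conjE)
  have "\<exists>I. (\<forall>i\<in>I. \<forall>x\<in>?D'. 0 < z x $ i) \<and> (\<forall>i\<in>-I. \<forall>x\<in>?D'. z x $ i \<le> 0) \<and>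
      (\<forall>i\<in>-I. \<forall>j\<in>I. \<forall>x\<in>?D'. ?c i j x = 0)"
    by (rule posv_dichotomy(2)[OF e' zm(1) pc p0 zm(2)]) (assumption | rule ssD[OF zm(3)])+
  then obtain J where J: "\<forall>i\<in>J. \<forall>x\<in>?D'. 0 < z x $ i" "\<forall>i\<in>-J. \<forall>x\<in>?D'. z x $ i \<le> 0"
    "\<forall>i\<in>-J. \<forall>j\<in>J. \<forall>x\<in>?D'. ?c i j x = 0"
    by (elim exE conjE)
  have iI: "i \<in> I" using I(2) i by force
  have x2': "reflect e x2 \<in> ?D'" using j(1) reflect_half[OF e] by simp
  have jJ: "j \<in> J" using J(2) x2' j(2) anti[of x2] by force
  have jI: "j \<notin> I" using I(1) j by force
  have iJ: "i \<notin> J"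
  proof
    assume "i \<in> J"
    then have "0 < z (reflect e x1) $ i" using J(1) reflect_half[OF e] i(1) by blast
    then show False using anti[of x1] i(2) by simp
  qed
  note oD = open_half[of e] bounded_half[of e] zp(1) and oD' = open_half[of "- e"] bounded_half[of "- e"] zm(1)
  define P where "P = posv ?D z"
  define N where "N = posv ?D' z"
  \<comment> \<open>The first variation of the symmetrised form at \<open>V\<close>, in the
    direction of a bump placed in component \<open>k\<close>.\<close>
  define L where "L V k y s = - integral UNIV (\<lambda>x. V x $ k * lap_bump y s x) -
    integral UNIV (\<lambda>x. (\<Sum>l\<in>UNIV. ?c l k x * V x $ l) * bump y s x)"
    for V :: "real^'n \<Rightarrow> real^'m" and k y s
  \<comment> \<open>If all these variations vanished, component \<open>k\<close> of \<open>V\<close>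
    would satisfy the strong maximum principle on all of \<open>\<Omega>\<close>, yet it is positive
    at \<open>p\<close> and zero at \<open>q\<close>.\<close>
  have exL: "\<exists>y s. 0 < s \<and> cball y s \<subseteq> \<Omega> \<and> L V k y s \<noteq> 0"
    if V: "\<And>k. continuous_on \<Omega> (\<lambda>x. V x $ k)" "\<And>k x. 0 \<le> V x $ k"
      and pos: "p \<in> \<Omega>" "0 < V p $ k" and zero: "q \<in> \<Omega>" "V q $ k = 0" for V :: "real^'n \<Rightarrow> real^'m" and k p q
  proof (rule ccontr)
    assume "\<not> ?thesis"
    then have L0: "L V k y s = 0" if "0 < s" "cball y s \<subseteq> \<Omega>" for y s using that by blast
    obtain M where M: "0 \<le> M" "\<And>i j x. x \<in> \<Omega> \<Longrightarrow> \<bar>pot i j x\<bar> \<le> M"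
      using jac_bounded unfolding pot_def by (metis ends_in_segment(1))
    have cM: "- M \<le> ?c k k x" if "x \<in> \<Omega>" for x
      using M(2)[OF that, of k k] by (simp add: sympart_def)
    have "(\<forall>x\<in>\<Omega>. V x $ k = 0) \<or> (\<forall>x\<in>\<Omega>. 0 < V x $ k)"
    proof (rule strong_maximum_principle[OF \<Omega>(1,2) V(1) V(2) M(1)])
      fix y s assume ys: "0 < (s::real)" "cball y s \<subseteq> \<Omega>"
      show "integral UNIV (\<lambda>x. V x $ k * lap_bump y s x) \<le> M * integral UNIV (\<lambda>x. V x $ k * bump y s x)"
      proof (rule weak_sol_component[where v = V and c = "?c" and D = \<Omega>])
        show "open \<Omega>" "0 < s" "cball y s \<subseteq> \<Omega>" by (rule \<Omega>(1) ys)+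
        show "continuous_on \<Omega> (\<lambda>x. V x $ i)" "0 \<le> V x $ i" for i x by (rule V)+
        show "continuous_on \<Omega> (?c i j)" for i j by (rule c0)
        show "0 \<le> ?c i j x" if "x \<in> \<Omega>" "i \<noteq> j" for i j x by (rule cn[OF that])
        show "- M \<le> ?c k k x" if "x \<in> \<Omega>" for x by (rule cM[OF that])
        show "- integral UNIV (\<lambda>x. V x $ k * lap_bump y s x) =
            integral UNIV (\<lambda>x. (\<Sum>l\<in>UNIV. ?c k l x * V x $ l) * bump y s x)"
          using L0[OF ys] by (simp add: L_def sympart_commute[of pot _ k])
      qed
    qed
    then show False using pos zero by force
  qed
  have Pc: "continuous_on S (\<lambda>x. P x $ k)" "0 \<le> P x $ k" for S k x
    unfolding P_def using continuous_on_posv[OF oD] cutv_bounds(3)[OF oD] by auto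
  have Nc: "continuous_on S (\<lambda>x. N x $ k)" "0 \<le> N x $ k" for S k x
    unfolding N_def using continuous_on_posv[OF oD'] cutv_bounds(3)[OF oD'] by auto
  have x1': "reflect e x1 \<in> ?D'" using i(1) reflect_half[OF e] by simp
  have notin: "x \<notin> ?D'" if "x \<in> ?D" for x using that half_disjoint by blast
  have P0: "P x $ k = 0" if "x \<notin> ?D" for x k using that by (simp add: P_def posv_def pos_on_def)
  have N0: "N x $ k = 0" if "x \<notin> ?D'" for x k using that by (simp add: N_def posv_def pos_on_def)
  have P0I: "P x $ k = 0" if "k \<notin> I" for x k
    using I(2) that by (auto simp: P_def posv_def pos_on_def max_def antisym)
  have N0J: "N x $ k = 0" if "k \<notin> J" for x k
    using J(2) that by (auto simp: N_def posv_def pos_on_def max_def antisym)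
  have "\<exists>y s. 0 < s \<and> cball y s \<subseteq> \<Omega> \<and> L P i y s \<noteq> 0"
  proof (rule exL[OF Pc])
    show "x1 \<in> \<Omega>" "reflect e x1 \<in> \<Omega>" using i(1) x1' half_subset by blast+
    show "0 < P x1 $ i" using i by (simp add: P_def posv_def pos_on_def)
    show "P (reflect e x1) $ i = 0" using P0 notin x1' by blast
  qed
  then obtain y1 s1 where b1: "0 < s1" "cball y1 s1 \<subseteq> \<Omega>" "L P i y1 s1 \<noteq> 0" by blast
  have "\<exists>y s. 0 < s \<and> cball y s \<subseteq> \<Omega> \<and> L N j y s \<noteq> 0"
  proof (rule exL[OF Nc])
    show "reflect e x2 \<in> \<Omega>" "x2 \<in> \<Omega>" using j(1) x2' half_subset by blast+
    show "0 < N (reflect e x2) $ j" using j x2' anti[of x2] by (simp add: N_def posv_def pos_on_def)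
    show "N x2 $ j = 0" using N0 notin j(1) by blast
  qed
  then obtain y2 s2 where b2: "0 < s2" "cball y2 s2 \<subseteq> \<Omega>" "L N j y2 s2 \<noteq> 0" by blast
  \<comment> \<open>Component \<open>j\<close> of \<open>P\<close> is zero, and its couplings to the
    positive components of \<open>P\<close> vanish, so \<open>P\<close> does not react to bumps in
    component \<open>j\<close>. This keeps the mixed terms of the 2 by 2 form small.\<close>
  have LPj: "L P j y s = 0" for y s
  proof -
    have *: "?c l j x * P x $ l = 0" for l x
    proof (cases "x \<in> ?D \<and> l \<in> I")
      case True
      then have "?c j l x = 0" using I(3) jI by blast
      then show ?thesis by (simp add: sympart_commute[of pot l])
    next
      case False
      then show ?thesis using P0 P0I by auto
    qed
    have "P x $ j = 0" for x using P0I jI by blast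
    then show ?thesis by (simp add: L_def *)
  qed
  have LNi: "L N i y s = 0" for y s
  proof -
    have *: "?c l i x * N x $ l = 0" for l x
    proof (cases "x \<in> ?D' \<and> l \<in> J")
      case True
      then have "?c i l x = 0" using J(3) iJ by blast
      then show ?thesis by (simp add: sympart_commute[of pot l])
    next
      case False
      then show ?thesis using N0 N0J by auto
    qed
    have "N x $ i = 0" for x using N0J iJ by blast
    then show ?thesis by (simp add: L_def *)
  qed
  define l1 l2 where "l1 = L P i y1 s1" and "l2 = L N j y2 s2"
  define B1 where "B1 x = bump y1 s1 x *\<^sub>R (axis i 1 :: real^'m)" for x
  define B2 where "B2 x = bump y2 s2 x *\<^sub>R (axis j 1 :: real^'m)" for x
  define f1 where "f1 k = cutv ?D z k" for k
  define f2 where "f2 k = cutv ?D' z k" for k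
  have tB: "tests \<Omega> B1" "tests \<Omega> B2"
    unfolding B1_def[abs_def] B2_def[abs_def] using b1 b2 by (auto intro!: tests_axis test_bump)
  have tf: "tests ?D (f1 k)" "tests ?D' (f2 k)" for k
    unfolding f1_def f2_def by (rule tests_cutv[OF oD] tests_cutv[OF oD'])+
  have tf': "tests \<Omega> (f1 k)" "tests \<Omega> (f2 k)" for k
    using tf tests_mono half_subset by blast+
  have lim: "(\<lambda>k. BF ?c (cutv (half d) z k) (\<lambda>x. bump y s x *\<^sub>R axis l 1)) \<longlonglongrightarrow> L (posv (half d) z) l y s"
    if "zero_trace (half d) z" "0 < s" for d y s l
    unfolding L_def by (rule BF_cutv_bump_lim[OF open_half bounded_half that(1) cl that(2)])
  have lims: "(\<lambda>k. BF ?c (f1 k) B1) \<longlonglongrightarrow> l1" "(\<lambda>k. BF ?c (f1 k) B2) \<longlonglongrightarrow> 0"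
    "(\<lambda>k. BF ?c (f2 k) B2) \<longlonglongrightarrow> l2" "(\<lambda>k. BF ?c (f2 k) B1) \<longlonglongrightarrow> 0"
    using lim[OF zp(1) b1(1), of y1 i] lim[OF zp(1) b2(1), of y2 j] lim[OF zm(1) b2(1), of y2 j] lim[OF zm(1) b1(1), of y1 i]
    unfolding P_def[symmetric] N_def[symmetric] LPj LNi f1_def f2_def B1_def[abs_def] B2_def[abs_def] l1_def l2_def
    by simp_all
  obtain q1 where q1: "q1 \<longlonglongrightarrow> 0" "\<And>k. BF pot (f1 k) (f1 k) \<le> q1 k"
    using BF_cutv_upper[OF oD pc zp(2)] unfolding f1_def by blast
  obtain q2 where q2: "q2 \<longlonglongrightarrow> 0" "\<And>k. BF pot (f2 k) (f2 k) \<le> q2 k"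
    using BF_cutv_upper[OF oD' pc zm(2)] unfolding f2_def by blast
  define m where "m = min (l1\<^sup>2) (l2\<^sup>2)"
  have m: "0 < m" "m \<le> l1\<^sup>2" "m \<le> l2\<^sup>2" using b1(3) b2(3) by (auto simp: m_def l1_def l2_def)
  define Q11 Q12 Q22 where "Q11 = l1\<^sup>2 * BF ?c B1 B1" and "Q12 = l1 * l2 * BF ?c B1 B2" and "Q22 = l2\<^sup>2 * BF ?c B2 B2"
  define n where "n = \<bar>Q11\<bar> + \<bar>Q12\<bar> + \<bar>Q22\<bar> + 1"
  have n: "0 < n" "\<bar>Q11\<bar> \<le> n" "\<bar>Q12\<bar> \<le> n" "\<bar>Q22\<bar> \<le> n" by (auto simp: n_def)
  \<comment> \<open>The step length. The linear gain is at least 2 r m, while each quadratic term is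
    at most r m / 2 because r n = m / 2. This leaves both diagonal entries below - r m and the mixed
    entry below r m.\<close>
  define r where "r = m / (2 * n)"
  have r: "0 < r" "r * n = m / 2" using m n by (auto simp: r_def)
  have rQ: "r\<^sup>2 * \<bar>Q\<bar> \<le> r * m / 2" if "\<bar>Q\<bar> \<le> n" for Q
  proof -
    have "r * (r * \<bar>Q\<bar>) \<le> r * (r * n)" using that r(1) by (intro mult_left_mono) auto
    then show ?thesis using r(2) by (simp add: power2_eq_square mult.assoc)
  qed
  define X where "X k x = f1 k x + (- r * l1) *\<^sub>R B1 x" for k x
  define Y where "Y k x = f2 k x + (- r * l2) *\<^sub>R B2 x" for k x
  have tXY: "tests \<Omega> (X k)" "tests \<Omega> (Y k)" for k
    unfolding X_def[abs_def] Y_def[abs_def] by (intro tests_add tests_scaleR tf' tB)+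
  have XX: "BF pot (X k) (X k) = BF pot (f1 k) (f1 k) + 2 * (- r * l1) * BF ?c (f1 k) B1 + (- r * l1)\<^sup>2 * BF ?c B1 B1" for k
    using BF_quadratic[where c = "?c" and t = "- r * l1", OF \<Omega>(1) c0 sympart_commute tf'(1)[of k] tB(1)]
    unfolding X_def[abs_def] BF_sympart[of pot "\<lambda>x. f1 k x + (- r * l1) *\<^sub>R B1 x"] BF_sympart[of pot "f1 k"] .
  have YY: "BF pot (Y k) (Y k) = BF pot (f2 k) (f2 k) + 2 * (- r * l2) * BF ?c (f2 k) B2 + (- r * l2)\<^sup>2 * BF ?c B2 B2" for k
    using BF_quadratic[where c = "?c" and t = "- r * l2", OF \<Omega>(1) c0 sympart_commute tf'(2)[of k] tB(2)]
    unfolding Y_def[abs_def] BF_sympart[of pot "\<lambda>x. f2 k x + (- r * l2) *\<^sub>R B2 x"] BF_sympart[of pot "f2 k"] .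
  have XY: "BF ?c (X k) (Y k) = (- r * l1) * BF ?c (f2 k) B1 + (- r * l2) * (BF ?c (f1 k) B2 + (- r * l1) * BF ?c B1 B2)" for k
  proof -
    have comm: "BF ?c S T = BF ?c T S" for S T by (rule BF_commute) (rule sympart_commute)
    have "BF ?c (X k) (Y k) = BF ?c (X k) (f2 k) + (- r * l2) * BF ?c (X k) B2"
      unfolding Y_def[abs_def] by (rule BF_add_right[where c = "?c", OF \<Omega>(1) c0 tf'(2) tB(2) tXY(1)])
    also have "BF ?c (X k) (f2 k) = BF ?c (f2 k) (f1 k) + (- r * l1) * BF ?c (f2 k) B1"
      unfolding comm[of "X k"] unfolding X_def[abs_def] by (rule BF_add_right[where c = "?c", OF \<Omega>(1) c0 tf'(1) tB(1) tf'(2)])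
    also have "BF ?c (f2 k) (f1 k) = 0"
      unfolding comm[of "f2 k"] by (rule BF_disjoint[OF tf half_disjoint])
    also have "BF ?c (X k) B2 = BF ?c B2 (f1 k) + (- r * l1) * BF ?c B2 B1"
      unfolding comm[of "X k"] unfolding X_def[abs_def] by (rule BF_add_right[where c = "?c", OF \<Omega>(1) c0 tf'(1) tB(1) tB(2)])
    finally show ?thesis unfolding comm[of B2] by simp
  qed
  have limX: "(\<lambda>k. q1 k + 2 * (- r * l1) * BF ?c (f1 k) B1 + (- r * l1)\<^sup>2 * BF ?c B1 B1) \<longlonglongrightarrow>
      0 + 2 * (- r * l1) * l1 + (- r * l1)\<^sup>2 * BF ?c B1 B1"
    by (intro tendsto_intros q1 lims)
  have limY: "(\<lambda>k. q2 k + 2 * (- r * l2) * BF ?c (f2 k) B2 + (- r * l2)\<^sup>2 * BF ?c B2 B2) \<longlonglongrightarrow>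
      0 + 2 * (- r * l2) * l2 + (- r * l2)\<^sup>2 * BF ?c B2 B2"
    by (intro tendsto_intros q2 lims)
  have limXY: "(\<lambda>k. \<bar>BF ?c (X k) (Y k)\<bar>) \<longlonglongrightarrow> \<bar>(- r * l1) * 0 + (- r * l2) * (0 + (- r * l1) * BF ?c B1 B2)\<bar>"
    unfolding XY by (intro tendsto_intros lims)
  have rm: "0 < r * m" using r m by simp
  have bX: "0 + 2 * (- r * l1) * l1 + (- r * l1)\<^sup>2 * BF ?c B1 B1 < - (r * m)"
  proof -
    have "(- r * l1)\<^sup>2 * BF ?c B1 B1 = r\<^sup>2 * Q11" by (simp add: Q11_def power_mult_distrib)
    also have "\<dots> \<le> r\<^sup>2 * \<bar>Q11\<bar>" by (intro mult_left_mono) auto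
    also have "\<dots> \<le> r * m / 2" by (rule rQ[OF n(2)])
    finally have "(- r * l1)\<^sup>2 * BF ?c B1 B1 \<le> r * m / 2" .
    moreover have "r * m \<le> r * l1\<^sup>2" using r m by (intro mult_left_mono) auto
    moreover have "2 * (- r * l1) * l1 = - 2 * (r * l1\<^sup>2)" by (simp add: power2_eq_square)
    ultimately show ?thesis using rm by linarith
  qed
  have bY: "0 + 2 * (- r * l2) * l2 + (- r * l2)\<^sup>2 * BF ?c B2 B2 < - (r * m)"
  proof -
    have "(- r * l2)\<^sup>2 * BF ?c B2 B2 = r\<^sup>2 * Q22" by (simp add: Q22_def power_mult_distrib)
    also have "\<dots> \<le> r\<^sup>2 * \<bar>Q22\<bar>" by (intro mult_left_mono) auto
    also have "\<dots> \<le> r * m / 2" by (rule rQ[OF n(4)])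
    finally have "(- r * l2)\<^sup>2 * BF ?c B2 B2 \<le> r * m / 2" .
    moreover have "r * m \<le> r * l2\<^sup>2" using r m by (intro mult_left_mono) auto
    moreover have "2 * (- r * l2) * l2 = - 2 * (r * l2\<^sup>2)" by (simp add: power2_eq_square)
    ultimately show ?thesis using rm by linarith
  qed
  have bXY: "\<bar>(- r * l1) * 0 + (- r * l2) * (0 + (- r * l1) * BF ?c B1 B2)\<bar> < r * m"
  proof -
    have "\<bar>(- r * l1) * 0 + (- r * l2) * (0 + (- r * l1) * BF ?c B1 B2)\<bar> = \<bar>r\<^sup>2 * Q12\<bar>"
      by (simp add: Q12_def power2_eq_square mult_ac)
    also have "\<dots> = r\<^sup>2 * \<bar>Q12\<bar>" by (simp add: abs_mult)
    also have "\<dots> \<le> r * m / 2" by (rule rQ[OF n(3)])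
    finally show ?thesis using rm by linarith
  qed
  have "eventually (\<lambda>k. q1 k + 2 * (- r * l1) * BF ?c (f1 k) B1 + (- r * l1)\<^sup>2 * BF ?c B1 B1 < - (r * m) \<and>
      q2 k + 2 * (- r * l2) * BF ?c (f2 k) B2 + (- r * l2)\<^sup>2 * BF ?c B2 B2 < - (r * m) \<and>
      \<bar>BF ?c (X k) (Y k)\<bar> < r * m) sequentially"
    by (intro eventually_conj order_tendstoD(2)[OF limX bX] order_tendstoD(2)[OF limY bY] order_tendstoD(2)[OF limXY bXY])
  then obtain k where k: "q1 k + 2 * (- r * l1) * BF ?c (f1 k) B1 + (- r * l1)\<^sup>2 * BF ?c B1 B1 < - (r * m)"
      "q2 k + 2 * (- r * l2) * BF ?c (f2 k) B2 + (- r * l2)\<^sup>2 * BF ?c B2 B2 < - (r * m)"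
      "\<bar>BF ?c (X k) (Y k)\<bar> < r * m"
    unfolding eventually_sequentially by blast
  show False
  proof (rule index_contra_bilinear[OF tXY])
    show "BF pot (X k) (X k) < - (r * m)" unfolding XX using k(1) q1(2)[of k] by linarith
    show "BF pot (Y k) (Y k) < - (r * m)" unfolding YY using k(2) q2(2)[of k] by linarith
    show "\<bar>BF ?c (X k) (Y k)\<bar> \<le> r * m" using k(3) by simp
  qed
qed

text \<open>The tangent may be taken at \<open>U x\<close> in either half, so \<open>w\<close> is a
  subsolution with the same potential \<open>pot\<close> on both sides. A negative component on
  \<open>half e\<close> is, by antisymmetry, a positive one on \<open>half (- e)\<close>.\<close>

lemma one_signed_convex:
  assumes e: "unitK K e" and ss: "semistable (half e)" "semistable (half (- e))"
    and cv: "\<forall>x\<in>\<Omega>. \<forall>i. convex_on UNIV (\<lambda>S. rhs x S $ i)"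
  shows "(\<forall>x\<in>half e. \<forall>i. 0 \<le> w e x $ i) \<or> (\<forall>x\<in>half e. \<forall>i. w e x $ i \<le> 0)"
proof (rule ccontr)
  assume "\<not> ?thesis"
  then obtain x1 i x2 j where x: "x1 \<in> half e" "0 < w e x1 $ i" "x2 \<in> half e" "w e x2 $ j < 0"
    by (auto simp: not_le)
  have sub: "subsol pot (half e) (w e)" if e: "unitK K e" for e
  proof (rule subsol_w[OF e pot_continuous_on(2)[OF half_subset]])
    fix i x assume x: "x \<in> half e" "0 < w e x $ i"
    then have xO: "x \<in> \<Omega>" using half_subset by blast
    have "wrhs e x $ i \<le> (\<Sum>j\<in>UNIV. jac i j x (U x) * (U x $ j - U (reflect e x) $ j))"
      unfolding wrhs_def vector_minus_component by (rule rhs_convex_le[OF xO]) (use cv xO in blast)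
    also have "\<dots> \<le> (\<Sum>j\<in>UNIV. jac i j x (U x) * max 0 (w e x $ j))"
    proof (rule sum_mono)
      fix j
      show "jac i j x (U x) * (U x $ j - U (reflect e x) $ j) \<le> jac i j x (U x) * max 0 (w e x $ j)"
        using jac_pos_part_le[OF xO, of "w e x" i j "U x"] x(2) by (simp add: w_def)
    qed
    finally show "wrhs e x $ i \<le> (\<Sum>j\<in>UNIV. pot i j x * max 0 (w e x $ j))" by (simp add: pot_def)
  qed
  have e': "unitK K (- e)" by (rule unitK_minus[OF e])
  show False
    by (rule not_both_signs[OF e zero_trace_w[OF e] sub[OF e] ss(1) _ _ ss(2) w_reflect[OF e] x])
      (use zero_trace_w[OF e'] sub[OF e'] in \<open>simp_all add: w_minus\<close>)
qed

end

subsection \<open>Rotating planes\<close>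

context elliptic_system
begin

lemma w_zero_half:
  assumes e: "unitK K e" and z: "\<And>x i. x \<in> half e \<Longrightarrow> w e x $ i = 0" and x: "x \<in> \<Omega>"
  shows "w e x = 0"
proof -
  consider "x \<in> half e" | "e \<bullet> x = 0" | "reflect e x \<in> half e"
    using x reflect_half[OF unitK_minus[OF e], of x] by (fastforce simp: half_def reflect_minus)
  then show ?thesis
  proof cases
    case 3
    then have "w e (reflect e x) = 0" using z by (simp add: vec_eq_iff)
    then show ?thesis using w_reflect[OF e, of x] by simp
  qed (use z in \<open>auto simp: vec_eq_iff w_def reflect_fix\<close>)
qed

text \<open>Componentwise strong maximum principle with mean-value coefficients. If some component
  vanished and another did not, the equation of the vanishing one would force their coupling to be
  zero at \<open>U y\<close> and at \<open>U (reflect e y)\<close>, that is, on both halves.\<close>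

lemma w_positive:
  assumes e: "unitK K e" and nn: "\<And>x i. x \<in> half e \<Longrightarrow> 0 \<le> w e x $ i"
  shows "(\<forall>x\<in>\<Omega>. w e x = 0) \<or> (\<forall>x\<in>half e. \<forall>i. 0 < w e x $ i)"
proof -
  have r\<Omega>: "reflect e x \<in> \<Omega> \<longleftrightarrow> x \<in> \<Omega>" for x by (rule symm_\<Omega>[OF symm_reflect[OF e]])
  obtain M where M: "0 \<le> M" "\<And>i j x y z Z. x \<in> \<Omega> \<Longrightarrow> y \<in> \<Omega> \<Longrightarrow> z \<in> \<Omega> \<Longrightarrow> Z \<in> closed_segment (U y) (U z) \<Longrightarrow> \<bar>jac i j x Z\<bar> \<le> M"
    using jac_bounded by blast
  have wc: "continuous_on (half e) (\<lambda>x. w e x $ i)" for i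
    using half_subset closure_subset
    by (intro continuous_on_component continuous_on_subset[OF w_continuous[OF e]]) blast
  have wC1: "C1_on (half e) (\<lambda>x. w e x $ i)" for i
    using zero_trace_w[OF e] by (simp add: zero_trace_def)
  have tb: "test (half e) (bump y s)" if "0 < s" "cball y s \<subseteq> half e" for y s
    using that by (intro test_bump) auto
  have tbO: "test \<Omega> (bump y s)" if "0 < s" "cball y s \<subseteq> half e" for y s
    using tb[OF that] half_subset by (rule test_mono)
  have eqn: "- integral UNIV (\<lambda>x. w e x $ i * lap_bump y s x) = integral UNIV (\<lambda>x. wrhs e x $ i * bump y s x)"
    if s: "0 < s" "cball y s \<subseteq> half e" for i y s
    unfolding w_eq[OF e tbO[OF s], symmetric] integral_by_parts_bump[OF less_imp_le[OF s(1)] s(2) open_half wC1] ..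
  \<comment> \<open>The mean-value point depends on \<open>x\<close> in an uncontrolled way. It is
    therefore used only for this pointwise bound, while the integrals contain the continuous
    \<open>wrhs\<close>.\<close>
  have low: "- M * w e x $ i \<le> wrhs e x $ i" if x: "x \<in> half e" for i x
  proof -
    have xO: "x \<in> \<Omega>" "reflect e x \<in> \<Omega>" using x half_subset r\<Omega> by blast+
    obtain Z where Z: "Z \<in> closed_segment (U (reflect e x)) (U x)"
      "wrhs e x $ i = (\<Sum>j\<in>UNIV. jac i j x Z * w e x $ j)"
      using rhs_mean_value[OF xO(1), of "U (reflect e x)" "U x" i] by (auto simp: wrhs_def w_def)
    have "- M * w e x $ i \<le> jac i i x Z * w e x $ i"
      using M(2)[OF xO(1,2,1) Z(1), of i i] nn[OF x] by (intro mult_right_mono) auto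
    also have "\<dots> \<le> (\<Sum>j\<in>UNIV. jac i j x Z * w e x $ j)"
    proof -
      have "(\<Sum>j\<in>UNIV. jac i j x Z * w e x $ j) = jac i i x Z * w e x $ i + (\<Sum>j\<in>UNIV - {i}. jac i j x Z * w e x $ j)"
        by (simp add: sum.remove[of UNIV i])
      moreover have "0 \<le> (\<Sum>j\<in>UNIV - {i}. jac i j x Z * w e x $ j)"
        using jac_nonneg[OF xO(1), of i] nn[OF x] by (intro sum_nonneg mult_nonneg_nonneg) auto
      ultimately show ?thesis by simp
    qed
    finally show ?thesis by (simp add: Z(2))
  qed
  have dich: "(\<forall>x\<in>half e. w e x $ i = 0) \<or> (\<forall>x\<in>half e. 0 < w e x $ i)" for i
  proof (rule strong_maximum_principle[OF open_half connected_half[OF e] wc nn M(1)])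
    fix y s assume s: "0 < (s::real)" "cball y s \<subseteq> half e"
    have "integral UNIV (\<lambda>x. - M * (w e x $ i * bump y s x)) \<le> integral UNIV (\<lambda>x. wrhs e x $ i * bump y s x)"
    proof (rule cc_integral_mono)
      have "cc (\<lambda>x. w e x $ i * bump y s x)"
        using csupp_cc[OF csupp_mult[OF open_half test_csupp[OF tb[OF s]] wc]] by (simp add: mult.commute)
      then show "cc (\<lambda>x. - M * (w e x $ i * bump y s x))" by (rule cc_cmult)
      show "cc (\<lambda>x. wrhs e x $ i * bump y s x)" by (rule wrhs_cc[OF e tbO[OF s]])
      fix x
      show "- M * (w e x $ i * bump y s x) \<le> wrhs e x $ i * bump y s x"
      proof (cases "x \<in> half e")
        case True
        from mult_right_mono[OF low[OF True, of i] bump_nonneg[of y s x]] show ?thesis by (simp add: mult.assoc)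
      qed (simp add: test_outside[OF tb[OF s]])
    qed
    then show "integral UNIV (\<lambda>x. w e x $ i * lap_bump y s x) \<le> M * integral UNIV (\<lambda>x. w e x $ i * bump y s x)"
      using eqn[OF s, of i] by simp
  qed auto
  define I where "I = {i. \<forall>x\<in>half e. 0 < w e x $ i}"
  have zI: "w e x $ i = 0" if "i \<notin> I" "x \<in> half e" for i x using dich[of i] that by (auto simp: I_def)
  consider "I = {}" | "I = UNIV" | "I \<noteq> {}" "I \<noteq> UNIV" by blast
  then show ?thesis
  proof cases
    case 1
    then show ?thesis using zI w_zero_half[OF e] by blast
  next
    case 2
    then show ?thesis by (auto simp: I_def)
  next
    case 3
    then obtain i j x where ij: "i \<notin> I" "j \<in> I" and x: "x \<in> half e \<union> half (- e)" "0 < pot i j x"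
      using coupling_half[OF e, of "- I"] by auto
    have wr: "wrhs e y $ i = 0" if "y \<in> half e" for y
    proof (rule fundamental_lemma_bump[OF open_half _ _ that])
      show "continuous_on (half e) (\<lambda>x. wrhs e x $ i)"
      proof -
        have "continuous_on (half e) (\<lambda>x. (case (x, U x) of (x, S) \<Rightarrow> rhs x S) - (case (x, U (reflect e x)) of (x, S) \<Rightarrow> rhs x S))"
          by (intro continuous_on_diff continuous_on_compose2[OF rhs_continuous] continuous_on_Pair continuous_on_id
              continuous_on_subset[OF U_continuous] continuous_on_subset[OF U_symm_continuous[OF symm_reflect[OF e]]])
            (use half_subset closure_subset in fastforce)+
        then have "continuous_on (half e) (wrhs e)" by (simp add: wrhs_def[abs_def])
        then show ?thesis by (rule continuous_on_component)
      qed
      fix y s assume s: "0 < (s::real)" "cball y s \<subseteq> half e"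
      have *: "w e x $ i * lap_bump y s x = 0" for x
      proof (cases "x \<in> half e")
        case False
        then have "x \<notin> ball y s" using s(2) ball_subset_cball by blast
        from bp_outside[OF _ this] s(1) show ?thesis by (simp add: lap_bump_def)
      qed (simp add: zI[OF ij(1)])
      show "integral UNIV (\<lambda>x. wrhs e x $ i * bump y s x) = 0"
        unfolding eqn[OF s, symmetric] * by simp
    qed
    have z: "pot i j y = 0 \<and> pot i j (reflect e y) = 0" if y: "y \<in> half e" for y
    proof -
      have yO: "y \<in> \<Omega>" using y half_subset by blast
      have le: "U (reflect e y) $ l \<le> U y $ l" for l using nn[OF y, of l] by (simp add: w_def)
      have eq: "U (reflect e y) $ i = U y $ i" using zI[OF ij(1) y] by (simp add: w_def)
      have lt: "U (reflect e y) $ j < U y $ j" using ij(2) y by (simp add: I_def w_def)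
      have r: "rhs y (U y) $ i = rhs y (U (reflect e y)) $ i" using wr[OF y] by (simp add: wrhs_def)
      show ?thesis
        using rhs_eq_jac_zero[OF yO le eq lt r] by (simp add: pot_def jac_symm[OF symm_reflect[OF e]])
    qed
    have "pot i j x = 0"
    proof (cases "x \<in> half e")
      case False
      then have "reflect e x \<in> half e" using x(1) reflect_half[OF unitK_minus[OF e]] by (simp add: reflect_minus)
      from z[OF this] show ?thesis by (simp add: reflect_reflect[OF e])
    qed (use z in blast)
    then show ?thesis using x(2) by simp
  qed
qed

text \<open>Maximum principle in small measure: the negative part of \<open>w\<close> lives in
  \<open>S\<close>, its Dirichlet energy is dominated by the constant potential \<open>M\<close> up
  to a null sequence, and the Poincare inequality absorbs that potential. The threshold
  \<open>k\<close> does not depend on \<open>e\<close>, as needed when the hyperplane moves.\<close>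

lemma w_nonneg_small:
  "\<exists>k>0. \<forall>e S. unitK K e \<longrightarrow> S \<in> lmeasurable \<longrightarrow> measure lebesgue S \<le> k \<longrightarrow>
    (\<forall>x\<in>half e - S. \<forall>i. 0 \<le> w e x $ i) \<longrightarrow> (\<forall>x\<in>half e. \<forall>i. 0 \<le> w e x $ i)"
proof -
  obtain M where M: "0 \<le> M" "\<And>i j x y z Z. x \<in> \<Omega> \<Longrightarrow> y \<in> \<Omega> \<Longrightarrow> z \<in> \<Omega> \<Longrightarrow> Z \<in> closed_segment (U y) (U z) \<Longrightarrow> \<bar>jac i j x Z\<bar> \<le> M"
    using jac_bounded by blast
  let ?m = "real CARD('m)"
  \<comment> \<open>Summing over all pairs of components costs a factor \<open>?m\<close>, so the
    potential contributes at most half of the squared L^2 norm.\<close>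
  define \<eta> where "\<eta> = 1 / (2 * (M * ?m + 1))"
  have Mm: "0 \<le> M * ?m" using M(1) by simp
  have \<eta>: "0 < \<eta>" "\<eta> * (M * ?m) \<le> 1/2" using Mm by (auto simp: \<eta>_def divide_simps)
  obtain k where k: "0 < k" "\<And>S u. S \<in> lmeasurable \<Longrightarrow> measure lebesgue S \<le> k \<Longrightarrow> test UNIV (u :: real^'n \<Rightarrow> real) \<Longrightarrow>
      (\<And>x. x \<notin> S \<Longrightarrow> u x = 0) \<Longrightarrow> integral UNIV (\<lambda>x. (u x)\<^sup>2) \<le> \<eta> * integral UNIV (\<lambda>x. gradient u x \<bullet> gradient u x)"
    using small_set_poincare[OF \<eta>(1)] by blast
  have "0 \<le> w e x $ i" if e: "unitK K e" and S: "S \<in> lmeasurable" "measure lebesgue S \<le> k"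
    and nn: "\<forall>x\<in>half e - S. \<forall>i. 0 \<le> w e x $ i" and x: "x \<in> half e" for e S x i
  proof -
    let ?D = "half e" and ?z = "\<lambda>x. - w e x" and ?b = "\<lambda>i j x. M"
    note oD = open_half[of e] bounded_half[of e] zero_trace_minus[OF zero_trace_w[OF e]]
    have r\<Omega>: "reflect e x \<in> \<Omega> \<longleftrightarrow> x \<in> \<Omega>" for x by (rule symm_\<Omega>[OF symm_reflect[OF e]])
    have sub: "subsol ?b ?D ?z"
    proof (rule subsolI[OF oD, of _ "\<lambda>x. - wrhs e x"])
      fix i \<phi> assume t: "test ?D \<phi>"
      then have tO: "test \<Omega> \<phi>" using half_subset by (rule test_mono)
      show "cc (\<lambda>x. (- wrhs e x) $ i * \<phi> x)" using cc_minus[OF wrhs_cc[OF e tO, of i]] by simp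
      have "gradient (\<lambda>y. (- w e y) $ i) x \<bullet> gradient \<phi> x = - (gradient (\<lambda>y. w e y $ i) x \<bullet> gradient \<phi> x)" for x
      proof (cases "x \<in> ?D")
        case True
        have "C1_on ?D (\<lambda>y. w e y $ i)" using zero_trace_w[OF e] by (simp add: zero_trace_def)
        from gradient_minus[OF C1_onD[OF this True]] show ?thesis by simp
      qed (simp add: test_outside[OF t])
      then show "integral UNIV (\<lambda>x. gradient (\<lambda>y. (- w e y) $ i) x \<bullet> gradient \<phi> x) = integral UNIV (\<lambda>x. (- wrhs e x) $ i * \<phi> x)"
        using w_eq[OF e tO, of i] by simp
    next
      fix i x assume x: "x \<in> ?D" "0 < (- w e x) $ i"
      then have xO: "x \<in> \<Omega>" "reflect e x \<in> \<Omega>" using half_subset r\<Omega> by blast+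
      obtain Z where Z: "Z \<in> closed_segment (U x) (U (reflect e x))"
        "(- wrhs e x) $ i = (\<Sum>j\<in>UNIV. jac i j x Z * (- w e x) $ j)"
        using rhs_mean_value[OF xO(1), of "U x" "U (reflect e x)" i] by (auto simp: wrhs_def w_def)
      have "jac i j x Z * (- w e x) $ j \<le> M * max 0 ((- w e x) $ j)" for j
      proof -
        have "jac i j x Z * (- w e x) $ j \<le> jac i j x Z * max 0 ((- w e x) $ j)"
          using x(2) by (intro jac_pos_part_le[OF xO(1)]) simp
        also have "\<dots> \<le> M * max 0 ((- w e x) $ j)"
          using M(2)[OF xO(1) xO Z(1), of i j] by (intro mult_right_mono) auto
        finally show ?thesis .
      qed
      then show "(- wrhs e x) $ i \<le> (\<Sum>j\<in>UNIV. M * max 0 ((- w e x) $ j))"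
        unfolding Z(2) by (rule sum_mono)
    qed auto
    obtain q where q: "q \<longlonglongrightarrow> 0" "\<And>n. BF ?b (cutv ?D ?z n) (cutv ?D ?z n) \<le> q n"
      using BF_cutv_upper[OF oD _ sub] by auto
    define s where "s n = (\<Sum>i\<in>UNIV. integral UNIV (\<lambda>x. (cutv ?D ?z n x $ i)\<^sup>2))" for n
    have t: "test ?D (\<lambda>x. cutv ?D ?z n x $ i)" for n i using tests_cutv[OF oD] by (simp add: tests_def)
    have c2: "cc (\<lambda>x. (cutv ?D ?z n x $ i)\<^sup>2)" for n i
      using cc_power[OF test_cc[OF t[of n i]], of 1] by (simp add: numeral_2_eq_2)
    have "s n \<le> 2 * \<eta> * q n" for n
    proof -
      let ?C = "cutv ?D ?z n"
      have C: "continuous_on ?D (?b i j)" for i j by auto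
      have "BF ?b ?C ?C = (\<Sum>i\<in>UNIV. integral UNIV (\<lambda>x. gradient (\<lambda>y. ?C y $ i) x \<bullet> gradient (\<lambda>y. ?C y $ i) x)) -
          (\<Sum>i\<in>UNIV. \<Sum>j\<in>UNIV. integral UNIV (\<lambda>x. M * ?C x $ i * ?C x $ j))"
        by (rule BF_eq[OF oD(1) C tests_cutv[OF oD] tests_cutv[OF oD]])
      moreover have "(\<Sum>i\<in>UNIV. \<Sum>j\<in>UNIV. integral UNIV (\<lambda>x. M * ?C x $ i * ?C x $ j)) \<le> M * ?m * s n"
      proof -
        have "integral UNIV (\<lambda>x. M * ?C x $ i * ?C x $ j) \<le> M / 2 * (integral UNIV (\<lambda>x. (?C x $ i)\<^sup>2) + integral UNIV (\<lambda>x. (?C x $ j)\<^sup>2))" for i j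
        proof -
          have "integral UNIV (\<lambda>x. M * (?C x $ i * ?C x $ j)) \<le> integral UNIV (\<lambda>x. M / 2 * ((?C x $ i)\<^sup>2 + (?C x $ j)\<^sup>2))"
          proof (intro cc_integral_mono cc_cmult cc_mult cc_add c2 test_cc[OF t])
            fix x
            have "0 \<le> (?C x $ i - ?C x $ j)\<^sup>2" by simp
            then have "?C x $ i * ?C x $ j \<le> 1/2 * ((?C x $ i)\<^sup>2 + (?C x $ j)\<^sup>2)" by (simp add: power2_diff)
            from mult_left_mono[OF this M(1)]
            show "M * (?C x $ i * ?C x $ j) \<le> M / 2 * ((?C x $ i)\<^sup>2 + (?C x $ j)\<^sup>2)" by simp
          qed
          also have "\<dots> = M / 2 * (integral UNIV (\<lambda>x. (?C x $ i)\<^sup>2) + integral UNIV (\<lambda>x. (?C x $ j)\<^sup>2))"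
            using cc_integral_add[OF c2 c2, of n i n j] by simp
          finally show ?thesis by (simp add: mult.assoc)
        qed
        then have "(\<Sum>i\<in>UNIV. \<Sum>j\<in>UNIV. integral UNIV (\<lambda>x. M * ?C x $ i * ?C x $ j)) \<le>
            (\<Sum>i\<in>UNIV. \<Sum>j\<in>UNIV. M / 2 * (integral UNIV (\<lambda>x. (?C x $ i)\<^sup>2) + integral UNIV (\<lambda>x. (?C x $ j)\<^sup>2)))"
          by (intro sum_mono)
        also have "\<dots> = M / 2 * (\<Sum>i\<in>UNIV. \<Sum>j\<in>UNIV. integral UNIV (\<lambda>x. (?C x $ i)\<^sup>2) + integral UNIV (\<lambda>x. (?C x $ j)\<^sup>2))"
          by (simp only: sum_distrib_left)
        also have "\<dots> = M * ?m * s n"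
          by (simp add: sum.distrib s_def sum_distrib_left[symmetric])
        finally show ?thesis .
      qed
      moreover have "s n \<le> \<eta> * (\<Sum>i\<in>UNIV. integral UNIV (\<lambda>x. gradient (\<lambda>y. ?C y $ i) x \<bullet> gradient (\<lambda>y. ?C y $ i) x))"
        unfolding s_def sum_distrib_left
      proof (rule sum_mono)
        fix i
        show "integral UNIV (\<lambda>x. (?C x $ i)\<^sup>2) \<le> \<eta> * integral UNIV (\<lambda>x. gradient (\<lambda>y. ?C y $ i) x \<bullet> gradient (\<lambda>y. ?C y $ i) x)"
        proof (rule k(2)[OF S test_mono[OF t subset_UNIV]])
          fix x assume "x \<notin> S"
          then have "x \<notin> ?D \<or> - w e x $ i \<le> 0" using nn by auto
          then show "?C x $ i = 0" by (auto simp: cutv_def cut_def intro!: trunc_eq_0(1) intro: order_trans[of _ 0])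
        qed
      qed
      ultimately have "s n \<le> \<eta> * (q n + M * ?m * s n)"
        using q(2)[of n] \<eta>(1) by (smt (verit) mult_left_mono)
      also have "\<dots> = \<eta> * q n + (\<eta> * (M * ?m)) * s n" by (simp add: algebra_simps)
      also have "(\<eta> * (M * ?m)) * s n \<le> 1/2 * s n"
        using \<eta>(2) by (intro mult_right_mono) (auto simp: s_def intro!: sum_nonneg cc_integral_nonneg c2)
      finally show ?thesis by simp
    qed
    moreover have "(\<lambda>n. 2 * \<eta> * q n) \<longlonglongrightarrow> 2 * \<eta> * 0" by (intro tendsto_intros q)
    moreover have "s \<longlonglongrightarrow> (\<Sum>i\<in>UNIV. integral UNIV (\<lambda>x. 1 * posv ?D ?z x $ i * posv ?D ?z x $ i))"
    proof -
      have "(\<lambda>n. integral UNIV (\<lambda>x. 1 * cutv ?D ?z n x $ i * cutv ?D ?z n x $ i)) \<longlonglongrightarrow> integral UNIV (\<lambda>x. 1 * posv ?D ?z x $ i * posv ?D ?z x $ i)" for i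
        by (rule cutv_integral_lim[OF oD, where H="\<lambda>x. posv ?D ?z x $ i"])
          (use cutv_bounds[OF oD] in \<open>auto intro!: cutv_lim[OF oD] test_cc[OF t] cc_posv[OF oD]\<close>)
      then show ?thesis unfolding s_def[abs_def] power2_eq_square by (intro tendsto_sum) simp
    qed
    ultimately have le: "(\<Sum>i\<in>UNIV. integral UNIV (\<lambda>x. posv ?D ?z x $ i * posv ?D ?z x $ i)) \<le> 0"
      by (auto intro!: LIMSEQ_le)
    have c: "cc (\<lambda>x. posv ?D ?z x $ i * posv ?D ?z x $ i)" for i by (intro cc_mult cc_posv[OF oD])
    have "0 \<le> integral UNIV (\<lambda>x. posv ?D ?z x $ i * posv ?D ?z x $ i)" for i
      by (rule cc_integral_nonneg[OF c]) simp
    then have "integral UNIV (\<lambda>x. posv ?D ?z x $ i * posv ?D ?z x $ i) = 0"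
      using le by (metis (no_types, lifting) UNIV_I antisym finite sum_nonneg sum_nonneg_eq_0_iff)
    then have "posv ?D ?z x $ i * posv ?D ?z x $ i = 0"
      by (intro cc_integral_eq_0D[OF c]) auto
    then show ?thesis using x by (simp add: posv_def pos_on_def max_def split: if_splits)
  qed
  with k(1) show ?thesis by blast
qed

end

context elliptic_system
begin

lemma w_param_continuous: "continuous_on (UNIV \<times> \<Omega>) (\<lambda>z. w (circ p q (fst z)) (snd z))"
  if "unitK K p" "unitK K q" "p \<bullet> q = 0"
proof -
  have s: "symm K (reflect (circ p q t))" for t by (rule symm_reflect[OF unitK_circ[OF that]])
  have "continuous_on (UNIV \<times> \<Omega>) (\<lambda>z :: real \<times> _. reflect (circ p q (fst z)) (snd z))"
    unfolding reflect_def by (intro continuous_intros)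
  then have "continuous_on (UNIV \<times> \<Omega>) (\<lambda>z :: real \<times> _. U (reflect (circ p q (fst z)) (snd z)))"
    by (rule continuous_on_compose2[OF U_continuous]) (auto simp: symm_closure[OF s] in_closure)
  moreover have "continuous_on (UNIV \<times> \<Omega>) (\<lambda>z :: real \<times> _. U (snd z))"
    by (rule continuous_on_compose2[OF U_continuous]) (auto intro!: continuous_intros simp: in_closure)
  ultimately show ?thesis unfolding w_def by (rule continuous_on_diff[rotated])
qed

definition nonneg_at :: "real^'n \<Rightarrow> bool"
  where "nonneg_at e \<longleftrightarrow> (\<forall>x\<in>half e. \<forall>i. 0 \<le> w e x $ i)"

lemma open_not_nonneg:
  assumes pq: "unitK K p" "unitK K q" "p \<bullet> q = 0"
  shows "open {t. \<not> nonneg_at (circ p q t)}"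
  unfolding open_contains_ball
proof
  fix t0 assume "t0 \<in> {t. \<not> nonneg_at (circ p q t)}"
  then obtain x i where x: "x \<in> half (circ p q t0)" "w (circ p q t0) x $ i < 0"
    by (auto simp: nonneg_at_def not_le)
  have xO: "x \<in> \<Omega>" using x(1) half_subset by blast
  obtain d where d: "d > 0" "\<And>t. \<bar>t - t0\<bar> < d \<Longrightarrow> {x} \<subseteq> half (circ p q t)"
    using half_stable[of "{x}" p q t0] x(1) by auto
  have "continuous_on UNIV (\<lambda>t. w (circ p q t) x $ i)"
    using continuous_on_slice2[of UNIV \<Omega> "\<lambda>t. w (circ p q t)" x] w_param_continuous[OF pq] xO
    by (intro continuous_on_component) (simp add: split_beta)
  then have "open {t. w (circ p q t) x $ i < 0}"
    by (intro open_Collect_less continuous_on_const)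
  then obtain d' where d': "d' > 0" "ball t0 d' \<subseteq> {t. w (circ p q t) x $ i < 0}"
    using x(2) open_contains_ball by (metis (no_types, lifting) mem_Collect_eq)
  have "\<not> nonneg_at (circ p q t)" if "t \<in> ball t0 (min d d')" for t
  proof -
    have "x \<in> half (circ p q t)" using d(2)[of t] that by (simp add: dist_real_def abs_minus_commute)
    moreover have "w (circ p q t) x $ i < 0" using d'(2) that by auto
    ultimately show ?thesis unfolding nonneg_at_def by (meson not_le)
  qed
  then show "\<exists>e>0. ball t0 e \<subseteq> {t. \<not> nonneg_at (circ p q t)}"
    using d d' by (intro exI[of _ "min d d'"]) auto
qed

text \<open>On a compact part of the half \<open>w\<close> is strictly positive, and stays so for
  nearby normals by the tube lemma. The rest has small measure and is covered by
  \<open>w_nonneg_small\<close>. Since a moving half also picks up points from the other side, the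
  compact set \<open>T\<close> exhausts both halves: its part \<open>C'\<close> on the far side
  stays on the far side.\<close>

lemma open_nonneg:
  assumes pq: "unitK K p" "unitK K q" "p \<bullet> q = 0"
    and nz: "\<And>t. \<exists>x\<in>\<Omega>. w (circ p q t) x \<noteq> 0"
  shows "open {t. nonneg_at (circ p q t)}"
  unfolding open_contains_ball
proof
  fix t0 assume t0: "t0 \<in> {t. nonneg_at (circ p q t)}"
  let ?e = "circ p q"
  have ue: "unitK K (?e t)" for t by (rule unitK_circ[OF pq])
  have neg: "circ (- p) (- q) t = - ?e t" for t by (simp add: circ_def)
  have pos: "0 < w (?e t0) x $ i" if "x \<in> half (?e t0)" for x i
    using w_positive[OF ue, of t0] t0 nz[of t0] that by (auto simp: nonneg_at_def)
  obtain k where k: "k > 0" "\<And>e S. unitK K e \<Longrightarrow> S \<in> lmeasurable \<Longrightarrow> measure lebesgue S \<le> k \<Longrightarrow>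
      (\<forall>x\<in>half e - S. \<forall>i. 0 \<le> w e x $ i) \<Longrightarrow> (\<forall>x\<in>half e. \<forall>i. 0 \<le> w e x $ i)"
    using w_nonneg_small by blast
  let ?H = "half (?e t0) \<union> half (- ?e t0)"
  have "open ?H" using open_half by blast
  then have Hs: "?H \<in> sets lebesgue" by auto
  obtain T where T: "closed T" "T \<subseteq> ?H" "?H - T \<in> lmeasurable" "emeasure lebesgue (?H - T) < ennreal k"
    by (rule sets_lebesgue_inner_closed[OF Hs k(1)])
  have mH: "measure lebesgue (?H - T) \<le> k"
    using T(4) k(1) by (simp add: measure_def enn2real_leI less_imp_le)
  \<comment> \<open>The exceptional set is the same for all nearby \<open>t\<close>. It differs from
    \<open>?H - T\<close> only by points of the hyperplane, so it inherits the small
    measure.\<close>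
  define S where "S = \<Omega> - T"
  have diff: "(?H - T - S) \<union> (S - (?H - T)) \<subseteq> {x. ?e t0 \<bullet> x = 0}"
    by (auto simp: S_def half_def)
  have negl: "negligible ((?H - T - S) \<union> (S - (?H - T)))"
    using hyperplane_negligible[OF ue] diff by (rule negligible_subset)
  have "\<Omega> \<in> lmeasurable" using \<Omega> by (simp add: lmeasurable_open)
  then have S: "S \<in> lmeasurable" unfolding S_def using T(1) by (simp add: fmeasurable_Diff)
  have mS: "measure lebesgue S \<le> k"
    using measure_negligible_symdiff[OF T(3) negl] mH by simp
  define C where "C = T \<inter> {x. 0 \<le> ?e t0 \<bullet> x}"
  define C' where "C' = T \<inter> {x. ?e t0 \<bullet> x \<le> 0}"
  have "bounded T" using T(2) half_subset \<Omega>(3) by (meson bounded_subset le_sup_iff order_trans)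
  then have "compact T" using T(1) by (simp add: compact_eq_bounded_closed)
  then have comp: "compact C" "compact C'"
    unfolding C_def C'_def by (auto intro!: compact_Int_closed closed_halfspace_ge closed_halfspace_le)
  have sub: "C \<subseteq> half (?e t0)" "C' \<subseteq> half (circ (- p) (- q) t0)"
    using T(2) unfolding C_def C'_def neg by (auto simp: half_def)
  obtain d where d: "d > 0" "\<And>t. \<bar>t - t0\<bar> < d \<Longrightarrow> C \<subseteq> half (?e t)"
    using half_stable[OF comp(1) sub(1)] by blast
  obtain d' where d': "d' > 0" "\<And>t. \<bar>t - t0\<bar> < d' \<Longrightarrow> C' \<subseteq> half (- ?e t)"
    using half_stable[OF comp(2) sub(2)] unfolding neg by blast
  let ?W = "\<Inter>i. {z \<in> UNIV \<times> \<Omega>. 0 < w (?e (fst z)) (snd z) $ i}"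
  have "open {z \<in> UNIV \<times> \<Omega>. 0 < w (?e (fst z)) (snd z) $ i}" for i
  proof -
    have "open ((UNIV \<times> \<Omega>) \<inter> (\<lambda>z. w (?e (fst z)) (snd z) $ i) -` {0<..})"
      by (intro continuous_open_preimage continuous_on_component w_param_continuous pq open_Times \<Omega>) auto
    moreover have "(UNIV \<times> \<Omega>) \<inter> (\<lambda>z. w (?e (fst z)) (snd z) $ i) -` {0<..} = {z \<in> UNIV \<times> \<Omega>. 0 < w (?e (fst z)) (snd z) $ i}"
      by auto
    ultimately show ?thesis by simp
  qed
  then have "open ?W" by (intro open_INT) auto
  moreover have "{t0} \<times> C \<subseteq> ?W" using sub(1) pos half_subset by fastforce
  ultimately obtain X where X: "t0 \<in> X" "open X" "X \<times> C \<subseteq> ?W"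
    using Elementary_Topology.tube_lemma[OF comp(1), of ?W t0] by blast
  then obtain d2 where d2: "d2 > 0" "ball t0 d2 \<subseteq> X" using open_contains_ball by metis
  have "nonneg_at (?e t)" if t: "t \<in> ball t0 (min d2 (min d d'))" for t
    unfolding nonneg_at_def
  proof (rule k(2)[OF ue S mS], intro ballI allI)
    fix x i assume x: "x \<in> half (?e t) - S"
    then have xT: "x \<in> T" using half_subset by (auto simp: S_def)
    have "C' \<subseteq> half (- ?e t)" using d'(2)[of t] t by (simp add: dist_real_def abs_minus_commute)
    then have "x \<notin> C'" using x half_disjoint[of "?e t"] by blast
    then have "x \<in> C" using xT by (auto simp: C_def C'_def)
    moreover have "t \<in> X" using t d2(2) by auto
    ultimately have "(t, x) \<in> ?W" using X(3) by blast
    then show "0 \<le> w (?e t) x $ i" by (auto intro: less_imp_le)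
  qed
  then show "\<exists>e>0. ball t0 e \<subseteq> {t. nonneg_at (circ p q t)}"
    using d(1) d'(1) d2(1) by (intro exI[of _ "min d2 (min d d')"]) auto
qed

lemma nonneg_at_minus:
  assumes e: "unitK K e" and le: "\<forall>x\<in>half e. \<forall>i. w e x $ i \<le> 0"
  shows "nonneg_at (- e)"
  unfolding nonneg_at_def w_minus
proof (intro ballI allI)
  fix x i assume "x \<in> half (- e)"
  then have "reflect e x \<in> half e" using reflect_half[OF unitK_minus[OF e]] by (simp add: reflect_minus)
  then have "w e (reflect e x) $ i \<le> 0" using le by blast
  then show "0 \<le> w e x $ i" by (simp add: w_reflect[OF e])
qed

lemma nonneg_at_both:
  assumes e: "unitK K e" and nn: "nonneg_at e" "nonneg_at (- e)" and x: "x \<in> \<Omega>"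
  shows "w e x = 0"
proof (rule w_zero_half[OF e _ x])
  fix x i assume x: "x \<in> half e"
  have "0 \<le> w e x $ i" using nn(1) x by (auto simp: nonneg_at_def)
  moreover have "reflect e x \<in> half (- e)" using x reflect_half[OF e] by blast
  then have "0 \<le> w e (reflect e x) $ i" using nn(2) by (auto simp: nonneg_at_def w_minus)
  then have "w e x $ i \<le> 0" by (simp add: w_reflect[OF e])
  ultimately show "w e x $ i = 0" by simp
qed

lemma unitK_axis: "l \<in> K \<Longrightarrow> unitK K (axis l 1)"
  unfolding unitK_def by (rule conjI[OF norm_axis_1]) (auto simp: part2_def vec_eq_iff axis_def)

lemma orthonormal_pair: "\<exists>p q. unitK K p \<and> unitK K q \<and> p \<bullet> q = 0"
proof -
  obtain k l where "k \<in> K" "l \<in> K" "k \<noteq> l"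
    using card_K by (metis One_nat_def card_le_Suc0_iff_eq finite not_less_eq_eq numeral_2_eq_2)
  then show ?thesis
    by (intro exI[of _ "axis k 1"] exI[of _ "axis l 1"]) (auto simp: unitK_axis inner_axis_axis)
qed

end

context morse_one
begin

text \<open>The assumption \<open>os\<close> is where the two convexity alternatives meet; what
  follows is the same for both.\<close>

lemma symmetric_direction:
  assumes os: "\<And>e. unitK K e \<Longrightarrow> semistable (half e) \<Longrightarrow> semistable (half (- e)) \<Longrightarrow>
    (\<forall>x\<in>half e. \<forall>i. 0 \<le> w e x $ i) \<or> (\<forall>x\<in>half e. \<forall>i. w e x $ i \<le> 0)"
  shows "\<exists>e. unitK K e \<and> (\<forall>x\<in>\<Omega>. w e x = 0)"
proof (rule ccontr)
  assume no: "\<not> ?thesis"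
  obtain p q where pq: "unitK K p" "unitK K q" "p \<bullet> q = 0" using orthonormal_pair by blast
  have ue: "unitK K (circ p q t)" for t by (rule unitK_circ[OF pq])
  have nz: "\<exists>x\<in>\<Omega>. w (circ p q t) x \<noteq> 0" for t using no ue by blast
  let ?T = "{t. nonneg_at (circ p q t)}"
  obtain t0 where "semistable (half (circ p q t0))" "semistable (half (- circ p q t0))"
    using semistable_both by blast
  from os[OF ue this] have "nonneg_at (circ p q t0) \<or> nonneg_at (circ p q (t0 + pi))"
    using nonneg_at_minus[OF ue] by (auto simp: nonneg_at_def circ_pi)
  then have T1: "?T \<noteq> {}" by auto
  have T2: "open ?T" by (rule open_nonneg[OF pq nz])
  have T3: "closed ?T"
  proof -
    have "- ?T = {t. \<not> nonneg_at (circ p q t)}" by auto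
    then show ?thesis using open_not_nonneg[OF pq] by (simp add: closed_def)
  qed
  have "?T = {} \<or> ?T = UNIV" by (rule iffD1[OF clopen conjI[OF T3 T2]])
  then have "?T = UNIV" by (rule disjE) (rule notE[OF T1])
  then have "nonneg_at (circ p q 0)" "nonneg_at (circ p q (0 + pi))" by auto
  then have "nonneg_at (circ p q 0)" "nonneg_at (- circ p q 0)" by (simp_all only: circ_pi)
  then show False using nonneg_at_both[OF ue] nz[of 0] by blast
qed

end

subsection \<open>Symmetry of second derivatives\<close>

text \<open>Two integrations by parts move both derivatives onto a bump, whose second derivatives
  are explicit and symmetric. Continuity then turns the tested identity into a pointwise
  one.\<close>

lemma gradient_gradient_symmetric:
  fixes u :: "real^'n \<Rightarrow> real"
  assumes D: "open D" and u: "C1_on D u" and g: "\<And>k. C1_on D (\<lambda>x. gradient u x $ k)" and x: "x \<in> D"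
  shows "gradient (\<lambda>x. gradient u x $ k) x $ l = gradient (\<lambda>x. gradient u x $ l) x $ k"
proof -
  let ?G = "\<lambda>k l x. gradient (\<lambda>x. gradient u x $ k) x $ l"
  have "?G k l x - ?G l k x = 0"
  proof (rule fundamental_lemma_bump[OF D _ _ x])
    show "continuous_on D (\<lambda>x. ?G k l x - ?G l k x)"
      by (intro continuous_intros continuous_on_component C1_on_continuous_gradient g)
    fix y s assume s: "0 < (s::real)" "cball y s \<subseteq> D"
    have tb: "test D (bump y s)" using s by (intro test_bump) auto
    have tg: "test D (\<lambda>x. gradient (bump y s) x $ l)" for l using s by (intro test_gradient_bump) auto
    have I: "integral UNIV (\<lambda>x. bump y s x * ?G k l x) =
        integral UNIV (\<lambda>x. gradient (\<lambda>x. gradient (bump y s) x $ l) x $ k * u x)" for k l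
    proof -
      have "integral UNIV (\<lambda>x. bump y s x * ?G k l x) = - integral UNIV (\<lambda>x. gradient (bump y s) x $ l * gradient u x $ k)"
        by (rule integral_by_parts_test(1)[OF D tb g])
      also have "\<dots> = integral UNIV (\<lambda>x. gradient (\<lambda>x. gradient (bump y s) x $ l) x $ k * u x)"
        unfolding integral_by_parts_test(1)[OF D tg u] by simp
      finally show ?thesis .
    qed
    have "integral UNIV (\<lambda>x. (?G k l x - ?G l k x) * bump y s x) =
        integral UNIV (\<lambda>x. bump y s x * ?G k l x - bump y s x * ?G l k x)" by (simp add: algebra_simps)
    also have "\<dots> = integral UNIV (\<lambda>x. bump y s x * ?G k l x) - integral UNIV (\<lambda>x. bump y s x * ?G l k x)"
      by (intro cc_integral_diff integral_by_parts_test(2)[OF D tb g])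
    also have "\<dots> = 0"
    proof -
      have "gradient (\<lambda>x. gradient (bump y s) x $ l) x $ k = gradient (\<lambda>x. gradient (bump y s) x $ k) x $ l" for x
        unfolding test_gradient_bump(2)[OF less_imp_le[OF s(1)] s(2)]
        by (cases "k = l") (simp_all add: mult_ac del: vector_minus_component)
      then show ?thesis by (simp add: I)
    qed
    finally show "integral UNIV (\<lambda>x. (?G k l x - ?G l k x) * bump y s x) = 0" .
  qed
  then show ?thesis by simp
qed

subsection \<open>Angular derivatives\<close>

lemma linear_rotgen: "linear (rotgen p q)"
  by (rule linearI) (auto simp: rotgen_def algebra_simps)

lemma continuous_on_rotgen [continuous_intros]: "continuous_on S g \<Longrightarrow> continuous_on S (\<lambda>x. rotgen p q (g x))"
  unfolding rotgen_def by (intro continuous_intros)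

context elliptic_system
begin

text \<open>The derivative of \<open>U\<close> along \<open>rotgen p q\<close>, expanded in
  coordinates because C^1 regularity of \<open>DU\<close> is available for each fixed direction;
  \<open>ang_eq\<close> gives the closed form.\<close>

definition ang :: "real^'n \<Rightarrow> real^'n \<Rightarrow> real^'n \<Rightarrow> real^'m"
  where "ang p q x = (\<Sum>k\<in>UNIV. rotgen p q x $ k *\<^sub>R DU x (axis k 1))"

lemma ang_eq: "x \<in> closure \<Omega> \<Longrightarrow> ang p q x = DU x (rotgen p q x)"
  unfolding ang_def by (rule linear_axis_expansion[OF DU_linear, symmetric])

lemma ang_continuous: "continuous_on (closure \<Omega>) (ang p q)"
  unfolding ang_def[abs_def]
  by (intro continuous_intros DU_continuous continuous_on_component)

lemma gradient_DU_symmetric: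
  assumes "x \<in> \<Omega>"
  shows "gradient (\<lambda>y. DU y (axis k 1) $ i) x $ l = gradient (\<lambda>y. DU y (axis l 1) $ i) x $ k"
proof -
  have eq: "gradient (\<lambda>x. U x $ i) x $ k = DU x (axis k 1) $ i" if "x \<in> \<Omega>" for x k
    using gradient_U[OF that] by simp
  have tr: "C1_on \<Omega> (\<lambda>x. gradient (\<lambda>x. U x $ i) x $ k)"
    "x \<in> \<Omega> \<Longrightarrow> gradient (\<lambda>x. gradient (\<lambda>x. U x $ i) x $ k) x = gradient (\<lambda>y. DU y (axis k 1) $ i) x" for k x
  proof -
    have d: "((\<lambda>x. gradient (\<lambda>x. U x $ i) x $ k) has_derivative (\<lambda>h. gradient (\<lambda>y. DU y (axis k 1) $ i) x \<bullet> h)) (at x)"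
      if "x \<in> \<Omega>" for x
      by (rule has_derivative_transform_within_open[OF C1_onD[OF DU_C1 that] \<Omega>(1) that]) (simp add: eq)
    show "C1_on \<Omega> (\<lambda>x. gradient (\<lambda>x. U x $ i) x $ k)"
      by (rule C1_onI[OF d C1_on_continuous_gradient[OF DU_C1]])
    show "x \<in> \<Omega> \<Longrightarrow> gradient (\<lambda>x. gradient (\<lambda>x. U x $ i) x $ k) x = gradient (\<lambda>y. DU y (axis k 1) $ i) x"
      by (rule gradient_eqI[OF d])
  qed
  show ?thesis
    using gradient_gradient_symmetric[OF \<Omega>(1) U_C1 tr(1) assms, of k l] by (simp add: tr(2)[OF assms])
qed

text \<open>Symmetry of second derivatives brings the gradient into the shape in which it appears
  when the gradient of the rotated solution is differentiated with respect to the angle.\<close>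

lemma
  shows ang_C1: "C1_on \<Omega> (\<lambda>x. ang p q x $ i)"
    and gradient_ang: "x \<in> \<Omega> \<Longrightarrow> gradient (\<lambda>x. ang p q x $ i) x $ l =
      (\<Sum>k\<in>UNIV. rotgen p q x $ k * gradient (\<lambda>y. DU y (axis l 1) $ i) x $ k + rotgen p q (axis l 1) $ k * DU x (axis k 1) $ i)"
proof -
  define G where "G x = (\<chi> l. \<Sum>k\<in>UNIV. rotgen p q x $ k * gradient (\<lambda>y. DU y (axis k 1) $ i) x $ l + rotgen p q (axis l 1) $ k * DU x (axis k 1) $ i)" for x
  have ax: "ang p q x $ i = (\<Sum>k\<in>UNIV. rotgen p q x $ k * DU x (axis k 1) $ i)" for x
    by (simp add: ang_def)
  have lin: "rotgen p q h $ k = (\<Sum>l\<in>UNIV. h $ l * rotgen p q (axis l 1) $ k)" for h k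
    using arg_cong[OF linear_axis_expansion[OF linear_rotgen, of p q h], of "\<lambda>v. v $ k"] by simp
  have d: "((\<lambda>x. ang p q x $ i) has_derivative (\<lambda>h. G x \<bullet> h)) (at x)" if x: "x \<in> \<Omega>" for x
  proof -
    have dk: "((\<lambda>x. rotgen p q x $ k) has_derivative (\<lambda>h. rotgen p q h $ k)) (at x)" for k
      by (intro bounded_linear.has_derivative[OF bounded_linear_vec_nth] linear_imp_has_derivative linear_rotgen)
    have "((\<lambda>x. ang p q x $ i) has_derivative (\<lambda>h. \<Sum>k\<in>UNIV. rotgen p q x $ k * (gradient (\<lambda>y. DU y (axis k 1) $ i) x \<bullet> h) + rotgen p q h $ k * DU x (axis k 1) $ i)) (at x)"
      unfolding ax by (intro has_derivative_sum has_derivative_mult dk C1_onD[OF DU_C1 x])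
    moreover have "(\<lambda>h. \<Sum>k\<in>UNIV. rotgen p q x $ k * (gradient (\<lambda>y. DU y (axis k 1) $ i) x \<bullet> h) + rotgen p q h $ k * DU x (axis k 1) $ i) = (\<lambda>h. G x \<bullet> h)"
    proof
      fix h
      have "(\<Sum>k\<in>UNIV. rotgen p q x $ k * (gradient (\<lambda>y. DU y (axis k 1) $ i) x \<bullet> h) + rotgen p q h $ k * DU x (axis k 1) $ i) =
          (\<Sum>k\<in>UNIV. \<Sum>l\<in>UNIV. (rotgen p q x $ k * gradient (\<lambda>y. DU y (axis k 1) $ i) x $ l + rotgen p q (axis l 1) $ k * DU x (axis k 1) $ i) * h $ l)"
        unfolding lin[of h] inner_vec_sum sum_distrib_left sum_distrib_right sum.distrib[symmetric]
        by (intro sum.cong refl) (simp add: algebra_simps)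
      also have "\<dots> = G x \<bullet> h"
        unfolding G_def inner_vec_sum by (subst sum.swap) (simp add: sum_distrib_right)
      finally show "(\<Sum>k\<in>UNIV. rotgen p q x $ k * (gradient (\<lambda>y. DU y (axis k 1) $ i) x \<bullet> h) + rotgen p q h $ k * DU x (axis k 1) $ i) = G x \<bullet> h" .
    qed
    ultimately show ?thesis by (rule has_derivative_eq_rhs)
  qed
  have cG: "continuous_on \<Omega> G"
    unfolding G_def
    by (intro continuous_on_vec_lambda continuous_intros continuous_on_component C1_on_continuous_gradient DU_C1
        continuous_on_subset[OF DU_continuous closure_subset])
  show "C1_on \<Omega> (\<lambda>x. ang p q x $ i)" by (rule C1_onI[OF d cG])
  show "x \<in> \<Omega> \<Longrightarrow> gradient (\<lambda>x. ang p q x $ i) x $ l =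
      (\<Sum>k\<in>UNIV. rotgen p q x $ k * gradient (\<lambda>y. DU y (axis l 1) $ i) x $ k + rotgen p q (axis l 1) $ k * DU x (axis k 1) $ i)"
    unfolding gradient_eqI[OF d] by (simp add: G_def gradient_DU_symmetric[of x _ i l])
qed

end

context elliptic_system
begin

lemma U_rotp_deriv:
  assumes pq: "unitK K p" "unitK K q" "p \<bullet> q = 0" and x: "x \<in> closure \<Omega>"
  shows "((\<lambda>t. U (rotp p q t x)) has_vector_derivative ang p q (rotp p q t x)) (at t within X)"
proof -
  have s: "rotp p q t x \<in> closure \<Omega>" for t using symm_closure[OF symm_rotp[OF pq]] x by blast
  have d1: "((\<lambda>t. rotp p q t x) has_derivative (\<lambda>h. h *\<^sub>R rotgen p q (rotp p q t x))) (at t within X)"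
    using rotp_deriv[OF pq] by (simp add: has_vector_derivative_def)
  have d2: "(U has_derivative DU (rotp p q t x)) (at (rotp p q t x) within (\<lambda>t. rotp p q t x) ` X)"
    by (rule has_derivative_subset[OF DU(1)[OF s]]) (use s in auto)
  have "(U \<circ> (\<lambda>t. rotp p q t x) has_derivative DU (rotp p q t x) \<circ> (\<lambda>h. h *\<^sub>R rotgen p q (rotp p q t x))) (at t within X)"
    by (rule diff_chain_within[OF d1 d2])
  moreover have "DU (rotp p q t x) \<circ> (\<lambda>h. h *\<^sub>R rotgen p q (rotp p q t x)) = (\<lambda>h. h *\<^sub>R ang p q (rotp p q t x))"
    by (auto simp: ang_eq[OF s] linear_scale[OF DU_linear[OF s]])
  ultimately show ?thesis by (simp add: has_vector_derivative_def o_def)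
qed

text \<open>The orbit of a frontier point under the rotations stays in the frontier, where
  \<open>U\<close> vanishes.\<close>

lemma ang_frontier:
  assumes pq: "unitK K p" "unitK K q" "p \<bullet> q = 0" and x: "x \<in> frontier \<Omega>"
  shows "ang p q x = 0"
proof -
  have xc: "x \<in> closure \<Omega>" using x by (simp add: frontier_\<Omega>)
  have "U (rotp p q t x) = 0" for t using symm_frontier[OF symm_rotp[OF pq]] x bc by blast
  then have "((\<lambda>t. 0) has_vector_derivative ang p q x) (at (0::real))"
    using U_rotp_deriv[OF pq xc, of 0 UNIV] by (simp add: rotp_0)
  moreover have "((\<lambda>t. 0 :: real^'m) has_vector_derivative 0) (at (0::real))" by simp
  ultimately show ?thesis by (rule vector_derivative_unique_at)
qed

lemma continuous_on_param:
  assumes pq: "unitK K p" "unitK K q" "p \<bullet> q = 0" and g: "continuous_on \<Omega> g"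
  shows "continuous_on (UNIV \<times> \<Omega>) (\<lambda>z. g (rotp p q (fst z) (snd z)))"
  by (rule continuous_on_compose2[OF g continuous_on_rotp]) (auto simp: symm_\<Omega>[OF symm_rotp[OF pq]])

lemma integral_test_param_deriv:
  fixes G G' :: "real \<Rightarrow> real^'n \<Rightarrow> real"
  assumes \<phi>: "csupp \<Omega> \<phi>" and d: "\<And>t x. x \<in> \<Omega> \<Longrightarrow> ((\<lambda>t. G t x) has_field_derivative G' t x) (at t)"
    and c: "continuous_on (UNIV \<times> \<Omega>) (\<lambda>z. G (fst z) (snd z))" and c': "continuous_on (UNIV \<times> \<Omega>) (\<lambda>z. G' (fst z) (snd z))"
  shows "((\<lambda>t. integral UNIV (\<lambda>x. \<phi> x * G t x)) has_field_derivative integral UNIV (\<lambda>x. \<phi> x * G' 0 x)) (at 0)"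
proof -
  obtain C where C: "compact C" "C \<subseteq> \<Omega>" "\<And>x. x \<notin> C \<Longrightarrow> \<phi> x = 0" "continuous_on UNIV \<phi>"
    using \<phi> by (auto simp: csupp_def)
  have C3: "x \<in> C" if "\<phi> x \<noteq> 0" for x using C(3) that by blast
  have cont: "continuous_on UNIV (\<lambda>z. \<phi> (snd z) * H (fst z) (snd z))"
    if H: "continuous_on (UNIV \<times> \<Omega>) (\<lambda>z. H (fst z) (snd z))" for H :: "real \<Rightarrow> real^'n \<Rightarrow> real"
  proof (rule continuous_on_mult_supp[of "UNIV \<times> C" "UNIV \<times> \<Omega>"])
    show "closed (UNIV \<times> C)" using C(1) by (simp add: closed_Times compact_imp_closed)
    show "open (UNIV \<times> \<Omega>)" using \<Omega>(1) by (simp add: open_Times)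
    show "continuous_on UNIV (\<lambda>z. \<phi> (snd z))"
      by (rule continuous_on_compose2[OF C(4)]) (auto intro!: continuous_intros)
    show "continuous_on (UNIV \<inter> UNIV \<times> \<Omega>) (\<lambda>z. H (fst z) (snd z))" using H by simp
  qed (use C(2) C3 in auto)
  show ?thesis
  proof (rule cc_integral_param_deriv[OF convex_UNIV UNIV_I C(1)])
    show "((\<lambda>t. \<phi> x * G t x) has_field_derivative \<phi> x * G' t x) (at t)" for t x
    proof (cases "x \<in> \<Omega>")
      case True
      then show ?thesis by (intro DERIV_cmult d)
    next
      case False
      then have "\<phi> x = 0" using C by auto
      then show ?thesis by simp
    qed
    show "continuous_on UNIV (\<lambda>x. \<phi> x * G t x)" for t
      using continuous_on_slice1[of UNIV UNIV "\<lambda>t x. \<phi> x * G t x" t] cont[OF c] by (simp add: split_beta)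
    show "continuous_on (UNIV \<times> UNIV) (\<lambda>(t, x). \<phi> x * G' t x)"
      using cont[OF c'] by (simp add: split_beta)
  qed (use C3 in auto)
qed

text \<open>
  Differentiate at \<open>t = 0\<close> the weak equation of the rotated solution, in which \<open>|x'|\<close> and \<open>x''\<close>
  do not depend on \<open>t\<close>.
\<close>

lemma ang_weak_eq:
  assumes pq: "unitK K p" "unitK K q" "p \<bullet> q = 0" and t: "test \<Omega> \<phi>"
  shows "integral UNIV (\<lambda>x. gradient (\<lambda>y. ang p q y $ i) x \<bullet> gradient \<phi> x) =
    integral UNIV (\<lambda>x. (\<Sum>j\<in>UNIV. pot i j x * ang p q x $ j) * \<phi> x)"
proof -
  let ?R = "rotp p q" and ?r = "rotgen p q"
  let ?g = "\<lambda>k y. DU y (axis k 1) $ i"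
  note S = symm_rotp[OF pq]
  have oR: "orthogonal_transformation (?R t)" for t using S by (simp add: symm_def)
  have RO: "?R t x \<in> \<Omega> \<longleftrightarrow> x \<in> \<Omega>" for t x by (rule symm_\<Omega>[OF S])
  have gc: "continuous_on \<Omega> (?g k)" "continuous_on \<Omega> (\<lambda>y. gradient (?g k) y)" for k
    by (auto intro: C1_on_continuous C1_on_continuous_gradient DU_C1)
  have Rd: "((\<lambda>t. ?R t x) has_derivative (\<lambda>h. h *\<^sub>R ?r (?R t x))) (at t)" for t x
    using rotp_deriv[OF pq] by (simp add: has_vector_derivative_def)
  \<comment> \<open>\<open>G l t\<close> is the partial derivative in direction \<open>l\<close> of
    the rotated solution and \<open>G'\<close> its derivative in \<open>t\<close>. Differentiating
    the weak equation in this form uses only second derivatives of \<open>U\<close>.\<close>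
  define G where "G l t x = (\<Sum>k\<in>UNIV. ?R t (axis l 1) $ k * ?g k (?R t x))" for l t x
  define G' where "G' l t x = (\<Sum>k\<in>UNIV. ?R t (axis l 1) $ k * (gradient (?g k) (?R t x) \<bullet> ?r (?R t x)) +
      ?r (?R t (axis l 1)) $ k * ?g k (?R t x))" for l t x
  have G: "gradient (\<lambda>y. U (?R t y) $ i) x $ l = G l t x" if x: "x \<in> \<Omega>" for l t x
  proof -
    have Rx: "?R t x \<in> \<Omega>" using x RO by simp
    have "gradient (\<lambda>y. U (?R t y) $ i) x \<bullet> axis l 1 = gradient (\<lambda>y. U y $ i) (?R t x) \<bullet> ?R t (axis l 1)"
    proof -
      have "((\<lambda>y. U (?R t y) $ i) has_derivative (\<lambda>h. gradient (\<lambda>y. U y $ i) (?R t x) \<bullet> ?R t h)) (at x)"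
        by (rule has_derivative_compose[OF linear_imp_has_derivative[OF orthogonal_transformation_linear[OF oR]] C1_onD[OF U_C1 Rx]])
      then have "(\<lambda>h. gradient (\<lambda>y. U (?R t y) $ i) x \<bullet> h) = (\<lambda>h. gradient (\<lambda>y. U y $ i) (?R t x) \<bullet> ?R t h)"
        using has_derivative_unique[OF C1_onD[OF U_symm_C1[OF S] x]] by blast
      then show ?thesis by (rule fun_cong)
    qed
    then have "gradient (\<lambda>y. U (?R t y) $ i) x $ l = gradient (\<lambda>y. U y $ i) (?R t x) \<bullet> ?R t (axis l 1)"
      by (simp add: inner_axis)
    then show ?thesis
      by (simp add: gradient_U[OF Rx] inner_vec_sum G_def mult.commute)
  qed
  have ax: "continuous_on UNIV (\<lambda>z::real \<times> (real^'n). ?R (fst z) (axis l 1))" for l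
    unfolding rotp_def by (intro continuous_intros)
  have cG: "continuous_on (UNIV \<times> \<Omega>) (\<lambda>z. G l (fst z) (snd z))" for l
    unfolding G_def
    by (intro continuous_on_sum continuous_on_mult continuous_on_component continuous_on_subset[OF ax] continuous_on_param[OF pq gc(1)]) auto
  have cG': "continuous_on (UNIV \<times> \<Omega>) (\<lambda>z. G' l (fst z) (snd z))" for l
    unfolding G'_def
    by (intro continuous_on_sum continuous_on_add continuous_on_mult continuous_on_inner continuous_on_component continuous_on_rotgen continuous_on_rotp
        continuous_on_subset[OF ax] continuous_on_param[OF pq gc(1)] continuous_on_param[OF pq gc(2)]) auto
  have dG: "((\<lambda>t. G l t x) has_field_derivative G' l t x) (at t)" if x: "x \<in> \<Omega>" for l t x
    unfolding G_def G'_def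
  proof (intro DERIV_sum)
    fix k
    have Rx: "?R t x \<in> \<Omega>" using x RO by simp
    have "((\<lambda>t. ?g k (?R t x)) has_derivative (\<lambda>h. gradient (?g k) (?R t x) \<bullet> (h *\<^sub>R ?r (?R t x)))) (at t)"
      by (rule has_derivative_compose[OF Rd C1_onD[OF DU_C1 Rx]])
    then have a: "((\<lambda>t. ?g k (?R t x)) has_field_derivative gradient (?g k) (?R t x) \<bullet> ?r (?R t x)) (at t)"
      by (rule has_derivative_imp_has_field_derivative) simp
    have "((\<lambda>t. ?R t (axis l 1) $ k) has_derivative (\<lambda>h. (h *\<^sub>R ?r (?R t (axis l 1))) $ k)) (at t)"
      by (rule bounded_linear.has_derivative[OF bounded_linear_vec_nth Rd])
    then have b: "((\<lambda>t. ?R t (axis l 1) $ k) has_field_derivative ?r (?R t (axis l 1)) $ k) (at t)"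
      by (rule has_derivative_imp_has_field_derivative) simp
    show "((\<lambda>t. ?R t (axis l 1) $ k * ?g k (?R t x)) has_field_derivative
        ?R t (axis l 1) $ k * (gradient (?g k) (?R t x) \<bullet> ?r (?R t x)) + ?r (?R t (axis l 1)) $ k * ?g k (?R t x)) (at t)"
      using DERIV_mult[OF b a] by (simp add: add.commute mult.commute)
  qed
  define H where "H t x = rhs x (U (?R t x)) $ i" for t x
  define H' where "H' t x = (\<Sum>j\<in>UNIV. jac i j x (U (?R t x)) * ang p q (?R t x) $ j)" for t x
  have cU: "continuous_on \<Omega> U" by (rule continuous_on_subset[OF U_continuous closure_subset])
  have ca: "continuous_on \<Omega> (ang p q)" by (rule continuous_on_subset[OF ang_continuous closure_subset])
  have cz: "continuous_on (UNIV \<times> \<Omega>) (\<lambda>z :: real \<times> _. (snd z, U (?R (fst z) (snd z))))"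
    by (intro continuous_intros continuous_on_param[OF pq cU])
  have cH: "continuous_on (UNIV \<times> \<Omega>) (\<lambda>z. H (fst z) (snd z))"
  proof -
    have "continuous_on (UNIV \<times> \<Omega>) (\<lambda>z :: real \<times> _. (\<lambda>(x, S). rhs x S) (snd z, U (?R (fst z) (snd z))))"
      by (rule continuous_on_compose2[OF rhs_continuous cz]) (auto simp: in_closure)
    then show ?thesis unfolding H_def by (intro continuous_on_component) simp
  qed
  have cH': "continuous_on (UNIV \<times> \<Omega>) (\<lambda>z. H' (fst z) (snd z))"
  proof -
    have "continuous_on (UNIV \<times> \<Omega>) (\<lambda>z :: real \<times> _. (\<lambda>(x, S). jac i j x S) (snd z, U (?R (fst z) (snd z))))" for j
      by (rule continuous_on_compose2[OF jac_continuous cz]) (auto simp: in_closure)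
    then show ?thesis
      unfolding H'_def by (intro continuous_on_sum continuous_on_mult continuous_on_component continuous_on_param[OF pq ca]) simp
  qed
  have dH: "((\<lambda>t. H t x) has_field_derivative H' t x) (at t)" if x: "x \<in> \<Omega>" for t x
  proof -
    have "((\<lambda>t. U (?R t x)) has_derivative (\<lambda>h. h *\<^sub>R ang p q (?R t x))) (at t)"
      using U_rotp_deriv[OF pq in_closure[OF x]] by (simp add: has_vector_derivative_def)
    from has_derivative_compose[OF this rhs_deriv[OF in_closure[OF x]]]
    have "((\<lambda>t. H t x) has_derivative (\<lambda>h. \<Sum>j\<in>UNIV. jac i j x (U (?R t x)) * (h *\<^sub>R ang p q (?R t x)) $ j)) (at t)"
      by (simp add: H_def)
    then show ?thesis
      by (rule has_derivative_imp_has_field_derivative) (simp add: H'_def sum_distrib_left mult_ac)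
  qed
  have cs: "csupp \<Omega> (\<lambda>x. gradient \<phi> x $ l)" for l by (rule test_csupp_gradient[OF t])
  have slice: "continuous_on \<Omega> (V s)" if "continuous_on (UNIV \<times> \<Omega>) (\<lambda>z. V (fst z) (snd z))" for V :: "real \<Rightarrow> real^'n \<Rightarrow> real" and s
    using continuous_on_slice1[of UNIV \<Omega> V s] that by (simp add: split_beta)
  have ccG: "cc (\<lambda>x. gradient \<phi> x $ l * G l s x)" "cc (\<lambda>x. gradient \<phi> x $ l * G' l s x)" for l s
    by (intro csupp_cc[OF csupp_mult[OF \<Omega>(1) cs]] slice cG cG')+
  have eq: "(\<Sum>l\<in>UNIV. integral UNIV (\<lambda>x. gradient \<phi> x $ l * G l s x)) = integral UNIV (\<lambda>x. \<phi> x * H s x)" for s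
  proof -
    have "gradient (\<lambda>y. U (?R s y) $ i) x \<bullet> gradient \<phi> x = (\<Sum>l\<in>UNIV. gradient \<phi> x $ l * G l s x)" for x
      using test_outside[OF t, of x] G[of x s] by (cases "x \<in> \<Omega>") (auto simp: inner_vec_sum mult.commute)
    then have "integral UNIV (\<lambda>x. \<Sum>l\<in>UNIV. gradient \<phi> x $ l * G l s x) = integral UNIV (\<lambda>x. rhs x (U (?R s x)) $ i * \<phi> x)"
      using weak_eq_symm[OF S t, of s i] by simp
    moreover have "(\<Sum>l\<in>UNIV. integral UNIV (\<lambda>x. gradient \<phi> x $ l * G l s x)) =
        integral UNIV (\<lambda>x. \<Sum>l\<in>UNIV. gradient \<phi> x $ l * G l s x)"
      by (intro cc_integral_sum[symmetric] ccG) auto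
    ultimately show ?thesis by (simp add: H_def mult.commute)
  qed
  have "((\<lambda>s. \<Sum>l\<in>UNIV. integral UNIV (\<lambda>x. gradient \<phi> x $ l * G l s x)) has_field_derivative
      (\<Sum>l\<in>UNIV. integral UNIV (\<lambda>x. gradient \<phi> x $ l * G' l 0 x))) (at 0)"
    by (intro DERIV_sum integral_test_param_deriv[OF cs dG cG cG'])
  moreover have "((\<lambda>s. integral UNIV (\<lambda>x. \<phi> x * H s x)) has_field_derivative integral UNIV (\<lambda>x. \<phi> x * H' 0 x)) (at 0)"
    by (rule integral_test_param_deriv[OF test_csupp[OF t] dH cH cH'])
  ultimately have "(\<Sum>l\<in>UNIV. integral UNIV (\<lambda>x. gradient \<phi> x $ l * G' l 0 x)) = integral UNIV (\<lambda>x. \<phi> x * H' 0 x)"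
    unfolding eq by (rule DERIV_unique)
  also have "(\<Sum>l\<in>UNIV. integral UNIV (\<lambda>x. gradient \<phi> x $ l * G' l 0 x)) =
      integral UNIV (\<lambda>x. \<Sum>l\<in>UNIV. gradient \<phi> x $ l * G' l 0 x)"
    by (intro cc_integral_sum[symmetric] ccG) auto
  also have "(\<lambda>x. \<Sum>l\<in>UNIV. gradient \<phi> x $ l * G' l 0 x) = (\<lambda>x. gradient (\<lambda>y. ang p q y $ i) x \<bullet> gradient \<phi> x)"
  proof
    fix x
    show "(\<Sum>l\<in>UNIV. gradient \<phi> x $ l * G' l 0 x) = gradient (\<lambda>y. ang p q y $ i) x \<bullet> gradient \<phi> x"
    proof (cases "x \<in> \<Omega>")
      case True
      have "G' l 0 x = gradient (\<lambda>y. ang p q y $ i) x $ l" for l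
      proof -
        have "(\<Sum>k\<in>UNIV. (axis l 1 :: real^'n) $ k * (gradient (?g k) x \<bullet> ?r x)) = gradient (?g l) x \<bullet> ?r x"
          by (simp add: axis_def if_distrib[of "\<lambda>v. v * _"] cong: if_cong)
        then show ?thesis
          by (simp add: G'_def rotp_0 gradient_ang[OF True] sum.distrib inner_vec_sum mult.commute)
      qed
      then show ?thesis by (simp add: inner_vec_sum mult.commute)
    qed (simp add: test_outside[OF t])
  qed
  finally show ?thesis by (simp add: H'_def rotp_0 pot_def mult.commute)
qed

lemma ang_test_cc:
  assumes t: "test \<Omega> \<phi>"
  shows "cc (\<lambda>x. (\<Sum>j\<in>UNIV. pot i j x * ang p q x $ j) * \<phi> x)"
proof -
  have "continuous_on \<Omega> (\<lambda>x. \<Sum>j\<in>UNIV. pot i j x * ang p q x $ j)"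
    by (intro continuous_intros continuous_on_component pot_continuous_on
        continuous_on_subset[OF ang_continuous closure_subset]) auto
  from csupp_cc[OF csupp_mult[OF \<Omega>(1) test_csupp[OF t] this]] show ?thesis by (simp add: mult.commute)
qed

lemma DU_reflect:
  assumes e: "unitK K e" and z: "\<forall>x\<in>\<Omega>. w e x = 0" and x: "x \<in> \<Omega>"
  shows "DU x h = DU (reflect e x) (reflect e h)"
proof -
  note s = symm_reflect[OF e]
  have lin: "linear (reflect e)" using s by (simp add: symm_def orthogonal_transformation_linear)
  have rx: "reflect e x \<in> \<Omega>" using symm_\<Omega>[OF s] x by blast
  have "((\<lambda>y. U (reflect e y)) has_derivative (\<lambda>h. DU (reflect e x) (reflect e h))) (at x)"
    by (rule has_derivative_compose[OF linear_imp_has_derivative[OF lin] DU_at[OF rx]])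
  then have "(U has_derivative (\<lambda>h. DU (reflect e x) (reflect e h))) (at x)"
    by (rule has_derivative_transform_within_open[OF _ \<Omega>(1) x]) (use z in \<open>simp add: w_def\<close>)
  then have "DU x = (\<lambda>h. DU (reflect e x) (reflect e h))" using has_derivative_unique[OF DU_at[OF x]] by blast
  then show ?thesis by (rule fun_cong)
qed

text \<open>Conjugation with the reflection reverses the sense of the rotation in the plane of
  \<open>e\<close> and \<open>q\<close>, while \<open>U\<close> is unchanged.\<close>

lemma ang_reflect:
  assumes e: "unitK K e" and z: "\<forall>x\<in>\<Omega>. w e x = 0" and eq: "e \<bullet> q = 0" and x: "x \<in> \<Omega>"
  shows "ang e q (reflect e x) = - ang e q x"
proof -
  have rx: "reflect e x \<in> \<Omega>" using symm_\<Omega>[OF symm_reflect[OF e]] x by blast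
  have "q \<bullet> reflect e x = q \<bullet> x" using eq by (simp add: reflect_def inner_diff_right inner_commute)
  then have r: "rotgen e q (reflect e x) = - reflect e (rotgen e q x)"
    using unitK_inner[OF e] eq
    by (simp add: rotgen_def inner_reflect[OF e]) (simp add: reflect_def inner_diff_right vec_eq_iff algebra_simps)
  have "ang e q (reflect e x) = DU (reflect e x) (- reflect e (rotgen e q x))"
    by (simp add: ang_eq[OF in_closure[OF rx]] r)
  also have "\<dots> = - DU x (rotgen e q x)"
    by (simp add: DU_reflect[OF e z x, symmetric] linear_neg[OF DU_linear[OF in_closure[OF rx]]])
  finally show ?thesis by (simp add: ang_eq[OF in_closure[OF x]])
qed

lemma ang_minus: "ang e (- q) x = - ang e q x"
  unfolding ang_def sum_negf[symmetric] by (simp add: rotgen_def flip: scaleR_minus_left)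

lemma zero_trace_ang:
  assumes e: "unitK K e" "unitK K q" "e \<bullet> q = 0" and z: "\<forall>x\<in>\<Omega>. w e x = 0"
  shows "zero_trace (half e) (ang e q)"
proof (rule zero_trace_half)
  show "ang e q x = 0" if "x \<in> \<Omega>" "e \<bullet> x = 0" for x
    using ang_reflect[OF e(1) z e(3) that(1)] by (simp add: reflect_fix[OF that(2)] eq_neg_iff_add_eq_0 flip: scaleR_2)
qed (auto intro: ang_C1 ang_continuous ang_frontier[OF e])

lemma pot_reflect:
  assumes e: "unitK K e" and z: "\<forall>x\<in>\<Omega>. w e x = 0" and x: "x \<in> \<Omega>"
  shows "pot i j (reflect e x) = pot i j x"
  using z x by (simp add: pot_def jac_symm[OF symm_reflect[OF e]] w_def)

end

context morse_one
begin

text \<open>A function of negative energy on one half has a mirror image of the same energy on the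
  other; disjoint supports would give index at least two.\<close>

lemma symmetric_semistable:
  assumes e: "unitK K e" and z: "\<forall>x\<in>\<Omega>. w e x = 0"
  shows "semistable (half e)"
proof (rule ccontr)
  assume "\<not> semistable (half e)"
  then obtain \<Phi> where \<Phi>: "tests (half e) \<Phi>" "BF pot \<Phi> \<Phi> < 0" using semistable_not by blast
  let ?\<Psi> = "\<lambda>x. \<Phi> (reflect e x)"
  have t\<Psi>: "tests (half (- e)) ?\<Psi>" by (rule tests_reflect_half[OF e \<Phi>(1)])
  have "BF pot ?\<Psi> ?\<Psi> = BF (\<lambda>i j x. pot i j (reflect e x)) \<Phi> \<Phi>"
    by (rule BF_pot_reflect[OF e tests_mono[OF \<Phi>(1) half_subset], symmetric])
  also have "\<dots> = BF pot \<Phi> \<Phi>"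
    by (rule BF_cong_on[OF \<Phi>(1)]) (use pot_reflect[OF e z] half_subset in blast)
  finally show False
    using index_contra_disjoint[OF \<Phi>(1) t\<Psi> half_subset half_subset half_disjoint \<Phi>(2)] \<Phi>(2) by simp
qed

text \<open>
  The positive part of the angular derivative minimises the quadratic form on the half, so the
  angular derivative, if not zero, has a sign and solves both the linearised system and its
  symmetrisation.
\<close>

lemma ang_dichotomy:
  assumes e: "unitK K e" "unitK K q" "e \<bullet> q = 0" and z: "\<forall>x\<in>\<Omega>. w e x = 0"
  shows "(\<forall>x\<in>half e. \<forall>i. ang e q x $ i \<le> 0) \<or>
    ((\<forall>x\<in>half e. \<forall>i. 0 < ang e q x $ i) \<and>
     (\<forall>x\<in>half e. \<forall>i. (\<Sum>j\<in>UNIV. pot i j x * ang e q x $ j) = (\<Sum>j\<in>UNIV. pot j i x * ang e q x $ j)))"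
proof -
  let ?v = "ang e q" and ?D = "half e" and ?c = "sympart pot"
  have zt: "zero_trace ?D ?v" by (rule zero_trace_ang[OF e z])
  have pc: "continuous_on (closure ?D) (pot i j)" for i j by (rule pot_continuous_on(2)[OF half_subset])
  have p0: "0 \<le> pot i j x" if "x \<in> ?D" "i \<noteq> j" for i j x using that pot_nonneg half_subset by blast
  have sub: "subsol pot ?D ?v"
  proof (rule subsolI[OF open_half bounded_half zt pc, where h = "\<lambda>x. \<chi> i. \<Sum>j\<in>UNIV. pot i j x * ?v x $ j"])
    fix i \<phi> assume "test ?D \<phi>"
    then have t: "test \<Omega> \<phi>" using half_subset by (rule test_mono)
    show "cc (\<lambda>x. (\<chi> i. \<Sum>j\<in>UNIV. pot i j x * ?v x $ j) $ i * \<phi> x)"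
      using ang_test_cc[OF t] by simp
    show "integral UNIV (\<lambda>x. gradient (\<lambda>y. ?v y $ i) x \<bullet> gradient \<phi> x) =
        integral UNIV (\<lambda>x. (\<chi> i. \<Sum>j\<in>UNIV. pot i j x * ?v x $ j) $ i * \<phi> x)"
      using ang_weak_eq[OF e t] by simp
  next
    fix i x assume x: "x \<in> ?D" "0 < ?v x $ i"
    then have xO: "x \<in> \<Omega>" using half_subset by blast
    have "(\<Sum>j\<in>UNIV. pot i j x * ?v x $ j) \<le> (\<Sum>j\<in>UNIV. pot i j x * max 0 (?v x $ j))"
      unfolding pot_def by (intro sum_mono jac_pos_part_le[OF xO]) (use x in simp)
    then show "(\<chi> i. \<Sum>j\<in>UNIV. pot i j x * ?v x $ j) $ i \<le> (\<Sum>j\<in>UNIV. pot i j x * max 0 (?v x $ j))" by simp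
  qed
  have nonneg: "0 \<le> BF pot \<Phi> \<Phi>" if "tests ?D \<Phi>" for \<Phi>
    using symmetric_semistable[OF e(1) z] that by (simp add: semistable_def)
  note P = posv_dichotomy[OF e(1) zt pc p0 sub nonneg]
  have sol: "weak_sol ?c ?D (posv ?D ?v)" by (rule P(1))
  have "\<exists>I. (\<forall>i\<in>I. \<forall>x\<in>?D. 0 < ?v x $ i) \<and> (\<forall>i\<in>-I. \<forall>x\<in>?D. ?v x $ i \<le> 0) \<and>
      (\<forall>i\<in>-I. \<forall>j\<in>I. \<forall>x\<in>?D. ?c i j x = 0)" by (rule P(2))
  then obtain I where I: "\<forall>i\<in>I. \<forall>x\<in>?D. 0 < ?v x $ i" "\<forall>i\<in>-I. \<forall>x\<in>?D. ?v x $ i \<le> 0"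
    "\<forall>i\<in>-I. \<forall>j\<in>I. \<forall>x\<in>?D. ?c i j x = 0" by (elim exE conjE)
  consider "I = {}" | "I = UNIV" | "I \<noteq> {}" "I \<noteq> UNIV" by blast
  then show ?thesis
  proof cases
    case 1
    then show ?thesis using I(2) by auto
  next
    case 3
    then obtain i j x where ij: "i \<in> I" "j \<in> -I" and x: "x \<in> ?D \<union> half (- e)" "0 < pot i j x"
      using coupling_half[OF e(1)] by blast
    have ne: "i \<noteq> j" using ij by auto
    have zz: "pot i j y = 0" if y: "y \<in> ?D" for y
    proof -
      have "?c j i y = 0" using I(3) ij y by blast
      moreover have "0 \<le> pot i j y" "0 \<le> pot j i y" using p0[OF y] ne by auto
      ultimately show ?thesis by (simp add: sympart_def)
    qed
    have "pot i j x = 0"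
    proof (cases "x \<in> ?D")
      case False
      then have r: "reflect e x \<in> ?D" "x \<in> \<Omega>"
        using x(1) reflect_half[OF unitK_minus[OF e(1)]] half_subset by (auto simp: reflect_minus)
      show ?thesis using zz[OF r(1)] pot_reflect[OF e(1) z r(2)] by simp
    qed (rule zz)
    then show ?thesis using x(2) by simp
  next
    case 2
    have pos: "0 < ?v x $ i" if "x \<in> ?D" for x i using I(1) 2 that by blast
    have pv: "posv ?D ?v x $ i = ?v x $ i" if "x \<in> ?D" for x i
      using pos[OF that, of i] that by (simp add: posv_def pos_on_def)
    \<comment> \<open>As \<open>?v\<close> is positive, it equals its positive part, and the two
      weak equations share their left-hand side. So the right-hand sides agree pointwise; the
      symmetrised one is the mean of the sums with \<open>pot\<close> and with its transpose, and
      these two are therefore equal.\<close>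
    have "(\<Sum>j\<in>UNIV. ?c i j x * ?v x $ j) - (\<Sum>j\<in>UNIV. pot i j x * ?v x $ j) = 0" if x: "x \<in> ?D" for x i
    proof (rule fundamental_lemma_bump[OF open_half _ _ x])
      have vc: "continuous_on ?D (\<lambda>x. ?v x $ j)" for j
        using zt by (auto simp: zero_trace_def intro: C1_on_continuous)
      have cD: "continuous_on ?D (pot i j)" for i j by (rule pot_continuous_on(1)[OF half_subset])
      have cS: "continuous_on ?D (?c i j)" for i j
        unfolding sympart_def by (intro continuous_on_divide continuous_on_add continuous_on_const cD) auto
      have c1: "continuous_on ?D (\<lambda>x. \<Sum>j\<in>UNIV. ?c i j x * ?v x $ j)" "continuous_on ?D (\<lambda>x. \<Sum>j\<in>UNIV. pot i j x * ?v x $ j)"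
        by (intro continuous_on_sum continuous_on_mult cS cD vc)+
      then show "continuous_on ?D (\<lambda>x. (\<Sum>j\<in>UNIV. ?c i j x * ?v x $ j) - (\<Sum>j\<in>UNIV. pot i j x * ?v x $ j))"
        by (rule continuous_on_diff)
      fix y s assume s: "0 < (s::real)" "cball y s \<subseteq> ?D"
      have tb: "test ?D (bump y s)" using s by (intro test_bump) auto
      have tbO: "test \<Omega> (bump y s)" using tb half_subset by (rule test_mono)
      have cc1: "cc (\<lambda>x. g x * bump y s x)" if "continuous_on ?D g" for g
        using csupp_cc[OF csupp_mult[OF open_half test_csupp[OF tb] that]] by (simp add: mult.commute)
      have out: "bump y s x = 0" "lap_bump y s x = 0" if "x \<notin> ?D" for x
      proof -
        have "x \<notin> ball y s" using that s(2) ball_subset_cball by blast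
        from bp_outside[OF _ this] s(1) show "bump y s x = 0" "lap_bump y s x = 0" by (auto simp: lap_bump_def bump_def)
      qed
      have "integral UNIV (\<lambda>x. (\<Sum>j\<in>UNIV. ?c i j x * ?v x $ j) * bump y s x) =
          integral UNIV (\<lambda>x. (\<Sum>j\<in>UNIV. ?c i j x * posv ?D ?v x $ j) * bump y s x)"
      proof (intro arg_cong[where f="integral UNIV"] ext)
        fix x
        show "(\<Sum>j\<in>UNIV. ?c i j x * ?v x $ j) * bump y s x = (\<Sum>j\<in>UNIV. ?c i j x * posv ?D ?v x $ j) * bump y s x"
          by (cases "x \<in> ?D") (simp_all add: pv out)
      qed
      also have "\<dots> = - integral UNIV (\<lambda>x. posv ?D ?v x $ i * lap_bump y s x)"
        using sol s unfolding weak_sol_def by simp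
      also have "integral UNIV (\<lambda>x. posv ?D ?v x $ i * lap_bump y s x) = integral UNIV (\<lambda>x. ?v x $ i * lap_bump y s x)"
      proof (intro arg_cong[where f="integral UNIV"] ext)
        fix x
        show "posv ?D ?v x $ i * lap_bump y s x = ?v x $ i * lap_bump y s x"
          by (cases "x \<in> ?D") (simp_all add: pv out)
      qed
      also have "- integral UNIV (\<lambda>x. ?v x $ i * lap_bump y s x) = integral UNIV (\<lambda>x. gradient (\<lambda>y. ?v y $ i) x \<bullet> gradient (bump y s) x)"
        using zt by (intro integral_by_parts_bump[OF less_imp_le[OF s(1)] s(2) open_half, symmetric]) (simp add: zero_trace_def)
      also have "\<dots> = integral UNIV (\<lambda>x. (\<Sum>j\<in>UNIV. pot i j x * ?v x $ j) * bump y s x)"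
        by (rule ang_weak_eq[OF e tbO])
      finally show "integral UNIV (\<lambda>x. ((\<Sum>j\<in>UNIV. ?c i j x * ?v x $ j) - (\<Sum>j\<in>UNIV. pot i j x * ?v x $ j)) * bump y s x) = 0"
        unfolding left_diff_distrib cc_integral_diff[OF cc1[OF c1(1)] cc1[OF c1(2)]] by simp
    qed
    moreover have "(\<Sum>j\<in>UNIV. ?c i j x * ?v x $ j) = ((\<Sum>j\<in>UNIV. pot i j x * ?v x $ j) + (\<Sum>j\<in>UNIV. pot j i x * ?v x $ j)) / 2" for i x
      unfolding sum.distrib[symmetric] sum_divide_distrib by (intro sum.cong refl) (simp add: sympart_def algebra_simps)
    ultimately have "(\<Sum>j\<in>UNIV. pot i j x * ?v x $ j) = (\<Sum>j\<in>UNIV. pot j i x * ?v x $ j)" if "x \<in> ?D" for x i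
      using that by fastforce
    then show ?thesis using pos by blast
  qed
qed

text \<open>The dichotomy is applied to \<open>q\<close> and to \<open>- q\<close>, of which the
  angular derivative is an odd function. The identity passes to the other half because
  \<open>ang\<close> is odd and \<open>pot\<close> even under the reflection; on the hyperplane the
  derivative vanishes.\<close>

lemma ang_sign:
  assumes e: "unitK K e" "unitK K q" "e \<bullet> q = 0" and z: "\<forall>x\<in>\<Omega>. w e x = 0"
  shows "(\<forall>x\<in>half e. \<forall>i. 0 < ang e q x $ i) \<or> (\<forall>x\<in>half e. \<forall>i. ang e q x $ i < 0) \<or> (\<forall>x\<in>\<Omega>. ang e q x = 0)"
    and ang_identity: "x \<in> \<Omega> \<Longrightarrow> (\<Sum>j\<in>UNIV. pot i j x * ang e q x $ j) = (\<Sum>j\<in>UNIV. pot j i x * ang e q x $ j)"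
proof -
  have q': "unitK K (- q)" "e \<bullet> (- q) = 0" using e by (auto simp: unitK_minus)
  note d1 = ang_dichotomy[OF e z] and d2 = ang_dichotomy[OF e(1) q' z, unfolded ang_minus]
  have cover: "x \<in> half e \<or> reflect e x \<in> half e \<or> e \<bullet> x = 0" if "x \<in> \<Omega>" for x
    using that reflect_half[OF unitK_minus[OF e(1)], of x] by (fastforce simp: half_def reflect_minus)
  have plane: "ang e q x = 0" if "x \<in> \<Omega>" "e \<bullet> x = 0" for x
    using ang_reflect[OF e(1) z e(3) that(1)] by (simp add: reflect_fix[OF that(2)] eq_neg_iff_add_eq_0 flip: scaleR_2)
  have zero: "ang e q x = 0" if le: "\<forall>x\<in>half e. \<forall>i. ang e q x $ i \<le> 0" "\<forall>x\<in>half e. \<forall>i. (- ang e q x) $ i \<le> 0"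
    and x: "x \<in> \<Omega>" for x
  proof -
    have h: "ang e q y = 0" if "y \<in> half e" for y
      using le that by (auto simp: vec_eq_iff intro!: antisym)
    show ?thesis
      using cover[OF x]
    proof (elim disjE)
      assume "reflect e x \<in> half e"
      from h[OF this] show ?thesis using ang_reflect[OF e(1) z e(3) x] by simp
    qed (use h plane x in auto)
  qed
  show "(\<forall>x\<in>half e. \<forall>i. 0 < ang e q x $ i) \<or> (\<forall>x\<in>half e. \<forall>i. ang e q x $ i < 0) \<or> (\<forall>x\<in>\<Omega>. ang e q x = 0)"
    using d1 d2 zero by auto
  have half_id: "(\<Sum>j\<in>UNIV. pot i j x * ang e q x $ j) = (\<Sum>j\<in>UNIV. pot j i x * ang e q x $ j)" if "x \<in> half e" for x i
  proof -
    have xO: "x \<in> \<Omega>" using that half_subset by blast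
    consider "\<forall>x\<in>half e. \<forall>i. ang e q x $ i \<le> 0" "\<forall>x\<in>half e. \<forall>i. (- ang e q x) $ i \<le> 0"
      | "\<forall>x\<in>half e. \<forall>i. (\<Sum>j\<in>UNIV. pot i j x * ang e q x $ j) = (\<Sum>j\<in>UNIV. pot j i x * ang e q x $ j)"
      | "\<forall>x\<in>half e. \<forall>i. (\<Sum>j\<in>UNIV. pot i j x * (- ang e q x) $ j) = (\<Sum>j\<in>UNIV. pot j i x * (- ang e q x) $ j)"
      using d1 d2 by blast
    then show ?thesis
    proof cases
      case 1
      then show ?thesis using zero[OF 1 xO] by simp
    next
      case 3
      then have "(\<Sum>j\<in>UNIV. pot i j x * (- ang e q x) $ j) = (\<Sum>j\<in>UNIV. pot j i x * (- ang e q x) $ j)" using that by blast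
      then show ?thesis by (simp add: sum_negf)
    qed (use that in blast)
  qed
  assume x: "x \<in> \<Omega>"
  show "(\<Sum>j\<in>UNIV. pot i j x * ang e q x $ j) = (\<Sum>j\<in>UNIV. pot j i x * ang e q x $ j)"
    using cover[OF x]
  proof (elim disjE)
    assume "reflect e x \<in> half e"
    from half_id[OF this, of i] show ?thesis
      by (simp add: ang_reflect[OF e(1) z e(3) x] pot_reflect[OF e(1) z x] sum_negf)
  qed (use half_id plane x in auto)
qed

end

subsection \<open>The axis of symmetry\<close>

lemma inner_part2: "part2 K p = 0 \<Longrightarrow> p \<bullet> part2 K x = 0"
  using inner_part1[of K p x] part1_plus_part2[of K x] inner_add_left[of "part1 K x" "part2 K x" p]
  by (simp add: inner_commute)

lemma part2_part1: "part2 K (part1 K x) = 0" and part2_part2: "part2 K (part2 K x) = part2 K x"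
  and part1_part2: "part1 K (part2 K x) = 0"
  by (simp_all add: part1_def part2_def vec_eq_iff)

lemma part2_linear_simps:
  "part2 K (x + y) = part2 K x + part2 K y" "part2 K (x - y) = part2 K x - part2 K y" "part2 K (c *\<^sub>R x) = c *\<^sub>R part2 K x"
  using linear_part2[of K] by (auto simp: linear_add linear_diff linear_scale)

lemma part1_linear_simps:
  "part1 K (x + y) = part1 K x + part1 K y" "part1 K (c *\<^sub>R x) = c *\<^sub>R part1 K x"
  using linear_part1[of K] by (auto simp: linear_add linear_scale)

lemma unitK_normalise: "part2 K z = 0 \<Longrightarrow> z \<noteq> 0 \<Longrightarrow> unitK K (z /\<^sub>R norm z)"
  by (simp add: unitK_def part2_linear_simps)

lemma part1_unitK: "unitK K e \<Longrightarrow> part1 K e = e"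
  using part1_plus_part2[of K e] by (simp add: unitK_def)

lemma angle_eq: "part2 K p = 0 \<Longrightarrow> angle K p x = arccos ((p \<bullet> x) / norm (part1 K x))"
  by (simp add: angle_def inner_part1 inner_commute[of x] divide_inverse mult.commute)

lemma polar:
  assumes p: "unitK K p"
  shows "norm (part1 K x) * cos (angle K p x) = p \<bullet> x"
    and "norm (part1 K x) * sin (angle K p x) = sqrt ((norm (part1 K x))\<^sup>2 - (p \<bullet> x)\<^sup>2)"
    and "0 \<le> angle K p x" "angle K p x \<le> pi"
proof -
  let ?\<rho> = "norm (part1 K x)"
  have p2: "part2 K p = 0" "norm p = 1" using p by (auto simp: unitK_def)
  have le: "\<bar>p \<bullet> x\<bar> \<le> ?\<rho>"
    using Cauchy_Schwarz_ineq2[of "part1 K x" p] p2 by (simp add: inner_part1 inner_commute[of x])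
  have b: "\<bar>(p \<bullet> x) / ?\<rho>\<bar> \<le> 1"
    using le by (auto simp: abs_divide divide_le_eq_1)
  then have b': "-1 \<le> (p \<bullet> x) / ?\<rho>" "(p \<bullet> x) / ?\<rho> \<le> 1" by linarith+
  show "0 \<le> angle K p x" "angle K p x \<le> pi"
    unfolding angle_eq[OF p2(1)] using b' by (auto intro: arccos_lbound arccos_ubound)
  have c: "cos (angle K p x) = (p \<bullet> x) / ?\<rho>" and s: "sin (angle K p x) = sqrt (1 - ((p \<bullet> x) / ?\<rho>)\<^sup>2)"
    unfolding angle_eq[OF p2(1)] using b' by (auto simp: cos_arccos sin_arccos)
  show "?\<rho> * cos (angle K p x) = p \<bullet> x" unfolding c using le by auto
  show "?\<rho> * sin (angle K p x) = sqrt (?\<rho>\<^sup>2 - (p \<bullet> x)\<^sup>2)"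
  \<comment> \<open>At x' = 0 the angle is a convention, but both sides are zero since |p . x| \<le>
    |x'|.\<close>
  proof (cases "?\<rho> = 0")
    case True
    then show ?thesis using le by simp
  next
    case False
    have "?\<rho> * sqrt (1 - ((p \<bullet> x) / ?\<rho>)\<^sup>2) = sqrt (?\<rho>\<^sup>2 * (1 - ((p \<bullet> x) / ?\<rho>)\<^sup>2))"
      by (simp add: real_sqrt_mult)
    also have "?\<rho>\<^sup>2 * (1 - ((p \<bullet> x) / ?\<rho>)\<^sup>2) = ?\<rho>\<^sup>2 - (p \<bullet> x)\<^sup>2"
      using False by (simp add: power_divide right_diff_distrib)
    finally show ?thesis unfolding s .
  qed
qed

lemma rotp_base:
  assumes p: "unitK K p" and e: "unitK K e" "e \<bullet> p = 0"
  shows "rotp p e \<theta> (part2 K x + r *\<^sub>R p) = part2 K x + (r * cos \<theta>) *\<^sub>R p + (r * sin \<theta>) *\<^sub>R e"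
proof -
  have "p \<bullet> part2 K x = 0" "e \<bullet> part2 K x = 0" using p e by (auto simp: unitK_def inner_part2)
  then show ?thesis
    using unitK_inner[OF p] e(2)
    by (simp add: rotp_def inner_add_right algebra_simps flip: scaleR_add_left)
qed

lemma base_parts:
  assumes p: "unitK K p" and r: "0 \<le> r"
  shows "norm (part1 K (part2 K x + r *\<^sub>R p)) = r" "part2 K (part2 K x + r *\<^sub>R p) = part2 K x"
  using p r part1_unitK[OF p]
  by (simp_all add: part1_linear_simps part2_linear_simps part1_part2 part2_part2 unitK_def)

context morse_one
begin

text \<open>Only two dimensions are guaranteed in the space of x', so the vector is sought on one
  circle; the angle with tan t = - (a . p) / (b . p) cancels the component along
  \<open>p\<close>.\<close>

lemma unitK_orthogonal:
  assumes p: "unitK K p"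
  shows "\<exists>e. unitK K e \<and> e \<bullet> p = 0"
proof -
  obtain a b where ab: "unitK K a" "unitK K b" "a \<bullet> b = 0" using orthonormal_pair by blast
  show ?thesis
  proof (cases "b \<bullet> p = 0")
    case False
    define t where "t = arctan (- (a \<bullet> p) / (b \<bullet> p))"
    have c: "cos t \<noteq> 0" unfolding t_def by simp
    have "circ a b t \<bullet> p = cos t * (a \<bullet> p + tan t * (b \<bullet> p))"
      using c by (simp add: circ_def inner_add_left tan_def distrib_left)
    also have "\<dots> = 0" using False by (simp add: t_def tan_arctan)
    finally show ?thesis using unitK_circ[OF ab] by blast
  qed (use ab in blast)
qed

lemma ang_functional:
  assumes "x \<in> \<Omega>"
  shows "\<exists>c. \<forall>\<xi>. ang e \<xi> x $ i = c \<bullet> \<xi>"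
proof -
  have l1: "linear (DU x)" using assms by (intro DU_linear in_closure)
  have l2: "linear (\<lambda>\<xi>. rotgen e \<xi> x)"
    by (rule linearI) (simp_all add: rotgen_def inner_add_left algebra_simps)
  have lin: "linear (\<lambda>\<xi>. ang e \<xi> x $ i)"
    unfolding ang_eq[OF in_closure[OF assms]]
    by (rule linearI) (simp_all add: linear_add[OF l1] linear_add[OF l2] linear_scale[OF l1] linear_scale[OF l2])
  have "ang e \<xi> x $ i = adjoint (\<lambda>\<xi>. ang e \<xi> x $ i) 1 \<bullet> \<xi>" for \<xi>
    using adjoint_works[OF lin, of \<xi> 1] by (simp add: inner_commute)
  then show ?thesis by blast
qed

lemma U_rotp_invariant:
  assumes e: "unitK K e" "unitK K \<xi>" "e \<bullet> \<xi> = 0" and zero: "\<And>x. x \<in> \<Omega> \<Longrightarrow> ang e \<xi> x = 0" and x: "x \<in> \<Omega>"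
  shows "U (rotp e \<xi> t x) = U x"
proof -
  have "((\<lambda>t. U (rotp e \<xi> t x)) has_vector_derivative 0) (at t within UNIV)" for t
    using U_rotp_deriv[OF e in_closure[OF x], of t UNIV] zero symm_\<Omega>[OF symm_rotp[OF e]] x by simp
  then obtain c where "\<And>t. U (rotp e \<xi> t x) = c"
    by (rule has_vector_derivative_zero_constant[OF convex_UNIV]) auto
  from this[of t] this[of 0] show ?thesis by (simp add: rotp_0)
qed

text \<open>
  The case \<open>p = 0\<close> is included: it is the one that leads to radial functions.
\<close>

lemma U_canonical:
  assumes e: "unitK K e" and z: "\<forall>x\<in>\<Omega>. w e x = 0" and p: "p = 0 \<or> unitK K p" "e \<bullet> p = 0"
    and zero: "\<And>\<xi> x. unitK K \<xi> \<Longrightarrow> e \<bullet> \<xi> = 0 \<Longrightarrow> p \<bullet> \<xi> = 0 \<Longrightarrow> x \<in> \<Omega> \<Longrightarrow> ang e \<xi> x = 0"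
    and x: "x \<in> \<Omega>"
  shows "U x = U (part2 K x + (p \<bullet> x) *\<^sub>R p + sqrt ((norm (part1 K x))\<^sup>2 - (p \<bullet> x)\<^sup>2) *\<^sub>R e)"
proof -
  define a b v where "a = p \<bullet> x" and "b = e \<bullet> x" and "v = part1 K x - a *\<^sub>R p - b *\<^sub>R e"
  have e2: "part2 K e = 0" "e \<bullet> e = 1" using e unitK_inner by (auto simp: unitK_def)
  have p2: "part2 K p = 0" using p(1) linear_0[OF linear_part2] by (auto simp: unitK_def)
  \<comment> \<open>Valid for \<open>p = 0\<close> too, where \<open>a = 0\<close>.\<close>
  have ap: "a * (p \<bullet> p) = a" using p(1) unitK_inner by (auto simp: a_def)
  have px: "p \<bullet> part1 K x = a" "e \<bullet> part1 K x = b"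
    using inner_part1[OF p2, of x] inner_part1[OF e2(1), of x] by (simp_all add: a_def b_def inner_commute)
  have v: "part2 K v = 0" "e \<bullet> v = 0" "p \<bullet> v = 0"
    using p(2) e2 p2 ap px by (simp_all add: v_def part2_linear_simps part2_part1 inner_diff_right inner_commute)
  have x1: "part1 K x = a *\<^sub>R p + b *\<^sub>R e + v" by (simp add: v_def)
  have xx: "x = part2 K x + a *\<^sub>R p + b *\<^sub>R e + v" using part1_plus_part2[of K x] x1 by (simp add: algebra_simps)
  have "(norm (part1 K x))\<^sup>2 = (a *\<^sub>R p + b *\<^sub>R e + v) \<bullet> (a *\<^sub>R p + b *\<^sub>R e + v)"
    unfolding x1 by (rule power2_norm_eq_inner)
  also have "\<dots> = a * (a * (p \<bullet> p)) + b\<^sup>2 + v \<bullet> v"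
    using p(2) v e2 by (simp add: inner_add_left inner_add_right inner_commute power2_eq_square)
  finally have n: "(norm (part1 K x))\<^sup>2 - a\<^sup>2 = b\<^sup>2 + (norm v)\<^sup>2" by (simp only: ap dot_square_norm[of v]) (simp add: power2_eq_square)
  define s where "s = sqrt (b\<^sup>2 + (norm v)\<^sup>2)"
  have "U x = U (part2 K x + a *\<^sub>R p + s *\<^sub>R e)"
  \<comment> \<open>With \<open>v = 0\<close> there may be no direction orthogonal to
    \<open>e\<close> and \<open>p\<close> to rotate in, for instance when k = 2; the reflection
    symmetry in \<open>e\<close> takes over.\<close>
  proof (cases "v = 0")
    case True
    then have s: "s = \<bar>b\<bar>" by (simp add: s_def)
    show ?thesis
    proof (cases "0 \<le> b")
      case b: True
      then show ?thesis using xx True s by simp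
    next
      case False
      have "x = part2 K x + a *\<^sub>R p + b *\<^sub>R e" using xx True by simp
      then have "x - (2 * b) *\<^sub>R e = (part2 K x + a *\<^sub>R p + b *\<^sub>R e) - (2 * b) *\<^sub>R e" by (rule arg_cong)
      also have "\<dots> = part2 K x + a *\<^sub>R p + s *\<^sub>R e" using False by (simp add: s vec_eq_iff algebra_simps)
      finally have "reflect e x = part2 K x + a *\<^sub>R p + s *\<^sub>R e" by (simp add: reflect_def b_def)
      moreover have "U x = U (reflect e x)" using z x by (simp add: w_def)
      ultimately show ?thesis by simp
    qed
  next
    case False
    define \<xi> where "\<xi> = v /\<^sub>R norm v"
    have \<xi>: "unitK K \<xi>" "e \<bullet> \<xi> = 0" "p \<bullet> \<xi> = 0"
      using unitK_normalise[OF v(1) False] v by (simp_all add: \<xi>_def)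
    have v\<xi>: "v = norm v *\<^sub>R \<xi>" using False by (simp add: \<xi>_def)
    have \<xi>x: "\<xi> \<bullet> x = norm v"
    proof -
      have "part2 K \<xi> = 0" using \<xi>(1) by (simp add: unitK_def)
      then have "\<xi> \<bullet> x = \<xi> \<bullet> part1 K x" using inner_part1[of K \<xi> x] by (simp add: inner_commute)
      also have "\<dots> = \<xi> \<bullet> v" using \<xi> by (simp add: x1 inner_add_right inner_commute)
      also have "\<dots> = norm v * (\<xi> \<bullet> \<xi>)" by (subst v\<xi>) simp
      finally show ?thesis using unitK_inner[OF \<xi>(1)] by simp
    qed
    have s: "0 < s" "s\<^sup>2 = b\<^sup>2 + (norm v)\<^sup>2" using False by (auto simp: s_def intro!: add_nonneg_pos)
    \<comment> \<open>This angle \<open>t\<close> takes \<open>b e + |v| \<xi>\<close> to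
      \<open>s e\<close> in the plane of \<open>e\<close> and \<open>\<xi>\<close>; the rest of
      \<open>x\<close> is fixed.\<close>
    have "(b / s)\<^sup>2 + (- norm v / s)\<^sup>2 = 1"
      using s(1) by (simp add: power_divide s(2)[symmetric] flip: add_divide_distrib)
    then obtain t where t: "b / s = cos t" "- norm v / s = sin t" using sincos_total_2pi by metis
    have bs: "b = s * cos t" "norm v = - s * sin t" using s(1) t by (auto simp: field_simps)
    have c1: "cos t * b - sin t * norm v = s"
    proof -
      have "cos t * b - sin t * norm v = s * ((cos t)\<^sup>2 + (sin t)\<^sup>2)"
        unfolding bs power2_eq_square by algebra
      then show ?thesis by (simp only: sin_cos_squared_add2 mult_1_right)
    qed
    have c2: "sin t * b + cos t * norm v = 0" unfolding bs by simp
    have "rotp e \<xi> t x = x + ((cos t * b - sin t * norm v) - b) *\<^sub>R e + ((sin t * b + cos t * norm v) - norm v) *\<^sub>R \<xi>"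
      by (simp add: rotp_def \<xi>x b_def[symmetric] algebra_simps)
    also have "\<dots> = x - b *\<^sub>R e - norm v *\<^sub>R \<xi> + s *\<^sub>R e"
      unfolding c1 c2 by (simp add: algebra_simps)
    also have "x - b *\<^sub>R e - norm v *\<^sub>R \<xi> = x - b *\<^sub>R e - v" by (simp flip: v\<xi>)
    also have "\<dots> = (part2 K x + a *\<^sub>R p + b *\<^sub>R e + v) - b *\<^sub>R e - v"
      by (rule arg_cong[OF xx, of "\<lambda>z. z - b *\<^sub>R e - v"])
    also have "\<dots> = part2 K x + a *\<^sub>R p" by (simp add: algebra_simps)
    finally show ?thesis using U_rotp_invariant[OF e \<xi>(1,2) zero[OF \<xi>] x, of t] by simp
  qed
  then show ?thesis unfolding s_def n[symmetric] by (simp add: a_def)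
qed

text \<open>One component at one point decides: by \<open>ang_sign\<close>, an angular derivative
  that vanishes there vanishes in all of \<open>\<Omega>\<close>. The axis is thus read off from a
  single linear functional.\<close>

lemma axis_exists:
  assumes e: "unitK K e" and z: "\<forall>x\<in>\<Omega>. w e x = 0" and nr: "\<not> radial K \<Omega> U"
  shows "\<exists>p. unitK K p \<and> e \<bullet> p = 0 \<and> (\<forall>x\<in>half e. \<forall>i. 0 < ang e p x $ i) \<and>
    (\<forall>\<xi> x. unitK K \<xi> \<longrightarrow> e \<bullet> \<xi> = 0 \<longrightarrow> p \<bullet> \<xi> = 0 \<longrightarrow> x \<in> \<Omega> \<longrightarrow> ang e \<xi> x = 0)"
proof -
  obtain x0 where x0: "x0 \<in> half e" using half_nonempty[OF e] by auto
  then have x0O: "x0 \<in> \<Omega>" using half_subset by blast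
  \<comment> \<open>\<open>undefined\<close> stands for an arbitrary component; by
    \<open>ang_sign\<close> they all share one sign.\<close>
  obtain c where c: "\<And>\<xi>. ang e \<xi> x0 $ undefined = c \<bullet> \<xi>" using ang_functional[OF x0O] by blast
  \<comment> \<open>The orthogonal projection of \<open>c\<close> onto the directions of x' that are
    orthogonal to \<open>e\<close>, on which it represents the same functional.\<close>
  define d where "d = part1 K c - (e \<bullet> c) *\<^sub>R e"
  have e2: "part2 K e = 0" "e \<bullet> e = 1" using e unitK_inner by (auto simp: unitK_def)
  have d2: "part2 K d = 0" by (simp add: d_def part2_linear_simps part2_part1 e2)
  have ed: "e \<bullet> d = 0" using e2 inner_part1[OF e2(1), of c] by (simp add: d_def inner_diff_right inner_commute)
  have d\<xi>: "c \<bullet> \<xi> = d \<bullet> \<xi>" if "unitK K \<xi>" "e \<bullet> \<xi> = 0" for \<xi>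
    using that inner_part1[of K \<xi> c] by (simp add: d_def inner_diff_left unitK_def)
  have zero: "ang e \<xi> x = 0" if \<xi>: "unitK K \<xi>" "e \<bullet> \<xi> = 0" "d \<bullet> \<xi> = 0" and x: "x \<in> \<Omega>" for \<xi> x
  proof -
    have "ang e \<xi> x0 $ undefined = 0" using c[of \<xi>] d\<xi>[OF \<xi>(1,2)] \<xi>(3) by simp
    then have "\<not> (\<forall>x\<in>half e. \<forall>i. 0 < ang e \<xi> x $ i)" "\<not> (\<forall>x\<in>half e. \<forall>i. ang e \<xi> x $ i < 0)"
      using x0 by (auto intro!: bexI[of _ x0] exI[of _ undefined])
    then have "\<forall>x\<in>\<Omega>. ang e \<xi> x = 0" using ang_sign(1)[OF e \<xi>(1,2) z] by blast
    then show ?thesis using x by blast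
  qed
  \<comment> \<open>If the functional vanished, so would every admissible angular derivative, and
    the canonical position with axis 0 would depend on |x'| and x'' only.\<close>
  have d0: "d \<noteq> 0"
  proof
    assume "d = 0"
    then have zero': "ang e \<xi> x = 0" if "unitK K \<xi>" "e \<bullet> \<xi> = 0" "0 \<bullet> \<xi> = 0" "x \<in> \<Omega>" for \<xi> x
      using zero that by simp
    have "U x = U (part2 K x + norm (part1 K x) *\<^sub>R e)" if "x \<in> \<Omega>" for x
    proof -
      have "U x = U (part2 K x + (0 \<bullet> x) *\<^sub>R 0 + sqrt ((norm (part1 K x))\<^sup>2 - (0 \<bullet> x)\<^sup>2) *\<^sub>R e)"
        by (rule U_canonical[OF e z _ _ zero' that]) simp_all
      then show ?thesis by simp
    qed
    then have "radial K \<Omega> U"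
      unfolding radial_def by (intro exI[of _ "\<lambda>r y. U (y + r *\<^sub>R e)"]) blast
    then show False using nr by contradiction
  qed
  define p where "p = d /\<^sub>R norm d"
  have p: "unitK K p" "e \<bullet> p = 0" using unitK_normalise[OF d2 d0] ed by (simp_all add: p_def)
  have "ang e p x0 $ undefined = d \<bullet> p" using c[of p] d\<xi>[OF p] by simp
  also have "\<dots> = norm d" using d0 by (simp add: p_def dot_square_norm power2_eq_square)
  finally have "0 < ang e p x0 $ undefined" using d0 by simp
  then have "\<not> (\<forall>x\<in>half e. \<forall>i. ang e p x $ i < 0)" "\<not> (\<forall>x\<in>\<Omega>. ang e p x = 0)"
    using x0 x0O by (auto intro!: bexI[of _ x0] exI[of _ undefined])
  then have "\<forall>x\<in>half e. \<forall>i. 0 < ang e p x $ i" using ang_sign(1)[OF e p z] by blast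
  moreover have "ang e \<xi> x = 0" if "unitK K \<xi>" "e \<bullet> \<xi> = 0" "p \<bullet> \<xi> = 0" "x \<in> \<Omega>" for \<xi> x
    using zero[OF that(1,2) _ that(4)] that(3) d0 by (simp add: p_def)
  ultimately show ?thesis using p by blast
qed

lemma ang_swap: "x \<in> \<Omega> \<Longrightarrow> ang p e x = - ang e p x"
  using linear_neg[OF DU_linear[OF in_closure], of x "rotgen e p x"]
  by (simp add: ang_eq[OF in_closure] rotgen_def)

lemma ang_plane:
  assumes e: "unitK K e" and z: "\<forall>x\<in>\<Omega>. w e x = 0" and p: "e \<bullet> p = 0" and x: "x \<in> \<Omega>" "e \<bullet> x = 0"
  shows "ang e p x = 0"
  using ang_reflect[OF e z p x(1)] by (simp add: reflect_fix[OF x(2)] eq_neg_iff_add_eq_0 flip: scaleR_2)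

lemma base_in:
  assumes p: "unitK K p" and x: "x \<in> \<Omega>"
  shows "part2 K x + norm (part1 K x) *\<^sub>R p \<in> \<Omega>"
  by (rule iffD2[OF \<Omega>_invariant[OF base_parts[OF p norm_ge_zero]] x])

text \<open>The profile samples \<open>U\<close> on the half circle that starts at the base point on
  the axis and turns towards \<open>e\<close>. For angles in [0, \<pi>] this arc stays on the side
  of \<open>e\<close>, or on the hyperplane, where the \<theta>-derivative \<open>- ang e p\<close>
  has the right sign.\<close>

lemma foliated_exists:
  assumes e: "unitK K e" and z: "\<forall>x\<in>\<Omega>. w e x = 0" and p: "unitK K p" "e \<bullet> p = 0"
    and pos: "\<forall>x\<in>half e. \<forall>i. 0 < ang e p x $ i"
    and zero: "\<And>\<xi> x. unitK K \<xi> \<Longrightarrow> e \<bullet> \<xi> = 0 \<Longrightarrow> p \<bullet> \<xi> = 0 \<Longrightarrow> x \<in> \<Omega> \<Longrightarrow> ang e \<xi> x = 0"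
  shows "foliated_Schwarz_rep K \<Omega> U p (\<lambda>r y \<theta>. U (rotp p e \<theta> (y + r *\<^sub>R p)))"
  unfolding foliated_Schwarz_rep_def
proof (intro conjI ballI impI allI)
  show "norm p = 1" "part2 K p = 0" using p(1) by (auto simp: unitK_def)
next
  fix x assume x: "x \<in> \<Omega>"
  show "U x = U (rotp p e (angle K p x) (part2 K x + norm (part1 K x) *\<^sub>R p))"
    unfolding rotp_base[OF p(1) e p(2)] polar(1,2)[OF p(1)]
    by (rule U_canonical[OF e z disjI2[OF p(1)] p(2) _ x]) (rule zero)
next
  fix x i assume x: "x \<in> \<Omega>" "part1 K x \<noteq> 0"
  have pe: "p \<bullet> e = 0" using p(2) by (simp add: inner_commute)
  define y where "y = part2 K x + norm (part1 K x) *\<^sub>R p"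
  have y: "y \<in> \<Omega>" unfolding y_def by (rule base_in[OF p(1) x(1)])
  have R: "rotp p e t y \<in> \<Omega>" for t using symm_\<Omega>[OF symm_rotp[OF p(1) e pe]] y by blast
  have d: "((\<lambda>t. U (rotp p e t y) $ i) has_field_derivative - ang e p (rotp p e t y) $ i) (at t)" for t
  proof -
    have "((\<lambda>t. U (rotp p e t y)) has_derivative (\<lambda>h. h *\<^sub>R ang p e (rotp p e t y))) (at t)"
      using U_rotp_deriv[OF p(1) e pe in_closure[OF y], of t UNIV] by (simp add: has_vector_derivative_def)
    from bounded_linear.has_derivative[OF bounded_linear_vec_nth this]
    show ?thesis by (rule has_derivative_imp_has_field_derivative) (simp add: ang_swap[OF R, where p = p and e = e])
  qed
  \<comment> \<open>The component of the arc along \<open>e\<close> is r sin t; where it is zero the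
    point lies on the hyperplane and the angular derivative vanishes.\<close>
  have nn: "0 \<le> ang e p (rotp p e t y) $ i" if t: "0 \<le> t" "t \<le> pi" for t
  proof -
    have "e \<bullet> part2 K x = 0" using e by (simp add: unitK_def inner_part2)
    then have "e \<bullet> rotp p e t y = norm (part1 K x) * sin t"
      using p(2) unitK_inner[OF e] by (simp add: y_def rotp_base[OF p(1) e p(2)] inner_add_right)
    then have "0 \<le> e \<bullet> rotp p e t y" using sin_ge_zero[OF t] by simp
    then consider "rotp p e t y \<in> half e" | "e \<bullet> rotp p e t y = 0" using R[of t] by (force simp: half_def)
    then show ?thesis
    proof cases
      case 1
      then show ?thesis using pos by (auto intro: less_imp_le)
    next
      case 2
      then show ?thesis using ang_plane[OF e z p(2) R] by simp
    qed
  qed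
  show "antimono_on {0..pi} (\<lambda>\<theta>. U (rotp p e \<theta> (part2 K x + norm (part1 K x) *\<^sub>R p)) $ i)"
    unfolding y_def[symmetric]
  proof (rule monotone_onI)
    fix s t assume st: "s \<in> {0..pi}" "t \<in> {0..pi}" "s \<le> t"
    show "U (rotp p e t y) $ i \<le> U (rotp p e s y) $ i"
    proof (rule DERIV_nonpos_imp_nonincreasing[OF st(3)])
      fix u assume "s \<le> u" "u \<le> t"
      then have "0 \<le> ang e p (rotp p e u y) $ i" using nn st by simp
      then show "\<exists>l. ((\<lambda>t. U (rotp p e t y) $ i) has_field_derivative l) (at u) \<and> l \<le> 0"
        using d[of u] by (intro exI[of _ "- ang e p (rotp p e u y) $ i"]) simp
    qed
  qed
qed

text \<open>Reflection in a direction orthogonal to the axis preserves the angle. The theorem speaks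
  of every representation, so the symmetry needed for the identity must be recovered from the given
  axis and not from the constructed one.\<close>

lemma rep_symmetric:
  assumes rep: "foliated_Schwarz_rep K \<Omega> U p W" and e: "unitK K e" "e \<bullet> p = 0" and x: "x \<in> \<Omega>"
  shows "w e x = 0"
proof -
  note s = symm_reflect[OF e(1)]
  have p: "part2 K p = 0" using rep by (simp add: foliated_Schwarz_rep_def)
  have rx: "reflect e x \<in> \<Omega>" using symm_\<Omega>[OF s] x by blast
  have n: "norm (part1 K (reflect e x)) = norm (part1 K x)" "part2 K (reflect e x) = part2 K x"
    using symm_norm_part1[OF s] s by (auto simp: symm_def)
  have "p \<bullet> reflect e x = p \<bullet> x" using e(2) by (simp add: reflect_def inner_diff_right inner_commute)
  then have "angle K p (reflect e x) = angle K p x" by (simp add: angle_eq[OF p] n)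
  moreover have "U y = W (norm (part1 K y)) (part2 K y) (angle K p y)" if "y \<in> \<Omega>" for y
    using rep that by (simp add: foliated_Schwarz_rep_def)
  ultimately have "U (reflect e x) = U x" using x rx n by simp
  then show ?thesis by (simp add: w_def)
qed

text \<open>With \<open>e\<close> pointing from the axis towards \<open>x\<close>, the point lies on
  the half circle spanned by \<open>p\<close> and \<open>e\<close>, along which \<open>W\<close> is
  forced to equal \<open>U\<close>. Its \<theta>-derivative is then an angular derivative of
  \<open>U\<close>, one-sided at the ends.\<close>

lemma rep_partial_theta:
  assumes rep: "foliated_Schwarz_rep K \<Omega> U p W" and x: "x \<in> \<Omega>" "part1 K x \<noteq> 0"
  shows "\<exists>e. unitK K e \<and> e \<bullet> p = 0 \<and>
    (\<forall>j. partial_theta W j (norm (part1 K x)) (part2 K x) (angle K p x) = - ang e p x $ j)"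
proof -
  have p: "unitK K p" using rep by (simp add: foliated_Schwarz_rep_def unitK_def)
  then have p2: "part2 K p = 0" "p \<bullet> p = 1" using unitK_inner by (auto simp: unitK_def)
  define \<rho> v where "\<rho> = norm (part1 K x)" and "v = part1 K x - (p \<bullet> x) *\<^sub>R p"
  have \<rho>: "0 < \<rho>" using x(2) by (simp add: \<rho>_def)
  have v: "part2 K v = 0" "v \<bullet> p = 0"
    using p2 inner_part1[OF p2(1), of x]
    by (simp_all add: v_def part2_linear_simps part2_part1 inner_diff_left inner_diff_right inner_commute)
  obtain e where e: "unitK K e" "e \<bullet> p = 0" "v = norm v *\<^sub>R e"
  \<comment> \<open>On the axis itself any direction orthogonal to \<open>p\<close> will do.\<close>
  proof (cases "v = 0")
    case True
    then show ?thesis using unitK_orthogonal[OF p] that by auto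
  next
    case False
    show ?thesis by (rule that[of "v /\<^sub>R norm v"]) (use unitK_normalise[OF v(1) False] v(2) False in auto)
  qed
  have pe: "p \<bullet> e = 0" using e(2) by (simp add: inner_commute)
  define y where "y = part2 K x + \<rho> *\<^sub>R p"
  define \<theta> where "\<theta> = angle K p x"
  have y: "y \<in> \<Omega>" unfolding y_def \<rho>_def by (rule base_in[OF p x(1)])
  have \<theta>: "0 \<le> \<theta>" "\<theta> \<le> pi" unfolding \<theta>_def by (rule polar[OF p])+
  note s = symm_rotp[OF p e(1) pe]
  have R: "rotp p e t y \<in> \<Omega>" for t using symm_\<Omega>[OF s] y by blast
  have x1: "part1 K x = (p \<bullet> x) *\<^sub>R p + norm v *\<^sub>R e" using e(3) by (simp add: v_def)
  have "\<rho>\<^sup>2 = ((p \<bullet> x) *\<^sub>R p + norm v *\<^sub>R e) \<bullet> ((p \<bullet> x) *\<^sub>R p + norm v *\<^sub>R e)"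
    unfolding \<rho>_def x1 by (rule power2_norm_eq_inner)
  also have "\<dots> = (p \<bullet> x)\<^sup>2 + (norm v)\<^sup>2"
    using p2 pe e(2) unitK_inner[OF e(1)] by (simp add: inner_add_left inner_add_right power2_eq_square)
  finally have "sqrt (\<rho>\<^sup>2 - (p \<bullet> x)\<^sup>2) = norm v" by simp
  then have "\<rho> * cos \<theta> = p \<bullet> x" "\<rho> * sin \<theta> = norm v"
    using polar(1,2)[OF p, of x] by (simp_all add: \<rho>_def \<theta>_def)
  then have yx: "rotp p e \<theta> y = x"
    using x1 part1_plus_part2[of K x] by (simp add: y_def rotp_base[OF p e(1,2)] add_ac)
  \<comment> \<open>The arc stays in \<open>\<Omega>\<close> and its point at parameter
    \<open>t\<close> has angle exactly \<open>t\<close>, so the representation determines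
    \<open>W\<close> on all of [0, \<pi>], endpoints included.\<close>
  have W: "W \<rho> (part2 K x) t = U (rotp p e t y)" if t: "t \<in> {0..pi}" for t
  proof -
    have n: "norm (part1 K (rotp p e t y)) = \<rho>" "part2 K (rotp p e t y) = part2 K x"
      using symm_norm_part1[OF s, of t y] s base_parts[OF p less_imp_le[OF \<rho>], of x] by (simp_all add: symm_def y_def)
    have "p \<bullet> rotp p e t y = \<rho> * cos t"
      using p2 pe by (simp add: y_def rotp_base[OF p e(1,2)] inner_add_right inner_part2)
    then have "angle K p (rotp p e t y) = t"
      using \<rho> t by (simp add: angle_eq[OF p2(1)] n arccos_cos)
    then show ?thesis using rep R[of t] n by (simp add: foliated_Schwarz_rep_def)
  qed
  have "partial_theta W j \<rho> (part2 K x) \<theta> = - ang e p x $ j" for j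
  proof -
    have "((\<lambda>t. U (rotp p e t y)) has_vector_derivative - ang e p x) (at \<theta> within {0..pi})"
      using U_rotp_deriv[OF p e(1) pe in_closure[OF y], of \<theta> "{0..pi}"] by (simp add: yx ang_swap[OF x(1), where p = p and e = e])
    from bounded_linear.has_vector_derivative[OF bounded_linear_vec_nth this, of j]
    have "((\<lambda>t. U (rotp p e t y) $ j) has_vector_derivative - ang e p x $ j) (at \<theta> within {0..pi})" by simp
    then have "((\<lambda>t. W \<rho> (part2 K x) t $ j) has_vector_derivative - ang e p x $ j) (at \<theta> within {0..pi})"
      by (rule has_vector_derivative_transform[rotated 2]) (use \<theta> W in auto)
    then show ?thesis
      unfolding partial_theta_def using \<theta> by (intro vector_derivative_within_cbox[of 0 pi, simplified]) auto
  qed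
  then show ?thesis using e by (auto simp: \<rho>_def \<theta>_def)
qed

lemma rep_identity:
  assumes rep: "foliated_Schwarz_rep K \<Omega> U p W" and x: "x \<in> \<Omega>" "part1 K x \<noteq> 0"
  shows "(\<Sum>j\<in>UNIV. pot i j x * partial_theta W j (norm (part1 K x)) (part2 K x) (angle K p x)) =
    (\<Sum>j\<in>UNIV. pot j i x * partial_theta W j (norm (part1 K x)) (part2 K x) (angle K p x))"
proof -
  have p: "unitK K p" using rep by (simp add: foliated_Schwarz_rep_def unitK_def)
  obtain e where e: "unitK K e" "e \<bullet> p = 0"
    "\<And>j. partial_theta W j (norm (part1 K x)) (part2 K x) (angle K p x) = - ang e p x $ j"
    using rep_partial_theta[OF rep x] by blast
  have z: "\<forall>x\<in>\<Omega>. w e x = 0" using rep_symmetric[OF rep e(1,2)] by blast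
  show ?thesis using ang_identity[OF e(1) p e(2) z x(1), of i] by (simp add: e(3) sum_negf)
qed

text \<open>With two components the diagonal terms of the identity cancel and leave one positive
  factor, which divides out on the open half. Continuity covers the hyperplane and reflection the
  other half.\<close>

lemma two_component_symmetry:
  assumes m: "CARD('m) = 2" and e: "unitK K e" and z: "\<forall>x\<in>\<Omega>. w e x = 0" and p: "unitK K p" "e \<bullet> p = 0"
    and pos: "\<forall>x\<in>half e. \<forall>i. 0 < ang e p x $ i" and x: "x \<in> \<Omega>"
  shows "pot i j x = pot j i x"
proof (cases "i = j")
  case False
  have U2: "UNIV = {i, j}"
    using m False by (intro card_subset_eq[symmetric]) auto
  have h: "pot i j y - pot j i y = 0" if y: "y \<in> half e" for y
  proof -
    have yO: "y \<in> \<Omega>" using y half_subset by blast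
    have "pot i j y * ang e p y $ j = pot j i y * ang e p y $ j"
      using ang_identity[OF e p z yO, of i] False by (simp add: U2)
    moreover have "0 < ang e p y $ j" using pos y by blast
    ultimately show ?thesis by simp
  qed
  have c: "pot i j y - pot j i y = 0" if y: "y \<in> \<Omega>" "0 \<le> e \<bullet> y" for y
  proof (rule continuous_constant_on_closure[of "half e" "\<lambda>y. pot i j y - pot j i y"])
    show "continuous_on (closure (half e)) (\<lambda>y. pot i j y - pot j i y)"
      by (intro continuous_intros pot_continuous_on(2)[OF half_subset])
  qed (use h closure_halfI[OF e y] in auto)
  show ?thesis
  proof (cases "0 \<le> e \<bullet> x")
    case True
    then show ?thesis using c[OF x] by simp
  next
    case False
    then have "pot i j (reflect e x) - pot j i (reflect e x) = 0"
      using symm_\<Omega>[OF symm_reflect[OF e]] x by (intro c) (simp_all add: inner_reflect[OF e])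
    then show ?thesis by (simp add: pot_reflect[OF e z x])
  qed
qed simp

end

theorem corollary1p1:
  fixes K :: "'n::finite set"
    and \<Omega> :: "(real^'n) set"
    and F :: "real \<Rightarrow> real^'n \<Rightarrow> real^'m \<Rightarrow> real^'m::finite"
    and U :: "real^'n \<Rightarrow> real^'m"
  assumes "2 \<le> card K"
    and "bounded_domain \<Omega>" and "smooth_boundary \<Omega>" and "rotationally_symmetric K \<Omega>"
    and "Ck_on 1 ({0..} \<times> closure (part2 K ` \<Omega>) \<times> UNIV) (\<lambda>(r, y, S). F r y S)"
    and "Ck_on 2 (closure \<Omega>) U"
    and "\<forall>x\<in>\<Omega>. - laplacian U x = F (norm (part1 K x)) (part2 K x) (U x)"
    and "\<forall>x\<in>frontier \<Omega>. U x = 0"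
    and "fully_coupled K F U \<Omega>"
    and "(\<forall>x\<in>\<Omega>. \<forall>i. convex_on UNIV (\<lambda>S. F (norm (part1 K x)) (part2 K x) S $ i)) \<or>
         (\<forall>x\<in>\<Omega>. \<forall>i j. convex_on UNIV (\<lambda>S. partial_s F i j (norm (part1 K x)) (part2 K x) S))"
    and "morse_index K F U \<Omega> = 1"
    and "\<not> radial K \<Omega> U"
  shows "(\<exists>p W. foliated_Schwarz_rep K \<Omega> U p W) \<and>
    (\<forall>p W. foliated_Schwarz_rep K \<Omega> U p W \<longrightarrow>
      (\<forall>x\<in>\<Omega>. part1 K x \<noteq> 0 \<longrightarrow>
        (let r = norm (part1 K x); y = part2 K x; \<theta> = angle K p x in
          \<forall>i. (\<Sum>j\<in>UNIV. partial_s F i j r y (W r y \<theta>) * partial_theta W j r y \<theta>) =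
              (\<Sum>j\<in>UNIV. partial_s F j i r y (W r y \<theta>) * partial_theta W j r y \<theta>)))) \<and>
    (CARD('m) = 2 \<longrightarrow>
      (\<forall>x\<in>\<Omega>. \<forall>i j. partial_s F i j (norm (part1 K x)) (part2 K x) (U x) =
                    partial_s F j i (norm (part1 K x)) (part2 K x) (U x)))"
proof -
  interpret morse_one K \<Omega> F U
    using assms by unfold_locales auto
  have pot_eq: "pot i j x = partial_s F i j (norm (part1 K x)) (part2 K x) (U x)" for i j x
    by (simp add: pot_def jac_def)
  have "(\<forall>x\<in>\<Omega>. \<forall>i. convex_on UNIV (\<lambda>S. rhs x S $ i)) \<or> (\<forall>x\<in>\<Omega>. \<forall>i j. convex_on UNIV (\<lambda>S. jac i j x S))"
    using assms(10) by (simp only: rhs_def jac_def)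
  then have "\<exists>e. unitK K e \<and> (\<forall>x\<in>\<Omega>. w e x = 0)"
    using symmetric_direction one_signed_convex one_signed_convex_jac by metis
  then obtain e where e: "unitK K e" "\<forall>x\<in>\<Omega>. w e x = 0" by blast
  obtain p where p: "unitK K p" "e \<bullet> p = 0" "\<forall>x\<in>half e. \<forall>i. 0 < ang e p x $ i"
    "\<And>\<xi> x. unitK K \<xi> \<Longrightarrow> e \<bullet> \<xi> = 0 \<Longrightarrow> p \<bullet> \<xi> = 0 \<Longrightarrow> x \<in> \<Omega> \<Longrightarrow> ang e \<xi> x = 0"
    using axis_exists[OF e assms(12)] by blast
  show ?thesis
  proof (intro conjI allI impI ballI)
    show "\<exists>p W. foliated_Schwarz_rep K \<Omega> U p W" using foliated_exists[OF e p] by blast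
  next
    fix p W x assume rep: "foliated_Schwarz_rep K \<Omega> U p W" and x: "x \<in> \<Omega>" "part1 K x \<noteq> 0"
    have "W (norm (part1 K x)) (part2 K x) (angle K p x) = U x"
      using rep x(1) by (simp add: foliated_Schwarz_rep_def)
    then show "let r = norm (part1 K x); y = part2 K x; \<theta> = angle K p x in
          \<forall>i. (\<Sum>j\<in>UNIV. partial_s F i j r y (W r y \<theta>) * partial_theta W j r y \<theta>) =
              (\<Sum>j\<in>UNIV. partial_s F j i r y (W r y \<theta>) * partial_theta W j r y \<theta>)"
      using rep_identity[OF rep x] by (simp add: Let_def pot_eq)
  next
    fix x i j assume "CARD('m) = 2" "x \<in> \<Omega>"
    then show "partial_s F i j (norm (part1 K x)) (part2 K x) (U x) =
        partial_s F j i (norm (part1 K x)) (part2 K x) (U x)"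
      using two_component_symmetry[OF _ e p(1-3)] by (simp add: pot_eq)
  qed
qed

end
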